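(* Let $G$ be a locally compact group and let $A$ be a Banach algebra with $\Delta(A)\neq\emptyset$. Then $M(G)\hat{\otimes}A$ is contractible if and only if $G$ is finite and $A$ is contractible.
   Context: $\Delta(A)$ is the character space of $A$ (non-zero multiplicative linear functionals). $M(G)$ is the measure algebra of $G$ (complex regular Borel measures under convolution, total variation norm), and $\hat{\otimes}$ denotes the projective tensor product of Banach algebras. A derivation from a Banach algebra $B$ into a Banach $B$-bimodule $E$ is a bounded linear map $D$ with $D(ab)=D(a)b+aD(b)$; it is inner if there is $z\in E$ with $D(a)=za-az$ for all $a\in B$. $B$ is contractible if every continuous derivation from $B$ into any Banach $B$-bimodule is inner. *)

theory Defs
  imports "HOL-Analysis.Analysis" "HOL-Algebra.Module"
begin

section \<open>Complex Banach spaces and Banach algebras\<close>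

definition complex_ring :: "complex ring" where
  "complex_ring = \<lparr>carrier = UNIV, monoid.mult = (*), one = 1, ring.zero = 0, add = (+)\<rparr>"

text \<open>
  One record serves for normed spaces and for normed algebras, in the same way as the record
  \<open>module\<close> of HOL-Algebra extends \<open>ring\<close>.  For a normed space the fields \<open>mult\<close> and \<open>one\<close> carry
  no meaning.  Banach algebras need not be unital, so for them the field \<open>one\<close> carries no meaning
  either.
\<close>

record 'a normed_alg = "(complex, 'a) module" +
  nrm :: "'a \<Rightarrow> real"

locale complex_normed_space = Module.module complex_ring E for E :: "'e normed_alg" (structure) +
  assumes nrm_nonneg: "x \<in> carrier E \<Longrightarrow> 0 \<le> nrm E x"
    and nrm_eq_zero: "x \<in> carrier E \<Longrightarrow> nrm E x = 0 \<longleftrightarrow> x = \<zero>\<^bsub>E\<^esub>"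
    and nrm_triangle: "x \<in> carrier E \<Longrightarrow> y \<in> carrier E \<Longrightarrow>
      nrm E (x \<oplus>\<^bsub>E\<^esub> y) \<le> nrm E x + nrm E y"
    and nrm_smult: "x \<in> carrier E \<Longrightarrow> nrm E (c \<odot>\<^bsub>E\<^esub> x) = cmod c * nrm E x"

definition cauchy_seqs :: "'e normed_alg \<Rightarrow> (nat \<Rightarrow> 'e) set" where
  "cauchy_seqs E = {s. (\<forall>n. s n \<in> carrier E) \<and>
     (\<forall>e>0. \<exists>N. \<forall>m\<ge>N. \<forall>n\<ge>N. nrm E (s m \<ominus>\<^bsub>E\<^esub> s n) < e)}"

locale complex_banach_space = complex_normed_space +
  assumes complete: "s \<in> cauchy_seqs E \<Longrightarrow>
    \<exists>x\<in>carrier E. (\<lambda>n. nrm E (s n \<ominus>\<^bsub>E\<^esub> x)) \<longlonglongrightarrow> 0"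

locale banach_algebra = complex_banach_space A for A :: "'a normed_alg" (structure) +
  assumes mult_closed: "x \<in> carrier A \<Longrightarrow> y \<in> carrier A \<Longrightarrow> x \<otimes>\<^bsub>A\<^esub> y \<in> carrier A"
    and mult_assoc: "x \<in> carrier A \<Longrightarrow> y \<in> carrier A \<Longrightarrow> z \<in> carrier A \<Longrightarrow>
      (x \<otimes>\<^bsub>A\<^esub> y) \<otimes>\<^bsub>A\<^esub> z = x \<otimes>\<^bsub>A\<^esub> (y \<otimes>\<^bsub>A\<^esub> z)"
    and distrib_right: "x \<in> carrier A \<Longrightarrow> y \<in> carrier A \<Longrightarrow> z \<in> carrier A \<Longrightarrow>
      (x \<oplus>\<^bsub>A\<^esub> y) \<otimes>\<^bsub>A\<^esub> z = (x \<otimes>\<^bsub>A\<^esub> z) \<oplus>\<^bsub>A\<^esub> (y \<otimes>\<^bsub>A\<^esub> z)"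
    and distrib_left: "x \<in> carrier A \<Longrightarrow> y \<in> carrier A \<Longrightarrow> z \<in> carrier A \<Longrightarrow>
      x \<otimes>\<^bsub>A\<^esub> (y \<oplus>\<^bsub>A\<^esub> z) = (x \<otimes>\<^bsub>A\<^esub> y) \<oplus>\<^bsub>A\<^esub> (x \<otimes>\<^bsub>A\<^esub> z)"
    and smult_mult: "x \<in> carrier A \<Longrightarrow> y \<in> carrier A \<Longrightarrow>
      (c \<odot>\<^bsub>A\<^esub> x) \<otimes>\<^bsub>A\<^esub> y = c \<odot>\<^bsub>A\<^esub> (x \<otimes>\<^bsub>A\<^esub> y)"
    and mult_smult: "x \<in> carrier A \<Longrightarrow> y \<in> carrier A \<Longrightarrow>
      x \<otimes>\<^bsub>A\<^esub> (c \<odot>\<^bsub>A\<^esub> y) = c \<odot>\<^bsub>A\<^esub> (x \<otimes>\<^bsub>A\<^esub> y)"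
    and nrm_mult: "x \<in> carrier A \<Longrightarrow> y \<in> carrier A \<Longrightarrow>
      nrm A (x \<otimes>\<^bsub>A\<^esub> y) \<le> nrm A x * nrm A y"

definition character_space :: "'a normed_alg \<Rightarrow> ('a \<Rightarrow> complex) set" where
  "character_space A = {\<phi> \<in> extensional (carrier A).
     (\<forall>x\<in>carrier A. \<forall>y\<in>carrier A. \<phi> (x \<oplus>\<^bsub>A\<^esub> y) = \<phi> x + \<phi> y) \<and>
     (\<forall>c. \<forall>x\<in>carrier A. \<phi> (c \<odot>\<^bsub>A\<^esub> x) = c * \<phi> x) \<and>
     (\<forall>x\<in>carrier A. \<forall>y\<in>carrier A. \<phi> (x \<otimes>\<^bsub>A\<^esub> y) = \<phi> x * \<phi> y) \<and>
     (\<exists>x\<in>carrier A. \<phi> x \<noteq> 0)}"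


section \<open>Bimodules, derivations and contractibility\<close>

text \<open>The left action of \<open>a\<close> on \<open>x\<close> is \<open>l a x\<close>, the right action is \<open>r x a\<close>.\<close>

locale banach_bimodule = E?: complex_banach_space E
  for B :: "'b normed_alg" and E :: "'e normed_alg" (structure)
    and l :: "'b \<Rightarrow> 'e \<Rightarrow> 'e" and r :: "'e \<Rightarrow> 'b \<Rightarrow> 'e" +
  assumes l_closed: "a \<in> carrier B \<Longrightarrow> x \<in> carrier E \<Longrightarrow> l a x \<in> carrier E"
    and r_closed: "a \<in> carrier B \<Longrightarrow> x \<in> carrier E \<Longrightarrow> r x a \<in> carrier E"
    and l_add: "a \<in> carrier B \<Longrightarrow> x \<in> carrier E \<Longrightarrow> y \<in> carrier E \<Longrightarrow>
      l a (x \<oplus>\<^bsub>E\<^esub> y) = l a x \<oplus>\<^bsub>E\<^esub> l a y"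
    and r_add: "a \<in> carrier B \<Longrightarrow> x \<in> carrier E \<Longrightarrow> y \<in> carrier E \<Longrightarrow>
      r (x \<oplus>\<^bsub>E\<^esub> y) a = r x a \<oplus>\<^bsub>E\<^esub> r y a"
    and l_smult: "a \<in> carrier B \<Longrightarrow> x \<in> carrier E \<Longrightarrow> l a (c \<odot>\<^bsub>E\<^esub> x) = c \<odot>\<^bsub>E\<^esub> l a x"
    and r_smult: "a \<in> carrier B \<Longrightarrow> x \<in> carrier E \<Longrightarrow> r (c \<odot>\<^bsub>E\<^esub> x) a = c \<odot>\<^bsub>E\<^esub> r x a"
    and add_l: "a \<in> carrier B \<Longrightarrow> b \<in> carrier B \<Longrightarrow> x \<in> carrier E \<Longrightarrow>
      l (a \<oplus>\<^bsub>B\<^esub> b) x = l a x \<oplus>\<^bsub>E\<^esub> l b x"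
    and add_r: "a \<in> carrier B \<Longrightarrow> b \<in> carrier B \<Longrightarrow> x \<in> carrier E \<Longrightarrow>
      r x (a \<oplus>\<^bsub>B\<^esub> b) = r x a \<oplus>\<^bsub>E\<^esub> r x b"
    and smult_l: "a \<in> carrier B \<Longrightarrow> x \<in> carrier E \<Longrightarrow> l (c \<odot>\<^bsub>B\<^esub> a) x = c \<odot>\<^bsub>E\<^esub> l a x"
    and smult_r: "a \<in> carrier B \<Longrightarrow> x \<in> carrier E \<Longrightarrow> r x (c \<odot>\<^bsub>B\<^esub> a) = c \<odot>\<^bsub>E\<^esub> r x a"
    and l_mult: "a \<in> carrier B \<Longrightarrow> b \<in> carrier B \<Longrightarrow> x \<in> carrier E \<Longrightarrow>
      l (a \<otimes>\<^bsub>B\<^esub> b) x = l a (l b x)"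
    and r_mult: "a \<in> carrier B \<Longrightarrow> b \<in> carrier B \<Longrightarrow> x \<in> carrier E \<Longrightarrow>
      r x (a \<otimes>\<^bsub>B\<^esub> b) = r (r x a) b"
    and l_r: "a \<in> carrier B \<Longrightarrow> b \<in> carrier B \<Longrightarrow> x \<in> carrier E \<Longrightarrow>
      r (l a x) b = l a (r x b)"
    and act_bounded: "\<exists>C. \<forall>a\<in>carrier B. \<forall>x\<in>carrier E.
      nrm E (l a x) \<le> C * nrm B a * nrm E x \<and> nrm E (r x a) \<le> C * nrm B a * nrm E x"

definition bounded_derivation ::
  "'b normed_alg \<Rightarrow> 'e normed_alg \<Rightarrow> ('b \<Rightarrow> 'e \<Rightarrow> 'e) \<Rightarrow> ('e \<Rightarrow> 'b \<Rightarrow> 'e) \<Rightarrow> ('b \<Rightarrow> 'e) \<Rightarrow> bool"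
where
  "bounded_derivation B E l r D \<longleftrightarrow>
     (\<forall>a\<in>carrier B. D a \<in> carrier E) \<and>
     (\<forall>a\<in>carrier B. \<forall>b\<in>carrier B. D (a \<oplus>\<^bsub>B\<^esub> b) = D a \<oplus>\<^bsub>E\<^esub> D b) \<and>
     (\<forall>c. \<forall>a\<in>carrier B. D (c \<odot>\<^bsub>B\<^esub> a) = c \<odot>\<^bsub>E\<^esub> D a) \<and>
     (\<exists>C. \<forall>a\<in>carrier B. nrm E (D a) \<le> C * nrm B a) \<and>
     (\<forall>a\<in>carrier B. \<forall>b\<in>carrier B. D (a \<otimes>\<^bsub>B\<^esub> b) = r (D a) b \<oplus>\<^bsub>E\<^esub> l a (D b))"

definition inner_derivation ::
  "'b normed_alg \<Rightarrow> 'e normed_alg \<Rightarrow> ('b \<Rightarrow> 'e \<Rightarrow> 'e) \<Rightarrow> ('e \<Rightarrow> 'b \<Rightarrow> 'e) \<Rightarrow> ('b \<Rightarrow> 'e) \<Rightarrow> bool"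
where
  "inner_derivation B E l r D \<longleftrightarrow> (\<exists>z\<in>carrier E. \<forall>a\<in>carrier B. D a = r z a \<ominus>\<^bsub>E\<^esub> l a z)"

definition derivations_inner :: "'e itself \<Rightarrow> 'b normed_alg \<Rightarrow> bool" where
  "derivations_inner _ B \<longleftrightarrow>
     (\<forall>(E :: 'e normed_alg) l r D. banach_bimodule B E l r \<longrightarrow>
        bounded_derivation B E l r D \<longrightarrow> inner_derivation B E l r D)"

text \<open>
  HOL has no quantification over types inside a formula, so the definition lets the bimodules have
  their carrier in one sufficiently large type.  This is no restriction: by the theorem
  \<open>contractible_derivations_inner\<close> below, a contractible Banach algebra has only inner bounded
  derivations into Banach bimodules over every type.  The reason is that a derivation takes its
  values in the closed sub-bimodule generated by its range, all of whose elements are limits of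
  sequences of expressions built from finite lists of elements of the algebra.
\<close>

definition contractible_algebra :: "'b normed_alg \<Rightarrow> bool" where
  "contractible_algebra (B :: 'b normed_alg) \<longleftrightarrow> derivations_inner TYPE(nat \<Rightarrow> 'b list) B"


subsection \<open>Independence of the type of the bimodules\<close>

lemma (in complex_normed_space) nrm_zero: "nrm E \<zero>\<^bsub>E\<^esub> = 0"
  using nrm_eq_zero[of "\<zero>\<^bsub>E\<^esub>"] by simp

lemma (in complex_normed_space) smultc_closed:
  "x \<in> carrier E \<Longrightarrow> c \<odot>\<^bsub>E\<^esub> x \<in> carrier E"
  using smult_closed[of c x] by (simp add: complex_ring_def)

lemma (in complex_normed_space) smultc_add:
  "x \<in> carrier E \<Longrightarrow> y \<in> carrier E \<Longrightarrow>
    c \<odot>\<^bsub>E\<^esub> (x \<oplus>\<^bsub>E\<^esub> y) = c \<odot>\<^bsub>E\<^esub> x \<oplus>\<^bsub>E\<^esub> c \<odot>\<^bsub>E\<^esub> y"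
  using smult_r_distr[of c x y] by (simp add: complex_ring_def)

lemma (in complex_normed_space) smultc_add_left:
  "x \<in> carrier E \<Longrightarrow> (c + d) \<odot>\<^bsub>E\<^esub> x = c \<odot>\<^bsub>E\<^esub> x \<oplus>\<^bsub>E\<^esub> d \<odot>\<^bsub>E\<^esub> x"
  using smult_l_distr[of c d x] by (simp add: complex_ring_def)

lemma (in complex_normed_space) smultc_assoc:
  "x \<in> carrier E \<Longrightarrow> (c * d) \<odot>\<^bsub>E\<^esub> x = c \<odot>\<^bsub>E\<^esub> (d \<odot>\<^bsub>E\<^esub> x)"
  using smult_assoc1[of c d x] by (simp add: complex_ring_def)

lemma (in complex_normed_space) smultc_one: "x \<in> carrier E \<Longrightarrow> 1 \<odot>\<^bsub>E\<^esub> x = x"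
  using smult_one[of x] by (simp add: complex_ring_def)

lemma (in complex_normed_space) smultc_zero: "x \<in> carrier E \<Longrightarrow> 0 \<odot>\<^bsub>E\<^esub> x = \<zero>\<^bsub>E\<^esub>"
  using smult_l_null[of x] by (simp add: complex_ring_def)

lemma (in complex_normed_space) smultc_minus_one:
  assumes x: "x \<in> carrier E" shows "(-1) \<odot>\<^bsub>E\<^esub> x = \<ominus>\<^bsub>E\<^esub> x"
proof -
  have "(-1) \<odot>\<^bsub>E\<^esub> x \<oplus>\<^bsub>E\<^esub> x = ((-1) + 1) \<odot>\<^bsub>E\<^esub> x"
    unfolding smultc_add_left[OF x] smultc_one[OF x] ..
  also have "\<dots> = \<zero>\<^bsub>E\<^esub>" using smultc_zero[OF x] by simp
  finally show ?thesis
    using minus_equality[of "(-1) \<odot>\<^bsub>E\<^esub> x" x] smultc_closed[OF x] x by simp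
qed

lemma (in complex_normed_space) minus_as_smult:
  "x \<in> carrier E \<Longrightarrow> y \<in> carrier E \<Longrightarrow> x \<ominus>\<^bsub>E\<^esub> y = x \<oplus>\<^bsub>E\<^esub> (-1) \<odot>\<^bsub>E\<^esub> y"
  by (simp add: smultc_minus_one minus_eq)

lemma (in complex_normed_space) nrm_minus_commute:
  assumes "x \<in> carrier E" "y \<in> carrier E"
  shows "nrm E (x \<ominus>\<^bsub>E\<^esub> y) = nrm E (y \<ominus>\<^bsub>E\<^esub> x)"
proof -
  have "y \<ominus>\<^bsub>E\<^esub> x = \<ominus>\<^bsub>E\<^esub> (x \<ominus>\<^bsub>E\<^esub> y)"
    using assms by (simp add: minus_eq minus_add a_comm)
  also have "\<dots> = (-1) \<odot>\<^bsub>E\<^esub> (x \<ominus>\<^bsub>E\<^esub> y)"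
    using assms by (simp add: smultc_minus_one)
  finally show ?thesis using assms by (simp add: nrm_smult)
qed

lemma (in complex_normed_space) minus_trans:
  assumes "x \<in> carrier E" "y \<in> carrier E" "z \<in> carrier E"
  shows "nrm E (x \<ominus>\<^bsub>E\<^esub> z) \<le> nrm E (x \<ominus>\<^bsub>E\<^esub> y) + nrm E (y \<ominus>\<^bsub>E\<^esub> z)"
proof -
  have "(x \<ominus>\<^bsub>E\<^esub> y) \<oplus>\<^bsub>E\<^esub> (y \<ominus>\<^bsub>E\<^esub> z) = x \<ominus>\<^bsub>E\<^esub> z"
    using assms by (simp add: minus_eq a_assoc r_neg1)
  then show ?thesis
    using nrm_triangle[of "x \<ominus>\<^bsub>E\<^esub> y" "y \<ominus>\<^bsub>E\<^esub> z"] assms by simp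
qed

lemma cring_complex_ring: "cring complex_ring"
proof (rule cringI)
  show "abelian_group complex_ring"
    by (rule abelian_groupI)
      (auto simp: complex_ring_def intro: exI[of _ "- x" for x] left_minus)
  show "Group.comm_monoid complex_ring"
    by (unfold_locales) (auto simp: complex_ring_def)
qed (auto simp: complex_ring_def algebra_simps)

text \<open>A closed sub-bimodule can be moved to another type along an injection.\<close>

definition transported :: "('e \<Rightarrow> 'u) \<Rightarrow> 'e set \<Rightarrow> 'e normed_alg \<Rightarrow> 'u normed_alg" where
  "transported \<kappa> X E = (let g = the_inv_into X \<kappa> in
     \<lparr>carrier = \<kappa> ` X, monoid.mult = undefined, one = undefined, ring.zero = \<kappa> \<zero>\<^bsub>E\<^esub>,
      add = (\<lambda>u v. \<kappa> (g u \<oplus>\<^bsub>E\<^esub> g v)), smult = (\<lambda>c u. \<kappa> (c \<odot>\<^bsub>E\<^esub> g u)),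
      nrm = (\<lambda>u. nrm E (g u))\<rparr>)"

lemma (in banach_bimodule) banach_bimodule_transported:
  fixes \<kappa> :: "'e \<Rightarrow> 'u"
  assumes X: "X \<subseteq> carrier E" and inj: "inj_on \<kappa> X"
    and zeroX: "\<zero>\<^bsub>E\<^esub> \<in> X"
    and addX: "\<And>x y. x \<in> X \<Longrightarrow> y \<in> X \<Longrightarrow> x \<oplus>\<^bsub>E\<^esub> y \<in> X"
    and smultX: "\<And>c x. x \<in> X \<Longrightarrow> c \<odot>\<^bsub>E\<^esub> x \<in> X"
    and lX: "\<And>a x. a \<in> carrier B \<Longrightarrow> x \<in> X \<Longrightarrow> l a x \<in> X"
    and rX: "\<And>a x. a \<in> carrier B \<Longrightarrow> x \<in> X \<Longrightarrow> r x a \<in> X"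
    and closedX: "\<And>s x. (\<And>n. s n \<in> X) \<Longrightarrow> x \<in> carrier E \<Longrightarrow>
      (\<lambda>n. nrm E (s n \<ominus>\<^bsub>E\<^esub> x)) \<longlonglongrightarrow> 0 \<Longrightarrow> x \<in> X"
  defines "g \<equiv> the_inv_into X \<kappa>" and "F \<equiv> transported \<kappa> X E"
  shows "banach_bimodule B F (\<lambda>a u. \<kappa> (l a (g u))) (\<lambda>u a. \<kappa> (r (g u) a))"
    and "\<And>x y. x \<in> X \<Longrightarrow> y \<in> X \<Longrightarrow> \<kappa> x \<ominus>\<^bsub>F\<^esub> \<kappa> y = \<kappa> (x \<ominus>\<^bsub>E\<^esub> y)"
proof -
  have g: "g (\<kappa> x) = x" if "x \<in> X" for x
    unfolding g_def by (rule the_inv_into_f_f[OF inj that])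
  have XE: "x \<in> carrier E" if "x \<in> X" for x using X that by auto
  have F: "carrier F = \<kappa> ` X" "\<zero>\<^bsub>F\<^esub> = \<kappa> \<zero>\<^bsub>E\<^esub>"
    "u \<oplus>\<^bsub>F\<^esub> v = \<kappa> (g u \<oplus>\<^bsub>E\<^esub> g v)" "c \<odot>\<^bsub>F\<^esub> u = \<kappa> (c \<odot>\<^bsub>E\<^esub> g u)"
    "nrm F u = nrm E (g u)" for u v c
    by (simp_all add: F_def transported_def g_def Let_def)
  have negX: "\<ominus>\<^bsub>E\<^esub> x \<in> X" if "x \<in> X" for x
    using smultX[OF that, of "-1"] smultc_minus_one[OF XE[OF that]] by simp
  have minusX: "x \<ominus>\<^bsub>E\<^esub> y \<in> X" if "x \<in> X" "y \<in> X" for x y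
    using addX[OF that(1) negX[OF that(2)]] by (simp add: minus_eq)
  have ab: "abelian_group F"
  proof (rule abelian_groupI)
    fix u assume "u \<in> carrier F"
    then obtain x where x: "x \<in> X" "u = \<kappa> x" by (auto simp: F)
    have "\<kappa> (\<ominus>\<^bsub>E\<^esub> x) \<in> carrier F" using negX[OF x(1)] by (simp add: F)
    moreover have "\<kappa> (\<ominus>\<^bsub>E\<^esub> x) \<oplus>\<^bsub>F\<^esub> u = \<zero>\<^bsub>F\<^esub>"
      using x negX[OF x(1)] XE by (simp add: F g l_neg)
    ultimately show "\<exists>v\<in>carrier F. v \<oplus>\<^bsub>F\<^esub> u = \<zero>\<^bsub>F\<^esub>" by blast
  qed (auto simp: F g addX zeroX XE a_ac)
  interpret F: abelian_group F by (rule ab)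
  have minusF: "\<kappa> x \<ominus>\<^bsub>F\<^esub> \<kappa> y = \<kappa> (x \<ominus>\<^bsub>E\<^esub> y)" if "x \<in> X" "y \<in> X" for x y
  proof -
    have "\<ominus>\<^bsub>F\<^esub> \<kappa> y = \<kappa> (\<ominus>\<^bsub>E\<^esub> y)"
    proof (rule F.minus_equality)
      show "\<kappa> (\<ominus>\<^bsub>E\<^esub> y) \<oplus>\<^bsub>F\<^esub> \<kappa> y = \<zero>\<^bsub>F\<^esub>"
        using that negX[OF that(2)] XE by (simp add: F g l_neg)
    qed (use that negX in \<open>auto simp: F\<close>)
    then show ?thesis
      using that negX by (simp add: a_minus_def F g)
  qed
  then show "\<And>x y. x \<in> X \<Longrightarrow> y \<in> X \<Longrightarrow> \<kappa> x \<ominus>\<^bsub>F\<^esub> \<kappa> y = \<kappa> (x \<ominus>\<^bsub>E\<^esub> y)" .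
  have nrmF: "nrm F (\<kappa> x) = nrm E x" if "x \<in> X" for x
    using that by (simp add: F g)
  have "Module.module complex_ring F"
    by (rule Module.moduleI[OF cring_complex_ring ab])
      (auto simp: F g addX smultX XE smultc_add smultc_add_left smultc_assoc smultc_one
        complex_ring_def)
  then have ns: "complex_normed_space F"
  proof (intro complex_normed_space.intro complex_normed_space_axioms.intro)
    fix u assume "u \<in> carrier F"
    then obtain x where x: "x \<in> X" "u = \<kappa> x" by (auto simp: F)
    have "x = \<zero>\<^bsub>E\<^esub> \<longleftrightarrow> \<kappa> x = \<kappa> \<zero>\<^bsub>E\<^esub>"
      using inj x zeroX by (auto dest: inj_onD)
    then show "nrm F u = 0 \<longleftrightarrow> u = \<zero>\<^bsub>F\<^esub>"
      using x XE nrm_eq_zero by (simp add: F g)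
  qed (auto simp: F g XE addX smultX nrm_nonneg nrm_triangle nrm_smult)
  have "complex_banach_space F"
  proof (rule complex_banach_space.intro[OF ns], rule complex_banach_space_axioms.intro)
    fix s assume s: "s \<in> cauchy_seqs F"
    define t where "t n = g (s n)" for n
    have sn: "s n \<in> \<kappa> ` X" for n using s by (auto simp: cauchy_seqs_def F)
    have tX: "t n \<in> X" and st: "s n = \<kappa> (t n)" for n
      using sn[of n] by (auto simp: t_def g)
    have "t \<in> cauchy_seqs E"
      using s tX unfolding cauchy_seqs_def
      by (simp add: st minusF nrmF minusX XE)
    then obtain x where x: "x \<in> carrier E" "(\<lambda>n. nrm E (t n \<ominus>\<^bsub>E\<^esub> x)) \<longlonglongrightarrow> 0"
      using complete by blast
    have xX: "x \<in> X" by (rule closedX[of t]) (use tX x in auto)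
    have "(\<lambda>n. nrm F (s n \<ominus>\<^bsub>F\<^esub> \<kappa> x)) \<longlonglongrightarrow> 0"
      using x(2) by (simp add: st minusF nrmF minusX tX xX)
    then show "\<exists>y\<in>carrier F. (\<lambda>n. nrm F (s n \<ominus>\<^bsub>F\<^esub> y)) \<longlonglongrightarrow> 0"
      using xX by (auto simp: F)
  qed
  then show "banach_bimodule B F (\<lambda>a u. \<kappa> (l a (g u))) (\<lambda>u a. \<kappa> (r (g u) a))"
  proof (intro banach_bimodule.intro banach_bimodule_axioms.intro)
    obtain C where C: "\<forall>a\<in>carrier B. \<forall>x\<in>carrier E.
      nrm E (l a x) \<le> C * nrm B a * nrm E x \<and> nrm E (r x a) \<le> C * nrm B a * nrm E x"
      using act_bounded by blast
    then show "\<exists>C. \<forall>a\<in>carrier B. \<forall>x\<in>carrier F.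
      nrm F (\<kappa> (l a (g x))) \<le> C * nrm B a * nrm F x \<and>
      nrm F (\<kappa> (r (g x) a)) \<le> C * nrm B a * nrm F x"
      by (intro exI[of _ C]) (auto simp: F g lX rX XE)
  qed (auto simp: F g lX rX addX smultX XE l_add r_add l_smult r_smult add_l add_r
      smult_l smult_r l_mult r_mult l_r)
qed

text \<open>The linear span of all \<open>D b\<close> and \<open>D b \<cdot> c\<close>, which is a sub-bimodule for a derivation \<open>D\<close>.\<close>

inductive_set derivation_span ::
  "'b normed_alg \<Rightarrow> 'e normed_alg \<Rightarrow> ('e \<Rightarrow> 'b \<Rightarrow> 'e) \<Rightarrow> ('b \<Rightarrow> 'e) \<Rightarrow> 'e set"
  for B :: "'b normed_alg" and E :: "'e normed_alg" and r D
where
  zero: "\<zero>\<^bsub>E\<^esub> \<in> derivation_span B E r D"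
| gen1: "b \<in> carrier B \<Longrightarrow> D b \<in> derivation_span B E r D"
| gen2: "b \<in> carrier B \<Longrightarrow> c \<in> carrier B \<Longrightarrow> r (D b) c \<in> derivation_span B E r D"
| add: "x \<in> derivation_span B E r D \<Longrightarrow> y \<in> derivation_span B E r D \<Longrightarrow>
    x \<oplus>\<^bsub>E\<^esub> y \<in> derivation_span B E r D"

context
  fixes E :: "'e normed_alg" and r :: "'e \<Rightarrow> 'b \<Rightarrow> 'e" and D :: "'b \<Rightarrow> 'e"
begin

fun decode :: "'b list \<Rightarrow> 'e" where
  "decode (b # c # d # xs) = (r (D b) c \<oplus>\<^bsub>E\<^esub> D d) \<oplus>\<^bsub>E\<^esub> decode xs"
| "decode _ = \<zero>\<^bsub>E\<^esub>"

end

theorem contractible_derivations_inner: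
  fixes B :: "'b normed_alg"
  assumes contr: "contractible_algebra B" and B: "banach_algebra B"
  shows "derivations_inner TYPE('e) B"
  unfolding derivations_inner_def
proof (intro allI impI)
  fix E :: "'e normed_alg" and l r D
  assume bim: "banach_bimodule B E l r" and der: "bounded_derivation B E l r D"
  interpret B: banach_algebra B by (rule B)
  interpret banach_bimodule B E l r by (rule bim)
  have D_closed: "D a \<in> carrier E" if "a \<in> carrier B" for a
    using der that by (auto simp: bounded_derivation_def)
  have D_add: "D (a \<oplus>\<^bsub>B\<^esub> b) = D a \<oplus>\<^bsub>E\<^esub> D b" if "a \<in> carrier B" "b \<in> carrier B" for a b
    using der that by (auto simp: bounded_derivation_def)
  have D_smult: "D (c \<odot>\<^bsub>B\<^esub> a) = c \<odot>\<^bsub>E\<^esub> D a" if "a \<in> carrier B" for a c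
    using der that by (auto simp: bounded_derivation_def)
  obtain CD where CD: "nrm E (D a) \<le> CD * nrm B a" if "a \<in> carrier B" for a
    using der unfolding bounded_derivation_def by blast
  have D_mult: "D (a \<otimes>\<^bsub>B\<^esub> b) = r (D a) b \<oplus>\<^bsub>E\<^esub> l a (D b)"
    if "a \<in> carrier B" "b \<in> carrier B" for a b
    using der that by (auto simp: bounded_derivation_def)
  obtain C where C: "nrm E (l a x) \<le> C * nrm B a * nrm E x"
      "nrm E (r x a) \<le> C * nrm B a * nrm E x" if "a \<in> carrier B" "x \<in> carrier E" for a x
    using act_bounded by blast
  have D0: "D \<zero>\<^bsub>B\<^esub> = \<zero>\<^bsub>E\<^esub>"
    using D_smult[of "\<zero>\<^bsub>B\<^esub>" 0] by (simp add: B.smultc_zero smultc_zero D_closed)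
  have l0: "l a \<zero>\<^bsub>E\<^esub> = \<zero>\<^bsub>E\<^esub>" and r0: "r \<zero>\<^bsub>E\<^esub> a = \<zero>\<^bsub>E\<^esub>" if "a \<in> carrier B" for a
    using l_smult[OF that, of "\<zero>\<^bsub>E\<^esub>" 0] r_smult[OF that, of "\<zero>\<^bsub>E\<^esub>" 0] that
    by (simp_all add: smultc_zero l_closed r_closed)
  have r_uminus: "r (\<ominus>\<^bsub>E\<^esub> x) a = \<ominus>\<^bsub>E\<^esub> r x a" if "a \<in> carrier B" "x \<in> carrier E" for a x
    using r_smult[OF that, of "-1"] that by (simp add: smultc_minus_one r_closed)
  have lD: "l a (D b) = D (a \<otimes>\<^bsub>B\<^esub> b) \<oplus>\<^bsub>E\<^esub> r (D ((-1) \<odot>\<^bsub>B\<^esub> a)) b"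
    if "a \<in> carrier B" "b \<in> carrier B" for a b
    using that
    by (simp add: D_mult D_smult r_smult D_closed r_closed l_closed smultc_minus_one
        r_uminus a_comm[of "r (D a) b"] a_assoc l_neg r_neg)

  let ?S = "derivation_span B E r D"
  have S_closed: "x \<in> carrier E" if "x \<in> ?S" for x
    using that by induction (auto simp: D_closed r_closed)
  have S_smult: "c \<odot>\<^bsub>E\<^esub> x \<in> ?S" if "x \<in> ?S" for c x
    using that
  proof induction
    case zero
    have "c \<odot>\<^bsub>E\<^esub> \<zero>\<^bsub>E\<^esub> = \<zero>\<^bsub>E\<^esub>"
      using smultc_assoc[of "\<zero>\<^bsub>E\<^esub>" c 0] by (simp add: smultc_zero)
    then show ?case by (simp add: derivation_span.zero)
  next
    case (gen1 b)
    then show ?case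
      using derivation_span.gen1[of "c \<odot>\<^bsub>B\<^esub> b" B D E r] by (simp add: D_smult B.smultc_closed)
  next
    case (gen2 b d)
    then show ?case
      using derivation_span.gen2[of "c \<odot>\<^bsub>B\<^esub> b" B d r D E]
      by (simp add: D_smult B.smultc_closed r_smult D_closed)
  next
    case (add x y)
    then show ?case by (simp add: smultc_add S_closed derivation_span.add)
  qed
  have S_r: "r x a \<in> ?S" if "x \<in> ?S" "a \<in> carrier B" for x a
    using that(1)
  proof induction
    case zero
    show ?case using that(2) by (simp add: r0 derivation_span.zero)
  next
    case (gen1 b)
    then show ?case using that(2) by (simp add: derivation_span.gen2)
  next
    case (gen2 b d)
    then show ?case
      using derivation_span.gen2[of b B "d \<otimes>\<^bsub>B\<^esub> a" r D E] that(2)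
      by (simp add: B.mult_closed r_mult D_closed)
  next
    case (add x y)
    then show ?case using that(2) by (simp add: r_add S_closed derivation_span.add)
  qed
  have S_l: "l a x \<in> ?S" if "x \<in> ?S" "a \<in> carrier B" for x a
    using that(1)
  proof induction
    case zero
    show ?case using that(2) by (simp add: l0 derivation_span.zero)
  next
    case (gen1 b)
    then show ?case using that(2)
      by (auto simp: lD B.mult_closed B.smultc_closed
          intro!: derivation_span.add derivation_span.gen1 derivation_span.gen2)
  next
    case (gen2 b d)
    have "l a (r (D b) d) = r (l a (D b)) d"
      using gen2 that(2) by (simp add: l_r D_closed)
    moreover have "l a (D b) \<in> ?S" using gen2 that(2)
      by (auto simp: lD B.mult_closed B.smultc_closed
          intro!: derivation_span.add derivation_span.gen1 derivation_span.gen2)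
    ultimately show ?case using S_r gen2 by simp
  next
    case (add x y)
    then show ?case using that(2) by (simp add: l_add S_closed derivation_span.add)
  qed

  define X where "X = {x \<in> carrier E. \<forall>e>0. \<exists>s\<in>?S. nrm E (x \<ominus>\<^bsub>E\<^esub> s) < e}"
  have XE: "X \<subseteq> carrier E" by (auto simp: X_def)
  have self: "nrm E (x \<ominus>\<^bsub>E\<^esub> x) = 0" if "x \<in> carrier E" for x
    using that by (simp add: minus_eq r_neg nrm_zero)
  have SX: "x \<in> X" if "x \<in> ?S" for x
    using that S_closed[OF that] self by (auto simp: X_def intro!: bexI[of _ x])
  have mapX: "f x \<in> X" if x: "x \<in> X"
      and f: "\<And>y. y \<in> carrier E \<Longrightarrow> f y \<in> carrier E" "\<And>y. y \<in> ?S \<Longrightarrow> f y \<in> ?S"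
      and Lip: "\<And>y z. y \<in> carrier E \<Longrightarrow> z \<in> carrier E \<Longrightarrow>
        nrm E (f y \<ominus>\<^bsub>E\<^esub> f z) \<le> K * nrm E (y \<ominus>\<^bsub>E\<^esub> z)" for f x and K :: real
    unfolding X_def
  proof (intro CollectI conjI allI impI)
    show "f x \<in> carrier E" using x f(1) by (auto simp: X_def)
    fix e :: real assume e: "0 < e"
    have "0 < e / (\<bar>K\<bar> + 1)" using e by (intro divide_pos_pos) auto
    then obtain s where s: "s \<in> ?S" "nrm E (x \<ominus>\<^bsub>E\<^esub> s) < e / (\<bar>K\<bar> + 1)"
      using x unfolding X_def by blast
    have xE: "x \<in> carrier E" and sE: "s \<in> carrier E" using x s S_closed by (auto simp: X_def)
    have "nrm E (f x \<ominus>\<^bsub>E\<^esub> f s) \<le> K * nrm E (x \<ominus>\<^bsub>E\<^esub> s)" by (rule Lip[OF xE sE])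
    also have "\<dots> \<le> (\<bar>K\<bar> + 1) * nrm E (x \<ominus>\<^bsub>E\<^esub> s)"
      by (intro mult_right_mono nrm_nonneg) (use xE sE in auto)
    also have "\<dots> < e"
      using s(2) pos_less_divide_eq[of "\<bar>K\<bar> + 1" "nrm E (x \<ominus>\<^bsub>E\<^esub> s)" e]
      by (simp add: mult.commute)
    finally show "\<exists>s\<in>?S. nrm E (f x \<ominus>\<^bsub>E\<^esub> s) < e" using s(1) f(2) by blast
  qed
  have X_add: "x \<oplus>\<^bsub>E\<^esub> y \<in> X" if x: "x \<in> X" and y: "y \<in> X" for x y
    unfolding X_def
  proof (intro CollectI conjI allI impI)
    have xE: "x \<in> carrier E" "y \<in> carrier E" using x y XE by auto
    then show "x \<oplus>\<^bsub>E\<^esub> y \<in> carrier E" by simp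
    fix e :: real assume "0 < e"
    then have e: "0 < e / 2" by simp
    from x e obtain s where s: "s \<in> ?S" "nrm E (x \<ominus>\<^bsub>E\<^esub> s) < e / 2" unfolding X_def by blast
    from y e obtain t where t: "t \<in> ?S" "nrm E (y \<ominus>\<^bsub>E\<^esub> t) < e / 2" unfolding X_def by blast
    have sE: "s \<in> carrier E" "t \<in> carrier E" using s t S_closed by auto
    have "(x \<oplus>\<^bsub>E\<^esub> y) \<ominus>\<^bsub>E\<^esub> (s \<oplus>\<^bsub>E\<^esub> t) = (x \<ominus>\<^bsub>E\<^esub> s) \<oplus>\<^bsub>E\<^esub> (y \<ominus>\<^bsub>E\<^esub> t)"
      using xE sE unfolding minus_eq minus_add[OF sE]
      by (simp only: a_assoc a_comm a_lcomm add.m_closed a_inv_closed)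
    then have "nrm E ((x \<oplus>\<^bsub>E\<^esub> y) \<ominus>\<^bsub>E\<^esub> (s \<oplus>\<^bsub>E\<^esub> t)) < e"
      using nrm_triangle[of "x \<ominus>\<^bsub>E\<^esub> s" "y \<ominus>\<^bsub>E\<^esub> t"] xE sE s t by simp
    then show "\<exists>u\<in>?S. nrm E ((x \<oplus>\<^bsub>E\<^esub> y) \<ominus>\<^bsub>E\<^esub> u) < e"
      using derivation_span.add[OF s(1) t(1)] by (rule bexI)
  qed
  have X_smult: "c \<odot>\<^bsub>E\<^esub> x \<in> X" if "x \<in> X" for c x
  proof (rule mapX[of x "\<lambda>x. c \<odot>\<^bsub>E\<^esub> x" "cmod c", OF that])
    fix y z assume yz: "y \<in> carrier E" "z \<in> carrier E"
    have "c \<odot>\<^bsub>E\<^esub> y \<ominus>\<^bsub>E\<^esub> c \<odot>\<^bsub>E\<^esub> z = c \<odot>\<^bsub>E\<^esub> (y \<ominus>\<^bsub>E\<^esub> z)"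
      using yz by (simp add: minus_as_smult smultc_add smultc_closed smultc_assoc[symmetric])
    then show "nrm E (c \<odot>\<^bsub>E\<^esub> y \<ominus>\<^bsub>E\<^esub> c \<odot>\<^bsub>E\<^esub> z) \<le> cmod c * nrm E (y \<ominus>\<^bsub>E\<^esub> z)"
      using yz by (simp add: nrm_smult)
  qed (auto simp: smultc_closed S_smult)
  have X_l: "l a x \<in> X" if a: "a \<in> carrier B" and "x \<in> X" for a x
  proof (rule mapX[of x "l a" "C * nrm B a", OF that(2)])
    fix y z assume yz: "y \<in> carrier E" "z \<in> carrier E"
    have "l a y \<ominus>\<^bsub>E\<^esub> l a z = l a (y \<ominus>\<^bsub>E\<^esub> z)"
      using yz a by (simp add: minus_as_smult l_add l_smult smultc_closed l_closed)
    then show "nrm E (l a y \<ominus>\<^bsub>E\<^esub> l a z) \<le> C * nrm B a * nrm E (y \<ominus>\<^bsub>E\<^esub> z)"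
      using C yz a by simp
  qed (auto simp: a l_closed S_l)
  have X_r: "r x a \<in> X" if a: "a \<in> carrier B" and "x \<in> X" for a x
  proof (rule mapX[of x "\<lambda>x. r x a" "C * nrm B a", OF that(2)])
    fix y z assume yz: "y \<in> carrier E" "z \<in> carrier E"
    have "r y a \<ominus>\<^bsub>E\<^esub> r z a = r (y \<ominus>\<^bsub>E\<^esub> z) a"
      using yz a by (simp add: minus_as_smult r_add r_smult smultc_closed r_closed)
    then show "nrm E (r y a \<ominus>\<^bsub>E\<^esub> r z a) \<le> C * nrm B a * nrm E (y \<ominus>\<^bsub>E\<^esub> z)"
      using C yz a by simp
  qed (auto simp: a r_closed S_r)
  have X_lim: "x \<in> X" if s: "\<And>n. s n \<in> X" and x: "x \<in> carrier E"
    and lim: "(\<lambda>n. nrm E (s n \<ominus>\<^bsub>E\<^esub> x)) \<longlonglongrightarrow> 0" for s x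
    unfolding X_def
  proof (intro CollectI conjI allI impI x)
    fix e :: real assume "0 < e"
    then have e: "0 < e / 2" by simp
    then have "\<forall>\<^sub>F n in sequentially. nrm E (s n \<ominus>\<^bsub>E\<^esub> x) < e / 2"
      using order_tendstoD(2)[OF lim] by blast
    then obtain n where n: "nrm E (s n \<ominus>\<^bsub>E\<^esub> x) < e / 2"
      by (auto simp: eventually_sequentially)
    obtain t where t: "t \<in> ?S" "nrm E (s n \<ominus>\<^bsub>E\<^esub> t) < e / 2"
      using s[of n] e unfolding X_def by blast
    have snE: "s n \<in> carrier E" using s XE by auto
    have "nrm E (x \<ominus>\<^bsub>E\<^esub> t) < e"
      using minus_trans[of x "s n" t] n t nrm_minus_commute[of x "s n"] x snE S_closed by force
    then show "\<exists>t\<in>?S. nrm E (x \<ominus>\<^bsub>E\<^esub> t) < e" using t by blast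
  qed

  let ?d = "decode E r D"
  have d_closed: "?d xs \<in> carrier E" if "set xs \<subseteq> carrier B" for xs
    using that
    by (induction xs rule: decode.induct) (auto simp: D_closed r_closed)
  have d_append: "?d (xs @ ys) = ?d xs \<oplus>\<^bsub>E\<^esub> ?d ys"
    if "set xs \<subseteq> carrier B" "set ys \<subseteq> carrier B" "3 dvd length xs" for xs ys
    using that
  proof (induction xs rule: decode.induct)
    case (1 b c d xs)
    have "3 dvd Suc (Suc (Suc (length xs))) \<longleftrightarrow> 3 dvd length xs" by presburger
    then show ?case using 1
      by (simp add: a_assoc d_closed D_closed r_closed)
  qed (simp_all add: d_closed dvd_eq_mod_eq_0)
  have S_code: "\<exists>xs. set xs \<subseteq> carrier B \<and> 3 dvd length xs \<and> ?d xs = x" if "x \<in> ?S" for x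
    using that
  proof induction
    case zero
    show ?case by (rule exI[of _ "[]"]) simp
  next
    case (gen1 b)
    then show ?case
      by (intro exI[of _ "[\<zero>\<^bsub>B\<^esub>, \<zero>\<^bsub>B\<^esub>, b]"]) (simp add: D0 r0 D_closed dvd_eq_mod_eq_0)
  next
    case (gen2 b c)
    then show ?case
      by (intro exI[of _ "[b, c, \<zero>\<^bsub>B\<^esub>]"]) (simp add: D0 r_closed D_closed dvd_eq_mod_eq_0)
  next
    case (add x y)
    then obtain xs ys where "set xs \<subseteq> carrier B" "3 dvd length xs" "?d xs = x"
      "set ys \<subseteq> carrier B" "3 dvd length ys" "?d ys = y" by blast
    then show ?case by (intro exI[of _ "xs @ ys"]) (simp add: d_append)
  qed

  define code :: "'e \<Rightarrow> (nat \<Rightarrow> 'b list) \<Rightarrow> bool" where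
    "code x f \<longleftrightarrow> (\<forall>n. ?d (f n) \<in> carrier E \<and> nrm E (x \<ominus>\<^bsub>E\<^esub> ?d (f n)) < 1 / real (Suc n))" for x f
  define \<kappa> where "\<kappa> x = (SOME f. code x f)" for x
  have \<kappa>: "code x (\<kappa> x)" if "x \<in> X" for x
    unfolding \<kappa>_def
  proof (rule someI_ex[of "code x"])
    have ex: "\<exists>xs. ?d xs \<in> carrier E \<and> nrm E (x \<ominus>\<^bsub>E\<^esub> ?d xs) < 1 / real (Suc n)" for n
    proof -
      have "0 < 1 / real (Suc n)" by simp
      then obtain s where s: "s \<in> ?S" "nrm E (x \<ominus>\<^bsub>E\<^esub> s) < 1 / real (Suc n)"
        using \<open>x \<in> X\<close> unfolding X_def by blast
      then show ?thesis using S_code[OF s(1)] S_closed by blast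
    qed
    show "\<exists>f. code x f" unfolding code_def by (rule choice, rule allI, rule ex)
  qed
  have inj: "inj_on \<kappa> X"
  proof (rule inj_onI)
    fix x y assume x: "x \<in> X" and y: "y \<in> X" and eq: "\<kappa> x = \<kappa> y"
    have E: "x \<in> carrier E" "y \<in> carrier E" using x y XE by auto
    have "nrm E (x \<ominus>\<^bsub>E\<^esub> y) \<le> 2 * inverse (real (Suc n))" for n
    proof -
      let ?z = "?d (\<kappa> x n)"
      have z: "?z \<in> carrier E" "nrm E (x \<ominus>\<^bsub>E\<^esub> ?z) < 1 / real (Suc n)"
          "nrm E (y \<ominus>\<^bsub>E\<^esub> ?z) < 1 / real (Suc n)"
        using \<kappa>[OF x] \<kappa>[OF y] eq unfolding code_def by metis+
      then show ?thesis
        using minus_trans[of x ?z y] nrm_minus_commute[of y ?z] E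
        by (simp add: inverse_eq_divide)
    qed
    moreover have "(\<lambda>n. 2 * inverse (real (Suc n))) \<longlonglongrightarrow> 0"
      using tendsto_mult_left[OF LIMSEQ_inverse_real_of_nat, of 2] by simp
    ultimately have "nrm E (x \<ominus>\<^bsub>E\<^esub> y) \<le> 0"
      by (intro LIMSEQ_le_const[of "\<lambda>n. 2 * inverse (real (Suc n))" 0]) auto
    then have "nrm E (x \<ominus>\<^bsub>E\<^esub> y) = 0" using nrm_nonneg[of "x \<ominus>\<^bsub>E\<^esub> y"] E by simp
    then have "x \<ominus>\<^bsub>E\<^esub> y = \<zero>\<^bsub>E\<^esub>" using nrm_eq_zero[of "x \<ominus>\<^bsub>E\<^esub> y"] E by simp
    then show "x = y"
      using minus_equality[of x "\<ominus>\<^bsub>E\<^esub> y"] E by (simp add: minus_eq)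
  qed
  have zeroX: "\<zero>\<^bsub>E\<^esub> \<in> X" by (rule SX[OF derivation_span.zero])
  define g where "g = the_inv_into X \<kappa>"
  define F where "F = transported \<kappa> X E"
  let ?l = "\<lambda>a u. \<kappa> (l a (g u))" and ?r = "\<lambda>u a. \<kappa> (r (g u) a)"
  note tr = banach_bimodule_transported[OF XE inj zeroX X_add X_smult X_l X_r X_lim]
  have bimF: "banach_bimodule B F ?l ?r"
    unfolding F_def g_def by (rule tr(1))
  have minusF: "\<kappa> x \<ominus>\<^bsub>F\<^esub> \<kappa> y = \<kappa> (x \<ominus>\<^bsub>E\<^esub> y)" if "x \<in> X" "y \<in> X" for x y
    unfolding F_def by (rule tr(2)) (use that in auto)
  have g: "g (\<kappa> x) = x" if "x \<in> X" for x
    unfolding g_def by (rule the_inv_into_f_f[OF inj that])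
  have F: "carrier F = \<kappa> ` X" "u \<oplus>\<^bsub>F\<^esub> v = \<kappa> (g u \<oplus>\<^bsub>E\<^esub> g v)"
    "c \<odot>\<^bsub>F\<^esub> u = \<kappa> (c \<odot>\<^bsub>E\<^esub> g u)" "nrm F u = nrm E (g u)" for u v c
    by (simp_all add: F_def transported_def g_def Let_def)
  have DX: "D a \<in> X" if "a \<in> carrier B" for a
    by (rule SX[OF derivation_span.gen1[OF that]])
  have derF: "bounded_derivation B F ?l ?r (\<lambda>a. \<kappa> (D a))"
    unfolding bounded_derivation_def
    by (auto simp: F g DX D_add D_smult D_mult X_l X_r intro!: exI[of _ CD] CD)
  from contr bimF derF have "inner_derivation B F ?l ?r (\<lambda>a. \<kappa> (D a))"
    unfolding contractible_algebra_def derivations_inner_def by blast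
  then obtain z where z: "z \<in> X" "\<And>a. a \<in> carrier B \<Longrightarrow> \<kappa> (D a) = \<kappa> (r z a) \<ominus>\<^bsub>F\<^esub> \<kappa> (l a z)"
    unfolding inner_derivation_def by (auto simp: F g)
  have "D a = r z a \<ominus>\<^bsub>E\<^esub> l a z" if a: "a \<in> carrier B" for a
  proof -
    have zX: "r z a \<in> X" "l a z \<in> X" using X_r[OF a z(1)] X_l[OF a z(1)] by auto
    have "r z a \<ominus>\<^bsub>E\<^esub> l a z \<in> X"
      using X_add[OF zX(1) X_smult[OF zX(2), of "-1"]] zX XE
      by (simp add: minus_as_smult subset_iff)
    moreover have "\<kappa> (D a) = \<kappa> (r z a \<ominus>\<^bsub>E\<^esub> l a z)" using z(2)[OF a] minusF[OF zX] by simp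
    ultimately show ?thesis using inj DX[OF a] by (auto dest: inj_onD)
  qed
  then show "inner_derivation B E l r D"
    unfolding inner_derivation_def using z(1) XE by blast
qed


section \<open>The measure algebra\<close>

text \<open>Complex Borel measures are set functions, with value 0 outside the Borel sets.\<close>

definition complex_measure :: "('g::topological_space set \<Rightarrow> complex) \<Rightarrow> bool" where
  "complex_measure \<mu> \<longleftrightarrow>
     (\<forall>S. S \<notin> sets borel \<longrightarrow> \<mu> S = 0) \<and>
     (\<forall>S :: nat \<Rightarrow> 'g set. range S \<subseteq> sets borel \<longrightarrow> disjoint_family S \<longrightarrow>
        (\<lambda>n. \<mu> (S n)) sums \<mu> (\<Union>n. S n))"

definition variation :: "('g::topological_space set \<Rightarrow> complex) \<Rightarrow> 'g set \<Rightarrow> ennreal" where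
  "variation \<mu> S = (SUP P \<in> {P. finite P \<and> P \<subseteq> sets borel \<and> disjoint P \<and> \<Union>P = S}.
     \<Sum>T\<in>P. ennreal (cmod (\<mu> T)))"

definition regular_measure :: "('g::topological_space set \<Rightarrow> complex) \<Rightarrow> bool" where
  "regular_measure \<mu> \<longleftrightarrow>
     (\<forall>S\<in>sets borel. variation \<mu> S = (INF U \<in> {U. open U \<and> S \<subseteq> U}. variation \<mu> U) \<and>
        variation \<mu> S = (SUP K \<in> {K. compact K \<and> K \<subseteq> S}. variation \<mu> K))"

text \<open>
  The positive part \<open>\<rho>\<^sup>+\<close> of a finite signed measure, \<open>\<rho>\<^sup>+ S = sup {\<rho> T | T \<subseteq> S}\<close>; the negative
  part is \<open>(- \<rho>)\<^sup>+\<close>.  (The function \<open>ennreal\<close> sends negative reals to 0, which does not change the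
  supremum since \<open>T = {}\<close> is allowed.)
\<close>

definition positive_part :: "('g::topological_space set \<Rightarrow> real) \<Rightarrow> 'g measure" where
  "positive_part \<rho> = measure_of UNIV (sets borel)
     (\<lambda>S. SUP T \<in> {T \<in> sets borel. T \<subseteq> S}. ennreal (\<rho> T))"

definition complex_integral ::
  "('g::topological_space set \<Rightarrow> complex) \<Rightarrow> ('g \<Rightarrow> complex) \<Rightarrow> complex"
where
  "complex_integral \<mu> f =
     (LINT x|positive_part (\<lambda>S. Re (\<mu> S)). f x) - (LINT x|positive_part (\<lambda>S. - Re (\<mu> S)). f x) +
     \<i> * ((LINT x|positive_part (\<lambda>S. Im (\<mu> S)). f x) - (LINT x|positive_part (\<lambda>S. - Im (\<mu> S)). f x))"

text \<open>
  Groups are written additively but are not assumed to be commutative (as always with the class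
  \<open>group_add\<close>).  The convolution is
  \<open>(\<mu> * \<nu>)(S) = \<integral>\<integral> 1\<^sub>S(x + y) d\<nu>(y) d\<mu>(x) = \<integral> \<nu>({y. x + y \<in> S}) d\<mu>(x)\<close>.
  The iterated form is used because for a group that is not second countable the Borel sets of the
  product may fail to belong to the product sigma-algebra.
\<close>

definition convolution ::
  "('g::{topological_space, plus} set \<Rightarrow> complex) \<Rightarrow> ('g set \<Rightarrow> complex) \<Rightarrow> 'g set \<Rightarrow> complex"
where
  "convolution \<mu> \<nu> S =
     (if S \<in> sets borel then complex_integral \<mu> (\<lambda>x. \<nu> {y. x + y \<in> S}) else 0)"

definition measure_algebra :: "('g::{topological_group_add, t2_space} set \<Rightarrow> complex) normed_alg" where
  "measure_algebra =
     \<lparr>carrier = {\<mu>. complex_measure \<mu> \<and> regular_measure \<mu>},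
      monoid.mult = convolution,
      one = (\<lambda>S. if S \<in> sets borel \<and> 0 \<in> S then 1 else 0),
      ring.zero = (\<lambda>S. 0),
      add = (\<lambda>\<mu> \<nu> S. \<mu> S + \<nu> S),
      smult = (\<lambda>c \<mu> S. c * \<mu> S),
      nrm = (\<lambda>\<mu>. enn2real (variation \<mu> UNIV))\<rparr>"


section \<open>The projective tensor product\<close>

text \<open>
  A list \<open>[(a\<^sub>1, b\<^sub>1), \<dots>, (a\<^sub>n, b\<^sub>n)]\<close> stands for the sum of the elementary tensors of \<open>a\<^sub>i\<close> and \<open>b\<^sub>i\<close>.
  The algebraic tensor product consists of such formal sums modulo the bilinearity relations.
\<close>

inductive_set tensor_rel ::
  "'a normed_alg \<Rightarrow> 'b normed_alg \<Rightarrow> (('a \<times> 'b) list \<times> ('a \<times> 'b) list) set"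
  for A :: "'a normed_alg" and B :: "'b normed_alg"
where
  refl: "L \<in> lists (carrier A \<times> carrier B) \<Longrightarrow> (L, L) \<in> tensor_rel A B"
| sym: "(L, M) \<in> tensor_rel A B \<Longrightarrow> (M, L) \<in> tensor_rel A B"
| trans: "(L, M) \<in> tensor_rel A B \<Longrightarrow> (M, N) \<in> tensor_rel A B \<Longrightarrow> (L, N) \<in> tensor_rel A B"
| append: "(L, L') \<in> tensor_rel A B \<Longrightarrow> (M, M') \<in> tensor_rel A B \<Longrightarrow>
    (L @ M, L' @ M') \<in> tensor_rel A B"
| commute: "L \<in> lists (carrier A \<times> carrier B) \<Longrightarrow> M \<in> lists (carrier A \<times> carrier B) \<Longrightarrow>
    (L @ M, M @ L) \<in> tensor_rel A B"
| add_left: "a \<in> carrier A \<Longrightarrow> a' \<in> carrier A \<Longrightarrow> b \<in> carrier B \<Longrightarrow>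
    ([(a \<oplus>\<^bsub>A\<^esub> a', b)], [(a, b), (a', b)]) \<in> tensor_rel A B"
| add_right: "a \<in> carrier A \<Longrightarrow> b \<in> carrier B \<Longrightarrow> b' \<in> carrier B \<Longrightarrow>
    ([(a, b \<oplus>\<^bsub>B\<^esub> b')], [(a, b), (a, b')]) \<in> tensor_rel A B"
| smult: "a \<in> carrier A \<Longrightarrow> b \<in> carrier B \<Longrightarrow>
    ([(c \<odot>\<^bsub>A\<^esub> a, b)], [(a, c \<odot>\<^bsub>B\<^esub> b)]) \<in> tensor_rel A B"
| zero: "b \<in> carrier B \<Longrightarrow> ([(\<zero>\<^bsub>A\<^esub>, b)], []) \<in> tensor_rel A B"

text \<open>
  Operations on classes are images of the operations on representatives.  The elements of a class
  are exactly the representations of the tensor, hence the infimum below is the projective norm.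
\<close>

definition algebraic_tensor ::
  "'a normed_alg \<Rightarrow> 'b normed_alg \<Rightarrow> ('a \<times> 'b) list set normed_alg"
where
  "algebraic_tensor A B =
     \<lparr>carrier = lists (carrier A \<times> carrier B) // tensor_rel A B,
      monoid.mult = (\<lambda>U V. \<Union>L\<in>U. \<Union>M\<in>V. tensor_rel A B ``
        {map (\<lambda>((a, b), (a', b')). (a \<otimes>\<^bsub>A\<^esub> a', b \<otimes>\<^bsub>B\<^esub> b')) (List.product L M)}),
      one = tensor_rel A B `` {[(\<one>\<^bsub>A\<^esub>, \<one>\<^bsub>B\<^esub>)]},
      ring.zero = tensor_rel A B `` {[]},
      add = (\<lambda>U V. \<Union>L\<in>U. \<Union>M\<in>V. tensor_rel A B `` {L @ M}),
      smult = (\<lambda>c U. \<Union>L\<in>U. tensor_rel A B `` {map (\<lambda>(a, b). (c \<odot>\<^bsub>A\<^esub> a, b)) L}),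
      nrm = (\<lambda>U. INF L\<in>U. \<Sum>(a, b)\<leftarrow>L. nrm A a * nrm B b)\<rparr>"

definition null_rel :: "'a normed_alg \<Rightarrow> ((nat \<Rightarrow> 'a) \<times> (nat \<Rightarrow> 'a)) set" where
  "null_rel V = {(s, t). s \<in> cauchy_seqs V \<and> t \<in> cauchy_seqs V \<and>
     (\<lambda>n. nrm V (s n \<ominus>\<^bsub>V\<^esub> t n)) \<longlonglongrightarrow> 0}"

text \<open>The completion of a normed algebra: Cauchy sequences modulo null sequences.\<close>

definition completion :: "'a normed_alg \<Rightarrow> (nat \<Rightarrow> 'a) set normed_alg" where
  "completion V =
     \<lparr>carrier = cauchy_seqs V // null_rel V,
      monoid.mult = (\<lambda>X Y. \<Union>s\<in>X. \<Union>t\<in>Y. null_rel V `` {\<lambda>n. s n \<otimes>\<^bsub>V\<^esub> t n}),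
      one = null_rel V `` {\<lambda>n. \<one>\<^bsub>V\<^esub>},
      ring.zero = null_rel V `` {\<lambda>n. \<zero>\<^bsub>V\<^esub>},
      add = (\<lambda>X Y. \<Union>s\<in>X. \<Union>t\<in>Y. null_rel V `` {\<lambda>n. s n \<oplus>\<^bsub>V\<^esub> t n}),
      smult = (\<lambda>c X. \<Union>s\<in>X. null_rel V `` {\<lambda>n. c \<odot>\<^bsub>V\<^esub> s n}),
      nrm = (\<lambda>X. THE \<rho>. \<forall>s\<in>X. (\<lambda>n. nrm V (s n)) \<longlonglongrightarrow> \<rho>)\<rparr>"

definition projective_tensor ::
  "'a normed_alg \<Rightarrow> 'b normed_alg \<Rightarrow> (nat \<Rightarrow> ('a \<times> 'b) list set) set normed_alg"
where
  "projective_tensor A B = completion (algebraic_tensor A B)"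

end

theory Submission
  imports Defs
begin

text \<open>
  Necessity rests on the fact that contractibility passes to quotients: along a bounded homomorphism \<open>\<theta>\<close> onto an
  algebra \<open>F\<close> every bimodule over \<open>F\<close> and every derivation of \<open>F\<close> can be pulled back, and an element that implements
  the pulled back derivation implements the original one.  Two homomorphisms are used.  The total mass
  \<open>\<mu> \<mapsto> \<mu> UNIV\<close> is a character of the measure algebra and gives the homomorphism \<open>\<mu> \<otimes> a \<mapsto> \<mu> UNIV \<cdot> a\<close> onto \<open>A\<close>
  (\<open>contractible_factor\<close>).  A character \<open>\<phi>\<close> of \<open>A\<close> and the passage to the atoms of a measure give the
  homomorphism \<open>\<mu> \<otimes> a \<mapsto> \<phi> a \<cdot> (\<lambda>x. \<mu> {x})\<close> into the absolutely summable functions on the group, regarded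
  as a discrete group (\<open>finite_group_if_contractible\<close>).  On that algebra the derivation
  \<open>f \<mapsto> f - (\<Sum>\<^sub>\<infinity>x. f x) \<cdot> \<delta>\<^sub>0\<close> into the functions with sum 0 can be implemented only if a non-zero constant
  function is summable, that is, if the group is finite (\<open>finite_group_if_l1_quotient\<close>).  Point masses
  exist whatever the topology of the group is, so discrete and non-discrete groups are treated alike.

  For sufficiency let \<open>D\<close> be a derivation of the tensor product.  Contractibility of \<open>A\<close>, which also provides a unit
  \<open>e\<close> of \<open>A\<close>, allows \<open>D\<close> to be changed by an inner derivation so that it vanishes on all \<open>\<delta>\<^sub>0 \<otimes> a\<close>.  It then
  suffices to average \<open>D (\<delta>\<^sub>h \<otimes> e) \<cdot> (\<delta>\<^sub>-\<^sub>h \<otimes> e)\<close> over the finite group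
  (\<open>derivation_inner_if_vanishes_on_factor\<close>): this implements \<open>D\<close> on all \<open>\<delta>\<^sub>g \<otimes> a\<close>, and these span a dense
  subspace because a measure on a finite group is a combination of point masses.

  Most of the work lies in the objects themselves.  The convolution of regular measures must be shown to be a
  regular measure on a group that need not be second countable, so that the Borel sets of the product may lie outside
  the product sigma-algebra.  The lemma \<open>squeezes_convolution_measure\<close> does this for positive measures, by
  approximating both factors and using local compactness, and \<open>variation_convolution_le\<close> transfers it to complex measures.
  The projective tensor product is treated only as far as its elements and homomorphisms are concerned: it is the
  completion of a seminormed algebra, elementary tensors span a dense subspace (\<open>bounded_linear_vanishes\<close>), and
  multiplicative bounded bilinear maps extend to it (\<open>extends_to_projective_tensor\<close>).  This needs a product that is
  bounded by some constant, and so a crude bound for the norm of a convolution is enough.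
\<close>


section \<open>Total variation\<close>

lemma complex_measure_sums:
  fixes S :: "nat \<Rightarrow> 'g::topological_space set"
  assumes "complex_measure \<mu>" "range S \<subseteq> sets borel" "disjoint_family S"
  shows "(\<lambda>n. \<mu> (S n)) sums \<mu> (\<Union>n. S n)"
  using assms by (auto simp: complex_measure_def)

lemma complex_measure_empty: "complex_measure \<mu> \<Longrightarrow> \<mu> {} = 0"
  using complex_measure_sums[of \<mu> "\<lambda>_. {}"] summable_const_iff[of "\<mu> {}"]
  by (auto simp: disjoint_family_on_def sums_iff)

lemma complex_measure_Un:
  assumes \<mu>: "complex_measure \<mu>" and "S \<in> sets borel" "T \<in> sets borel" "S \<inter> T = {}"
  shows "\<mu> (S \<union> T) = \<mu> S + \<mu> T"
proof -
  have "(\<lambda>n. \<mu> (binaryset S T n)) sums \<mu> (\<Union>n. binaryset S T n)"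
    using assms by (intro complex_measure_sums)
      (auto simp: range_binaryset_eq disjoint_family_on_def binaryset_def)
  moreover have "(\<lambda>n. \<mu> (binaryset S T n)) sums (\<mu> S + \<mu> T)"
    by (rule binaryset_sums) (rule complex_measure_empty[OF \<mu>])
  ultimately show ?thesis by (simp add: UN_binaryset_eq sums_unique2)
qed

lemma complex_measure_Diff:
  assumes \<mu>: "complex_measure \<mu>" and "S \<in> sets borel" "T \<in> sets borel" "T \<subseteq> S"
  shows "\<mu> (S - T) = \<mu> S - \<mu> T"
proof -
  have "\<mu> (T \<union> (S - T)) = \<mu> T + \<mu> (S - T)" using assms by (intro complex_measure_Un) auto
  moreover have "T \<union> (S - T) = S" using assms by auto
  ultimately show ?thesis by simp
qed

lemma complex_measure_finite_UN:
  assumes \<mu>: "complex_measure \<mu>" and "finite I" "\<And>i. i \<in> I \<Longrightarrow> F i \<in> sets borel"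
    and "disjoint_family_on F I"
  shows "\<mu> (\<Union>i\<in>I. F i) = (\<Sum>i\<in>I. \<mu> (F i))"
  using assms(2-)
proof (induction I rule: finite_induct)
  case empty
  show ?case using complex_measure_empty[OF \<mu>] by simp
next
  case (insert i I)
  have "F i \<inter> (\<Union>j\<in>I. F j) = {}"
    using insert.hyps insert.prems(2) by (fastforce simp: disjoint_family_on_def)
  then have "\<mu> (F i \<union> (\<Union>j\<in>I. F j)) = \<mu> (F i) + \<mu> (\<Union>j\<in>I. F j)"
    using insert by (intro complex_measure_Un[OF \<mu>]) (auto intro: sets.finite_UN)
  then show ?case using insert by (auto simp: disjoint_family_on_def)
qed

text \<open>
  The total variation and the positive part are both suprema over finite families of subsets.  For such set
  functions one inequality of additivity is clear for two sets, by joining families, and the other one for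
  countably many sets, by cutting a family into pieces; the two together suffice.
\<close>

lemma countably_additive_if_super_sub:
  fixes V :: "'a set \<Rightarrow> ennreal"
  assumes M: "sigma_algebra \<Omega> M"
    and super: "\<And>S T. S \<in> M \<Longrightarrow> T \<in> M \<Longrightarrow> S \<inter> T = {} \<Longrightarrow> V S + V T \<le> V (S \<union> T)"
    and sub: "\<And>S. range S \<subseteq> M \<Longrightarrow> disjoint_family S \<Longrightarrow> V (\<Union>n. S n) \<le> (\<Sum>n. V (S n))"
  shows "countably_additive M V"
proof (rule countably_additiveI)
  interpret sigma_algebra \<Omega> M by (rule M)
  fix S :: "nat \<Rightarrow> 'a set"
  assume S: "range S \<subseteq> M" "disjoint_family S" "(\<Union>n. S n) \<in> M"
  have SM: "S n \<in> M" for n using S(1) by auto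
  have mono: "V A \<le> V B" if "A \<in> M" "B \<in> M" "A \<subseteq> B" for A B
  proof -
    have "V A \<le> V A + V (B - A)" by simp
    also have "\<dots> \<le> V (A \<union> (B - A))" using that by (intro super) auto
    also have "A \<union> (B - A) = B" using that by auto
    finally show ?thesis .
  qed
  have "(\<Sum>i<n. V (S i)) \<le> V (\<Union>i<n. S i)" for n
  proof (induction n)
    case (Suc n)
    have "S n \<inter> S i = {}" if "i < n" for i
      using S(2) that by (simp add: disjoint_family_on_def)
    then have "S n \<inter> (\<Union>i<n. S i) = {}" by blast
    then have "V (S n) + V (\<Union>i<n. S i) \<le> V (S n \<union> (\<Union>i<n. S i))"
      by (intro super finite_UN) (auto simp: SM)
    moreover have "S n \<union> (\<Union>i<n. S i) = (\<Union>i<Suc n. S i)" by (auto simp: less_Suc_eq)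
    moreover have "(\<Sum>i<Suc n. V (S i)) \<le> V (S n) + V (\<Union>i<n. S i)"
      using add_mono[OF Suc order_refl[of "V (S n)"]] by (simp add: add.commute)
    ultimately show ?case by (simp only:)
  qed simp
  moreover have "V (\<Union>i<n. S i) \<le> V (\<Union>n. S n)" for n
    by (intro mono finite_UN S(3)) (auto simp: SM)
  ultimately have "(\<Sum>i<n. V (S i)) \<le> V (\<Union>n. S n)" for n by (rule order_trans)
  then have "(\<Sum>n. V (S n)) \<le> V (\<Union>n. S n)" by (intro suminf_le_const) auto
  with sub[OF S(1,2)] show "(\<Sum>n. V (S n)) = V (\<Union>n. S n)" by (rule antisym[rotated])
qed

lemma ennreal_SUP_add_SUP_le:
  fixes f :: "'i \<Rightarrow> ennreal" and g :: "'j \<Rightarrow> ennreal"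
  assumes "I \<noteq> {}" "J \<noteq> {}" and le: "\<And>i j. i \<in> I \<Longrightarrow> j \<in> J \<Longrightarrow> f i + g j \<le> c"
  shows "(SUP i\<in>I. f i) + (SUP j\<in>J. g j) \<le> c"
proof -
  have "(SUP i\<in>I. f i) + (SUP j\<in>J. g j) = (SUP i\<in>I. f i + (SUP j\<in>J. g j))"
    by (simp add: ennreal_SUP_add_left assms(1))
  also have "\<dots> = (SUP i\<in>I. SUP j\<in>J. f i + g j)"
    by (simp add: ennreal_SUP_add_right assms(2))
  also have "\<dots> \<le> c" by (intro SUP_least le)
  finally show ?thesis .
qed

lemma variation_upper:
  assumes \<mu>: "complex_measure \<mu>" and I: "finite I" "\<And>i. i \<in> I \<Longrightarrow> F i \<in> sets borel"
    and disj: "disjoint_family_on F I" and S: "S \<in> sets borel" "(\<Union>i\<in>I. F i) \<subseteq> S"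
  shows "(\<Sum>i\<in>I. ennreal (cmod (\<mu> (F i)))) \<le> variation \<mu> S"
proof -
  let ?R = "S - (\<Union>i\<in>I. F i)"
  let ?P = "insert ?R (F ` I)"
  have [measurable]: "?R \<in> sets borel" using I S by (auto intro: sets.finite_UN)
  have "(\<Sum>i\<in>I. ennreal (cmod (\<mu> (F i)))) = (\<Sum>T\<in>F ` I. ennreal (cmod (\<mu> T)))"
  proof (subst sum.reindex_nontrivial[OF I(1)])
    fix i j assume "i \<in> I" "j \<in> I" "i \<noteq> j" "F i = F j"
    then have "F i = {}" using disj unfolding disjoint_family_on_def by (metis Int_absorb)
    then show "ennreal (cmod (\<mu> (F i))) = 0" by (simp add: complex_measure_empty[OF \<mu>])
  qed simp
  also have "\<dots> \<le> (\<Sum>T\<in>?P. ennreal (cmod (\<mu> T)))"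
    using I by (intro sum_mono2) auto
  also have "\<dots> \<le> variation \<mu> S"
    unfolding variation_def
  proof (rule SUP_upper, intro CollectI conjI)
    show "disjoint ?P"
    proof (rule disjointI)
      fix a b assume ab: "a \<in> ?P" "b \<in> ?P" "a \<noteq> b"
      have "F i \<inter> F j = {}" if "i \<in> I" "j \<in> I" "F i \<noteq> F j" for i j
        using disj that unfolding disjoint_family_on_def by metis
      then show "a \<inter> b = {}" using ab by auto
    qed
  qed (use I S in auto)
  finally show ?thesis .
qed

lemma cmod_le_variation:
  assumes "complex_measure \<mu>" "S \<in> sets borel"
  shows "ennreal (cmod (\<mu> S)) \<le> variation \<mu> S"
  using variation_upper[of \<mu> "{()}" "\<lambda>_. S" S] assms by (auto simp: disjoint_family_on_def)

lemma variation_least: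
  assumes "\<And>P. finite P \<Longrightarrow> P \<subseteq> sets borel \<Longrightarrow> disjoint P \<Longrightarrow> \<Union>P = S \<Longrightarrow>
    (\<Sum>T\<in>P. ennreal (cmod (\<mu> T))) \<le> c"
  shows "variation \<mu> S \<le> c"
  unfolding variation_def by (intro SUP_least) (use assms in auto)

lemma partitions_nonempty:
  "S \<in> sets borel \<Longrightarrow> {P. finite P \<and> P \<subseteq> sets borel \<and> disjoint P \<and> \<Union>P = S} \<noteq> {}"
  by (auto intro!: exI[of _ "{S}"])

lemma disjoint_family_on_id: "disjoint P \<Longrightarrow> disjoint_family_on (\<lambda>T. T) P"
  by (auto simp: disjoint_family_on_def disjoint_def)

lemma variation_countably_additive:
  assumes \<mu>: "complex_measure \<mu>"
  shows "countably_additive (sets borel) (variation \<mu>)"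
proof (rule countably_additive_if_super_sub)
  show "sigma_algebra UNIV (sets borel)" using sets.sigma_algebra_axioms[of borel] by simp
next
  fix S T :: "'a set"
  assume ST: "S \<in> sets borel" "T \<in> sets borel" "S \<inter> T = {}"
  have "(\<Sum>T\<in>P. ennreal (cmod (\<mu> T))) + (\<Sum>T\<in>Q. ennreal (cmod (\<mu> T))) \<le> variation \<mu> (S \<union> T)"
    if P: "finite P" "P \<subseteq> sets borel" "disjoint P" "\<Union>P = S"
      and Q: "finite Q" "Q \<subseteq> sets borel" "disjoint Q" "\<Union>Q = T" for P Q
  proof -
    have "P \<inter> Q \<subseteq> {{}}" using P Q ST by auto
    then have 0: "(\<Sum>T\<in>P \<inter> Q. ennreal (cmod (\<mu> T))) = 0"
      by (intro sum.neutral) (auto simp: complex_measure_empty[OF \<mu>])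
    have "disjoint (P \<union> Q)" using P Q ST by (intro disjoint_union) auto
    then have "(\<Sum>T\<in>P \<union> Q. ennreal (cmod (\<mu> T))) \<le> variation \<mu> (S \<union> T)"
      using P Q ST by (intro variation_upper[OF \<mu>] disjoint_family_on_id) auto
    then show ?thesis using sum.union_inter[OF P(1) Q(1), of "\<lambda>T. ennreal (cmod (\<mu> T))"] 0 by simp
  qed
  then show "variation \<mu> S + variation \<mu> T \<le> variation \<mu> (S \<union> T)"
    unfolding variation_def[of \<mu> S] variation_def[of \<mu> T]
    by (intro ennreal_SUP_add_SUP_le partitions_nonempty ST) auto
next
  fix S :: "nat \<Rightarrow> 'a set"
  assume S: "range S \<subseteq> sets borel" "disjoint_family S"
  show "variation \<mu> (\<Union>n. S n) \<le> (\<Sum>n. variation \<mu> (S n))"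
  proof (rule variation_least)
    fix P assume P: "finite P" "P \<subseteq> sets borel" "disjoint P" "\<Union>P = (\<Union>n. S n)"
    have "ennreal (cmod (\<mu> T)) \<le> (\<Sum>n. ennreal (cmod (\<mu> (T \<inter> S n))))" if "T \<in> P" for T
    proof -
      have "(\<lambda>n. \<mu> (T \<inter> S n)) sums \<mu> (\<Union>n. T \<inter> S n)"
        using S P that by (intro complex_measure_sums[OF \<mu>]) (auto simp: disjoint_family_on_def)
      moreover have "(\<Union>n. T \<inter> S n) = T" using P that by auto
      ultimately have "(\<lambda>n. ennreal (cmod (\<Sum>i<n. \<mu> (T \<inter> S i)))) \<longlonglongrightarrow> ennreal (cmod (\<mu> T))"
        by (intro tendsto_ennrealI tendsto_norm) (simp add: sums_def)
      moreover have "ennreal (cmod (\<Sum>i<n. \<mu> (T \<inter> S i))) \<le> (\<Sum>n. ennreal (cmod (\<mu> (T \<inter> S n))))" for n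
      proof -
        have "ennreal (cmod (\<Sum>i<n. \<mu> (T \<inter> S i))) \<le> (\<Sum>i<n. ennreal (cmod (\<mu> (T \<inter> S i))))"
          by (simp add: norm_sum ennreal_leI)
        also have "\<dots> \<le> (\<Sum>n. ennreal (cmod (\<mu> (T \<inter> S n))))"
          by (rule sum_le_suminf) auto
        finally show ?thesis .
      qed
      ultimately show ?thesis using LIMSEQ_le_const2 by fast
    qed
    then have "(\<Sum>T\<in>P. ennreal (cmod (\<mu> T))) \<le> (\<Sum>T\<in>P. \<Sum>n. ennreal (cmod (\<mu> (T \<inter> S n))))"
      by (intro sum_mono) auto
    also have "\<dots> = (\<Sum>n. \<Sum>T\<in>P. ennreal (cmod (\<mu> (T \<inter> S n))))"
      by (rule suminf_sum[symmetric]) simp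
    also have "\<dots> \<le> (\<Sum>n. variation \<mu> (S n))"
    proof (intro suminf_le variation_upper[OF \<mu>] P(1))
      fix n show "disjoint_family_on (\<lambda>T. T \<inter> S n) P"
        using P(3) by (auto simp: disjoint_family_on_def disjoint_def)
    qed (use S P in auto)
    finally show "(\<Sum>T\<in>P. ennreal (cmod (\<mu> T))) \<le> (\<Sum>n. variation \<mu> (S n))" .
  qed
qed

lemma variation_empty: "complex_measure \<mu> \<Longrightarrow> variation \<mu> {} = 0"
  by (rule antisym[OF variation_least])
    (auto intro!: sum.neutral simp del: sum_ennreal simp: complex_measure_empty)

definition variation_measure :: "('g::topological_space set \<Rightarrow> complex) \<Rightarrow> 'g measure" where
  "variation_measure \<mu> = measure_of UNIV (sets borel) (variation \<mu>)"

lemma sets_variation_measure [simp, measurable_cong]: "sets (variation_measure \<mu>) = sets borel"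
  using sets.sigma_sets_eq[of borel] by (simp add: variation_measure_def)

lemma space_variation_measure [simp]: "space (variation_measure \<mu>) = UNIV"
  by (simp add: variation_measure_def)

lemma emeasure_variation_measure:
  assumes "complex_measure \<mu>" "S \<in> sets borel"
  shows "emeasure (variation_measure \<mu>) S = variation \<mu> S"
  unfolding variation_measure_def
  using variation_countably_additive[OF assms(1)] variation_empty[OF assms(1)] assms(2)
    sets.sigma_algebra_axioms[of borel]
  by (intro emeasure_measure_of_sigma) (auto simp: positive_def)

text \<open>
  Among the four half planes \<open>Re z > 0\<close>, \<open>Re z < 0\<close>, \<open>Im z > 0\<close>, \<open>Im z < 0\<close> one catches at least a quarter of
  the sum of the moduli, and the terms in a half plane do not cancel.
\<close>

lemma exists_subset_norm_sum_ge:
  fixes z :: "'i \<Rightarrow> complex"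
  assumes "finite I"
  shows "\<exists>J\<subseteq>I. (\<Sum>i\<in>I. cmod (z i)) \<le> 4 * cmod (\<Sum>i\<in>J. z i)"
proof (rule ccontr)
  assume neg: "\<not> ?thesis"
  define s where "s = (\<Sum>i\<in>I. cmod (z i))"
  have less: "4 * cmod (\<Sum>i\<in>J. z i) < s" if "J \<subseteq> I" for J
  proof (rule ccontr)
    assume "\<not> ?thesis"
    then have "\<exists>J\<subseteq>I. (\<Sum>i\<in>I. cmod (z i)) \<le> 4 * cmod (\<Sum>i\<in>J. z i)"
      using that by (intro exI[of _ J]) (simp add: s_def)
    then show False using neg by contradiction
  qed
  have part: "(\<Sum>i\<in>I. max 0 (Re (c * z i))) < s / 4" if c: "cmod c = 1" for c
  proof -
    let ?J = "{i\<in>I. Re (c * z i) > 0}"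
    have "(\<Sum>i\<in>I. max 0 (Re (c * z i))) = (\<Sum>i\<in>?J. max 0 (Re (c * z i)))"
      using assms by (intro sum.mono_neutral_right) auto
    also have "\<dots> = Re (c * (\<Sum>i\<in>?J. z i))"
      by (auto simp: sum_distrib_left intro!: sum.cong)
    also have "\<dots> \<le> cmod (\<Sum>i\<in>?J. z i)"
      using complex_Re_le_cmod[of "c * (\<Sum>i\<in>?J. z i)"] c by (simp add: norm_mult)
    also have "\<dots> < s / 4"
      using less[of ?J] by simp
    finally show ?thesis .
  qed
  have "s \<le> (\<Sum>i\<in>I. max 0 (Re (1 * z i)) + max 0 (Re (-1 * z i)) +
      max 0 (Re (\<i> * z i)) + max 0 (Re (-\<i> * z i)))"
    unfolding s_def
  proof (rule sum_mono)
    fix i show "cmod (z i) \<le> max 0 (Re (1 * z i)) + max 0 (Re (-1 * z i)) +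
      max 0 (Re (\<i> * z i)) + max 0 (Re (-\<i> * z i))"
      using cmod_le[of "z i"] by (auto simp: max_def)
  qed
  also have "\<dots> < s / 4 + s / 4 + s / 4 + s / 4"
    unfolding sum.distrib by (intro add_strict_mono part) auto
  finally show False by simp
qed

lemma variation_Un_disjoint:
  assumes \<mu>: "complex_measure \<mu>" and "S \<in> sets borel" "T \<in> sets borel" "S \<inter> T = {}"
  shows "variation \<mu> (S \<union> T) = variation \<mu> S + variation \<mu> T"
  using plus_emeasure[of S "variation_measure \<mu>" T] assms
  by (simp add: emeasure_variation_measure)

text \<open>
  A set \<open>E\<close> of infinite variation contains a set \<open>A\<close> such that \<open>cmod (\<mu> A)\<close> and \<open>cmod (\<mu> (E - A))\<close> both exceed 1,
  and one of \<open>A\<close> and \<open>E - A\<close> again has infinite variation.  Splitting off the other one again and again yields a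
  disjoint sequence of sets whose measures do not form a convergent series.
\<close>

lemma variation_finite:
  assumes \<mu>: "complex_measure \<mu>"
  shows "variation \<mu> UNIV < \<infinity>"
proof (rule ccontr)
  assume "\<not> variation \<mu> UNIV < \<infinity>"
  then have inf: "variation \<mu> UNIV = \<infinity>" by (simp add: less_top[symmetric])
  have big: "\<exists>A\<in>sets borel. A \<subseteq> E \<and> t < cmod (\<mu> A)"
    if E: "variation \<mu> E = \<infinity>" and t: "0 \<le> t" for E t
  proof -
    have "ennreal (4 * t) < variation \<mu> E" using E by simp
    then obtain P where P: "finite P" "P \<subseteq> sets borel" "disjoint P" "\<Union>P = E"
        "ennreal (4 * t) < (\<Sum>T\<in>P. ennreal (cmod (\<mu> T)))"
      unfolding variation_def less_SUP_iff by auto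
    then have 1: "4 * t < (\<Sum>T\<in>P. cmod (\<mu> T))"
      using t by (simp add: ennreal_less_iff sum_nonneg)
    obtain Q where Q: "Q \<subseteq> P" "(\<Sum>T\<in>P. cmod (\<mu> T)) \<le> 4 * cmod (\<Sum>T\<in>Q. \<mu> T)"
      using exists_subset_norm_sum_ge[OF P(1)] by blast
    have "\<mu> (\<Union>T\<in>Q. T) = (\<Sum>T\<in>Q. \<mu> T)"
      using P Q by (intro complex_measure_finite_UN[OF \<mu>])
        (auto intro: finite_subset disjoint_family_on_mono[OF Q(1) disjoint_family_on_id])
    then show ?thesis using 1 Q P
      by (intro bexI[of _ "\<Union>Q"]) (auto intro: finite_subset sets.finite_Union)
  qed
  have step: "\<exists>A\<in>sets borel. A \<subseteq> E \<and> 1 < cmod (\<mu> A) \<and> variation \<mu> (E - A) = \<infinity>"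
    if E: "E \<in> sets borel" "variation \<mu> E = \<infinity>" for E
  proof -
    obtain A where A: "A \<in> sets borel" "A \<subseteq> E" "1 + cmod (\<mu> E) < cmod (\<mu> A)"
      using big[OF E(2), of "1 + cmod (\<mu> E)"] by auto
    have "variation \<mu> (A \<union> (E - A)) = variation \<mu> A + variation \<mu> (E - A)"
      using A E by (intro variation_Un_disjoint[OF \<mu>]) auto
    moreover have "A \<union> (E - A) = E" using A by auto
    ultimately have "variation \<mu> A + variation \<mu> (E - A) = \<infinity>" using E by simp
    then consider "variation \<mu> A = \<infinity>" | "variation \<mu> (E - A) = \<infinity>"
      by (auto simp: ennreal_add_eq_top)
    then show ?thesis
    proof cases
      case 1
      have "cmod (\<mu> A) - cmod (\<mu> E) \<le> cmod (\<mu> (E - A))"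
        using A E norm_triangle_ineq3[of "\<mu> A" "\<mu> E"]
        by (simp add: complex_measure_Diff[OF \<mu>] norm_minus_commute)
      moreover have "E - (E - A) = A" using A by auto
      ultimately show ?thesis using A E 1 by (intro bexI[of _ "E - A"]) auto
    next
      case 2
      moreover have "1 < cmod (\<mu> A)" using A(3) norm_ge_zero[of "\<mu> E"] by linarith
      ultimately show ?thesis using A by (intro bexI[of _ A]) auto
    qed
  qed
  then have "\<forall>E\<in>{E \<in> sets borel. variation \<mu> E = \<infinity>}. \<exists>A. A \<in> sets borel \<and> A \<subseteq> E \<and>
      1 < cmod (\<mu> A) \<and> variation \<mu> (E - A) = \<infinity>"
    by blast
  from bchoice[OF this] obtain f where f: "f E \<in> sets borel" "f E \<subseteq> E" "1 < cmod (\<mu> (f E))"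
      "variation \<mu> (E - f E) = \<infinity>" if "E \<in> sets borel" "variation \<mu> E = \<infinity>" for E
    by blast
  define E where "E n = ((\<lambda>E. E - f E) ^^ n) UNIV" for n
  have ESuc: "E (Suc n) = E n - f (E n)" for n by (simp add: E_def)
  have E: "E n \<in> sets borel \<and> variation \<mu> (E n) = \<infinity>" for n
  proof (induction n)
    case 0 show ?case using inf by (simp add: E_def)
  next
    case (Suc n) then show ?case using f[of "E n"] by (auto simp: ESuc)
  qed
  have mono: "E m \<subseteq> E n" if "n \<le> m" for m n
    using that by (rule lift_Suc_antimono_le[of E, rotated]) (auto simp: ESuc)
  have "disjoint_family (\<lambda>n. f (E n))"
  proof -
    have "f (E m) \<inter> f (E n) = {}" if "m < n" for m n
    proof -
      have "E n \<subseteq> E m - f (E m)" using mono[of "Suc m" n] that by (simp add: ESuc)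
      moreover have "f (E n) \<subseteq> E n" using f(2) E by blast
      ultimately show ?thesis by blast
    qed
    then have "f (E m) \<inter> f (E n) = {}" if "m \<noteq> n" for m n
      using that by (cases m n rule: linorder_cases) blast+
    then show ?thesis unfolding disjoint_family_on_def by blast
  qed
  then have "(\<lambda>n. \<mu> (f (E n))) sums \<mu> (\<Union>n. f (E n))"
    by (intro complex_measure_sums[OF \<mu>]) (use f(1) E in blast)
  then have "(\<lambda>n. \<mu> (f (E n))) \<longlonglongrightarrow> 0" by (intro summable_LIMSEQ_zero) (auto simp: sums_iff)
  then have "\<forall>\<^sub>F n in sequentially. cmod (\<mu> (f (E n))) < 1"
    using tendstoD[of "\<lambda>n. \<mu> (f (E n))" 0 sequentially 1] by simp
  then obtain n where "cmod (\<mu> (f (E n))) < 1" by (auto simp: eventually_sequentially)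
  moreover have "1 < cmod (\<mu> (f (E n)))" using f(3) E by blast
  ultimately show False by linarith
qed

lemma finite_variation_measure:
  assumes "complex_measure \<mu>"
  shows "finite_measure (variation_measure \<mu>)"
proof (rule finite_measureI)
  show "emeasure (variation_measure \<mu>) (space (variation_measure \<mu>)) \<noteq> \<infinity>"
    using variation_finite[OF assms] emeasure_variation_measure[OF assms, of UNIV] by auto
qed


section \<open>Regular measures\<close>

text \<open>
  For a finite measure the two conditions of regularity amount to squeezing every Borel set between a
  compact and an open set; this form is stable under sums and under passing to smaller measures.
\<close>

definition squeezes :: "'g::topological_space measure \<Rightarrow> 'g set \<Rightarrow> bool" where
  "squeezes N S \<longleftrightarrow> (\<forall>e>0. \<exists>K U. compact K \<and> open U \<and> K \<subseteq> S \<and> S \<subseteq> U \<and> emeasure N (U - K) < ennreal e)"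

lemma compact_borel: "compact (K :: 'g::t2_space set) \<Longrightarrow> K \<in> sets borel"
  by (intro borel_closed compact_imp_closed)

lemma squeezesD:
  assumes "squeezes N S" "0 < e"
  obtains K U where "compact K" "open U" "K \<subseteq> S" "S \<subseteq> U" "emeasure N (U - K) < ennreal e"
proof -
  have "\<exists>K U. compact K \<and> open U \<and> K \<subseteq> S \<and> S \<subseteq> U \<and> emeasure N (U - K) < ennreal e"
    using assms by (simp add: squeezes_def)
  then show thesis using that by metis
qed

lemma variation_mono:
  assumes "complex_measure \<mu>" "S \<subseteq> T" "S \<in> sets borel" "T \<in> sets borel"
  shows "variation \<mu> S \<le> variation \<mu> T"
  using emeasure_mono[of S T "variation_measure \<mu>"] assms by (simp add: emeasure_variation_measure)

lemma regular_measure_iff_squeezes: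
  fixes \<mu> :: "'g::t2_space set \<Rightarrow> complex"
  assumes \<mu>: "complex_measure \<mu>"
  shows "regular_measure \<mu> \<longleftrightarrow> (\<forall>S\<in>sets borel. squeezes (variation_measure \<mu>) S)"
proof (intro iffI ballI)
  note em = emeasure_variation_measure[OF \<mu>]
  fix S :: "'g set" assume reg: "regular_measure \<mu>" and S: "S \<in> sets borel"
  interpret W: finite_measure "variation_measure \<mu>" by (rule finite_variation_measure[OF \<mu>])
  let ?W = "variation_measure \<mu>"
  show "squeezes ?W S"
    unfolding squeezes_def
  proof (intro allI impI)
    fix e :: real assume e: "0 < e"
    have reg_S: "variation \<mu> S = (INF U \<in> {U. open U \<and> S \<subseteq> U}. variation \<mu> U)"
        "variation \<mu> S = (SUP K \<in> {K. compact K \<and> K \<subseteq> S}. variation \<mu> K)"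
      using reg S unfolding regular_measure_def by blast+
    have var: "variation \<mu> T = ennreal (measure ?W T)" if "T \<in> sets borel" for T
      unfolding em[OF that, symmetric] by (rule W.emeasure_eq_measure)
    have "(INF U \<in> {U. open U \<and> S \<subseteq> U}. variation \<mu> U) < emeasure ?W S + ennreal (e/2)"
    proof -
      have "(INF U \<in> {U. open U \<and> S \<subseteq> U}. variation \<mu> U) = ennreal (measure ?W S)"
        unfolding reg_S(1)[symmetric] by (rule var[OF S])
      also have "\<dots> < ennreal (measure ?W S + e/2)" using e by (simp add: ennreal_less_iff)
      also have "\<dots> = emeasure ?W S + ennreal (e/2)" using e by (simp add: W.emeasure_eq_measure)
      finally show ?thesis .
    qed
    then obtain U where U: "open U" "S \<subseteq> U" "emeasure ?W U < emeasure ?W S + ennreal (e/2)"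
      unfolding INF_less_iff by (auto simp: em)
    obtain K where K: "compact K" "K \<subseteq> S" "measure ?W S < measure ?W K + e/2"
    proof (cases "measure ?W S = 0")
      case True
      then show ?thesis using e by (intro that[of "{}"]) auto
    next
      case False
      then have "ennreal (measure ?W S - e/2) < ennreal (measure ?W S)"
        using e by (intro ennreal_lessI) (auto simp: zero_less_measure_iff)
      also have "\<dots> = (SUP K \<in> {K. compact K \<and> K \<subseteq> S}. variation \<mu> K)"
        unfolding reg_S(2)[symmetric] by (rule var[OF S, symmetric])
      finally obtain K where K: "compact K" "K \<subseteq> S" "ennreal (measure ?W S - e/2) < variation \<mu> K"
        unfolding less_SUP_iff by blast
      have "variation \<mu> K = ennreal (measure ?W K)"
        by (rule var[OF compact_borel[OF K(1)]])
      then have "\<not> measure ?W K \<le> measure ?W S - e/2" using K(3) ennreal_leI not_less by metis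
      then show ?thesis using K by (intro that[of K]) auto
    qed
    have KB: "K \<in> sets borel" "U \<in> sets borel" using K U by (auto intro: compact_borel)
    have "measure ?W U < measure ?W S + e/2" "measure ?W S < measure ?W K + e/2"
      using U(3) K(3) e by (simp_all add: W.emeasure_eq_measure ennreal_less_iff flip: ennreal_plus)
    moreover have "measure ?W (U - K) = measure ?W U - measure ?W K"
      using K U KB by (intro W.finite_measure_Diff) auto
    ultimately have "measure ?W (U - K) < e" by linarith
    then have "emeasure ?W (U - K) < ennreal e"
      using e by (simp add: W.emeasure_eq_measure ennreal_lessI del: measure_Diff)
    then show "\<exists>K U. compact K \<and> open U \<and> K \<subseteq> S \<and> S \<subseteq> U \<and> emeasure ?W (U - K) < ennreal e"
      using K U by blast
  qed
next
  note em = emeasure_variation_measure[OF \<mu>]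
  let ?W = "variation_measure \<mu>"
  assume sq: "\<forall>S\<in>sets borel. squeezes ?W S"
  show "regular_measure \<mu>"
    unfolding regular_measure_def
  proof (intro ballI conjI)
    fix S :: "'g set" assume S: "S \<in> sets borel"
    show "variation \<mu> S = (INF U \<in> {U. open U \<and> S \<subseteq> U}. variation \<mu> U)"
    proof (rule antisym)
      show "variation \<mu> S \<le> (INF U \<in> {U. open U \<and> S \<subseteq> U}. variation \<mu> U)"
        using S by (auto intro!: INF_greatest variation_mono[OF \<mu>])
      show "(INF U \<in> {U. open U \<and> S \<subseteq> U}. variation \<mu> U) \<le> variation \<mu> S"
      proof (rule ennreal_le_epsilon)
        fix e :: real assume "0 < e"
        then obtain K U where KU: "compact K" "open U" "K \<subseteq> S" "S \<subseteq> U" "emeasure ?W (U - K) < ennreal e"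
          by (rule squeezesD[OF sq[rule_format, OF S]])
        have KB: "K \<in> sets borel" "U \<in> sets borel" using KU by (auto intro: compact_borel)
        have "(INF U \<in> {U. open U \<and> S \<subseteq> U}. variation \<mu> U) \<le> variation \<mu> U"
          using KU by (intro INF_lower) auto
        also have "variation \<mu> U = variation \<mu> S + variation \<mu> (U - S)"
          using variation_Un_disjoint[OF \<mu>, of S "U - S"] S KB KU(4) by (simp add: Un_absorb1)
        also have "\<dots> \<le> variation \<mu> S + ennreal e"
        proof (rule add_left_mono)
          have "variation \<mu> (U - S) \<le> variation \<mu> (U - K)"
            using S KU KB by (intro variation_mono[OF \<mu>]) auto
          also have "\<dots> = emeasure ?W (U - K)" using KB by (intro em[symmetric]) auto
          finally show "variation \<mu> (U - S) \<le> ennreal e" using KU(5) by simp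
        qed
        finally show "(INF U \<in> {U. open U \<and> S \<subseteq> U}. variation \<mu> U) \<le> variation \<mu> S + ennreal e" .
      qed
    qed
    show "variation \<mu> S = (SUP K \<in> {K. compact K \<and> K \<subseteq> S}. variation \<mu> K)"
    proof (rule antisym)
      show "(SUP K \<in> {K. compact K \<and> K \<subseteq> S}. variation \<mu> K) \<le> variation \<mu> S"
        using S by (auto intro!: SUP_least variation_mono[OF \<mu>] compact_borel)
      show "variation \<mu> S \<le> (SUP K \<in> {K. compact K \<and> K \<subseteq> S}. variation \<mu> K)"
      proof (rule ennreal_le_epsilon)
        fix e :: real assume "0 < e"
        then obtain K U where KU: "compact K" "open U" "K \<subseteq> S" "S \<subseteq> U" "emeasure ?W (U - K) < ennreal e"
          by (rule squeezesD[OF sq[rule_format, OF S]])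
        have KB: "K \<in> sets borel" "U \<in> sets borel" using KU by (auto intro: compact_borel)
        have "variation \<mu> S = variation \<mu> K + variation \<mu> (S - K)"
          using variation_Un_disjoint[OF \<mu>, of K "S - K"] S KB KU(3) by (simp add: Un_absorb1)
        also have "\<dots> \<le> (SUP K \<in> {K. compact K \<and> K \<subseteq> S}. variation \<mu> K) + ennreal e"
        proof (rule add_mono)
          show "variation \<mu> K \<le> (SUP K \<in> {K. compact K \<and> K \<subseteq> S}. variation \<mu> K)"
            using KU by (intro SUP_upper) auto
          have "variation \<mu> (S - K) \<le> variation \<mu> (U - K)"
            using S KU KB by (intro variation_mono[OF \<mu>]) auto
          also have "\<dots> = emeasure ?W (U - K)" using KB by (intro em[symmetric]) auto
          finally show "variation \<mu> (S - K) \<le> ennreal e" using KU(5) by simp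
        qed
        finally show "variation \<mu> S \<le> (SUP K \<in> {K. compact K \<and> K \<subseteq> S}. variation \<mu> K) + ennreal e" .
      qed
    qed
  qed
qed

text \<open>
  The sets that can be squeezed form a sigma-algebra.  A complement \<open>- S\<close> is approximated from inside by the part of
  \<open>- U\<close> in a compact set that carries almost the whole mass, since \<open>- U\<close> need not be compact; such a set is
  provided by the assumption for the open set \<open>UNIV\<close>.
\<close>

lemma squeezes_if_open_inner:
  fixes N :: "'g::t2_space measure"
  assumes N: "finite_measure N" and sets: "sets N = sets borel"
    and inner: "\<And>U e. open U \<Longrightarrow> 0 < e \<Longrightarrow> \<exists>K. compact K \<and> K \<subseteq> U \<and> emeasure N (U - K) < ennreal e"
    and S: "S \<in> sets borel"
  shows "squeezes N S"
proof -
  interpret N: finite_measure N by (rule N)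
  have cp: "K \<in> sets N" if "compact K" for K using compact_borel[OF that] by (simp add: sets)
  have op: "U \<in> sets N" if "open U" for U using that by (simp add: sets)
  have "S \<in> sigma_sets UNIV {U. open U}" using S by (simp add: borel_def)
  then show ?thesis
  proof induction
    case (Basic U)
    then show ?case using inner unfolding squeezes_def by fast
  next
    case Empty
    show ?case by (auto simp: squeezes_def intro!: exI[of _ "{}"])
  next
    case (Compl S)
    show ?case
      unfolding squeezes_def
    proof (intro allI impI)
      fix e :: real assume "0 < e"
      then have e: "0 < e/2" by simp
      obtain K U where KU: "compact K" "open U" "K \<subseteq> S" "S \<subseteq> U" "emeasure N (U - K) < ennreal (e/2)"
        using squeezesD[OF Compl.IH e] by blast
      obtain T where T: "compact T" "emeasure N (UNIV - T) < ennreal (e/2)"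
        using inner[OF open_UNIV e] by blast
      have "emeasure N ((UNIV - K) - T \<inter> (UNIV - U)) \<le> emeasure N ((UNIV - T) \<union> (U - K))"
        using KU T by (intro emeasure_mono sets.Un sets.Diff cp op) auto
      also have "\<dots> \<le> emeasure N (UNIV - T) + emeasure N (U - K)"
        using KU T by (intro emeasure_subadditive sets.Diff cp op) auto
      also have "\<dots> < ennreal (e/2) + ennreal (e/2)"
        using KU T by (intro add_strict_mono)
      also have "\<dots> = ennreal e" using e by (simp flip: ennreal_plus)
      finally have "emeasure N ((UNIV - K) - T \<inter> (UNIV - U)) < ennreal e" .
      moreover have "compact (T \<inter> (UNIV - U))"
        using T KU by (intro compact_Int_closed) (auto simp: Compl_eq_Diff_UNIV[symmetric])
      moreover have "open (UNIV - K)"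
        using KU by (auto simp: Compl_eq_Diff_UNIV[symmetric] intro: compact_imp_closed)
      ultimately show "\<exists>K U. compact K \<and> open U \<and> K \<subseteq> UNIV - S \<and> UNIV - S \<subseteq> U \<and> emeasure N (U - K) < ennreal e"
        using KU by (intro exI[of _ "T \<inter> (UNIV - U)"] exI[of _ "UNIV - K"]) blast
    qed
  next
    case (Union S)
    show ?case
      unfolding squeezes_def
    proof (intro allI impI)
      fix e :: real assume e: "0 < e"
      have "\<forall>n. \<exists>K U. compact K \<and> open U \<and> K \<subseteq> S n \<and> S n \<subseteq> U \<and> emeasure N (U - K) < ennreal (e/2 * (1/2)^Suc n)"
        using Union.IH e unfolding squeezes_def by simp
      then obtain K U where KU: "compact (K n)" "open (U n)" "K n \<subseteq> S n" "S n \<subseteq> U n"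
          "emeasure N (U n - K n) < ennreal (e/2 * (1/2)^Suc n)" for n
        by metis
      let ?U = "\<Union>n. U n"
      define D where "D m = (\<Union>n\<le>m. K n)" for m
      have D: "compact (D m)" for m unfolding D_def using KU(1) by (intro compact_UN) auto
      have "emeasure N (?U - (\<Union>m. D m)) \<le> emeasure N (\<Union>n. U n - K n)"
      proof (rule emeasure_mono)
        show "?U - (\<Union>m. D m) \<subseteq> (\<Union>n. U n - K n)" by (force simp: D_def)
        show "(\<Union>n. U n - K n) \<in> sets N" using op[OF KU(2)] cp[OF KU(1)] by auto
      qed
      also have "\<dots> \<le> (\<Sum>n. emeasure N (U n - K n))"
        using op[OF KU(2)] cp[OF KU(1)] by (intro emeasure_subadditive_countably) auto
      also have "\<dots> \<le> (\<Sum>n. ennreal (e/2 * (1/2)^Suc n))"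
        using KU(5) by (intro suminf_le less_imp_le) auto
      also have "\<dots> = ennreal (e/2)"
      proof -
        have "(\<lambda>n. e/2 * (1/2)^Suc n) sums (e/2 * 1)"
          by (intro sums_mult power_half_series)
        then show ?thesis using e by (intro suminf_ennreal_eq) auto
      qed
      also have "\<dots> < ennreal e" using e by (simp add: ennreal_less_iff)
      finally have lt: "emeasure N (?U - (\<Union>m. D m)) < ennreal e" .
      have "(\<lambda>m. emeasure N (?U - D m)) \<longlonglongrightarrow> emeasure N (\<Inter>m. ?U - D m)"
      proof (rule Lim_emeasure_decseq)
        show "range (\<lambda>m. ?U - D m) \<subseteq> sets N" using op[OF KU(2)] cp[OF D] by auto
        show "decseq (\<lambda>m. ?U - D m)" by (auto simp: decseq_def D_def intro: order_trans)
      qed simp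
      moreover have "(\<Inter>m. ?U - D m) = ?U - (\<Union>m. D m)" by auto
      ultimately have "\<forall>\<^sub>F m in sequentially. emeasure N (?U - D m) < ennreal e"
        using order_tendstoD(2)[of _ "emeasure N (\<Inter>m. ?U - D m)" sequentially "ennreal e"] lt by simp
      then obtain m where "emeasure N (?U - D m) < ennreal e" by (auto simp: eventually_sequentially)
      moreover have "D m \<subseteq> (\<Union>n. S n)" using KU(3) unfolding D_def by blast
      moreover have "(\<Union>n. S n) \<subseteq> ?U" using KU(4) by blast
      moreover have "open ?U" using KU(2) by blast
      ultimately show "\<exists>K U. compact K \<and> open U \<and> K \<subseteq> (\<Union>n. S n) \<and> (\<Union>n. S n) \<subseteq> U \<and> emeasure N (U - K) < ennreal e"
        using D by (intro exI[of _ "D m"] exI[of _ ?U] conjI)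
    qed
  qed
qed

lemma squeezes_mono:
  assumes sq: "squeezes N S" and le: "\<And>T. T \<in> sets borel \<Longrightarrow> emeasure N' T \<le> C * emeasure N T"
    and C: "C < \<infinity>"
  shows "squeezes N' (S :: 'g::t2_space set)"
  unfolding squeezes_def
proof (intro allI impI)
  fix e :: real assume e: "0 < e"
  obtain c where c: "C = ennreal c" "0 \<le> c" using C by (cases C) auto
  have "0 < e / (c + 1)" using e c by simp
  then obtain K U where KU: "compact K" "open U" "K \<subseteq> S" "S \<subseteq> U" "emeasure N (U - K) < ennreal (e / (c + 1))"
    using squeezesD[OF sq] by blast
  have "emeasure N' (U - K) \<le> C * emeasure N (U - K)"
    using KU by (intro le) (auto intro: compact_borel)
  also have "\<dots> \<le> ennreal c * ennreal (e / (c + 1))"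
    using KU c by (auto intro!: mult_left_mono)
  also have "\<dots> = ennreal (c * (e / (c + 1)))" using c e by (subst ennreal_mult) auto
  also have "\<dots> < ennreal e" using c e by (simp add: ennreal_less_iff field_simps)
  finally show "\<exists>K U. compact K \<and> open U \<and> K \<subseteq> S \<and> S \<subseteq> U \<and> emeasure N' (U - K) < ennreal e"
    using KU by blast
qed

lemma squeezes_add:
  assumes sq: "squeezes N S" "squeezes N' S" and sets: "sets N = sets borel" "sets N' = sets borel"
    and le: "\<And>T. T \<in> sets borel \<Longrightarrow> emeasure M T \<le> emeasure N T + emeasure N' T"
  shows "squeezes M (S :: 'g::t2_space set)"
  unfolding squeezes_def
proof (intro allI impI)
  fix e :: real assume "0 < e"
  then have e: "0 < e/2" by simp
  obtain K U where KU: "compact K" "open U" "K \<subseteq> S" "S \<subseteq> U" "emeasure N (U - K) < ennreal (e/2)"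
    using squeezesD[OF sq(1) e] by blast
  obtain L V where LV: "compact L" "open V" "L \<subseteq> S" "S \<subseteq> V" "emeasure N' (V - L) < ennreal (e/2)"
    using squeezesD[OF sq(2) e] by blast
  let ?T = "U \<inter> V - (K \<union> L)"
  have "emeasure M ?T \<le> emeasure N ?T + emeasure N' ?T"
    using KU LV by (intro le sets.Diff sets.Un sets.Int compact_borel borel_open)
  also have "\<dots> \<le> emeasure N (U - K) + emeasure N' (V - L)"
    using compact_borel[OF KU(1)] compact_borel[OF LV(1)] KU(2) LV(2)
    by (intro add_mono emeasure_mono) (auto simp: sets)
  also have "\<dots> < ennreal (e/2) + ennreal (e/2)" using KU LV by (intro add_strict_mono)
  also have "\<dots> = ennreal e" using e by (simp flip: ennreal_plus)
  finally have "emeasure M ?T < ennreal e" .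
  moreover have "compact (K \<union> L)" "open (U \<inter> V)" using KU LV by auto
  ultimately show "\<exists>K U. compact K \<and> open U \<and> K \<subseteq> S \<and> S \<subseteq> U \<and> emeasure M (U - K) < ennreal e"
    using KU LV by blast
qed


section \<open>Integration against a complex measure\<close>

text \<open>
  The four measures that make up the integral are the positive parts of \<open>Re (c \<cdot> \<mu>)\<close> for the fourth roots of
  unity \<open>c\<close>.
\<close>

definition directional_part ::
  "('g::topological_space set \<Rightarrow> complex) \<Rightarrow> complex \<Rightarrow> 'g measure" where
  "directional_part \<mu> c = positive_part (\<lambda>S. Re (c * \<mu> S))"

lemma complex_integral_directional:
  "complex_integral \<mu> f =
     (LINT x|directional_part \<mu> 1. f x) - (LINT x|directional_part \<mu> (-1). f x) +
     \<i> * ((LINT x|directional_part \<mu> (-\<i>). f x) - (LINT x|directional_part \<mu> \<i>. f x))"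
  by (simp add: complex_integral_def directional_part_def)

lemma sets_directional_part [simp, measurable_cong]: "sets (directional_part \<mu> c) = sets borel"
  using sets.sigma_sets_eq[of borel] by (simp add: directional_part_def positive_part_def)

lemma space_directional_part [simp]: "space (directional_part \<mu> c) = UNIV"
  by (simp add: directional_part_def positive_part_def)

lemma ennreal_sum_le: "ennreal (\<Sum>i\<in>I. f i) \<le> (\<Sum>i\<in>I. ennreal (f i))"
proof -
  have "ennreal (\<Sum>i\<in>I. f i) \<le> ennreal (\<Sum>i\<in>I. max 0 (f i))"
    by (intro ennreal_leI sum_mono) auto
  also have "\<dots> = (\<Sum>i\<in>I. ennreal (max 0 (f i)))" by (subst sum_ennreal) auto
  also have "\<dots> = (\<Sum>i\<in>I. ennreal (f i))"
    by (intro sum.cong) (auto simp: max_def ennreal_neg)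
  finally show ?thesis .
qed

lemma emeasure_directional_part:
  assumes \<mu>: "complex_measure \<mu>" and S: "S \<in> sets borel"
  shows "emeasure (directional_part \<mu> c) S = (SUP T \<in> {T \<in> sets borel. T \<subseteq> S}. ennreal (Re (c * \<mu> T)))"
proof -
  define V where "V S = (SUP T \<in> {T \<in> sets borel. T \<subseteq> S}. ennreal (Re (c * \<mu> T)))" for S
  have ne: "{T \<in> sets borel. T \<subseteq> S} \<noteq> {}" for S :: "'a set" by auto
  have V_upper: "ennreal (Re (c * \<mu> T)) \<le> V S" if "T \<in> sets borel" "T \<subseteq> S" for S T
    unfolding V_def using that by (intro SUP_upper) auto
  have "countably_additive (sets borel) V"
  proof (rule countably_additive_if_super_sub)
    show "sigma_algebra UNIV (sets borel)" using sets.sigma_algebra_axioms[of borel] by simp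
  next
    fix S S' :: "'a set" assume S: "S \<in> sets borel" "S' \<in> sets borel" "S \<inter> S' = {}"
    have "ennreal (Re (c * \<mu> T)) + ennreal (Re (c * \<mu> T')) \<le> V (S \<union> S')"
      if T: "T \<in> sets borel" "T \<subseteq> S" "T' \<in> sets borel" "T' \<subseteq> S'" for T T'
    proof -
      have "\<mu> (T \<union> T') = \<mu> T + \<mu> T'" using T S by (intro complex_measure_Un[OF \<mu>]) auto
      then have sum: "Re (c * \<mu> (T \<union> T')) = Re (c * \<mu> T) + Re (c * \<mu> T')"
        by (simp add: distrib_left)
      have "ennreal (Re (c * \<mu> (T \<union> T'))) \<le> V (S \<union> S')" "ennreal (Re (c * \<mu> T)) \<le> V (S \<union> S')"
          "ennreal (Re (c * \<mu> T')) \<le> V (S \<union> S')"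
        by (intro V_upper; use T in auto)+
      then show ?thesis unfolding sum
        by (cases "0 \<le> Re (c * \<mu> T)"; cases "0 \<le> Re (c * \<mu> T')")
          (auto simp: ennreal_neg simp flip: ennreal_plus)
    qed
    then show "V S + V S' \<le> V (S \<union> S')"
      unfolding V_def[of S] V_def[of S'] by (intro ennreal_SUP_add_SUP_le ne) auto
  next
    fix S :: "nat \<Rightarrow> 'a set" assume S: "range S \<subseteq> sets borel" "disjoint_family S"
    show "V (\<Union>n. S n) \<le> (\<Sum>n. V (S n))"
      unfolding V_def[of "\<Union>n. S n"]
    proof (rule SUP_least)
      fix T assume T: "T \<in> {T \<in> sets borel. T \<subseteq> (\<Union>n. S n)}"
      have "(\<lambda>n. \<mu> (T \<inter> S n)) sums \<mu> (\<Union>n. T \<inter> S n)"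
        using S T by (intro complex_measure_sums[OF \<mu>]) (auto simp: disjoint_family_on_def)
      moreover have "(\<Union>n. T \<inter> S n) = T" using T by auto
      ultimately have "(\<lambda>n. c * \<mu> (T \<inter> S n)) sums (c * \<mu> T)" by (intro sums_mult) simp
      then have "(\<lambda>n. Re (c * \<mu> (T \<inter> S n))) sums Re (c * \<mu> T)" by (rule sums_Re)
      then have lim: "(\<lambda>n. ennreal (\<Sum>i<n. Re (c * \<mu> (T \<inter> S i)))) \<longlonglongrightarrow> ennreal (Re (c * \<mu> T))"
        unfolding sums_def by (rule tendsto_ennrealI)
      have "ennreal (\<Sum>i<n. Re (c * \<mu> (T \<inter> S i))) \<le> (\<Sum>n. V (S n))" for n
      proof -
        have "ennreal (\<Sum>i<n. Re (c * \<mu> (T \<inter> S i))) \<le> (\<Sum>i<n. ennreal (Re (c * \<mu> (T \<inter> S i))))"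
          by (rule ennreal_sum_le)
        also have "\<dots> \<le> (\<Sum>i<n. V (S i))"
          using S T by (intro sum_mono V_upper) auto
        also have "\<dots> \<le> (\<Sum>n. V (S n))" by (rule sum_le_suminf) auto
        finally show ?thesis .
      qed
      then show "ennreal (Re (c * \<mu> T)) \<le> (\<Sum>n. V (S n))"
        using LIMSEQ_le_const2[OF lim] by fast
    qed
  qed
  moreover have "positive (sets borel) V"
    using complex_measure_empty[OF \<mu>] by (auto simp: positive_def V_def)
  moreover have "sigma_algebra UNIV (sets borel)" using sets.sigma_algebra_axioms[of borel] by simp
  ultimately have "emeasure (measure_of UNIV (sets borel) V) S = V S"
    using S by (intro emeasure_measure_of_sigma)
  then show ?thesis by (simp add: V_def[abs_def] directional_part_def positive_part_def)
qed

lemma directional_part_le_variation: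
  assumes \<mu>: "complex_measure \<mu>" and c: "cmod c = 1" and S: "S \<in> sets borel"
  shows "emeasure (directional_part \<mu> c) S \<le> variation \<mu> S"
  unfolding emeasure_directional_part[OF \<mu> S]
proof (rule SUP_least)
  fix T assume T: "T \<in> {T \<in> sets borel. T \<subseteq> S}"
  have "Re (c * \<mu> T) \<le> cmod (\<mu> T)"
    using complex_Re_le_cmod[of "c * \<mu> T"] c by (simp add: norm_mult)
  then have "ennreal (Re (c * \<mu> T)) \<le> ennreal (cmod (\<mu> T))" by (rule ennreal_leI)
  also have "\<dots> \<le> variation \<mu> T" using T by (intro cmod_le_variation[OF \<mu>]) auto
  also have "\<dots> \<le> variation \<mu> S" using T S by (intro variation_mono[OF \<mu>]) auto
  finally show "ennreal (Re (c * \<mu> T)) \<le> variation \<mu> S" .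
qed

lemma directional_part_le_variation_measure:
  assumes \<mu>: "complex_measure \<mu>" and c: "cmod c = 1"
  shows "directional_part \<mu> c \<le> variation_measure \<mu>"
proof (rule less_eq_measure.intros(3))
  show "emeasure (directional_part \<mu> c) \<le> emeasure (variation_measure \<mu>)"
  proof (rule le_funI)
    fix S show "emeasure (directional_part \<mu> c) S \<le> emeasure (variation_measure \<mu>) S"
      using directional_part_le_variation[OF \<mu> c, of S]
      by (cases "S \<in> sets borel") (simp_all add: emeasure_variation_measure[OF \<mu>] emeasure_notin_sets)
  qed
qed simp_all

lemma finite_directional_part:
  assumes \<mu>: "complex_measure \<mu>" and c: "cmod c = 1"
  shows "finite_measure (directional_part \<mu> c)"
proof (rule finite_measureI)
  show "emeasure (directional_part \<mu> c) (space (directional_part \<mu> c)) \<noteq> \<infinity>"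
    using directional_part_le_variation[OF assms, of UNIV] variation_finite[OF \<mu>]
    by (auto simp: top_unique)
qed

text \<open>The supremum over \<open>T \<subseteq> S\<close> turns into the one for \<open>- c\<close> when \<open>T\<close> is replaced by \<open>S - T\<close>.\<close>

lemma directional_part_jordan:
  assumes \<mu>: "complex_measure \<mu>" and c: "cmod c = 1" and S: "S \<in> sets borel"
  shows "measure (directional_part \<mu> c) S - measure (directional_part \<mu> (-c)) S = Re (c * \<mu> S)"
proof -
  have le: "measure (directional_part \<mu> d) S \<le> Re (d * \<mu> S) + measure (directional_part \<mu> (-d)) S"
    if d: "cmod d = 1" for d
  proof -
    interpret P: finite_measure "directional_part \<mu> d" by (rule finite_directional_part[OF \<mu> d])
    interpret N: finite_measure "directional_part \<mu> (-d)"
      by (rule finite_directional_part[OF \<mu>]) (simp add: d)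
    have T: "Re (d * \<mu> T) \<le> Re (d * \<mu> S) + measure (directional_part \<mu> (-d)) S"
      if "T \<in> sets borel" "T \<subseteq> S" for T
    proof -
      have "ennreal (Re (- d * \<mu> (S - T))) \<le> emeasure (directional_part \<mu> (-d)) S"
        unfolding emeasure_directional_part[OF \<mu> S] using that S by (intro SUP_upper) auto
      then have "Re (- d * \<mu> (S - T)) \<le> measure (directional_part \<mu> (-d)) S"
        by (simp add: N.emeasure_eq_measure)
      then show ?thesis
        using complex_measure_Diff[OF \<mu> S that] by (simp add: algebra_simps)
    qed
    have nonneg: "0 \<le> Re (d * \<mu> S) + measure (directional_part \<mu> (-d)) S"
      using T[of "{}"] by (simp add: complex_measure_empty[OF \<mu>])
    have "emeasure (directional_part \<mu> d) S
        \<le> ennreal (Re (d * \<mu> S) + measure (directional_part \<mu> (-d)) S)"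
      unfolding emeasure_directional_part[OF \<mu> S] by (intro SUP_least ennreal_leI T) auto
    then show ?thesis using nonneg by (simp add: P.emeasure_eq_measure)
  qed
  from le[OF c] le[of "-c"] c show ?thesis by simp
qed

lemma integrable_directional_part:
  fixes f :: "'g::topological_space \<Rightarrow> complex"
  assumes "complex_measure \<mu>" "cmod c = 1" and f: "f \<in> borel_measurable borel" "\<And>x. cmod (f x) \<le> B"
  shows "integrable (directional_part \<mu> c) f"
proof -
  interpret finite_measure "directional_part \<mu> c" by (rule finite_directional_part[OF assms(1,2)])
  show ?thesis
    using f by (intro integrable_const_bound[of _ B]) (auto cong: measurable_cong_sets)
qed

lemma complex_integral_indicator:
  assumes \<mu>: "complex_measure \<mu>" and S: "S \<in> sets borel"
  shows "complex_integral \<mu> (\<lambda>x. indicator S x *\<^sub>R d) = \<mu> S * d"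
proof -
  have int: "(LINT x|directional_part \<mu> c. indicator S x *\<^sub>R d) = measure (directional_part \<mu> c) S *\<^sub>R d"
    if "cmod c = 1" for c
  proof -
    interpret finite_measure "directional_part \<mu> c" by (rule finite_directional_part[OF \<mu> that])
    have "(LINT x|directional_part \<mu> c. indicator S x *\<^sub>R d) =
        (LINT x|directional_part \<mu> c. indicator S x) *\<^sub>R d"
      using S by (intro integral_scaleR_left) (simp add: less_top[symmetric])
    then show ?thesis using S by simp
  qed
  have "complex_integral \<mu> (\<lambda>x. indicator S x *\<^sub>R d) =
      (complex_of_real (measure (directional_part \<mu> 1) S - measure (directional_part \<mu> (-1)) S) +
       \<i> * complex_of_real (measure (directional_part \<mu> (-\<i>)) S - measure (directional_part \<mu> (-(-\<i>))) S)) * d"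
    by (simp add: complex_integral_directional int scaleR_conv_of_real algebra_simps)
  also have "\<dots> = (complex_of_real (Re (\<mu> S)) + \<i> * complex_of_real (Im (\<mu> S))) * d"
    by (subst (1 2) directional_part_jordan[OF \<mu> _ S]) auto
  finally show ?thesis by (simp add: complex_eq[symmetric])
qed

lemma complex_integral_add:
  assumes \<mu>: "complex_measure \<mu>"
    and f: "f \<in> borel_measurable borel" "\<And>x. cmod (f x) \<le> B"
    and g: "g \<in> borel_measurable borel" "\<And>x. cmod (g x) \<le> C"
  shows "complex_integral \<mu> (\<lambda>x. f x + g x) = complex_integral \<mu> f + complex_integral \<mu> g"
  using integrable_directional_part[OF \<mu> _ f] integrable_directional_part[OF \<mu> _ g]
  by (simp add: complex_integral_directional algebra_simps)

lemma complex_integral_mult_right: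
  "complex_integral \<mu> (\<lambda>x. c * f x) = c * complex_integral \<mu> f"
  by (simp add: complex_integral_directional algebra_simps)

lemma complex_integral_bounded_convergence:
  assumes \<mu>: "complex_measure \<mu>"
    and s: "\<And>n. s n \<in> borel_measurable borel" "\<And>n x. cmod (s n x) \<le> B"
    and f: "f \<in> borel_measurable borel" and lim: "\<And>x. (\<lambda>n. s n x) \<longlonglongrightarrow> f x"
  shows "(\<lambda>n. complex_integral \<mu> (s n)) \<longlonglongrightarrow> complex_integral \<mu> f"
proof -
  have "(\<lambda>n. LINT x|directional_part \<mu> c. s n x) \<longlonglongrightarrow> (LINT x|directional_part \<mu> c. f x)"
    if "cmod c = 1" for c
  proof -
    interpret finite_measure "directional_part \<mu> c" by (rule finite_directional_part[OF \<mu> that])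
    show ?thesis
      by (rule integral_dominated_convergence[where w = "\<lambda>_. B"])
        (use s f lim in \<open>auto cong: measurable_cong_sets\<close>)
  qed
  then show ?thesis unfolding complex_integral_directional by (intro tendsto_intros) auto
qed

text \<open>
  Each of the four parts is bounded by the total variation, hence the factor 4.  Any constant serves to make the
  convolution a bounded product.
\<close>

lemma complex_integral_bound:
  assumes \<mu>: "complex_measure \<mu>" and f: "f \<in> borel_measurable borel" "\<And>x. cmod (f x) \<le> B"
  shows "ennreal (cmod (complex_integral \<mu> f)) \<le> 4 * (\<integral>\<^sup>+x. ennreal (cmod (f x)) \<partial>variation_measure \<mu>)"
    (is "_ \<le> 4 * ?I")
proof -
  let ?L = "\<lambda>c. LINT x|directional_part \<mu> c. f x"
  have L: "ennreal (cmod (?L c)) \<le> ?I" if c: "cmod c = 1" for c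
  proof -
    have "ennreal (cmod (?L c)) \<le> (\<integral>\<^sup>+x. ennreal (cmod (f x)) \<partial>directional_part \<mu> c)"
      by (rule integral_norm_bound_ennreal) (rule integrable_directional_part[OF \<mu> c f])
    also have "\<dots> \<le> ?I"
      by (rule nn_integral_mono_measure) (auto intro: directional_part_le_variation_measure[OF \<mu> c])
    finally show ?thesis .
  qed
  have "cmod (complex_integral \<mu> f) \<le> cmod (?L 1) + cmod (?L (-1)) + cmod (?L (-\<i>)) + cmod (?L \<i>)"
  proof -
    have "cmod (complex_integral \<mu> f) \<le> cmod (?L 1 - ?L (-1)) + cmod (\<i> * (?L (-\<i>) - ?L \<i>))"
      unfolding complex_integral_directional by (rule norm_triangle_ineq)
    also have "\<dots> \<le> (cmod (?L 1) + cmod (?L (-1))) + (cmod (?L (-\<i>)) + cmod (?L \<i>))"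
      by (intro add_mono norm_triangle_ineq4) (simp add: norm_mult norm_triangle_ineq4)
    finally show ?thesis by simp
  qed
  then have "ennreal (cmod (complex_integral \<mu> f)) \<le>
      ennreal (cmod (?L 1)) + ennreal (cmod (?L (-1))) + ennreal (cmod (?L (-\<i>))) + ennreal (cmod (?L \<i>))"
    by (simp add: ennreal_leI flip: ennreal_plus)
  also have "\<dots> \<le> ?I + ?I + ?I + ?I" by (intro add_mono L) auto
  also have "\<dots> = (1 + 1 + 1 + 1) * ?I" by (simp only: distrib_right mult_1)
  finally show ?thesis by simp
qed

text \<open>Bounded Borel functions are obtained from indicators by sums and bounded pointwise limits.\<close>

lemma bounded_borel_induct [consumes 2, case_names indicator add lim]:
  fixes f :: "'g::topological_space \<Rightarrow> complex"
  assumes f: "f \<in> borel_measurable borel" "\<And>x. cmod (f x) \<le> B"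
    and ind: "\<And>S d. S \<in> sets borel \<Longrightarrow> P (\<lambda>x. indicator S x *\<^sub>R d)"
    and add: "\<And>g h b c. g \<in> borel_measurable borel \<Longrightarrow> h \<in> borel_measurable borel \<Longrightarrow>
      (\<And>x. cmod (g x) \<le> b) \<Longrightarrow> (\<And>x. cmod (h x) \<le> c) \<Longrightarrow> P g \<Longrightarrow> P h \<Longrightarrow> P (\<lambda>x. g x + h x)"
    and lim: "\<And>s g b. (\<And>n. s n \<in> borel_measurable borel) \<Longrightarrow> (\<And>n x. cmod (s n x) \<le> b) \<Longrightarrow>
      g \<in> borel_measurable borel \<Longrightarrow> (\<And>x. (\<lambda>n. s n x) \<longlonglongrightarrow> g x) \<Longrightarrow> (\<And>n. P (s n)) \<Longrightarrow> P g"
  shows "P f"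
proof -
  have simple: "P s" if s: "simple_function borel s" for s :: "'g \<Rightarrow> complex"
  proof -
    have fin: "finite (range s)" and vim: "s -` {v} \<in> sets borel" for v
      using simple_functionD[OF s] by auto
    have "P (\<lambda>x. \<Sum>v\<in>V. indicator (s -` {v}) x *\<^sub>R v)" if "finite V" for V
      using that
    proof induction
      case empty
      show ?case using ind[of "{}" 0] by simp
    next
      case (insert v V)
      have "P (\<lambda>x. indicator (s -` {v}) x *\<^sub>R v + (\<Sum>v\<in>V. indicator (s -` {v}) x *\<^sub>R v))"
      proof (rule add[of _ _ "cmod v" "\<Sum>v\<in>V. cmod v"])
        show "cmod (\<Sum>v\<in>V. indicator (s -` {v}) x *\<^sub>R v) \<le> (\<Sum>v\<in>V. cmod v)" for x
          by (intro sum_norm_le) (auto simp: indicator_def)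
        have meas: "(\<lambda>x. indicator (s -` {v}) x *\<^sub>R v) \<in> borel_measurable borel" for v
          using vim by simp
        show "(\<lambda>x. indicator (s -` {v}) x *\<^sub>R v) \<in> borel_measurable borel" by (rule meas)
        show "(\<lambda>x. \<Sum>v\<in>V. indicator (s -` {v}) x *\<^sub>R v) \<in> borel_measurable borel"
          by (intro borel_measurable_sum meas)
        show "P (\<lambda>x. indicator (s -` {v}) x *\<^sub>R v)" by (rule ind[OF vim])
      qed (use insert in \<open>auto simp: indicator_def\<close>)
      then show ?case by (simp only: sum.insert[OF insert.hyps])
    qed
    from this[OF fin] have "P (\<lambda>x. \<Sum>v\<in>range s. indicator (s -` {v}) x *\<^sub>R v)" .
    moreover have "(\<Sum>v\<in>range s. indicator (s -` {v}) x *\<^sub>R v) = s x" for x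
    proof -
      have "(\<Sum>v\<in>range s. indicator (s -` {v}) x *\<^sub>R v) = (\<Sum>v\<in>range s. if v = s x then v else 0)"
        by (intro sum.cong) (auto simp: indicator_def)
      then show ?thesis using fin by simp
    qed
    ultimately show ?thesis by simp
  qed
  obtain F where F: "\<And>i. simple_function borel (F i)" "\<And>x. (\<lambda>i. F i x) \<longlonglongrightarrow> f x"
      "\<And>i x. dist (F i x) 0 \<le> 2 * dist (f x) 0"
    using borel_measurable_implies_sequence_metric[OF f(1), of 0] by auto
  have "cmod (F i x) \<le> 2 * B" for i x
    using F(3)[of i x] f(2)[of x] by simp
  with F f show ?thesis
    by (intro lim[of F "2 * B" f]) (auto intro: simple borel_measurable_simple_function)
qed

lemma complex_integral_add_measure:
  assumes \<mu>: "complex_measure \<mu>" and \<nu>: "complex_measure \<nu>" and \<mu>\<nu>: "complex_measure (\<lambda>S. \<mu> S + \<nu> S)"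
    and f: "f \<in> borel_measurable borel" "\<And>x. cmod (f x) \<le> B"
  shows "complex_integral (\<lambda>S. \<mu> S + \<nu> S) f = complex_integral \<mu> f + complex_integral \<nu> f"
  using f
proof (induction rule: bounded_borel_induct)
  case (indicator S d)
  then show ?case
    by (simp add: complex_integral_indicator[OF \<mu>] complex_integral_indicator[OF \<nu>]
        complex_integral_indicator[OF \<mu>\<nu>] distrib_right)
next
  case (add g h b c)
  note lin = complex_integral_add[OF _ add(1) add(3) add(2) add(4)]
  show ?case by (simp add: lin[OF \<mu>] lin[OF \<nu>] lin[OF \<mu>\<nu>] add.IH)
next
  case (lim s g b)
  note conv = complex_integral_bounded_convergence[OF _ lim(1,2,3,4)]
  have "(\<lambda>n. complex_integral (\<lambda>S. \<mu> S + \<nu> S) (s n)) \<longlonglongrightarrow> complex_integral \<mu> g + complex_integral \<nu> g"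
    unfolding lim(5) by (intro tendsto_add conv \<mu> \<nu>)
  then show ?case by (rule LIMSEQ_unique[OF conv[OF \<mu>\<nu>]])
qed

lemma complex_integral_smult_measure:
  assumes \<mu>: "complex_measure \<mu>" and c\<mu>: "complex_measure (\<lambda>S. c * \<mu> S)"
    and f: "f \<in> borel_measurable borel" "\<And>x. cmod (f x) \<le> B"
  shows "complex_integral (\<lambda>S. c * \<mu> S) f = c * complex_integral \<mu> f"
  using f
proof (induction rule: bounded_borel_induct)
  case (indicator S d)
  then show ?case
    by (simp add: complex_integral_indicator[OF \<mu>] complex_integral_indicator[OF c\<mu>] mult.assoc)
next
  case (add g h b d)
  note lin = complex_integral_add[OF _ add(1) add(3) add(2) add(4)]
  show ?case by (simp add: lin[OF \<mu>] lin[OF c\<mu>] add.IH distrib_left)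
next
  case (lim s g b)
  note conv = complex_integral_bounded_convergence[OF _ lim(1,2,3,4)]
  have "(\<lambda>n. complex_integral (\<lambda>S. c * \<mu> S) (s n)) \<longlonglongrightarrow> c * complex_integral \<mu> g"
    unfolding lim(5) by (intro tendsto_mult_left conv \<mu>)
  then show ?case by (rule LIMSEQ_unique[OF conv[OF c\<mu>]])
qed


section \<open>Convolution of regular measures\<close>

lemma translate_borel:
  fixes S :: "'g::topological_group_add set"
  assumes "S \<in> sets borel"
  shows "{y. x + y \<in> S} \<in> sets borel"
proof -
  have "(\<lambda>y. x + y) \<in> borel_measurable borel"
    by (intro borel_measurable_continuous_onI continuous_intros)
  from measurable_sets[OF this assms] show ?thesis by (simp add: vimage_def)
qed

lemma translate_open:
  fixes S :: "'g::topological_group_add set"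
  assumes "open S"
  shows "open {y. x + y \<in> S}"
proof -
  have "open ((\<lambda>y. x + y) -` S)"
    by (rule open_vimage[OF assms]) (intro continuous_intros)
  then show ?thesis by (simp add: vimage_def)
qed

lemma compact_sum_in_open:
  fixes S :: "'g::topological_group_add set"
  assumes S: "open S" and L: "compact L" and sub: "\<And>y. y \<in> L \<Longrightarrow> x + y \<in> S"
  obtains V where "open V" "x \<in> V" "\<And>v y. v \<in> V \<Longrightarrow> y \<in> L \<Longrightarrow> v + y \<in> S"
proof -
  let ?W = "(\<lambda>p. fst p + snd p) -` S"
  have "open ?W" by (rule open_vimage[OF S]) (intro continuous_intros)
  moreover have "{x} \<times> L \<subseteq> ?W" using sub by auto
  ultimately have "\<exists>U V. openin euclidean U \<and> openin euclidean V \<and> x \<in> U \<and> L \<subseteq> V \<and> U \<times> V \<subseteq> ?W"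
    using L by (intro tube_lemma_right) (auto simp: euclidean_product_topology)
  then show thesis using that by (fastforce simp: subset_iff)
qed

lemma squeezes_inner:
  assumes N: "finite_measure N" and sets: "sets N = sets borel"
    and U: "U \<in> sets borel" and sq: "squeezes N (U :: 'g::t2_space set)" and q: "q < emeasure N U"
  obtains K where "compact K" "K \<subseteq> U" "q < emeasure N K"
proof -
  interpret N: finite_measure N by (rule N)
  obtain r where r: "q = ennreal r" "0 \<le> r" using q by (cases q) auto
  then have "0 < measure N U - r" using q by (simp add: N.emeasure_eq_measure ennreal_less_iff)
  then obtain K V where K: "compact K" "open V" "K \<subseteq> U" "U \<subseteq> V"
      "emeasure N (V - K) < ennreal (measure N U - r)"
    using squeezesD[OF sq] by metis
  have KB: "K \<in> sets N" using compact_borel[OF K(1)] by (simp add: sets)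
  have "measure N (U - K) \<le> measure N (V - K)"
    using K KB by (intro N.finite_measure_mono) (auto simp: sets)
  moreover have "measure N (V - K) < measure N U - r"
    using K(5) \<open>0 < measure N U - r\<close> by (simp add: N.emeasure_eq_measure ennreal_less_iff)
  moreover have "measure N (U - K) = measure N U - measure N K"
    using U KB K by (intro N.finite_measure_Diff) (auto simp: sets)
  ultimately have "r < measure N K" by linarith
  then have "q < emeasure N K" using r by (simp add: N.emeasure_eq_measure ennreal_less_iff)
  then show thesis using that K by blast
qed

text \<open>
  For open \<open>S\<close> the function \<open>x \<mapsto> Q {y. x + y \<in> S}\<close> is lower semicontinuous: a compact subset of
  \<open>- x + S\<close> that carries more than a given mass stays in \<open>- v + S\<close> for all \<open>v\<close> close to \<open>x\<close>.
\<close>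

lemma measurable_emeasure_translate:
  fixes Q :: "'g::{topological_group_add, t2_space} measure"
  assumes Q: "finite_measure Q" and sets: "sets Q = sets borel"
    and sq: "\<And>S. S \<in> sets borel \<Longrightarrow> squeezes Q S" and S: "S \<in> sets borel"
  shows "(\<lambda>x. emeasure Q {y. x + y \<in> S}) \<in> borel_measurable borel"
proof -
  interpret Q: finite_measure Q by (rule Q)
  have tr: "{y. x + y \<in> T} \<in> sets Q" if "T \<in> sets borel" for x T
    using translate_borel[OF that] by (simp add: sets)
  have bs: "sigma_sets UNIV {U. open U} = sets (borel :: 'g measure)" by (simp add: borel_def)
  have "Int_stable {U :: 'g set. open U}" by (auto simp: Int_stable_def)
  moreover have "{U :: 'g set. open U} \<subseteq> Pow UNIV" by simp
  moreover have "S \<in> sigma_sets UNIV {U. open U}" using S by (simp add: bs)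
  ultimately show ?thesis
  proof (induction rule: sigma_sets_induct_disjoint)
    case (basic U)
    then have U: "open U" by simp
    show ?case
    proof (rule borel_measurableI_greater)
      fix q :: ennreal
      have "open {x. q < emeasure Q {y. x + y \<in> U}}"
      proof (subst open_subopen, intro ballI)
        fix x assume "x \<in> {x. q < emeasure Q {y. x + y \<in> U}}"
        then have q: "q < emeasure Q {y. x + y \<in> U}" by simp
        have B: "{y. x + y \<in> U} \<in> sets borel" using translate_open[OF U] by simp
        obtain L where L: "compact L" "L \<subseteq> {y. x + y \<in> U}" "q < emeasure Q L"
          by (rule squeezes_inner[OF Q sets B sq[OF B] q])
        obtain V where V: "open V" "x \<in> V" "\<And>v y. v \<in> V \<Longrightarrow> y \<in> L \<Longrightarrow> v + y \<in> U"
          using compact_sum_in_open[OF U L(1), of x] L(2) by auto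
        have "q < emeasure Q {y. v + y \<in> U}" if "v \<in> V" for v
        proof -
          have "emeasure Q L \<le> emeasure Q {y. v + y \<in> U}"
            using V(3)[OF that] U by (intro emeasure_mono tr) auto
          then show ?thesis using L(3) by (rule less_le_trans[rotated])
        qed
        then show "\<exists>T. open T \<and> x \<in> T \<and> T \<subseteq> {x. q < emeasure Q {y. x + y \<in> U}}"
          using V by blast
      qed
      then show "{x \<in> space borel. q < emeasure Q {y. x + y \<in> U}} \<in> sets borel" by simp
    qed
  next
    case empty
    show ?case by simp
  next
    case (compl T)
    have T: "T \<in> sets borel" using compl.hyps by (simp add: bs)
    have "emeasure Q {y. x + y \<in> UNIV - T} = emeasure Q UNIV - emeasure Q {y. x + y \<in> T}" for x
    proof -
      have "{y. x + y \<in> UNIV - T} = space Q - {y. x + y \<in> T}"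
        using sets_eq_imp_space_eq[OF sets] by auto
      then show ?thesis
        using emeasure_compl[OF tr[OF T]] sets_eq_imp_space_eq[OF sets] by simp
    qed
    then show ?case using compl.IH by simp
  next
    case (union T)
    have T: "T i \<in> sets borel" for i using union.hyps(2) by (auto simp: bs)
    have "emeasure Q {y. x + y \<in> (\<Union>i. T i)} = (\<Sum>i. emeasure Q {y. x + y \<in> T i})" for x
    proof -
      have "{y. x + y \<in> (\<Union>i. T i)} = (\<Union>i. {y. x + y \<in> T i})" by auto
      moreover have "disjoint_family (\<lambda>i. {y. x + y \<in> T i})"
        using union.hyps(1) by (fastforce simp: disjoint_family_on_def)
      ultimately show ?thesis
        using suminf_emeasure[of "\<lambda>i. {y. x + y \<in> T i}" Q] tr[OF T] by (simp add: image_subset_iff)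
    qed
    then show ?case using union.IH by simp
  qed
qed

definition convolution_measure :: "'g::{topological_space, plus} measure \<Rightarrow> 'g measure \<Rightarrow> 'g measure" where
  "convolution_measure P Q =
     measure_of UNIV (sets borel) (\<lambda>S. \<integral>\<^sup>+x. emeasure Q {y. x + y \<in> S} \<partial>P)"

lemma sets_convolution_measure [simp, measurable_cong]: "sets (convolution_measure P Q) = sets borel"
  using sets.sigma_sets_eq[of borel] by (simp add: convolution_measure_def)

lemma space_convolution_measure [simp]: "space (convolution_measure P Q) = UNIV"
  by (simp add: convolution_measure_def)

lemma emeasure_convolution_measure:
  fixes Q :: "'g::{topological_group_add, t2_space} measure"
  assumes P: "sets P = sets borel" and Q: "finite_measure Q" and setsQ: "sets Q = sets borel"
    and sq: "\<And>S. S \<in> sets borel \<Longrightarrow> squeezes Q S" and S: "S \<in> sets borel"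
  shows "emeasure (convolution_measure P Q) S = (\<integral>\<^sup>+x. emeasure Q {y. x + y \<in> S} \<partial>P)"
  unfolding convolution_measure_def
proof (rule emeasure_measure_of_sigma)
  show "sigma_algebra UNIV (sets (borel :: 'g measure))"
    using sets.sigma_algebra_axioms[of "borel :: 'g measure"] by simp
  show "positive (sets borel) (\<lambda>S. \<integral>\<^sup>+x. emeasure Q {y. x + y \<in> S} \<partial>P)"
    by (simp add: positive_def)
  show "countably_additive (sets borel) (\<lambda>S. \<integral>\<^sup>+x. emeasure Q {y. x + y \<in> S} \<partial>P)"
  proof (rule countably_additiveI)
    fix T :: "nat \<Rightarrow> 'g set"
    assume T: "range T \<subseteq> sets borel" "disjoint_family T"
    have TB: "T i \<in> sets borel" for i using T by auto
    have [measurable]: "(\<lambda>x. emeasure Q {y. x + y \<in> T i}) \<in> borel_measurable P" for i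
      unfolding measurable_cong_sets[OF P HOL.refl] by (rule measurable_emeasure_translate[OF Q setsQ sq TB])
    have "emeasure Q {y. x + y \<in> (\<Union>i. T i)} = (\<Sum>i. emeasure Q {y. x + y \<in> T i})" for x
    proof -
      have "{y. x + y \<in> (\<Union>i. T i)} = (\<Union>i. {y. x + y \<in> T i})" by auto
      moreover have "disjoint_family (\<lambda>i. {y. x + y \<in> T i})"
        using T(2) by (fastforce simp: disjoint_family_on_def)
      ultimately show ?thesis
        using suminf_emeasure[of "\<lambda>i. {y. x + y \<in> T i}" Q] translate_borel[OF TB] setsQ
        by (simp add: image_subset_iff)
    qed
    then show "(\<Sum>i. \<integral>\<^sup>+x. emeasure Q {y. x + y \<in> T i} \<partial>P) =
        (\<integral>\<^sup>+x. emeasure Q {y. x + y \<in> (\<Union>i. T i)} \<partial>P)"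
      by (simp add: nn_integral_suminf)
  qed
qed (rule S)

text \<open>
  For a single \<open>x\<close> a compact part \<open>L\<close> of \<open>- x + S\<close> has mass \<open>> q\<close>, and by local compactness \<open>x\<close> has a compact
  neighbourhood \<open>C\<close> with \<open>C + L \<subseteq> S\<close>.  Finitely many of these neighbourhoods cover \<open>K\<close>, and the union of the
  corresponding sums \<open>C + L\<close> is the compact set that is sought.
\<close>

lemma translate_mass_on_compact:
  fixes Q :: "'g::{topological_group_add, t2_space} measure"
  assumes lc: "locally_compact_space (euclidean :: 'g topology)"
    and Q: "finite_measure Q" and sets: "sets Q = sets borel"
    and sq: "\<And>S. S \<in> sets borel \<Longrightarrow> squeezes Q S" and S: "open S" and K: "compact K"
    and q: "\<And>x. x \<in> K \<Longrightarrow> q < emeasure Q {y. x + y \<in> S}"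
  shows "\<exists>C. compact C \<and> C \<subseteq> S \<and> (\<forall>x\<in>K. q < emeasure Q {y. x + y \<in> C})"
proof -
  have "\<exists>L U C. compact L \<and> open U \<and> compact C \<and> x \<in> U \<and> U \<subseteq> C \<and> q < emeasure Q L \<and>
      (\<lambda>p. fst p + snd p) ` (C \<times> L) \<subseteq> S" if x: "x \<in> K" for x
  proof -
    have B: "{y. x + y \<in> S} \<in> sets borel" using translate_open[OF S] by simp
    obtain L where L: "compact L" "L \<subseteq> {y. x + y \<in> S}" "q < emeasure Q L"
      by (rule squeezes_inner[OF Q sets B sq[OF B] q[OF x]])
    obtain V where V: "open V" "x \<in> V" "\<And>v y. v \<in> V \<Longrightarrow> y \<in> L \<Longrightarrow> v + y \<in> S"
      using compact_sum_in_open[OF S L(1), of x] L(2) by auto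
    have "Hausdorff_space (euclidean :: 'g topology)"
      unfolding Hausdorff_space_def disjnt_def using hausdorff by simp blast
    then have "neighbourhood_base_of (compactin euclidean) (euclidean :: 'g topology)"
      using lc by (subst locally_compact_space_neighbourhood_base[symmetric]) auto
    then have "\<exists>U C. open U \<and> compact C \<and> x \<in> U \<and> U \<subseteq> C \<and> C \<subseteq> V"
      using V(1,2) unfolding neighbourhood_base_of by simp
    then obtain U C where "open U" "compact C" "x \<in> U" "U \<subseteq> C" "C \<subseteq> V" by metis
    then show ?thesis using L V by (intro exI[of _ L] exI[of _ U] exI[of _ C]) auto
  qed
  then have "\<forall>x\<in>K. \<exists>L U C. compact L \<and> open U \<and> compact C \<and> x \<in> U \<and> U \<subseteq> C \<and> q < emeasure Q L \<and>
      (\<lambda>p. fst p + snd p) ` (C \<times> L) \<subseteq> S"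
    by simp
  from bchoice[OF this] obtain L where "\<forall>x\<in>K. \<exists>U C. compact (L x) \<and> open U \<and> compact C \<and> x \<in> U \<and>
      U \<subseteq> C \<and> q < emeasure Q (L x) \<and> (\<lambda>p. fst p + snd p) ` (C \<times> L x) \<subseteq> S" ..
  from bchoice[OF this] obtain U where "\<forall>x\<in>K. \<exists>C. compact (L x) \<and> open (U x) \<and> compact C \<and> x \<in> U x \<and>
      U x \<subseteq> C \<and> q < emeasure Q (L x) \<and> (\<lambda>p. fst p + snd p) ` (C \<times> L x) \<subseteq> S" ..
  from bchoice[OF this] obtain C where C: "\<forall>x\<in>K. compact (L x) \<and> open (U x) \<and> compact (C x) \<and> x \<in> U x \<and>
      U x \<subseteq> C x \<and> q < emeasure Q (L x) \<and> (\<lambda>p. fst p + snd p) ` (C x \<times> L x) \<subseteq> S" ..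
  have LUC: "\<And>x. x \<in> K \<Longrightarrow> compact (L x)" "\<And>x. x \<in> K \<Longrightarrow> open (U x)"
      "\<And>x. x \<in> K \<Longrightarrow> compact (C x)" "\<And>x. x \<in> K \<Longrightarrow> x \<in> U x" "\<And>x. x \<in> K \<Longrightarrow> U x \<subseteq> C x"
      "\<And>x. x \<in> K \<Longrightarrow> q < emeasure Q (L x)"
      "\<And>x. x \<in> K \<Longrightarrow> (\<lambda>p. fst p + snd p) ` (C x \<times> L x) \<subseteq> S"
    by (drule bspec[OF C], elim conjE, assumption)+
  obtain F where F: "F \<subseteq> K" "finite F" "K \<subseteq> (\<Union>x\<in>F. U x)"
    by (rule compactE_image[OF K, of K U]) (use LUC(2,4) in auto)
  define D where "D = (\<Union>x\<in>F. (\<lambda>p. fst p + snd p) ` (C x \<times> L x))"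
  have D: "compact D"
    unfolding D_def
  proof (rule compact_UN[OF F(2)])
    fix x assume "x \<in> F"
    then have "x \<in> K" using F by auto
    then show "compact ((\<lambda>p. fst p + snd p) ` (C x \<times> L x))"
      using LUC by (intro compact_continuous_image compact_Times continuous_intros) auto
  qed
  moreover have "D \<subseteq> S" unfolding D_def using LUC(7) F(1) by blast
  moreover have "q < emeasure Q {y. x + y \<in> D}" if x: "x \<in> K" for x
  proof -
    obtain z where z: "z \<in> F" "x \<in> U z" using F(3) x by auto
    then have zK: "z \<in> K" using F by auto
    have "L z \<subseteq> {y. x + y \<in> D}"
    proof
      fix y assume "y \<in> L z"
      then have "(x, y) \<in> C z \<times> L z" using z LUC(5)[OF zK] by auto
      then show "y \<in> {y. x + y \<in> D}" using z(1) unfolding D_def by force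
    qed
    moreover have "{y. x + y \<in> D} \<in> sets Q"
      using translate_borel[OF compact_borel[OF D]] by (simp add: sets)
    ultimately have "emeasure Q (L z) \<le> emeasure Q {y. x + y \<in> D}" by (intro emeasure_mono)
    with LUC(6)[OF zK] show ?thesis by (rule less_le_trans)
  qed
  ultimately show ?thesis by blast
qed

text \<open>
  For open \<open>U\<close> let \<open>f x\<close> be the mass that \<open>Q\<close> gives to \<open>- x + U\<close>.  Each level set \<open>{x. q < f x}\<close> with rational \<open>q\<close>
  is exhausted, up to a \<open>P\<close>-null set, by countably many compact sets, and on each of them a single compact
  part of \<open>U\<close> already has translates of mass \<open>> q\<close>.  The union of these countably many compact parts therefore
  has the full measure of \<open>U\<close>.
\<close>

lemma convolution_measure_open_inner:
  fixes Q :: "'g::{topological_group_add, t2_space} measure"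
  assumes lc: "locally_compact_space (euclidean :: 'g topology)"
    and P: "finite_measure P" and setsP: "sets P = sets borel"
    and sqP: "\<And>S. S \<in> sets borel \<Longrightarrow> squeezes P S"
    and Q: "finite_measure Q" and setsQ: "sets Q = sets borel"
    and sqQ: "\<And>S. S \<in> sets borel \<Longrightarrow> squeezes Q S"
    and fin: "finite_measure (convolution_measure P Q)"
    and U: "open U" and e: "0 < e"
  shows "\<exists>K. compact K \<and> K \<subseteq> U \<and> emeasure (convolution_measure P Q) (U - K) < ennreal e"
proof -
  let ?N = "convolution_measure P Q"
  interpret N: finite_measure ?N by (rule fin)
  note em = emeasure_convolution_measure[OF setsP Q setsQ sqQ]
  define f where "f T x = emeasure Q {y. x + y \<in> T}" for T x
  define q where "q n = ennreal (real_of_rat (nat_to_rat_surj n))" for n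
  define G where "G n = {x. q n < f U x}" for n
  have f_meas: "f T \<in> borel_measurable borel" if "T \<in> sets borel" for T
    unfolding f_def[abs_def] by (rule measurable_emeasure_translate[OF Q setsQ sqQ that])
  have f_mono: "f T x \<le> f T' x" if "T \<subseteq> T'" "T' \<in> sets borel" for T T' x
    unfolding f_def using that translate_borel[OF that(2)] by (intro emeasure_mono) (auto simp: setsQ)
  have G: "G n \<in> sets borel" for n
    using measurable_sets[OF f_meas[of U], of "{q n<..}"] U by (simp add: G_def vimage_def)
  have "\<exists>K C. compact K \<and> K \<subseteq> G n \<and> emeasure P (G n - K) < ennreal (inverse (real (Suc m))) \<and>
      compact C \<and> C \<subseteq> U \<and> (\<forall>x\<in>K. q n < f C x)" for n m
  proof -
    have "0 < inverse (real (Suc m))" by simp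
    then obtain K V where K: "compact K" "open V" "K \<subseteq> G n" "G n \<subseteq> V"
        "emeasure P (V - K) < ennreal (inverse (real (Suc m)))"
      using squeezesD[OF sqP[OF G]] by metis
    have "emeasure P (G n - K) \<le> emeasure P (V - K)"
      using K compact_borel[OF K(1)] by (intro emeasure_mono) (auto simp: setsP)
    moreover have "\<exists>C. compact C \<and> C \<subseteq> U \<and> (\<forall>x\<in>K. q n < f C x)"
      unfolding f_def using K(3)
      by (intro translate_mass_on_compact[OF lc Q setsQ sqQ U K(1)]) (auto simp: G_def f_def)
    ultimately show ?thesis using K by (meson le_less_trans)
  qed
  then have "\<forall>k. \<exists>K C. compact K \<and> K \<subseteq> G (fst k) \<and>
      emeasure P (G (fst k) - K) < ennreal (inverse (real (Suc (snd k)))) \<and>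
      compact C \<and> C \<subseteq> U \<and> (\<forall>x\<in>K. q (fst k) < f C x)"
    by simp
  from choice[OF this] obtain K' where "\<forall>k. \<exists>C. compact (K' k) \<and> K' k \<subseteq> G (fst k) \<and>
      emeasure P (G (fst k) - K' k) < ennreal (inverse (real (Suc (snd k)))) \<and>
      compact C \<and> C \<subseteq> U \<and> (\<forall>x\<in>K' k. q (fst k) < f C x)" ..
  from choice[OF this] obtain C' where C': "\<forall>k. compact (K' k) \<and> K' k \<subseteq> G (fst k) \<and>
      emeasure P (G (fst k) - K' k) < ennreal (inverse (real (Suc (snd k)))) \<and>
      compact (C' k) \<and> C' k \<subseteq> U \<and> (\<forall>x\<in>K' k. q (fst k) < f (C' k) x)" ..
  define K where "K n m = K' (n, m)" for n m
  define C where "C n m = C' (n, m)" for n m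
  have KC: "\<And>n m. compact (K n m)" "\<And>n m. K n m \<subseteq> G n"
      "\<And>n m. emeasure P (G n - K n m) < ennreal (inverse (real (Suc m)))"
      "\<And>n m. compact (C n m)" "\<And>n m. C n m \<subseteq> U" "\<And>n m x. x \<in> K n m \<Longrightarrow> q n < f (C n m) x"
    using spec[OF C', of "(n, m)" for n m] unfolding K_def C_def by auto
  define c where "c k = C (fst (prod_decode k)) (snd (prod_decode k))" for k
  define D where "D = (\<Union>k. c k)"
  define E where "E k = (\<Union>i\<le>k. c i)" for k
  have cC: "C n m = c (prod_encode (n, m))" for n m by (simp add: c_def)
  have c: "compact (c k)" "c k \<subseteq> U" for k using KC(4,5) by (auto simp: c_def)
  have E: "compact (E k)" "E k \<subseteq> U" for k
    unfolding E_def using c by (auto intro!: compact_UN)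
  have DB: "D \<in> sets borel" unfolding D_def using compact_borel[OF c(1)] by auto
  have DU: "D \<subseteq> U" unfolding D_def using c(2) by auto
  have null: "G n - (\<Union>m. K n m) \<in> null_sets P" for n
  proof (rule null_setsI)
    have KB: "K n m \<in> sets P" for n m using compact_borel[OF KC(1)] by (simp add: setsP)
    show "G n - (\<Union>m. K n m) \<in> sets P" using G KB by (auto simp: setsP)
    have "emeasure P (G n - (\<Union>m. K n m)) \<le> 0 + ennreal d" if d: "0 < d" for d
    proof -
      obtain m where m: "inverse (real (Suc m)) < d" using reals_Archimedean[OF d] by auto
      have "emeasure P (G n - (\<Union>m. K n m)) \<le> emeasure P (G n - K n m)"
        using G KB by (intro emeasure_mono) (auto simp: setsP)
      also have "\<dots> \<le> ennreal (inverse (real (Suc m)))" using KC(3) by (rule less_imp_le)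
      also have "\<dots> \<le> ennreal d" using m by (intro ennreal_leI) simp
      finally show ?thesis by simp
    qed
    then show "emeasure P (G n - (\<Union>m. K n m)) = 0"
      using ennreal_le_epsilon[of 0 "emeasure P (G n - (\<Union>m. K n m))"] by simp
  qed
  have "AE x in P. \<forall>n. x \<notin> G n - (\<Union>m. K n m)"
    unfolding AE_all_countable by (intro allI AE_not_in null)
  then have "AE x in P. f U x \<le> f D x"
  proof eventually_elim
    case (elim x)
    show ?case
    proof (rule ccontr)
      assume "\<not> f U x \<le> f D x"
      then obtain r :: rat where r: "f D x < ennreal (real_of_rat r)" "ennreal (real_of_rat r) < f U x"
        using ennreal_rat_dense by (auto simp: not_le)
      obtain n where n: "r = nat_to_rat_surj n" using surj_nat_to_rat_surj by (metis surjD)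
      then have "x \<in> G n" using r by (simp add: G_def q_def)
      then obtain m where "x \<in> K n m" using elim by blast
      then have "q n < f (C n m) x" by (rule KC(6))
      also have "\<dots> \<le> f D x" by (rule f_mono[OF _ DB]) (auto simp: D_def cC)
      finally show False using r n by (simp add: q_def)
    qed
  qed
  then have "(\<integral>\<^sup>+x. f U x \<partial>P) \<le> (\<integral>\<^sup>+x. f D x \<partial>P)" by (rule nn_integral_mono_AE)
  then have "emeasure ?N U \<le> emeasure ?N D" using U DB by (simp add: em f_def)
  moreover have "emeasure ?N D \<le> emeasure ?N U" using DU U by (intro emeasure_mono) auto
  moreover have "emeasure ?N (U - D) = emeasure ?N U - emeasure ?N D"
    using DU U DB by (intro emeasure_Diff) auto
  ultimately have 0: "emeasure ?N (U - D) = 0" by (simp add: antisym)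
  have "(\<lambda>k. emeasure ?N (U - E k)) \<longlonglongrightarrow> emeasure ?N (\<Inter>k. U - E k)"
  proof (rule Lim_emeasure_decseq)
    show "range (\<lambda>k. U - E k) \<subseteq> sets ?N" using compact_borel[OF E(1)] U by auto
    show "decseq (\<lambda>k. U - E k)" by (auto simp: decseq_def E_def intro: order_trans)
  qed simp
  moreover have "(\<Inter>k. U - E k) = U - D" by (auto simp: E_def D_def)
  ultimately have "\<forall>\<^sub>F k in sequentially. emeasure ?N (U - E k) < ennreal e"
    using order_tendstoD(2)[of _ 0 sequentially "ennreal e"] 0 e by simp
  then obtain k where "emeasure ?N (U - E k) < ennreal e" by (auto simp: eventually_sequentially)
  then show ?thesis using E by blast
qed

lemma emeasure_convolution_measure_UNIV:
  fixes Q :: "'g::{topological_group_add, t2_space} measure"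
  assumes "sets P = sets borel" "finite_measure Q" "sets Q = sets borel"
    and "\<And>S. S \<in> sets borel \<Longrightarrow> squeezes Q S"
  shows "emeasure (convolution_measure P Q) UNIV = emeasure P UNIV * emeasure Q UNIV"
  using emeasure_convolution_measure[OF assms, of UNIV] sets_eq_imp_space_eq[OF assms(1)]
  by (simp add: mult.commute)

lemma squeezes_convolution_measure:
  fixes Q :: "'g::{topological_group_add, t2_space} measure"
  assumes lc: "locally_compact_space (euclidean :: 'g topology)"
    and P: "finite_measure P" "sets P = sets borel" "\<And>S. S \<in> sets borel \<Longrightarrow> squeezes P S"
    and Q: "finite_measure Q" "sets Q = sets borel" "\<And>S. S \<in> sets borel \<Longrightarrow> squeezes Q S"
    and S: "S \<in> sets borel"
  shows "squeezes (convolution_measure P Q) S"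
proof -
  have "emeasure (convolution_measure P Q) UNIV < \<infinity>"
    using emeasure_convolution_measure_UNIV[OF P(2) Q] finite_measure.emeasure_finite[OF P(1)]
      finite_measure.emeasure_finite[OF Q(1)] by (simp add: ennreal_mult_less_top less_top)
  then have fin: "finite_measure (convolution_measure P Q)"
    by (intro finite_measureI) simp
  show ?thesis
    by (rule squeezes_if_open_inner[OF fin _ convolution_measure_open_inner[OF lc P Q fin] S]) simp_all
qed


section \<open>The measure algebra\<close>

lemma carrier_measure_algebra:
  "\<mu> \<in> carrier measure_algebra \<longleftrightarrow> complex_measure \<mu> \<and> regular_measure \<mu>"
  by (simp add: measure_algebra_def)

lemma carrier_measure_algebraD:
  assumes "\<mu> \<in> carrier measure_algebra"
  shows "complex_measure \<mu>" "S \<in> sets borel \<Longrightarrow> squeezes (variation_measure \<mu>) S"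
  using assms by (auto simp: carrier_measure_algebra regular_measure_iff_squeezes)

lemma carrier_measure_algebraI:
  "complex_measure \<mu> \<Longrightarrow> (\<And>S. S \<in> sets borel \<Longrightarrow> squeezes (variation_measure \<mu>) S) \<Longrightarrow>
    \<mu> \<in> carrier measure_algebra"
  by (simp add: carrier_measure_algebra regular_measure_iff_squeezes)

lemma nrm_measure_algebra: "nrm measure_algebra \<mu> = enn2real (variation \<mu> UNIV)"
  by (simp add: measure_algebra_def)

lemma variation_eq_nrm:
  "complex_measure \<mu> \<Longrightarrow> variation \<mu> UNIV = ennreal (nrm measure_algebra \<mu>)"
  using variation_finite[of \<mu>] by (simp add: nrm_measure_algebra ennreal_enn2real)

lemma cmod_le_nrm:
  assumes "complex_measure \<mu>"
  shows "cmod (\<mu> S) \<le> nrm measure_algebra \<mu>"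
proof (cases "S \<in> sets borel")
  case True
  have "ennreal (cmod (\<mu> S)) \<le> variation \<mu> S" by (rule cmod_le_variation[OF assms True])
  also have "\<dots> \<le> variation \<mu> UNIV" using True by (intro variation_mono[OF assms]) auto
  finally show ?thesis
    unfolding variation_eq_nrm[OF assms] by (simp add: nrm_measure_algebra)
next
  case False
  then show ?thesis using assms by (simp add: complex_measure_def nrm_measure_algebra)
qed

lemma complex_measure_add:
  "complex_measure \<mu> \<Longrightarrow> complex_measure \<nu> \<Longrightarrow> complex_measure (\<lambda>S. \<mu> S + \<nu> S)"
  by (auto simp: complex_measure_def intro!: sums_add)

lemma complex_measure_smult: "complex_measure \<mu> \<Longrightarrow> complex_measure (\<lambda>S. c * \<mu> S)"
  by (auto simp: complex_measure_def intro!: sums_mult)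

lemma variation_add:
  assumes \<mu>: "complex_measure \<mu>" and \<nu>: "complex_measure \<nu>" and S: "S \<in> sets borel"
  shows "variation (\<lambda>S. \<mu> S + \<nu> S) S \<le> variation \<mu> S + variation \<nu> S"
proof (rule variation_least)
  fix P assume P: "finite P" "P \<subseteq> sets borel" "disjoint P" "\<Union>P = S"
  have "(\<Sum>T\<in>P. ennreal (cmod (\<mu> T + \<nu> T))) \<le> (\<Sum>T\<in>P. ennreal (cmod (\<mu> T)) + ennreal (cmod (\<nu> T)))"
    by (intro sum_mono) (simp add: norm_triangle_ineq ennreal_leI flip: ennreal_plus)
  also have "\<dots> = (\<Sum>T\<in>P. ennreal (cmod (\<mu> T))) + (\<Sum>T\<in>P. ennreal (cmod (\<nu> T)))"
    by (rule sum.distrib)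
  also have "\<dots> \<le> variation \<mu> S + variation \<nu> S"
    using P S by (intro add_mono variation_upper \<mu> \<nu> disjoint_family_on_id) auto
  finally show "(\<Sum>T\<in>P. ennreal (cmod (\<mu> T + \<nu> T))) \<le> variation \<mu> S + variation \<nu> S" .
qed

lemma variation_smult: "variation (\<lambda>S. c * \<mu> S) S = ennreal (cmod c) * variation \<mu> S"
  unfolding variation_def SUP_mult_left_ennreal
  by (simp only: norm_mult ennreal_mult[OF norm_ge_zero norm_ge_zero] sum_distrib_left)

lemma measure_algebra_add_closed:
  fixes \<mu> :: "'g::{topological_group_add, t2_space} set \<Rightarrow> complex"
  assumes \<mu>: "\<mu> \<in> carrier measure_algebra" and \<nu>: "\<nu> \<in> carrier measure_algebra"
  shows "(\<lambda>S. \<mu> S + \<nu> S) \<in> carrier measure_algebra"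
proof (rule carrier_measure_algebraI)
  note cm = carrier_measure_algebraD(1)[OF \<mu>] carrier_measure_algebraD(1)[OF \<nu>]
  show cms: "complex_measure (\<lambda>S. \<mu> S + \<nu> S)" by (rule complex_measure_add[OF cm])
  fix S :: "'g set" assume S: "S \<in> sets borel"
  show "squeezes (variation_measure (\<lambda>S. \<mu> S + \<nu> S)) S"
    by (rule squeezes_add[OF carrier_measure_algebraD(2)[OF \<mu> S] carrier_measure_algebraD(2)[OF \<nu> S]])
      (simp_all add: emeasure_variation_measure cms cm variation_add)
qed

lemma measure_algebra_smult_closed:
  fixes \<mu> :: "'g::{topological_group_add, t2_space} set \<Rightarrow> complex"
  assumes \<mu>: "\<mu> \<in> carrier measure_algebra"
  shows "(\<lambda>S. c * \<mu> S) \<in> carrier measure_algebra"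
proof (rule carrier_measure_algebraI)
  note cm = carrier_measure_algebraD(1)[OF \<mu>]
  show cms: "complex_measure (\<lambda>S. c * \<mu> S)" by (rule complex_measure_smult[OF cm])
  fix S :: "'g set" assume S: "S \<in> sets borel"
  show "squeezes (variation_measure (\<lambda>S. c * \<mu> S)) S"
    by (rule squeezes_mono[OF carrier_measure_algebraD(2)[OF \<mu> S], where C = "ennreal (cmod c)"])
      (simp_all add: emeasure_variation_measure cms cm variation_smult)
qed

lemma complex_measure_zero: "complex_measure (\<lambda>S. 0)"
  by (auto simp: complex_measure_def)

lemma squeezes_null:
  "compact K \<Longrightarrow> open U \<Longrightarrow> K \<subseteq> S \<Longrightarrow> S \<subseteq> U \<Longrightarrow> emeasure N (U - K) = 0 \<Longrightarrow> squeezes N S"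
  unfolding squeezes_def by (intro allI impI exI[of _ K] exI[of _ U]) simp

lemma measure_algebra_zero_closed:
  "(\<lambda>S :: 'g::{topological_group_add, t2_space} set. 0) \<in> carrier measure_algebra"
proof (rule carrier_measure_algebraI[OF complex_measure_zero])
  fix S :: "'g set"
  have "variation (\<lambda>S :: 'g set. 0) T = 0" for T
    using variation_smult[of 0 "\<lambda>_. 0" T] by simp
  then have "emeasure (variation_measure (\<lambda>S. 0)) T = 0" for T :: "'g set"
    by (cases "T \<in> sets borel")
      (simp_all add: emeasure_variation_measure complex_measure_zero emeasure_notin_sets)
  then show "squeezes (variation_measure (\<lambda>S. 0)) S"
    by (intro squeezes_null[of "{}" UNIV]) auto
qed

text \<open>
  The four parts of \<open>\<nu>\<close> are bounded by the total variation and therefore inherit its regularity, so that the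
  result on translates of positive measures applies to each of them.
\<close>

lemma measurable_translate:
  fixes \<nu> :: "'g::{topological_group_add, t2_space} set \<Rightarrow> complex"
  assumes \<nu>: "\<nu> \<in> carrier measure_algebra" and S: "S \<in> sets borel"
  shows "(\<lambda>x. \<nu> {y. x + y \<in> S}) \<in> borel_measurable borel"
proof -
  note cm = carrier_measure_algebraD(1)[OF \<nu>]
  let ?m = "\<lambda>c x. measure (directional_part \<nu> c) {y. x + y \<in> S}"
  have meas: "?m c \<in> borel_measurable borel" if c: "cmod c = 1" for c
  proof -
    have "squeezes (directional_part \<nu> c) T" if "T \<in> sets borel" for T
      by (rule squeezes_mono[OF carrier_measure_algebraD(2)[OF \<nu> that], where C = 1])
        (simp_all add: emeasure_variation_measure[OF cm] directional_part_le_variation[OF cm c])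
    then show ?thesis
      unfolding measure_def
      by (intro borel_measurable_enn2real measurable_emeasure_translate
          finite_directional_part[OF cm c] S) simp_all
  qed
  have "\<nu> {y. x + y \<in> S} = complex_of_real (?m 1 x - ?m (-1) x) +
      \<i> * complex_of_real (?m (-\<i>) x - ?m (-(-\<i>)) x)" for x
    by (subst (1 2) directional_part_jordan[OF cm _ translate_borel[OF S]])
      (auto simp: complex_eq_iff)
  then show ?thesis using meas by simp
qed

lemma complex_measure_convolution:
  fixes \<mu> :: "'g::{topological_group_add, t2_space} set \<Rightarrow> complex"
  assumes \<mu>: "complex_measure \<mu>" and \<nu>: "\<nu> \<in> carrier measure_algebra"
  shows "complex_measure (convolution \<mu> \<nu>)"
  unfolding complex_measure_def
proof (intro conjI allI impI)
  fix S :: "'g set" assume "S \<notin> sets borel"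
  then show "convolution \<mu> \<nu> S = 0" by (simp add: convolution_def)
next
  note cm = carrier_measure_algebraD(1)[OF \<nu>]
  fix S :: "nat \<Rightarrow> 'g set" assume S: "range S \<subseteq> sets borel" "disjoint_family S"
  have SB: "S n \<in> sets borel" for n using S by auto
  define F where "F n x = (\<Sum>i<n. \<nu> {y. x + y \<in> S i})" for n x
  have fin: "F n x = \<nu> {y. x + y \<in> (\<Union>i<n. S i)}" for n x
  proof -
    have "{y. x + y \<in> (\<Union>i<n. S i)} = (\<Union>i\<in>{..<n}. {y. x + y \<in> S i})" by auto
    moreover have "disjoint_family_on (\<lambda>i. {y. x + y \<in> S i}) {..<n}"
      using S(2) by (fastforce simp: disjoint_family_on_def)
    ultimately show ?thesis
      using translate_borel[OF SB] by (simp add: F_def complex_measure_finite_UN[OF cm])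
  qed
  have Fm: "F n \<in> borel_measurable borel" for n
    unfolding F_def[abs_def] by (intro borel_measurable_sum measurable_translate[OF \<nu> SB])
  have "(\<lambda>n. complex_integral \<mu> (F n)) \<longlonglongrightarrow> complex_integral \<mu> (\<lambda>x. \<nu> {y. x + y \<in> (\<Union>n. S n)})"
  proof (rule complex_integral_bounded_convergence[OF \<mu> Fm])
    show "cmod (F n x) \<le> nrm measure_algebra \<nu>" for n x
      unfolding fin by (rule cmod_le_nrm[OF cm])
    show "(\<lambda>x. \<nu> {y. x + y \<in> (\<Union>n. S n)}) \<in> borel_measurable borel"
      by (rule measurable_translate[OF \<nu>]) (use SB in auto)
    fix x
    have "disjoint_family (\<lambda>i. {y. x + y \<in> S i})"
      using S(2) by (fastforce simp: disjoint_family_on_def)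
    then have "(\<lambda>i. \<nu> {y. x + y \<in> S i}) sums \<nu> (\<Union>i. {y. x + y \<in> S i})"
      using translate_borel[OF SB] by (intro complex_measure_sums[OF cm]) auto
    moreover have "(\<Union>i. {y. x + y \<in> S i}) = {y. x + y \<in> (\<Union>n. S n)}" by auto
    ultimately show "(\<lambda>n. F n x) \<longlonglongrightarrow> \<nu> {y. x + y \<in> (\<Union>n. S n)}" by (simp add: sums_def F_def)
  qed
  moreover have "complex_integral \<mu> (F n) = (\<Sum>i<n. convolution \<mu> \<nu> (S i))" for n
  proof (induction n)
    case 0
    show ?case using complex_integral_mult_right[of \<mu> 0 "\<lambda>_. 0"] by (simp add: F_def[abs_def])
  next
    case (Suc n)
    have "complex_integral \<mu> (F (Suc n)) = complex_integral \<mu> (\<lambda>x. F n x + \<nu> {y. x + y \<in> S n})"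
      by (simp add: F_def[abs_def])
    also have "\<dots> = complex_integral \<mu> (F n) + complex_integral \<mu> (\<lambda>x. \<nu> {y. x + y \<in> S n})"
      by (rule complex_integral_add[OF \<mu> Fm _ measurable_translate[OF \<nu> SB] cmod_le_nrm[OF cm]])
        (unfold fin, rule cmod_le_nrm[OF cm])
    finally show ?case using Suc SB by (simp add: convolution_def)
  qed
  moreover have "complex_integral \<mu> (\<lambda>x. \<nu> {y. x + y \<in> (\<Union>n. S n)}) = convolution \<mu> \<nu> (\<Union>n. S n)"
    using SB by (auto simp: convolution_def)
  ultimately show "(\<lambda>n. convolution \<mu> \<nu> (S n)) sums convolution \<mu> \<nu> (\<Union>n. S n)"
    by (simp add: sums_def)
qed

text \<open>
  The convolution is dominated by that of the total variations.  This carries over both its regularity and the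
  bound of its norm from positive measures.
\<close>

lemma variation_convolution_le:
  fixes \<mu> :: "'g::{topological_group_add, t2_space} set \<Rightarrow> complex"
  assumes \<mu>: "complex_measure \<mu>" and \<nu>: "\<nu> \<in> carrier measure_algebra" and S: "S \<in> sets borel"
  shows "variation (convolution \<mu> \<nu>) S
    \<le> 4 * emeasure (convolution_measure (variation_measure \<mu>) (variation_measure \<nu>)) S"
proof (rule variation_least)
  note cm = carrier_measure_algebraD(1)[OF \<nu>]
  let ?N = "convolution_measure (variation_measure \<mu>) (variation_measure \<nu>)"
  have em: "emeasure ?N T = (\<integral>\<^sup>+x. emeasure (variation_measure \<nu>) {y. x + y \<in> T} \<partial>variation_measure \<mu>)"
    if "T \<in> sets borel" for T
    by (rule emeasure_convolution_measure[OF _ finite_variation_measure[OF cm] _ _ that])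
      (simp_all add: carrier_measure_algebraD(2)[OF \<nu>])
  have le: "ennreal (cmod (convolution \<mu> \<nu> T)) \<le> 4 * emeasure ?N T" if T: "T \<in> sets borel" for T
  proof -
    have "ennreal (cmod (convolution \<mu> \<nu> T))
        \<le> 4 * (\<integral>\<^sup>+x. ennreal (cmod (\<nu> {y. x + y \<in> T})) \<partial>variation_measure \<mu>)"
      using T complex_integral_bound[OF \<mu> measurable_translate[OF \<nu> T] cmod_le_nrm[OF cm]]
      by (simp add: convolution_def)
    also have "\<dots> \<le> 4 * emeasure ?N T"
      unfolding em[OF T] emeasure_variation_measure[OF cm translate_borel[OF T]]
      by (intro mult_left_mono nn_integral_mono cmod_le_variation[OF cm translate_borel[OF T]]) simp
    finally show ?thesis .
  qed
  fix P assume P: "finite P" "P \<subseteq> sets borel" "disjoint P" "\<Union>P = S"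
  have "(\<Sum>T\<in>P. ennreal (cmod (convolution \<mu> \<nu> T))) \<le> (\<Sum>T\<in>P. 4 * emeasure ?N T)"
    using P by (intro sum_mono le) auto
  also have "\<dots> = 4 * emeasure ?N (\<Union>T\<in>P. T)"
    using P sum_emeasure[of "\<lambda>T. T" P ?N] disjoint_family_on_id[OF P(3)]
    by (simp flip: sum_distrib_left)
  finally show "(\<Sum>T\<in>P. ennreal (cmod (convolution \<mu> \<nu> T))) \<le> 4 * emeasure ?N S" using P by simp
qed

lemma convolution_closed:
  fixes \<mu> :: "'g::{topological_group_add, t2_space} set \<Rightarrow> complex"
  assumes lc: "locally_compact_space (euclidean :: 'g topology)"
    and \<mu>: "\<mu> \<in> carrier measure_algebra" and \<nu>: "\<nu> \<in> carrier measure_algebra"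
  shows "convolution \<mu> \<nu> \<in> carrier measure_algebra"
proof (rule carrier_measure_algebraI)
  note cm = carrier_measure_algebraD(1)[OF \<mu>] carrier_measure_algebraD(1)[OF \<nu>]
  show cmc: "complex_measure (convolution \<mu> \<nu>)" by (rule complex_measure_convolution[OF cm(1) \<nu>])
  fix S :: "'g set" assume S: "S \<in> sets borel"
  have "squeezes (convolution_measure (variation_measure \<mu>) (variation_measure \<nu>)) S"
    by (rule squeezes_convolution_measure[OF lc finite_variation_measure[OF cm(1)] _ _
          finite_variation_measure[OF cm(2)] _ _ S])
      (simp_all add: carrier_measure_algebraD(2)[OF \<mu>] carrier_measure_algebraD(2)[OF \<nu>])
  then show "squeezes (variation_measure (convolution \<mu> \<nu>)) S"
    by (rule squeezes_mono[where C = 4])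
      (simp_all add: emeasure_variation_measure[OF cmc] variation_convolution_le[OF cm(1) \<nu>])
qed

lemma nrm_convolution:
  fixes \<mu> :: "'g::{topological_group_add, t2_space} set \<Rightarrow> complex"
  assumes \<mu>: "\<mu> \<in> carrier measure_algebra" and \<nu>: "\<nu> \<in> carrier measure_algebra"
  shows "nrm measure_algebra (convolution \<mu> \<nu>) \<le> 4 * nrm measure_algebra \<mu> * nrm measure_algebra \<nu>"
proof -
  note cm = carrier_measure_algebraD(1)[OF \<mu>] carrier_measure_algebraD(1)[OF \<nu>]
  have "ennreal (nrm measure_algebra (convolution \<mu> \<nu>)) = variation (convolution \<mu> \<nu>) UNIV"
    by (rule variation_eq_nrm[OF complex_measure_convolution[OF cm(1) \<nu>], symmetric])
  also have "\<dots> \<le> 4 * emeasure (convolution_measure (variation_measure \<mu>) (variation_measure \<nu>)) UNIV"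
    by (rule variation_convolution_le[OF cm(1) \<nu>]) simp
  also have "\<dots> = 4 * (emeasure (variation_measure \<mu>) UNIV * emeasure (variation_measure \<nu>) UNIV)"
    by (subst emeasure_convolution_measure_UNIV[OF _ finite_variation_measure[OF cm(2)]])
      (simp_all add: carrier_measure_algebraD(2)[OF \<nu>])
  also have "\<dots> = 4 * (ennreal (nrm measure_algebra \<mu>) * ennreal (nrm measure_algebra \<nu>))"
    by (simp add: emeasure_variation_measure cm variation_eq_nrm)
  also have "\<dots> = ennreal (4 * nrm measure_algebra \<mu> * nrm measure_algebra \<nu>)"
    by (simp add: ennreal_mult nrm_measure_algebra mult.assoc)
  finally show ?thesis by (simp add: nrm_measure_algebra)
qed

lemma convolution_add_left:
  fixes \<mu> :: "'g::{topological_group_add, t2_space} set \<Rightarrow> complex"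
  assumes \<mu>: "complex_measure \<mu>" "complex_measure \<mu>'" and \<nu>: "\<nu> \<in> carrier measure_algebra"
  shows "convolution (\<lambda>S. \<mu> S + \<mu>' S) \<nu> = (\<lambda>S. convolution \<mu> \<nu> S + convolution \<mu>' \<nu> S)"
  using complex_integral_add_measure[OF \<mu> complex_measure_add[OF \<mu>] measurable_translate[OF \<nu>]
      cmod_le_nrm[OF carrier_measure_algebraD(1)[OF \<nu>]]]
  by (auto simp: convolution_def fun_eq_iff)

lemma convolution_add_right:
  fixes \<mu> :: "'g::{topological_group_add, t2_space} set \<Rightarrow> complex"
  assumes \<mu>: "complex_measure \<mu>" and \<nu>: "\<nu> \<in> carrier measure_algebra" "\<nu>' \<in> carrier measure_algebra"
  shows "convolution \<mu> (\<lambda>S. \<nu> S + \<nu>' S) = (\<lambda>S. convolution \<mu> \<nu> S + convolution \<mu> \<nu>' S)"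
  using complex_integral_add[OF \<mu> measurable_translate[OF \<nu>(1)] cmod_le_nrm[OF carrier_measure_algebraD(1)[OF \<nu>(1)]]
      measurable_translate[OF \<nu>(2)] cmod_le_nrm[OF carrier_measure_algebraD(1)[OF \<nu>(2)]]]
  by (auto simp: convolution_def fun_eq_iff)

lemma convolution_smult_left:
  fixes \<mu> :: "'g::{topological_group_add, t2_space} set \<Rightarrow> complex"
  assumes \<mu>: "complex_measure \<mu>" and \<nu>: "\<nu> \<in> carrier measure_algebra"
  shows "convolution (\<lambda>S. c * \<mu> S) \<nu> = (\<lambda>S. c * convolution \<mu> \<nu> S)"
  using complex_integral_smult_measure[OF \<mu> complex_measure_smult[OF \<mu>] measurable_translate[OF \<nu>]
      cmod_le_nrm[OF carrier_measure_algebraD(1)[OF \<nu>]]]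
  by (auto simp: convolution_def fun_eq_iff)

lemma convolution_smult_right: "convolution \<mu> (\<lambda>S. c * \<nu> S) = (\<lambda>S. c * convolution \<mu> \<nu> S)"
  by (auto simp: convolution_def fun_eq_iff complex_integral_mult_right)

lemma complex_integral_const: "complex_measure \<mu> \<Longrightarrow> complex_integral \<mu> (\<lambda>_. d) = \<mu> UNIV * d"
  using complex_integral_indicator[of \<mu> UNIV d] by simp

lemma convolution_UNIV:
  "complex_measure \<mu> \<Longrightarrow> convolution \<mu> \<nu> UNIV = \<mu> UNIV * \<nu> UNIV"
  by (simp add: convolution_def complex_integral_const)


subsection \<open>The discrete part of a measure\<close>

lemma sum_atoms_le_nrm:
  fixes \<mu> :: "'g::t1_space set \<Rightarrow> complex"
  assumes \<mu>: "complex_measure \<mu>" and F: "finite F"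
  shows "(\<Sum>x\<in>F. cmod (\<mu> {x})) \<le> enn2real (variation \<mu> UNIV)"
proof -
  have "(\<Sum>x\<in>F. ennreal (cmod (\<mu> {x}))) \<le> variation \<mu> UNIV"
    by (rule variation_upper[OF \<mu> F]) (auto simp: disjoint_family_on_def)
  then have "ennreal (\<Sum>x\<in>F. cmod (\<mu> {x})) \<le> ennreal (enn2real (variation \<mu> UNIV))"
    using variation_finite[OF \<mu>] by (simp add: ennreal_enn2real)
  then show ?thesis by (simp add: ennreal_le_iff)
qed

lemma atoms_summable:
  fixes \<mu> :: "'g::t1_space set \<Rightarrow> complex"
  assumes \<mu>: "complex_measure \<mu>"
  shows "(\<lambda>x. cmod (\<mu> {x})) summable_on UNIV"
  by (rule nonneg_bdd_above_summable_on) (auto intro!: bdd_aboveI2 sum_atoms_le_nrm[OF \<mu>])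

lemma infsum_atoms_le_nrm:
  fixes \<mu> :: "'g::t1_space set \<Rightarrow> complex"
  assumes \<mu>: "complex_measure \<mu>"
  shows "(\<Sum>\<^sub>\<infinity>x. cmod (\<mu> {x})) \<le> enn2real (variation \<mu> UNIV)"
  by (rule infsum_le_finite_sums[OF atoms_summable[OF \<mu>] sum_atoms_le_nrm[OF \<mu>]])

lemma complex_integral_finite_support:
  fixes \<mu> :: "'g::t1_space set \<Rightarrow> complex"
  assumes \<mu>: "complex_measure \<mu>" and F: "finite F"
  shows "complex_integral \<mu> (\<lambda>x. \<Sum>a\<in>F. indicator {a} x *\<^sub>R f a) = (\<Sum>a\<in>F. \<mu> {a} * f a)"
  using F
proof induction
  case empty
  show ?case using complex_integral_const[OF \<mu>, of 0] by simp
next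
  case (insert a F)
  have "complex_integral \<mu> (\<lambda>x. indicator {a} x *\<^sub>R f a + (\<Sum>a\<in>F. indicator {a} x *\<^sub>R f a)) =
      complex_integral \<mu> (\<lambda>x. indicator {a} x *\<^sub>R f a) + complex_integral \<mu> (\<lambda>x. \<Sum>a\<in>F. indicator {a} x *\<^sub>R f a)"
  proof (rule complex_integral_add[OF \<mu>, where B = "cmod (f a)" and C = "\<Sum>a\<in>F. cmod (f a)"])
    show "cmod (\<Sum>a\<in>F. indicator {a} x *\<^sub>R f a) \<le> (\<Sum>a\<in>F. cmod (f a))" for x
      by (intro sum_norm_le) (auto simp: indicator_def)
  qed (auto simp: indicator_def intro!: borel_measurable_sum borel_measurable_scaleR borel_measurable_indicator)
  then show ?case by (simp only: sum.insert[OF insert.hyps] complex_integral_indicator[OF \<mu>] insert.IH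
        borel_closed[OF closed_singleton])
qed

text \<open>An absolutely summable function only sees the atoms of the measure, as its support is countable.\<close>

lemma complex_integral_summable:
  fixes \<mu> :: "'g::t1_space set \<Rightarrow> complex"
  assumes \<mu>: "complex_measure \<mu>" and f: "f \<in> borel_measurable borel" "\<And>x. cmod (f x) \<le> B"
    and sf: "(\<lambda>x. cmod (f x)) summable_on UNIV"
  shows "complex_integral \<mu> f = (\<Sum>\<^sub>\<infinity>x. \<mu> {x} * f x)"
proof (cases "\<exists>x. f x \<noteq> 0")
  case False
  then have "f = (\<lambda>_. 0)" by auto
  then show ?thesis using complex_integral_const[OF \<mu>, of 0] by simp
next
  case True
  define A where "A = {x. f x \<noteq> 0}"
  have A: "countable A" "A \<noteq> {}"
    using summable_countable_real[OF sf] True by (auto simp: A_def)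
  define F where "F n = from_nat_into A ` {..<n}" for n
  have finF: "finite (F n)" and FA: "F n \<subseteq> A" for n
    using from_nat_into[OF A(2)] by (auto simp: F_def)
  have ev: "\<forall>\<^sub>F n in sequentially. X \<subseteq> F n" if X: "finite X" "X \<subseteq> A" for X
    using X
  proof (induction X rule: finite_induct)
    case (insert a X)
    then obtain k where k: "a = from_nat_into A k"
      using from_nat_into_surj[OF A(1)] by auto
    have "\<forall>\<^sub>F n in sequentially. a \<in> F n"
      using eventually_gt_at_top[of k] by eventually_elim (auto simp: F_def k)
    moreover have "\<forall>\<^sub>F n in sequentially. X \<subseteq> F n" using insert by auto
    ultimately show ?case by eventually_elim auto
  qed simp
  have lim: "filterlim F (finite_subsets_at_top A) sequentially"
    unfolding filterlim_finite_subsets_at_top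
    using ev finF FA by (auto elim!: eventually_mono[rotated])
  define s where "s n x = (\<Sum>a\<in>F n. indicator {a} x *\<^sub>R f a)" for n x
  have s_eq: "s n x = (if x \<in> F n then f x else 0)" for n x
  proof -
    have "s n x = (\<Sum>a\<in>F n. if a = x then f x else 0)"
      unfolding s_def by (intro sum.cong) (auto simp: indicator_def)
    then show ?thesis using finF by simp
  qed
  have "(\<lambda>n. complex_integral \<mu> (s n)) \<longlonglongrightarrow> complex_integral \<mu> f"
  proof (rule complex_integral_bounded_convergence[OF \<mu> _ _ f(1)])
    show "s n \<in> borel_measurable borel" for n
      unfolding s_def[abs_def]
      by (intro borel_measurable_sum borel_measurable_scaleR borel_measurable_indicator) auto
    show "cmod (s n x) \<le> B" for n x
      using f(2)[of x] by (auto simp: s_eq intro: order_trans[OF norm_ge_zero])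
    show "(\<lambda>n. s n x) \<longlonglongrightarrow> f x" for x
    proof (cases "x \<in> A")
      case True
      have "\<forall>\<^sub>F n in sequentially. s n x = f x"
        using ev[of "{x}"] True by (simp add: s_eq eventually_mono)
      then show ?thesis by (rule tendsto_eventually)
    next
      case False
      then have "s n x = f x" for n using FA by (auto simp: s_eq A_def)
      then show ?thesis by simp
    qed
  qed
  moreover have "(\<lambda>n. \<Sum>a\<in>F n. \<mu> {a} * f a) \<longlonglongrightarrow> (\<Sum>\<^sub>\<infinity>x\<in>A. \<mu> {x} * f x)"
  proof -
    have "(\<lambda>x. cmod (\<mu> {x} * f x)) summable_on UNIV"
    proof (rule Infinite_Sum.abs_summable_on_comparison_test)
      show "(\<lambda>x. cmod (complex_of_real (enn2real (variation \<mu> UNIV)) * f x)) summable_on UNIV"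
        using sf by (simp add: norm_mult summable_on_cmult_right)
      show "cmod (\<mu> {x} * f x) \<le> cmod (complex_of_real (enn2real (variation \<mu> UNIV)) * f x)" for x
        using sum_atoms_le_nrm[OF \<mu>, of "{x}"] by (auto simp: norm_mult intro!: mult_right_mono)
    qed
    then have "(\<lambda>x. \<mu> {x} * f x) summable_on UNIV" by (rule Infinite_Sum.abs_summable_summable)
    then have "(\<lambda>x. \<mu> {x} * f x) summable_on A" by (rule summable_on_subset_banach) simp
    then have "((\<lambda>x. \<mu> {x} * f x) has_sum (\<Sum>\<^sub>\<infinity>x\<in>A. \<mu> {x} * f x)) A" by simp
    then show ?thesis unfolding has_sum_def by (rule filterlim_compose[OF _ lim])
  qed
  ultimately have "complex_integral \<mu> f = (\<Sum>\<^sub>\<infinity>x\<in>A. \<mu> {x} * f x)"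
    unfolding s_def[abs_def] complex_integral_finite_support[OF \<mu> finF] by (rule LIMSEQ_unique)
  also have "\<dots> = (\<Sum>\<^sub>\<infinity>x. \<mu> {x} * f x)"
    by (rule infsum_cong_neutral) (auto simp: A_def)
  finally show ?thesis .
qed

text \<open>
  The function \<open>x \<mapsto> \<nu> {- x + g}\<close> that is integrated against \<open>\<mu>\<close> is absolutely summable, so only the atoms of \<open>\<mu>\<close>
  contribute: the diffuse parts of \<open>\<mu>\<close> and \<open>\<nu>\<close> produce no atoms.
\<close>

lemma convolution_atom:
  fixes \<mu> :: "'g::{topological_group_add, t2_space} set \<Rightarrow> complex"
  assumes \<mu>: "complex_measure \<mu>" and \<nu>: "\<nu> \<in> carrier measure_algebra"
  shows "convolution \<mu> \<nu> {g} = (\<Sum>\<^sub>\<infinity>x. \<mu> {x} * \<nu> {- x + g})"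
proof -
  have tr: "{y. x + y \<in> {g}} = {- x + g}" for x
    by (auto simp: add.assoc[symmetric])
  have "(\<lambda>x. cmod (\<nu> {- x + g})) summable_on UNIV"
    using summable_on_reindex_bij_witness[of UNIV "\<lambda>x. g - x" "\<lambda>x. - x + g" UNIV
        "\<lambda>x. norm (\<nu> {x})" "\<lambda>x. norm (\<nu> {- x + g})"]
      atoms_summable[OF carrier_measure_algebraD(1)[OF \<nu>]]
    by (simp add: algebra_simps minus_diff_eq)
  then have "complex_integral \<mu> (\<lambda>x. \<nu> {- x + g}) = (\<Sum>\<^sub>\<infinity>x. \<mu> {x} * \<nu> {- x + g})"
    using measurable_translate[OF \<nu>, of "{g}"]
    by (intro complex_integral_summable[OF \<mu> _ cmod_le_nrm[OF carrier_measure_algebraD(1)[OF \<nu>]]])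
      (simp_all only: tr borel_closed[OF closed_singleton])
  then show ?thesis unfolding convolution_def tr by simp
qed


subsection \<open>Point masses\<close>

definition point_mass :: "'g::topological_space \<Rightarrow> 'g set \<Rightarrow> complex" where
  "point_mass g S = (if S \<in> sets borel \<and> g \<in> S then 1 else 0)"

lemma complex_measure_point_mass: "complex_measure (point_mass (g :: 'g::topological_space))"
  unfolding complex_measure_def
proof (intro conjI allI impI)
  fix S :: "nat \<Rightarrow> 'g set" assume S: "range S \<subseteq> sets borel" "disjoint_family S"
  show "(\<lambda>n. point_mass g (S n)) sums point_mass g (\<Union>n. S n)"
  proof (cases "\<exists>n. g \<in> S n")
    case True
    then obtain n where n: "g \<in> S n" by blast
    have "point_mass g (S m) = (if m = n then 1 else 0)" for m
      using S n by (auto simp: point_mass_def disjoint_family_on_def)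
    moreover have "point_mass g (\<Union>n. S n) = 1" using S n by (auto simp: point_mass_def)
    ultimately show ?thesis using sums_single[of n "\<lambda>_. 1 :: complex"] by simp
  qed (auto simp: point_mass_def)
qed (simp add: point_mass_def)

lemma point_mass_closed: "point_mass (g :: 'g::{topological_group_add, t2_space}) \<in> carrier measure_algebra"
proof (rule carrier_measure_algebraI[OF complex_measure_point_mass])
  fix S :: "'g set" assume S: "S \<in> sets borel"
  have 0: "emeasure (variation_measure (point_mass g)) T = 0" if "g \<notin> T" "T \<in> sets borel" for T
  proof -
    have "variation (point_mass g) T \<le> 0"
      by (rule variation_least) (use that in \<open>auto simp: point_mass_def intro!: sum.neutral\<close>)
    then show ?thesis using that by (simp add: emeasure_variation_measure complex_measure_point_mass)
  qed
  show "squeezes (variation_measure (point_mass g)) S"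
  proof (cases "g \<in> S")
    case True
    then show ?thesis using 0[of "UNIV - {g}"] by (intro squeezes_null[of "{g}" UNIV]) auto
  next
    case False
    then show ?thesis using 0[of "UNIV - {g}"]
      by (intro squeezes_null[of "{}" "UNIV - {g}"]) auto
  qed
qed

lemma complex_integral_point_mass:
  fixes f :: "'g::topological_space \<Rightarrow> complex"
  assumes "f \<in> borel_measurable borel" "\<And>x. cmod (f x) \<le> B"
  shows "complex_integral (point_mass g) f = f g"
  using assms
proof (induction rule: bounded_borel_induct)
  case (indicator S d)
  then show ?case
    by (simp only: complex_integral_indicator[OF complex_measure_point_mass])
      (simp add: point_mass_def indicator_def)
next
  case (add u v b c)
  then show ?case
    by (simp add: complex_integral_add[OF complex_measure_point_mass add(1,3,2,4)])
next
  case (lim s u b)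
  have "(\<lambda>n. s n g) \<longlonglongrightarrow> complex_integral (point_mass g) u"
    using complex_integral_bounded_convergence[OF complex_measure_point_mass[of g] lim(1,2,3,4)] lim(5)
    by simp
  then show ?case using lim(4)[of g] by (rule LIMSEQ_unique)
qed

lemma convolution_point_mass:
  fixes g h :: "'g::{topological_group_add, t2_space}"
  shows "convolution (point_mass g) (point_mass h) = point_mass (g + h)"
proof
  fix S
  show "convolution (point_mass g) (point_mass h) S = point_mass (g + h) S"
  proof (cases "S \<in> sets borel")
    case True
    then have "convolution (point_mass g) (point_mass h) S = point_mass h {y. g + y \<in> S}"
      unfolding convolution_def
      using complex_integral_point_mass[OF measurable_translate[OF point_mass_closed True]
          cmod_le_nrm[OF complex_measure_point_mass]] by simp
    then show ?thesis using True translate_borel[OF True, of g] by (auto simp: point_mass_def)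
  qed (simp add: convolution_def point_mass_def)
qed

lemma measure_finite_group:
  fixes \<mu> :: "'g::t2_space set \<Rightarrow> complex"
  assumes fin: "finite (UNIV :: 'g set)" and \<mu>: "complex_measure \<mu>"
  shows "\<mu> S = (\<Sum>g\<in>UNIV. \<mu> {g} * point_mass g S)"
proof -
  have B: "T \<in> sets borel" for T :: "'g set"
    using finite_subset[OF subset_UNIV fin, of T] by (intro borel_closed finite_imp_closed)
  have "\<mu> S = \<mu> (\<Union>g\<in>S. {g})" by simp
  also have "\<dots> = (\<Sum>g\<in>S. \<mu> {g})"
    using finite_subset[OF subset_UNIV fin, of S] B
    by (intro complex_measure_finite_UN[OF \<mu>]) (auto simp: disjoint_family_on_def)
  also have "\<dots> = (\<Sum>g\<in>UNIV. \<mu> {g} * point_mass g S)"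
    using fin B by (intro sum.mono_neutral_cong_left) (auto simp: point_mass_def)
  finally show ?thesis .
qed


section \<open>Seminormed algebras and their completions\<close>

text \<open>
  The common frame for the measure algebra, for \<open>A\<close> and for their algebraic tensor product.  A seminorm and a
  product that is bounded by some constant suffice for everything that is done with the completion, which
  identifies elements at distance 0 anyway.
\<close>

locale seminormed_algebra = Module.module complex_ring V for V :: "'v normed_alg" (structure) +
  assumes nrm_nonneg: "x \<in> carrier V \<Longrightarrow> 0 \<le> nrm V x"
    and nrm_triangle: "x \<in> carrier V \<Longrightarrow> y \<in> carrier V \<Longrightarrow> nrm V (x \<oplus> y) \<le> nrm V x + nrm V y"
    and nrm_smult: "x \<in> carrier V \<Longrightarrow> nrm V (c \<odot> x) = cmod c * nrm V x"
    and mult_closed: "x \<in> carrier V \<Longrightarrow> y \<in> carrier V \<Longrightarrow> x \<otimes> y \<in> carrier V"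
    and distrib_right: "x \<in> carrier V \<Longrightarrow> y \<in> carrier V \<Longrightarrow> z \<in> carrier V \<Longrightarrow>
      (x \<oplus> y) \<otimes> z = (x \<otimes> z) \<oplus> (y \<otimes> z)"
    and distrib_left: "x \<in> carrier V \<Longrightarrow> y \<in> carrier V \<Longrightarrow> z \<in> carrier V \<Longrightarrow>
      x \<otimes> (y \<oplus> z) = (x \<otimes> y) \<oplus> (x \<otimes> z)"
    and smult_mult: "x \<in> carrier V \<Longrightarrow> y \<in> carrier V \<Longrightarrow>
      (c \<odot> x) \<otimes> y = c \<odot> (x \<otimes> y)"
    and mult_smult: "x \<in> carrier V \<Longrightarrow> y \<in> carrier V \<Longrightarrow>
      x \<otimes> (c \<odot> y) = c \<odot> (x \<otimes> y)"
    and nrm_mult_bounded: "\<exists>C. \<forall>x\<in>carrier V. \<forall>y\<in>carrier V. nrm V (x \<otimes> y) \<le> C * nrm V x * nrm V y"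
begin

lemma smultc_closed: "x \<in> carrier V \<Longrightarrow> c \<odot> x \<in> carrier V"
  using smult_closed[of c x] by (simp add: complex_ring_def)

lemma smultc_add: "x \<in> carrier V \<Longrightarrow> y \<in> carrier V \<Longrightarrow>
    c \<odot> (x \<oplus> y) = c \<odot> x \<oplus> c \<odot> y"
  using smult_r_distr[of c x y] by (simp add: complex_ring_def)

lemma smultc_add_left: "x \<in> carrier V \<Longrightarrow> (c + d) \<odot> x = c \<odot> x \<oplus> d \<odot> x"
  using smult_l_distr[of c d x] by (simp add: complex_ring_def)

lemma smultc_assoc: "x \<in> carrier V \<Longrightarrow> (c * d) \<odot> x = c \<odot> (d \<odot> x)"
  using smult_assoc1[of c d x] by (simp add: complex_ring_def)

lemma smultc_one: "x \<in> carrier V \<Longrightarrow> 1 \<odot> x = x"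
  using smult_one[of x] by (simp add: complex_ring_def)

lemma smultc_zero: "x \<in> carrier V \<Longrightarrow> 0 \<odot> x = \<zero>"
  using smult_l_null[of x] by (simp add: complex_ring_def)

lemma minus_as_smult:
  assumes "x \<in> carrier V" "y \<in> carrier V"
  shows "x \<ominus> y = x \<oplus> (-1) \<odot> y"
proof -
  have "(-1) \<odot> y \<oplus> y = ((-1) + 1) \<odot> y"
    unfolding smultc_add_left[OF assms(2)] smultc_one[OF assms(2)] ..
  also have "\<dots> = \<zero>" using smultc_zero[OF assms(2)] by simp
  finally have "\<ominus> y = (-1) \<odot> y"
    using minus_equality[of "(-1) \<odot> y" y] smultc_closed assms by simp
  then show ?thesis by (simp add: minus_eq)
qed

lemma nrm_zero: "nrm V \<zero> = 0"
  using nrm_smult[of "\<zero>" 0] smultc_zero[of "\<zero>"] by simp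

lemma nrm_self: "x \<in> carrier V \<Longrightarrow> nrm V (x \<ominus> x) = 0"
  by (simp add: minus_eq r_neg nrm_zero)

lemma nrm_minus_commute:
  assumes "x \<in> carrier V" "y \<in> carrier V"
  shows "nrm V (x \<ominus> y) = nrm V (y \<ominus> x)"
proof -
  have "y \<ominus> x = (-1) \<odot> (x \<ominus> y)"
    using assms smultc_closed
    by (simp add: minus_as_smult smultc_add smultc_assoc[symmetric] smultc_one a_comm)
  then show ?thesis using assms by (simp add: nrm_smult)
qed

lemma nrm_minus_trans:
  assumes "x \<in> carrier V" "y \<in> carrier V" "z \<in> carrier V"
  shows "nrm V (x \<ominus> z) \<le> nrm V (x \<ominus> y) + nrm V (y \<ominus> z)"
proof -
  have "(x \<ominus> y) \<oplus> (y \<ominus> z) = x \<ominus> z"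
    using assms by (simp add: minus_eq a_assoc r_neg1)
  then show ?thesis using nrm_triangle[of "x \<ominus> y" "y \<ominus> z"] assms by simp
qed

lemma nrm_diff_le:
  assumes "x \<in> carrier V" "y \<in> carrier V"
  shows "\<bar>nrm V x - nrm V y\<bar> \<le> nrm V (x \<ominus> y)"
proof -
  have "nrm V u \<le> nrm V (u \<ominus> v) + nrm V v" if "u \<in> carrier V" "v \<in> carrier V" for u v
  proof -
    have "(u \<ominus> v) \<oplus> v = u" using that by (simp add: minus_eq a_assoc l_neg)
    then show ?thesis using nrm_triangle[of "u \<ominus> v" v] that by simp
  qed
  from this[of x y] this[of y x] show ?thesis
    using assms nrm_minus_commute[of x y] by simp
qed

lemma nrm_add_minus_add:
  assumes "a \<in> carrier V" "b \<in> carrier V" "c \<in> carrier V" "d \<in> carrier V"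
  shows "nrm V ((a \<oplus> b) \<ominus> (c \<oplus> d)) \<le> nrm V (a \<ominus> c) + nrm V (b \<ominus> d)"
proof -
  have "(a \<oplus> b) \<ominus> (c \<oplus> d) = (a \<ominus> c) \<oplus> (b \<ominus> d)"
    using assms smultc_closed by (simp add: minus_as_smult smultc_add a_ac)
  then show ?thesis using nrm_triangle[of "a \<ominus> c" "b \<ominus> d"] assms by simp
qed

lemma nrm_smult_minus_smult:
  assumes "a \<in> carrier V" "b \<in> carrier V"
  shows "nrm V (c \<odot> a \<ominus> c \<odot> b) = cmod c * nrm V (a \<ominus> b)"
proof -
  have "c \<odot> a \<ominus> c \<odot> b = c \<odot> (a \<ominus> b)"
    using assms by (simp add: minus_as_smult smultc_add smultc_closed smultc_assoc[symmetric])
  then show ?thesis using assms by (simp add: nrm_smult)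
qed

lemma nrm_mult_bound:
  "\<exists>C\<ge>0. \<forall>x\<in>carrier V. \<forall>y\<in>carrier V. nrm V (x \<otimes> y) \<le> C * nrm V x * nrm V y"
proof -
  obtain C where C: "nrm V (x \<otimes> y) \<le> C * nrm V x * nrm V y" if "x \<in> carrier V" "y \<in> carrier V" for x y
    using nrm_mult_bounded by blast
  have "nrm V (x \<otimes> y) \<le> \<bar>C\<bar> * nrm V x * nrm V y" if xy: "x \<in> carrier V" "y \<in> carrier V" for x y
  proof -
    have "C * (nrm V x * nrm V y) \<le> \<bar>C\<bar> * (nrm V x * nrm V y)"
      using nrm_nonneg xy by (intro mult_right_mono) auto
    then show ?thesis using C[OF xy] by (simp add: mult.assoc)
  qed
  then show ?thesis by (intro exI[of _ "\<bar>C\<bar>"]) simp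
qed

lemma nrm_mult_minus_mult:
  assumes C: "\<And>x y. x \<in> carrier V \<Longrightarrow> y \<in> carrier V \<Longrightarrow> nrm V (x \<otimes> y) \<le> C * nrm V x * nrm V y"
    and V: "a \<in> carrier V" "b \<in> carrier V" "c \<in> carrier V" "d \<in> carrier V"
  shows "nrm V (a \<otimes> b \<ominus> c \<otimes> d)
    \<le> C * nrm V (a \<ominus> c) * nrm V b + C * nrm V c * nrm V (b \<ominus> d)"
proof -
  have "a \<otimes> b \<ominus> c \<otimes> b = (a \<ominus> c) \<otimes> b"
    using V by (simp add: minus_as_smult mult_closed smultc_closed distrib_right smult_mult)
  moreover have "c \<otimes> b \<ominus> c \<otimes> d = c \<otimes> (b \<ominus> d)"
    using V by (simp add: minus_as_smult mult_closed smultc_closed distrib_left mult_smult)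
  ultimately show ?thesis
    using nrm_minus_trans[of "a \<otimes> b" "c \<otimes> b" "c \<otimes> d"]
      C[of "a \<ominus> c" b] C[of c "b \<ominus> d"] V
    by (simp add: mult_closed)
qed

lemma mult_zero: "x \<in> carrier V \<Longrightarrow> x \<otimes> \<zero> = \<zero>"
  using mult_smult[of x "\<zero>" 0] by (simp add: smultc_zero mult_closed)

lemma zero_mult: "x \<in> carrier V \<Longrightarrow> \<zero> \<otimes> x = \<zero>"
  using smult_mult[of "\<zero>" x 0] by (simp add: smultc_zero mult_closed)

lemma smultc_of_zero: "c \<odot> \<zero> = \<zero>"
  using smultc_assoc[of "\<zero>" c 0] by (simp add: smultc_zero)

lemma cauchy_carrier: "s \<in> cauchy_seqs V \<Longrightarrow> s n \<in> carrier V"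
  by (simp add: cauchy_seqs_def)

lemma cauchyD: "s \<in> cauchy_seqs V \<Longrightarrow> 0 < e \<Longrightarrow> \<exists>N. \<forall>m\<ge>N. \<forall>n\<ge>N. nrm V (s m \<ominus> s n) < e"
  by (simp add: cauchy_seqs_def)

lemma cauchy_const: "x \<in> carrier V \<Longrightarrow> (\<lambda>_. x) \<in> cauchy_seqs V"
  by (simp add: cauchy_seqs_def nrm_self)

lemma cauchy_nrm_convergent:
  assumes s: "s \<in> cauchy_seqs V"
  shows "convergent (\<lambda>n. nrm V (s n))"
proof (rule Cauchy_convergent, rule CauchyI)
  fix e :: real assume "0 < e"
  then obtain N where N: "\<forall>m\<ge>N. \<forall>n\<ge>N. nrm V (s m \<ominus> s n) < e" using cauchyD[OF s] by blast
  have "norm (nrm V (s m) - nrm V (s n)) < e" if "m \<ge> N" "n \<ge> N" for m n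
  proof -
    have "nrm V (s m \<ominus> s n) < e" using N that by blast
    then show ?thesis using nrm_diff_le[OF cauchy_carrier[OF s, of m] cauchy_carrier[OF s, of n]] by simp
  qed
  then show "\<exists>M. \<forall>m\<ge>M. \<forall>n\<ge>M. norm (nrm V (s m) - nrm V (s n)) < e" by blast
qed

lemma cauchy_bounded:
  assumes s: "s \<in> cauchy_seqs V"
  shows "\<exists>B\<ge>0. \<forall>n. nrm V (s n) \<le> B"
proof -
  obtain B where B: "\<And>n. norm (nrm V (s n)) \<le> B"
    using convergent_imp_Bseq[OF cauchy_nrm_convergent[OF s]] unfolding Bseq_def by auto
  have "0 \<le> B" using B[of 0] norm_ge_zero[of "nrm V (s 0)"] by linarith
  moreover have "nrm V (s n) \<le> B" for n using B[of n] by simp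
  ultimately show ?thesis by blast
qed

lemma cauchy_combine:
  assumes s: "s \<in> cauchy_seqs V" and t: "t \<in> cauchy_seqs V" and u: "\<And>n. u n \<in> carrier V"
    and K: "0 \<le> K" "\<And>m n. nrm V (u m \<ominus> u n) \<le> K * (nrm V (s m \<ominus> s n) + nrm V (t m \<ominus> t n))"
  shows "u \<in> cauchy_seqs V"
  unfolding cauchy_seqs_def
proof (intro CollectI conjI allI impI u)
  fix e :: real assume e: "0 < e"
  then have e': "0 < e / (2 * K + 1)" using K(1) by simp
  obtain N where N: "\<forall>m\<ge>N. \<forall>n\<ge>N. nrm V (s m \<ominus> s n) < e / (2 * K + 1)" using cauchyD[OF s e'] by blast
  obtain N' where N': "\<forall>m\<ge>N'. \<forall>n\<ge>N'. nrm V (t m \<ominus> t n) < e / (2 * K + 1)" using cauchyD[OF t e'] by blast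
  have "nrm V (u m \<ominus> u n) < e" if "m \<ge> max N N'" "n \<ge> max N N'" for m n
  proof -
    have "nrm V (s m \<ominus> s n) \<le> e / (2 * K + 1)" "nrm V (t m \<ominus> t n) \<le> e / (2 * K + 1)"
      using N N' that by (simp_all add: less_imp_le)
    then have "K * (nrm V (s m \<ominus> s n) + nrm V (t m \<ominus> t n)) \<le> K * (e / (2 * K + 1) + e / (2 * K + 1))"
      using K(1) by (intro mult_left_mono) auto
    also have "\<dots> = 2 * K * e / (2 * K + 1)" by simp
    also have "\<dots> < e" using e K(1) by (simp add: pos_divide_less_eq algebra_simps)
    finally show ?thesis using K(2)[of m n] by linarith
  qed
  then show "\<exists>N. \<forall>m\<ge>N. \<forall>n\<ge>N. nrm V (u m \<ominus> u n) < e" by blast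
qed

lemma cauchy_add: "s \<in> cauchy_seqs V \<Longrightarrow> t \<in> cauchy_seqs V \<Longrightarrow> (\<lambda>n. s n \<oplus> t n) \<in> cauchy_seqs V"
  by (rule cauchy_combine[of s t _ 1]) (auto simp: cauchy_carrier nrm_add_minus_add)

lemma cauchy_smult: "s \<in> cauchy_seqs V \<Longrightarrow> (\<lambda>n. c \<odot> s n) \<in> cauchy_seqs V"
  by (rule cauchy_combine[of s s _ "cmod c"])
    (auto simp: cauchy_carrier smultc_closed nrm_smult_minus_smult nrm_nonneg intro!: mult_left_mono)

lemma mult_combine:
  assumes C: "0 \<le> C" "\<And>x y. x \<in> carrier V \<Longrightarrow> y \<in> carrier V \<Longrightarrow> nrm V (x \<otimes> y) \<le> C * nrm V x * nrm V y"
    and V: "a \<in> carrier V" "b \<in> carrier V" "c \<in> carrier V" "d \<in> carrier V"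
    and B: "nrm V b \<le> B" "nrm V c \<le> B"
  shows "nrm V (a \<otimes> b \<ominus> c \<otimes> d)
    \<le> C * B * (nrm V (a \<ominus> c) + nrm V (b \<ominus> d))"
proof -
  have "C * nrm V (a \<ominus> c) * nrm V b \<le> C * nrm V (a \<ominus> c) * B"
    using C B V nrm_nonneg by (intro mult_left_mono) auto
  moreover have "C * nrm V c * nrm V (b \<ominus> d) \<le> C * B * nrm V (b \<ominus> d)"
    using C B V nrm_nonneg by (intro mult_left_mono mult_right_mono) auto
  ultimately show ?thesis
    using nrm_mult_minus_mult[OF C(2) V] by (simp add: algebra_simps)
qed

lemma cauchy_mult:
  assumes s: "s \<in> cauchy_seqs V" and t: "t \<in> cauchy_seqs V"
  shows "(\<lambda>n. s n \<otimes> t n) \<in> cauchy_seqs V"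
proof -
  obtain C where C0: "0 \<le> C" and C': "\<forall>x\<in>carrier V. \<forall>y\<in>carrier V. nrm V (x \<otimes> y) \<le> C * nrm V x * nrm V y"
    using nrm_mult_bound by blast
  note C = C0 bspec[OF bspec[OF C']]
  obtain B where B: "0 \<le> B" "\<forall>n. nrm V (s n) \<le> B" using cauchy_bounded[OF s] by blast
  obtain B' where B': "0 \<le> B'" "\<forall>n. nrm V (t n) \<le> B'" using cauchy_bounded[OF t] by blast
  show ?thesis
  proof (rule cauchy_combine[OF s t, where K = "C * max B B'"])
    show "nrm V (s m \<otimes> t m \<ominus> s n \<otimes> t n)
        \<le> C * max B B' * (nrm V (s m \<ominus> s n) + nrm V (t m \<ominus> t n))" for m n
      by (rule mult_combine[OF C]) (use spec[OF B(2), of n] spec[OF B'(2), of m] cauchy_carrier s t in auto)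
  qed (use C B cauchy_carrier s t in \<open>auto simp: mult_closed\<close>)
qed

lemma null_rel_combine:
  assumes st: "(s, s') \<in> null_rel V" "(t, t') \<in> null_rel V"
    and u: "u \<in> cauchy_seqs V" "u' \<in> cauchy_seqs V"
    and K: "\<And>n. nrm V (u n \<ominus> u' n) \<le> K * (nrm V (s n \<ominus> s' n) + nrm V (t n \<ominus> t' n))"
  shows "(u, u') \<in> null_rel V"
proof -
  have "(\<lambda>n. K * (nrm V (s n \<ominus> s' n) + nrm V (t n \<ominus> t' n))) \<longlonglongrightarrow> K * (0 + 0)"
    using st by (intro tendsto_intros) (auto simp: null_rel_def)
  then have lim: "(\<lambda>n. K * (nrm V (s n \<ominus> s' n) + nrm V (t n \<ominus> t' n))) \<longlonglongrightarrow> 0"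
    by simp
  have "(\<lambda>n. nrm V (u n \<ominus> u' n)) \<longlonglongrightarrow> 0"
  proof (rule Lim_null_comparison[OF _ lim])
    have "0 \<le> nrm V (u n \<ominus> u' n)" for n
      using cauchy_carrier[OF u(1)] cauchy_carrier[OF u(2)] by (intro nrm_nonneg minus_closed)
    then show "\<forall>\<^sub>F n in sequentially. norm (nrm V (u n \<ominus> u' n))
        \<le> K * (nrm V (s n \<ominus> s' n) + nrm V (t n \<ominus> t' n))"
      using K by simp
  qed
  then show ?thesis using u by (simp add: null_rel_def)
qed

lemma null_relD: "(s, t) \<in> null_rel V \<Longrightarrow> s \<in> cauchy_seqs V \<and> t \<in> cauchy_seqs V"
  by (simp add: null_rel_def)

lemma null_rel_refl: "s \<in> cauchy_seqs V \<Longrightarrow> (s, s) \<in> null_rel V"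
  by (simp add: null_rel_def nrm_self cauchy_carrier)

lemma null_rel_sym: "(s, t) \<in> null_rel V \<Longrightarrow> (t, s) \<in> null_rel V"
  using nrm_minus_commute cauchy_carrier by (auto simp: null_rel_def)

lemma null_rel_trans:
  assumes "(s, t) \<in> null_rel V" "(t, u) \<in> null_rel V"
  shows "(s, u) \<in> null_rel V"
  by (rule null_rel_combine[OF assms, where K = 1])
    (use assms in \<open>auto simp: null_rel_def cauchy_carrier intro!: nrm_minus_trans\<close>)

lemma equiv_null_rel: "equiv (cauchy_seqs V) (null_rel V)"
proof (intro equivI refl_onI symI transI)
  show "null_rel V \<subseteq> cauchy_seqs V \<times> cauchy_seqs V" by (auto simp: null_rel_def)
qed (fact null_rel_refl null_rel_sym null_rel_trans)+

lemma null_class_eq: "(s, t) \<in> null_rel V \<Longrightarrow> null_rel V `` {s} = null_rel V `` {t}"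
  by (rule equiv_class_eq[OF equiv_null_rel])

lemma completion_carrier:
  "X \<in> carrier (completion V) \<longleftrightarrow> (\<exists>s\<in>cauchy_seqs V. X = null_rel V `` {s})"
  by (auto simp: completion_def quotient_def)

lemma completion_add:
  assumes "s \<in> cauchy_seqs V" "t \<in> cauchy_seqs V"
  shows "null_rel V `` {s} \<oplus>\<^bsub>completion V\<^esub> null_rel V `` {t} = null_rel V `` {\<lambda>n. s n \<oplus> t n}"
proof -
  have "congruent2 (null_rel V) (null_rel V) (\<lambda>s t. null_rel V `` {\<lambda>n. s n \<oplus> t n})"
  proof (rule congruent2I')
    fix s s' t t' assume *: "(s, s') \<in> null_rel V" "(t, t') \<in> null_rel V"
    have "((\<lambda>n. s n \<oplus> t n), (\<lambda>n. s' n \<oplus> t' n)) \<in> null_rel V"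
      using null_relD[OF *(1)] null_relD[OF *(2)]
      by (intro null_rel_combine[OF *, where K = 1]) (auto simp: cauchy_add cauchy_carrier nrm_add_minus_add)
    then show "null_rel V `` {\<lambda>n. s n \<oplus> t n} = null_rel V `` {\<lambda>n. s' n \<oplus> t' n}"
      by (rule null_class_eq)
  qed
  from UN_equiv_class2[OF equiv_null_rel equiv_null_rel this assms] show ?thesis
    by (simp add: completion_def)
qed

lemma completion_mult:
  assumes "s \<in> cauchy_seqs V" "t \<in> cauchy_seqs V"
  shows "null_rel V `` {s} \<otimes>\<^bsub>completion V\<^esub> null_rel V `` {t} = null_rel V `` {\<lambda>n. s n \<otimes> t n}"
proof -
  have "congruent2 (null_rel V) (null_rel V) (\<lambda>s t. null_rel V `` {\<lambda>n. s n \<otimes> t n})"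
  proof (rule congruent2I')
    fix s s' t t' assume *: "(s, s') \<in> null_rel V" "(t, t') \<in> null_rel V"
    note c = null_relD[OF *(1)] null_relD[OF *(2)]
    obtain C where C0: "0 \<le> C" and C': "\<forall>x\<in>carrier V. \<forall>y\<in>carrier V. nrm V (x \<otimes> y) \<le> C * nrm V x * nrm V y"
      using nrm_mult_bound by blast
    note C = C0 bspec[OF bspec[OF C']]
    obtain B where B: "\<forall>n. nrm V (s' n) \<le> B" using cauchy_bounded[of s'] c by blast
    obtain B' where B': "\<forall>n. nrm V (t n) \<le> B'" using cauchy_bounded[of t] c by blast
    have "((\<lambda>n. s n \<otimes> t n), (\<lambda>n. s' n \<otimes> t' n)) \<in> null_rel V"
    proof (rule null_rel_combine[OF *])
      show "nrm V (s n \<otimes> t n \<ominus> s' n \<otimes> t' n)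
          \<le> C * max B B' * (nrm V (s n \<ominus> s' n) + nrm V (t n \<ominus> t' n))" for n
        by (rule mult_combine[OF C]) (use spec[OF B, of n] spec[OF B', of n] cauchy_carrier c in auto)
    qed (use c in \<open>auto intro: cauchy_mult\<close>)
    then show "null_rel V `` {\<lambda>n. s n \<otimes> t n} = null_rel V `` {\<lambda>n. s' n \<otimes> t' n}"
      by (rule null_class_eq)
  qed
  from UN_equiv_class2[OF equiv_null_rel equiv_null_rel this assms] show ?thesis
    by (simp add: completion_def)
qed

lemma completion_smult:
  assumes "s \<in> cauchy_seqs V"
  shows "c \<odot>\<^bsub>completion V\<^esub> null_rel V `` {s} = null_rel V `` {\<lambda>n. c \<odot> s n}"
proof -
  have "congruent (null_rel V) (\<lambda>s. null_rel V `` {\<lambda>n. c \<odot> s n})"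
  proof (rule congruentI)
    fix s s' assume *: "(s, s') \<in> null_rel V"
    have "((\<lambda>n. c \<odot> s n), (\<lambda>n. c \<odot> s' n)) \<in> null_rel V"
      using null_relD[OF *]
      by (intro null_rel_combine[OF * *, where K = "cmod c"])
        (auto simp: cauchy_smult cauchy_carrier nrm_smult_minus_smult nrm_nonneg intro!: mult_left_mono)
    then show "null_rel V `` {\<lambda>n. c \<odot> s n} = null_rel V `` {\<lambda>n. c \<odot> s' n}"
      by (rule null_class_eq)
  qed
  from UN_equiv_class[OF equiv_null_rel this assms] show ?thesis by (simp add: completion_def)
qed

lemma completion_nrm:
  assumes s: "s \<in> cauchy_seqs V"
  shows "(\<lambda>n. nrm V (s n)) \<longlonglongrightarrow> nrm (completion V) (null_rel V `` {s})"
proof -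
  obtain \<rho> where \<rho>: "(\<lambda>n. nrm V (s n)) \<longlonglongrightarrow> \<rho>"
    using cauchy_nrm_convergent[OF s] by (auto simp: convergent_def)
  have t: "(\<lambda>n. nrm V (t n)) \<longlonglongrightarrow> \<rho>" if "(s, t) \<in> null_rel V" for t
  proof -
    have "(\<lambda>n. nrm V (s n) - nrm V (t n)) \<longlonglongrightarrow> 0"
    proof (rule tendsto_rabs_zero_cancel, rule tendsto_sandwich[OF _ _ tendsto_const])
      show "(\<lambda>n. nrm V (s n \<ominus> t n)) \<longlonglongrightarrow> 0" using that by (simp add: null_rel_def)
      show "\<forall>\<^sub>F n in sequentially. \<bar>nrm V (s n) - nrm V (t n)\<bar> \<le> nrm V (s n \<ominus> t n)"
        using null_relD[OF that] by (auto intro!: always_eventually nrm_diff_le simp: cauchy_carrier)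
    qed simp
    from tendsto_diff[OF \<rho> this] show ?thesis by simp
  qed
  have "(THE \<rho>. \<forall>t\<in>null_rel V `` {s}. (\<lambda>n. nrm V (t n)) \<longlonglongrightarrow> \<rho>) = \<rho>"
  proof (rule the_equality)
    show "\<forall>t\<in>null_rel V `` {s}. (\<lambda>n. nrm V (t n)) \<longlonglongrightarrow> \<rho>" using t by auto
    fix \<sigma> assume "\<forall>t\<in>null_rel V `` {s}. (\<lambda>n. nrm V (t n)) \<longlonglongrightarrow> \<sigma>"
    then have "(\<lambda>n. nrm V (s n)) \<longlonglongrightarrow> \<sigma>" using null_rel_refl[OF s] by auto
    then show "\<sigma> = \<rho>" using \<rho> by (rule LIMSEQ_unique)
  qed
  then show ?thesis using \<rho> by (simp add: completion_def)
qed

lemma completion_nrm_const: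
  "x \<in> carrier V \<Longrightarrow> nrm (completion V) (null_rel V `` {\<lambda>_. x}) = nrm V x"
  using LIMSEQ_unique[OF completion_nrm[OF cauchy_const] tendsto_const] by blast

lemma completion_nrm_nonneg:
  assumes "X \<in> carrier (completion V)"
  shows "0 \<le> nrm (completion V) X"
proof -
  obtain s where s: "s \<in> cauchy_seqs V" "X = null_rel V `` {s}"
    using assms unfolding completion_carrier by blast
  show ?thesis
    unfolding s(2) by (rule LIMSEQ_le_const[OF completion_nrm[OF s(1)]])
      (intro exI allI impI nrm_nonneg cauchy_carrier[OF s(1)])
qed

lemma completion_dense:
  assumes s: "s \<in> cauchy_seqs V"
  shows "(\<lambda>n. nrm (completion V) (null_rel V `` {s} \<oplus>\<^bsub>completion V\<^esub>
    ((-1) \<odot>\<^bsub>completion V\<^esub> null_rel V `` {\<lambda>_. s n}))) \<longlonglongrightarrow> 0"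
proof (rule LIMSEQ_I)
  fix e :: real assume e: "0 < e"
  then have "0 < e/2" by simp
  then obtain N where N: "\<forall>m\<ge>N. \<forall>n\<ge>N. nrm V (s m \<ominus> s n) < e/2" using cauchyD[OF s] by blast
  have "norm (nrm (completion V) (null_rel V `` {s} \<oplus>\<^bsub>completion V\<^esub>
      ((-1) \<odot>\<^bsub>completion V\<^esub> null_rel V `` {\<lambda>_. s n})) - 0) < e" (is "norm (?r - 0) < e")
    if n: "n \<ge> N" for n
  proof -
    let ?d = "\<lambda>m. s m \<oplus> (-1) \<odot> s n"
    have c: "(\<lambda>_. (-1) \<odot> s n) \<in> cauchy_seqs V"
      by (intro cauchy_const smultc_closed cauchy_carrier[OF s])
    have d: "?d \<in> cauchy_seqs V" by (rule cauchy_add[OF s c])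
    have "?r = nrm (completion V) (null_rel V `` {?d})"
      using cauchy_const[OF cauchy_carrier[OF s]] c s by (simp add: completion_add completion_smult)
    then have lim: "(\<lambda>m. nrm V (?d m)) \<longlonglongrightarrow> ?r" using completion_nrm[OF d] by simp
    have "?r \<le> e/2"
    proof (rule LIMSEQ_le_const2[OF lim], intro exI allI impI)
      fix m assume "N \<le> m"
      then show "nrm V (?d m) \<le> e/2"
        using N[rule_format, OF \<open>N \<le> m\<close> n] cauchy_carrier[OF s]
        by (subst minus_as_smult[symmetric]) auto
    qed
    moreover have "0 \<le> ?r"
      by (rule LIMSEQ_le_const[OF lim]) (intro exI allI impI nrm_nonneg cauchy_carrier[OF d])
    ultimately show ?thesis using e by simp
  qed
  then show "\<exists>N. \<forall>n\<ge>N. norm (nrm (completion V) (null_rel V `` {s} \<oplus>\<^bsub>completion V\<^esub>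
      ((-1) \<odot>\<^bsub>completion V\<^esub> null_rel V `` {\<lambda>_. s n})) - 0) < e" by blast
qed

end

lemma banach_algebra_seminormed:
  assumes "banach_algebra A"
  shows "seminormed_algebra A"
proof -
  interpret banach_algebra A by (rule assms)
  show ?thesis
    by unfold_locales
      (auto simp: nrm_nonneg nrm_triangle nrm_smult mult_closed distrib_right distrib_left smult_mult mult_smult
        intro!: exI[of _ 1] nrm_mult)
qed


section \<open>Bounded homomorphisms\<close>

definition bounded_hom :: "'b normed_alg \<Rightarrow> 'f normed_alg \<Rightarrow> ('b \<Rightarrow> 'f) \<Rightarrow> bool" where
  "bounded_hom B F \<theta> \<longleftrightarrow>
     (\<forall>a\<in>carrier B. \<theta> a \<in> carrier F) \<and>
     (\<forall>a\<in>carrier B. \<forall>b\<in>carrier B. \<theta> (a \<oplus>\<^bsub>B\<^esub> b) = \<theta> a \<oplus>\<^bsub>F\<^esub> \<theta> b) \<and>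
     (\<forall>c. \<forall>a\<in>carrier B. \<theta> (c \<odot>\<^bsub>B\<^esub> a) = c \<odot>\<^bsub>F\<^esub> \<theta> a) \<and>
     (\<forall>a\<in>carrier B. \<forall>b\<in>carrier B. \<theta> (a \<otimes>\<^bsub>B\<^esub> b) = \<theta> a \<otimes>\<^bsub>F\<^esub> \<theta> b) \<and>
     (\<exists>K. \<forall>a\<in>carrier B. nrm F (\<theta> a) \<le> K * nrm B a)"

lemma bounded_homD:
  assumes "bounded_hom B F \<theta>"
  shows "a \<in> carrier B \<Longrightarrow> \<theta> a \<in> carrier F"
    and "a \<in> carrier B \<Longrightarrow> b \<in> carrier B \<Longrightarrow> \<theta> (a \<oplus>\<^bsub>B\<^esub> b) = \<theta> a \<oplus>\<^bsub>F\<^esub> \<theta> b"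
    and "a \<in> carrier B \<Longrightarrow> \<theta> (c \<odot>\<^bsub>B\<^esub> a) = c \<odot>\<^bsub>F\<^esub> \<theta> a"
    and "a \<in> carrier B \<Longrightarrow> b \<in> carrier B \<Longrightarrow> \<theta> (a \<otimes>\<^bsub>B\<^esub> b) = \<theta> a \<otimes>\<^bsub>F\<^esub> \<theta> b"
    and "\<exists>K. \<forall>a\<in>carrier B. nrm F (\<theta> a) \<le> K * nrm B a"
  using assms by (auto simp: bounded_hom_def)

text \<open>
  Derivations are moved between algebras along homomorphisms: those of a quotient become derivations of the tensor
  product, and those of the tensor product become derivations of the factor \<open>A\<close>.
\<close>

lemma banach_bimodule_pullback:
  assumes bim: "banach_bimodule F E l r" and \<theta>: "bounded_hom B F \<theta>"
    and nonneg: "\<And>a. a \<in> carrier F \<Longrightarrow> 0 \<le> nrm F a"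
  shows "banach_bimodule B E (\<lambda>a. l (\<theta> a)) (\<lambda>x a. r x (\<theta> a))"
proof -
  interpret banach_bimodule F E l r by (rule bim)
  note h = bounded_homD[OF \<theta>]
  show ?thesis
  proof (intro banach_bimodule.intro complex_banach_space_axioms banach_bimodule_axioms.intro)
    obtain C where C: "\<forall>a\<in>carrier F. \<forall>x\<in>carrier E.
      nrm E (l a x) \<le> C * nrm F a * nrm E x \<and> nrm E (r x a) \<le> C * nrm F a * nrm E x"
      using act_bounded by blast
    obtain K where K: "\<forall>a\<in>carrier B. nrm F (\<theta> a) \<le> K * nrm B a" using h(5) by blast
    show "\<exists>C. \<forall>a\<in>carrier B. \<forall>x\<in>carrier E. nrm E (l (\<theta> a) x) \<le> C * nrm B a * nrm E x \<and>
      nrm E (r x (\<theta> a)) \<le> C * nrm B a * nrm E x"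
    proof (intro exI[of _ "\<bar>C\<bar> * K"] ballI)
      fix a x assume a: "a \<in> carrier B" and x: "x \<in> carrier E"
      have "C * nrm F (\<theta> a) * nrm E x \<le> \<bar>C\<bar> * (K * nrm B a) * nrm E x"
        using K a x nrm_nonneg[OF x] nonneg[OF h(1)[OF a]]
        by (intro mult_right_mono mult_mono) auto
      then show "nrm E (l (\<theta> a) x) \<le> \<bar>C\<bar> * K * nrm B a * nrm E x \<and>
          nrm E (r x (\<theta> a)) \<le> \<bar>C\<bar> * K * nrm B a * nrm E x"
        using C h(1)[OF a] x by (fastforce simp: mult.assoc)
    qed
  qed (simp_all add: h l_closed r_closed l_add r_add l_smult r_smult add_l add_r smult_l smult_r l_mult r_mult l_r)
qed

lemma bounded_derivation_pullback:
  assumes D: "bounded_derivation F E l r D" and \<theta>: "bounded_hom B F \<theta>"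
    and nonneg: "\<And>a. a \<in> carrier F \<Longrightarrow> 0 \<le> nrm F a"
  shows "bounded_derivation B E (\<lambda>a. l (\<theta> a)) (\<lambda>x a. r x (\<theta> a)) (\<lambda>a. D (\<theta> a))"
proof -
  note h = bounded_homD[OF \<theta>]
  obtain C where C: "\<forall>a\<in>carrier F. nrm E (D a) \<le> C * nrm F a"
    using D unfolding bounded_derivation_def by blast
  obtain K where K: "\<forall>a\<in>carrier B. nrm F (\<theta> a) \<le> K * nrm B a" using h(5) by blast
  have "nrm E (D (\<theta> a)) \<le> \<bar>C\<bar> * K * nrm B a" if a: "a \<in> carrier B" for a
  proof -
    have "nrm E (D (\<theta> a)) \<le> C * nrm F (\<theta> a)" using C h(1)[OF a] by blast
    also have "\<dots> \<le> \<bar>C\<bar> * (K * nrm B a)"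
      using K a nonneg[OF h(1)[OF a]] by (intro mult_mono) auto
    finally show ?thesis by (simp add: mult.assoc)
  qed
  then have "\<exists>C. \<forall>a\<in>carrier B. nrm E (D (\<theta> a)) \<le> C * nrm B a" by blast
  then show ?thesis
    using D h unfolding bounded_derivation_def by simp
qed

text \<open>
  Contractibility only speaks of bimodules over one type.  A derivation with values in a closed submodule \<open>X\<close>
  is implemented by an element of \<open>X\<close> as soon as \<open>X\<close> can be injected into that type.
\<close>

lemma derivation_into_submodule_inner:
  fixes \<kappa> :: "'e \<Rightarrow> 'u"
  assumes contr: "derivations_inner TYPE('u) B"
    and bim: "banach_bimodule B (E :: 'e normed_alg) l r" and der: "bounded_derivation B E l r D"
    and X: "X \<subseteq> carrier E" and inj: "inj_on \<kappa> X"
    and DX: "\<And>a. a \<in> carrier B \<Longrightarrow> D a \<in> X"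
    and zeroX: "\<zero>\<^bsub>E\<^esub> \<in> X"
    and addX: "\<And>x y. x \<in> X \<Longrightarrow> y \<in> X \<Longrightarrow> x \<oplus>\<^bsub>E\<^esub> y \<in> X"
    and smultX: "\<And>c x. x \<in> X \<Longrightarrow> c \<odot>\<^bsub>E\<^esub> x \<in> X"
    and lX: "\<And>a x. a \<in> carrier B \<Longrightarrow> x \<in> X \<Longrightarrow> l a x \<in> X"
    and rX: "\<And>a x. a \<in> carrier B \<Longrightarrow> x \<in> X \<Longrightarrow> r x a \<in> X"
    and closedX: "\<And>s x. (\<And>n. s n \<in> X) \<Longrightarrow> x \<in> carrier E \<Longrightarrow>
      (\<lambda>n. nrm E (s n \<ominus>\<^bsub>E\<^esub> x)) \<longlonglongrightarrow> 0 \<Longrightarrow> x \<in> X"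
  shows "\<exists>z\<in>X. \<forall>a\<in>carrier B. D a = r z a \<ominus>\<^bsub>E\<^esub> l a z"
proof -
  interpret banach_bimodule B E l r by (rule bim)
  define g where "g = the_inv_into X \<kappa>"
  define F where "F = transported \<kappa> X E"
  note tr = banach_bimodule_transported[OF X inj zeroX addX smultX lX rX closedX]
  have bimF: "banach_bimodule B F (\<lambda>a u. \<kappa> (l a (g u))) (\<lambda>u a. \<kappa> (r (g u) a))"
    unfolding F_def g_def by (rule tr(1))
  have minusF: "\<kappa> x \<ominus>\<^bsub>F\<^esub> \<kappa> y = \<kappa> (x \<ominus>\<^bsub>E\<^esub> y)" if "x \<in> X" "y \<in> X" for x y
    unfolding F_def by (rule tr(2)) (use that in auto)
  have g: "g (\<kappa> x) = x" if "x \<in> X" for x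
    unfolding g_def by (rule the_inv_into_f_f[OF inj that])
  have F: "carrier F = \<kappa> ` X" "u \<oplus>\<^bsub>F\<^esub> v = \<kappa> (g u \<oplus>\<^bsub>E\<^esub> g v)"
    "c \<odot>\<^bsub>F\<^esub> u = \<kappa> (c \<odot>\<^bsub>E\<^esub> g u)" "nrm F u = nrm E (g u)" for u v c
    by (simp_all add: F_def transported_def g_def Let_def)
  have "bounded_derivation B F (\<lambda>a u. \<kappa> (l a (g u))) (\<lambda>u a. \<kappa> (r (g u) a)) (\<lambda>a. \<kappa> (D a))"
    using der unfolding bounded_derivation_def by (simp add: F g DX lX rX)
  with contr bimF have "inner_derivation B F (\<lambda>a u. \<kappa> (l a (g u))) (\<lambda>u a. \<kappa> (r (g u) a)) (\<lambda>a. \<kappa> (D a))"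
    unfolding derivations_inner_def by blast
  then obtain z where z: "z \<in> X" "\<And>a. a \<in> carrier B \<Longrightarrow> \<kappa> (D a) = \<kappa> (r z a) \<ominus>\<^bsub>F\<^esub> \<kappa> (l a z)"
    unfolding inner_derivation_def by (auto simp: F g)
  have "D a = r z a \<ominus>\<^bsub>E\<^esub> l a z" if a: "a \<in> carrier B" for a
  proof -
    have zX: "r z a \<in> X" "l a z \<in> X" using rX[OF a z(1)] lX[OF a z(1)] by auto
    have "r z a \<ominus>\<^bsub>E\<^esub> l a z \<in> X"
      using addX[OF zX(1) smultX[OF zX(2), of "-1"]] zX X by (simp add: minus_as_smult subset_iff)
    moreover have "\<kappa> (D a) = \<kappa> (r z a \<ominus>\<^bsub>E\<^esub> l a z)" using z(2)[OF a] minusF[OF zX] by simp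
    ultimately show ?thesis using inj DX[OF a] by (auto dest: inj_onD)
  qed
  then show ?thesis using z(1) by blast
qed

lemma derivation_inner_if_injective:
  fixes \<kappa> :: "'e \<Rightarrow> 'u"
  assumes contr: "derivations_inner TYPE('u) B" and inj: "inj \<kappa>"
    and bim: "banach_bimodule B (E :: 'e normed_alg) l r" and der: "bounded_derivation B E l r D"
  shows "\<exists>z\<in>carrier E. \<forall>a\<in>carrier B. D a = r z a \<ominus>\<^bsub>E\<^esub> l a z"
proof -
  interpret banach_bimodule B E l r by (rule bim)
  show ?thesis
  proof (rule derivation_into_submodule_inner[OF contr bim der, of "carrier E" \<kappa>])
    show "D a \<in> carrier E" if "a \<in> carrier B" for a
      using der that by (simp add: bounded_derivation_def)
  qed (use inj in \<open>auto simp: smultc_closed l_closed r_closed intro: inj_on_subset\<close>)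
qed


subsection \<open>Extension to the completion\<close>

lemma (in complex_banach_space) limit_unique:
  assumes s: "\<And>n. s n \<in> carrier E" and x: "x \<in> carrier E" "y \<in> carrier E"
    and lim: "(\<lambda>n. nrm E (s n \<ominus>\<^bsub>E\<^esub> x)) \<longlonglongrightarrow> 0" "(\<lambda>n. nrm E (s n \<ominus>\<^bsub>E\<^esub> y)) \<longlonglongrightarrow> 0"
  shows "x = y"
proof -
  have "nrm E (x \<ominus>\<^bsub>E\<^esub> y) \<le> nrm E (s n \<ominus>\<^bsub>E\<^esub> x) + nrm E (s n \<ominus>\<^bsub>E\<^esub> y)" for n
    using minus_trans[OF x(1) s x(2), of n] nrm_minus_commute[OF x(1) s, of n] by simp
  moreover have "(\<lambda>n. nrm E (s n \<ominus>\<^bsub>E\<^esub> x) + nrm E (s n \<ominus>\<^bsub>E\<^esub> y)) \<longlonglongrightarrow> 0"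
    using tendsto_add[OF lim] by simp
  ultimately have "nrm E (x \<ominus>\<^bsub>E\<^esub> y) \<le> 0"
    by (intro LIMSEQ_le_const[of _ 0 "nrm E (x \<ominus>\<^bsub>E\<^esub> y)"]) auto
  then have "x \<ominus>\<^bsub>E\<^esub> y = \<zero>\<^bsub>E\<^esub>"
    using nrm_nonneg[of "x \<ominus>\<^bsub>E\<^esub> y"] nrm_eq_zero[of "x \<ominus>\<^bsub>E\<^esub> y"] x by simp
  then show ?thesis
    using minus_equality[of x "\<ominus>\<^bsub>E\<^esub> y"] x by (simp add: minus_eq)
qed

text \<open>
  The extension of \<open>h\<close> by continuity.  Any Cauchy sequence in the class \<open>X\<close> determines the value.
\<close>

definition completion_lift :: "'f normed_alg \<Rightarrow> ('v \<Rightarrow> 'f) \<Rightarrow> (nat \<Rightarrow> 'v) set \<Rightarrow> 'f" where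
  "completion_lift F h X =
     (SOME y. y \<in> carrier F \<and> (\<exists>s\<in>X. (\<lambda>n. nrm F (h (s n) \<ominus>\<^bsub>F\<^esub> y)) \<longlonglongrightarrow> 0))"

context
  fixes V :: "'v normed_alg" and F :: "'f normed_alg" and h
  assumes V: "seminormed_algebra V" and F: "banach_algebra F" and h: "bounded_hom V F h"
begin

interpretation V: seminormed_algebra V by (rule V)
interpretation F: banach_algebra F by (rule F)
interpretation FS: seminormed_algebra F by (rule banach_algebra_seminormed[OF F])

lemma hom_bound:
  "\<exists>K\<ge>0. \<forall>x\<in>carrier V. nrm F (h x) \<le> K * nrm V x"
proof -
  obtain K where K: "\<forall>x\<in>carrier V. nrm F (h x) \<le> K * nrm V x" using bounded_homD(5)[OF h] by blast
  have "nrm F (h x) \<le> \<bar>K\<bar> * nrm V x" if x: "x \<in> carrier V" for x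
  proof -
    have "K * nrm V x \<le> \<bar>K\<bar> * nrm V x" using V.nrm_nonneg[OF x] by (intro mult_right_mono) auto
    then show ?thesis using K x by force
  qed
  then show ?thesis by (intro exI[of _ "\<bar>K\<bar>"]) simp
qed

lemma hom_diff:
  assumes "x \<in> carrier V" "y \<in> carrier V"
  shows "h x \<ominus>\<^bsub>F\<^esub> h y = h (x \<ominus>\<^bsub>V\<^esub> y)"
  using assms bounded_homD[OF h]
  by (simp add: V.minus_as_smult FS.minus_as_smult V.smultc_closed)

lemma hom_cauchy:
  assumes s: "s \<in> cauchy_seqs V"
  shows "(\<lambda>n. h (s n)) \<in> cauchy_seqs F"
  unfolding cauchy_seqs_def
proof (intro CollectI conjI allI impI)
  show "h (s n) \<in> carrier F" for n by (intro bounded_homD(1)[OF h] V.cauchy_carrier[OF s])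
  fix e :: real assume e: "0 < e"
  obtain K where K: "K \<ge> 0" "\<forall>x\<in>carrier V. nrm F (h x) \<le> K * nrm V x" using hom_bound by blast
  have "0 < e / (K + 1)" using e K by simp
  then obtain N where N: "\<forall>m\<ge>N. \<forall>n\<ge>N. nrm V (s m \<ominus>\<^bsub>V\<^esub> s n) < e / (K + 1)" using V.cauchyD[OF s] by blast
  have "nrm F (h (s m) \<ominus>\<^bsub>F\<^esub> h (s n)) < e" if "m \<ge> N" "n \<ge> N" for m n
  proof -
    note c = V.cauchy_carrier[OF s]
    have "nrm F (h (s m) \<ominus>\<^bsub>F\<^esub> h (s n)) \<le> K * nrm V (s m \<ominus>\<^bsub>V\<^esub> s n)"
      using K(2) c hom_diff[OF c c] by simp
    also have "\<dots> \<le> K * (e / (K + 1))"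
      using N that K(1) by (intro mult_left_mono) (auto intro: less_imp_le)
    also have "\<dots> < e" using e K(1) by (simp add: pos_divide_less_eq algebra_simps)
    finally show ?thesis .
  qed
  then show "\<exists>N. \<forall>m\<ge>N. \<forall>n\<ge>N. nrm F (h (s m) \<ominus>\<^bsub>F\<^esub> h (s n)) < e" by blast
qed

lemma hom_null:
  assumes st: "(s, t) \<in> null_rel V"
  shows "(\<lambda>n. nrm F (h (s n) \<ominus>\<^bsub>F\<^esub> h (t n))) \<longlonglongrightarrow> 0"
proof -
  obtain K where K: "K \<ge> 0" "\<forall>x\<in>carrier V. nrm F (h x) \<le> K * nrm V x" using hom_bound by blast
  have c: "s n \<in> carrier V" "t n \<in> carrier V" for n
    using V.null_relD[OF st] V.cauchy_carrier by auto
  have le: "norm (nrm F (h (s n) \<ominus>\<^bsub>F\<^esub> h (t n))) \<le> K * nrm V (s n \<ominus>\<^bsub>V\<^esub> t n)" for n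
    using K(2) c hom_diff[OF c] bounded_homD(1)[OF h] by (simp add: F.nrm_nonneg)
  have "(\<lambda>n. nrm V (s n \<ominus>\<^bsub>V\<^esub> t n)) \<longlonglongrightarrow> 0" using st by (simp add: null_rel_def)
  from tendsto_mult_left[OF this, of K] have lim: "(\<lambda>n. K * nrm V (s n \<ominus>\<^bsub>V\<^esub> t n)) \<longlonglongrightarrow> 0"
    by simp
  show ?thesis by (rule Lim_null_comparison[OF always_eventually[OF allI[OF le]] lim])
qed

lemma completion_lift:
  assumes s: "s \<in> cauchy_seqs V"
  shows "completion_lift F h (null_rel V `` {s}) \<in> carrier F"
    and "(\<lambda>n. nrm F (h (s n) \<ominus>\<^bsub>F\<^esub> completion_lift F h (null_rel V `` {s}))) \<longlonglongrightarrow> 0"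
proof -
  let ?X = "null_rel V `` {s}" and ?y = "completion_lift F h (null_rel V `` {s})"
  have "\<exists>y. y \<in> carrier F \<and> (\<exists>s\<in>?X. (\<lambda>n. nrm F (h (s n) \<ominus>\<^bsub>F\<^esub> y)) \<longlonglongrightarrow> 0)"
    using F.complete[OF hom_cauchy[OF s]] V.null_rel_refl[OF s] by blast
  then have *: "?y \<in> carrier F \<and> (\<exists>s\<in>?X. (\<lambda>n. nrm F (h (s n) \<ominus>\<^bsub>F\<^esub> ?y)) \<longlonglongrightarrow> 0)"
    unfolding completion_lift_def by (rule someI_ex)
  then show y: "?y \<in> carrier F" ..
  from * obtain t where t: "(s, t) \<in> null_rel V" "(\<lambda>n. nrm F (h (t n) \<ominus>\<^bsub>F\<^esub> ?y)) \<longlonglongrightarrow> 0" by auto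
  have c: "h (s n) \<in> carrier F" "h (t n) \<in> carrier F" for n
    using V.null_relD[OF t(1)] V.cauchy_carrier bounded_homD(1)[OF h] by auto
  have lim: "(\<lambda>n. nrm F (h (s n) \<ominus>\<^bsub>F\<^esub> h (t n)) + nrm F (h (t n) \<ominus>\<^bsub>F\<^esub> ?y)) \<longlonglongrightarrow> 0"
    using tendsto_add[OF hom_null[OF t(1)] t(2)] by simp
  have le: "norm (nrm F (h (s n) \<ominus>\<^bsub>F\<^esub> ?y)) \<le> nrm F (h (s n) \<ominus>\<^bsub>F\<^esub> h (t n)) + nrm F (h (t n) \<ominus>\<^bsub>F\<^esub> ?y)" for n
    using FS.nrm_minus_trans[OF c y, of n n] c[of n] y by (simp add: F.nrm_nonneg)
  show "(\<lambda>n. nrm F (h (s n) \<ominus>\<^bsub>F\<^esub> ?y)) \<longlonglongrightarrow> 0"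
    by (rule Lim_null_comparison[OF always_eventually[OF allI[OF le]] lim])
qed

lemma completion_lift_eqI:
  assumes s: "s \<in> cauchy_seqs V" and y: "y \<in> carrier F" and lim: "(\<lambda>n. nrm F (h (s n) \<ominus>\<^bsub>F\<^esub> y)) \<longlonglongrightarrow> 0"
  shows "completion_lift F h (null_rel V `` {s}) = y"
  by (rule F.limit_unique[OF _ completion_lift(1)[OF s] y completion_lift(2)[OF s] lim])
    (intro bounded_homD(1)[OF h] V.cauchy_carrier[OF s])

lemma completion_lift_const:
  "x \<in> carrier V \<Longrightarrow> completion_lift F h (null_rel V `` {\<lambda>_. x}) = h x"
  by (rule completion_lift_eqI) (simp_all add: V.cauchy_const bounded_homD(1)[OF h] FS.nrm_self)

lemma bounded_hom_completion_lift: "bounded_hom (completion V) F (completion_lift F h)"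
proof -
  let ?L = "\<lambda>s. completion_lift F h (null_rel V `` {s})"
  note hD = bounded_homD[OF h]
  have hc: "h (s n) \<in> carrier F" if "s \<in> cauchy_seqs V" for s n
    using that by (intro hD V.cauchy_carrier)
  note lim0 = Lim_null_comparison[OF always_eventually]
  have add: "?L (\<lambda>n. s n \<oplus>\<^bsub>V\<^esub> t n) = ?L s \<oplus>\<^bsub>F\<^esub> ?L t" if st: "s \<in> cauchy_seqs V" "t \<in> cauchy_seqs V" for s t
  proof (rule completion_lift_eqI[OF V.cauchy_add[OF st]])
    note L = completion_lift[OF st(1)] completion_lift[OF st(2)]
    show "?L s \<oplus>\<^bsub>F\<^esub> ?L t \<in> carrier F" using L by simp
    have "norm (nrm F (h (s n \<oplus>\<^bsub>V\<^esub> t n) \<ominus>\<^bsub>F\<^esub> (?L s \<oplus>\<^bsub>F\<^esub> ?L t)))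
        \<le> nrm F (h (s n) \<ominus>\<^bsub>F\<^esub> ?L s) + nrm F (h (t n) \<ominus>\<^bsub>F\<^esub> ?L t)" for n
      using FS.nrm_add_minus_add[OF hc[OF st(1)] hc[OF st(2)] L(1) L(3), of n n] hc[OF st(1), of n] hc[OF st(2), of n] L
      by (simp add: hD V.cauchy_carrier[OF st(1)] V.cauchy_carrier[OF st(2)] F.nrm_nonneg)
    moreover have "(\<lambda>n. nrm F (h (s n) \<ominus>\<^bsub>F\<^esub> ?L s) + nrm F (h (t n) \<ominus>\<^bsub>F\<^esub> ?L t)) \<longlonglongrightarrow> 0"
      using tendsto_add[OF L(2) L(4)] by simp
    ultimately show "(\<lambda>n. nrm F (h (s n \<oplus>\<^bsub>V\<^esub> t n) \<ominus>\<^bsub>F\<^esub> (?L s \<oplus>\<^bsub>F\<^esub> ?L t))) \<longlonglongrightarrow> 0"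
      by (rule lim0[OF allI])
  qed
  have smult: "?L (\<lambda>n. c \<odot>\<^bsub>V\<^esub> s n) = c \<odot>\<^bsub>F\<^esub> ?L s" if s: "s \<in> cauchy_seqs V" for s c
  proof (rule completion_lift_eqI[OF V.cauchy_smult[OF s]])
    note L = completion_lift[OF s]
    show "c \<odot>\<^bsub>F\<^esub> ?L s \<in> carrier F" using L by (simp add: F.smultc_closed)
    have "nrm F (h (c \<odot>\<^bsub>V\<^esub> s n) \<ominus>\<^bsub>F\<^esub> c \<odot>\<^bsub>F\<^esub> ?L s) = cmod c * nrm F (h (s n) \<ominus>\<^bsub>F\<^esub> ?L s)" for n
      using FS.nrm_smult_minus_smult[OF hc[OF s] L(1), of c n] by (simp add: hD V.cauchy_carrier[OF s])
    then show "(\<lambda>n. nrm F (h (c \<odot>\<^bsub>V\<^esub> s n) \<ominus>\<^bsub>F\<^esub> c \<odot>\<^bsub>F\<^esub> ?L s)) \<longlonglongrightarrow> 0"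
      using tendsto_mult_left[OF L(2), of "cmod c"] by simp
  qed
  have mult: "?L (\<lambda>n. s n \<otimes>\<^bsub>V\<^esub> t n) = ?L s \<otimes>\<^bsub>F\<^esub> ?L t" if st: "s \<in> cauchy_seqs V" "t \<in> cauchy_seqs V" for s t
  proof (rule completion_lift_eqI[OF V.cauchy_mult[OF st]])
    note L = completion_lift[OF st(1)] completion_lift[OF st(2)]
    show "?L s \<otimes>\<^bsub>F\<^esub> ?L t \<in> carrier F" using L by (simp add: F.mult_closed)
    obtain B where B: "\<forall>n. nrm F (h (t n)) \<le> B" using FS.cauchy_bounded[OF hom_cauchy[OF st(2)]] by blast
    let ?B = "max B (nrm F (?L s))"
    have "norm (nrm F (h (s n \<otimes>\<^bsub>V\<^esub> t n) \<ominus>\<^bsub>F\<^esub> (?L s \<otimes>\<^bsub>F\<^esub> ?L t)))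
        \<le> 1 * ?B * (nrm F (h (s n) \<ominus>\<^bsub>F\<^esub> ?L s) + nrm F (h (t n) \<ominus>\<^bsub>F\<^esub> ?L t))" for n
    proof -
      have "nrm F (h (s n) \<otimes>\<^bsub>F\<^esub> h (t n) \<ominus>\<^bsub>F\<^esub> ?L s \<otimes>\<^bsub>F\<^esub> ?L t)
          \<le> 1 * ?B * (nrm F (h (s n) \<ominus>\<^bsub>F\<^esub> ?L s) + nrm F (h (t n) \<ominus>\<^bsub>F\<^esub> ?L t))"
        using spec[OF B, of n] hc[OF st(1), of n] hc[OF st(2), of n] L
        by (intro FS.mult_combine) (auto simp: F.nrm_mult)
      then show ?thesis
        using hc[OF st(1), of n] hc[OF st(2), of n] L
        by (simp add: hD V.cauchy_carrier[OF st(1)] V.cauchy_carrier[OF st(2)] F.nrm_nonneg F.mult_closed)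
    qed
    moreover have "(\<lambda>n. 1 * ?B * (nrm F (h (s n) \<ominus>\<^bsub>F\<^esub> ?L s) + nrm F (h (t n) \<ominus>\<^bsub>F\<^esub> ?L t))) \<longlonglongrightarrow> 0"
      using tendsto_mult_left[OF tendsto_add[OF L(2) L(4)], of "1 * ?B"] by simp
    ultimately show "(\<lambda>n. nrm F (h (s n \<otimes>\<^bsub>V\<^esub> t n) \<ominus>\<^bsub>F\<^esub> (?L s \<otimes>\<^bsub>F\<^esub> ?L t))) \<longlonglongrightarrow> 0"
      by (rule lim0[OF allI])
  qed
  obtain K where K: "K \<ge> 0" "\<forall>x\<in>carrier V. nrm F (h x) \<le> K * nrm V x" using hom_bound by blast
  have bound: "nrm F (?L s) \<le> K * nrm (completion V) (null_rel V `` {s})" if s: "s \<in> cauchy_seqs V" for s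
  proof (rule LIMSEQ_le)
    note L = completion_lift[OF s]
    show "(\<lambda>n. K * nrm V (s n) + nrm F (h (s n) \<ominus>\<^bsub>F\<^esub> ?L s)) \<longlonglongrightarrow> K * nrm (completion V) (null_rel V `` {s})"
      using tendsto_add[OF tendsto_mult_left[OF V.completion_nrm[OF s], of K] L(2)] by simp
    have "nrm F (?L s) \<le> K * nrm V (s n) + nrm F (h (s n) \<ominus>\<^bsub>F\<^esub> ?L s)" for n
    proof -
      have "nrm F (?L s) - nrm F (h (s n)) \<le> nrm F (h (s n) \<ominus>\<^bsub>F\<^esub> ?L s)"
        using FS.nrm_diff_le[OF hc[OF s, of n] L(1)] by linarith
      then show ?thesis using K(2) V.cauchy_carrier[OF s, of n] by fastforce
    qed
    then show "\<exists>N. \<forall>n\<ge>N. nrm F (?L s) \<le> K * nrm V (s n) + nrm F (h (s n) \<ominus>\<^bsub>F\<^esub> ?L s)" by blast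
  qed simp
  show ?thesis
    unfolding bounded_hom_def
  proof (intro conjI)
    show "\<exists>K. \<forall>X\<in>carrier (completion V). nrm F (completion_lift F h X) \<le> K * nrm (completion V) X"
      using bound by (intro exI[of _ K]) (auto simp: V.completion_carrier)
  qed (auto simp: V.completion_carrier V.completion_add V.completion_mult V.completion_smult
      completion_lift(1) add smult mult)
qed

end


section \<open>The algebraic tensor product\<close>

definition weight :: "'a normed_alg \<Rightarrow> 'b normed_alg \<Rightarrow> ('a \<times> 'b) list \<Rightarrow> real" where
  "weight M A L = (\<Sum>(a, b)\<leftarrow>L. nrm M a * nrm A b)"

definition pair_mult :: "'a normed_alg \<Rightarrow> 'b normed_alg \<Rightarrow> 'a \<times> 'b \<Rightarrow> 'a \<times> 'b \<Rightarrow> 'a \<times> 'b" where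
  "pair_mult M A p q = (fst p \<otimes>\<^bsub>M\<^esub> fst q, snd p \<otimes>\<^bsub>A\<^esub> snd q)"

text \<open>
  The terms are grouped by the left factor, in the order of \<open>List.product\<close>, which allows induction on the left list.
\<close>

definition list_mult :: "'a normed_alg \<Rightarrow> 'b normed_alg \<Rightarrow> ('a \<times> 'b) list \<Rightarrow> ('a \<times> 'b) list \<Rightarrow> ('a \<times> 'b) list" where
  "list_mult M A L N = concat (map (\<lambda>p. map (pair_mult M A p) N) L)"

definition list_smult :: "'a normed_alg \<Rightarrow> complex \<Rightarrow> ('a \<times> 'b) list \<Rightarrow> ('a \<times> 'b) list" where
  "list_smult M c L = map (\<lambda>(a, b). (c \<odot>\<^bsub>M\<^esub> a, b)) L"

lemma list_mult_product:
  "map (\<lambda>((a, b), (a', b')). (a \<otimes>\<^bsub>M\<^esub> a', b \<otimes>\<^bsub>A\<^esub> b')) (List.product L N) = list_mult M A L N"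
  by (induction L) (auto simp: list_mult_def pair_mult_def split_beta)

lemma le_mult_cINF:
  fixes f :: "'i \<Rightarrow> real"
  assumes "I \<noteq> {}" "0 \<le> k" "\<And>i. i \<in> I \<Longrightarrow> x \<le> k * f i"
  shows "x \<le> k * (INF i\<in>I. f i)"
proof (cases "k = 0")
  case True
  then show ?thesis using assms by auto
next
  case False
  then have "x / k \<le> (INF i\<in>I. f i)"
    using assms by (intro cINF_greatest) (auto simp: divide_le_eq mult.commute)
  then show ?thesis using False assms(2) by (simp add: divide_le_eq mult.commute)
qed

lemma le_add_cINF:
  fixes f :: "'i \<Rightarrow> real"
  assumes "I \<noteq> {}" "\<And>i. i \<in> I \<Longrightarrow> x \<le> f i + c"
  shows "x \<le> (INF i\<in>I. f i) + c"
proof -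
  have "x - c \<le> (INF i\<in>I. f i)" using assms by (intro cINF_greatest) (auto simp: algebra_simps)
  then show ?thesis by simp
qed

locale tensor_pair = M: seminormed_algebra M + A: seminormed_algebra A
  for M :: "'m normed_alg" and A :: "'a normed_alg"
begin

abbreviation "R \<equiv> tensor_rel M A"
abbreviation "Ls \<equiv> lists (carrier M \<times> carrier A)"
abbreviation "T \<equiv> algebraic_tensor M A"
abbreviation cl :: "('m \<times> 'a) list \<Rightarrow> ('m \<times> 'a) list set" where "cl L \<equiv> R `` {L}"

lemma append_Ls: "L \<in> Ls \<Longrightarrow> N \<in> Ls \<Longrightarrow> L @ N \<in> Ls"
  by simp

lemma rel_lists: "(L, L') \<in> R \<Longrightarrow> L \<in> Ls \<and> L' \<in> Ls"
  by (induction rule: tensor_rel.induct) (auto simp: M.smultc_closed A.smultc_closed)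

lemma equiv_rel: "equiv Ls R"
proof (intro equivI refl_onI symI transI)
  show "R \<subseteq> Ls \<times> Ls" by (intro subrelI SigmaI) (use rel_lists in blast)+
qed (fact tensor_rel.refl tensor_rel.sym tensor_rel.trans)+

lemma cl_eq: "(L, N) \<in> R \<Longrightarrow> cl L = cl N"
  by (rule equiv_class_eq[OF equiv_rel])

lemma rel_Cons: "(L, N) \<in> R \<Longrightarrow> p \<in> carrier M \<times> carrier A \<Longrightarrow> (p # L, p # N) \<in> R"
  using tensor_rel.append[OF tensor_rel.refl, of "[p]" M A L N] by simp

lemma rel_perm:
  assumes "mset L = mset N" "L \<in> Ls"
  shows "(L, N) \<in> R"
  using assms
proof (induction L arbitrary: N)
  case Nil
  then show ?case by (simp add: tensor_rel.refl)
next
  case (Cons p L)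
  have "p \<in> set N" using Cons.prems(1) by (metis list.set_intros(1) set_mset_mset)
  then obtain N1 N2 where N: "N = N1 @ p # N2" by (meson split_list)
  then have m: "mset L = mset (N1 @ N2)" using Cons.prems(1) by simp
  then have "set L = set (N1 @ N2)" by (rule mset_eq_setD)
  then have s: "N1 \<in> Ls" "N2 \<in> Ls" "[p] \<in> Ls" using Cons.prems(2) by auto
  have "(p # L, p # (N1 @ N2)) \<in> R"
    using Cons.IH[OF m] Cons.prems(2) by (intro rel_Cons) auto
  moreover have "([p] @ N1, N1 @ [p]) \<in> R" by (rule tensor_rel.commute[OF s(3,1)])
  then have "(([p] @ N1) @ N2, (N1 @ [p]) @ N2) \<in> R"
    by (rule tensor_rel.append[OF _ tensor_rel.refl[OF s(2)]])
  ultimately show ?case unfolding N using tensor_rel.trans by fastforce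
qed

text \<open>
  Scaling, and multiplication by a fixed elementary tensor from either side, act on both factors by linear maps.
  All checks that the operations respect the bilinearity relations are thereby reduced to this one induction.
\<close>

lemma rel_map:
  assumes LN: "(L, N) \<in> R"
    and f: "\<And>x. x \<in> carrier M \<Longrightarrow> f x \<in> carrier M"
      "\<And>x y. x \<in> carrier M \<Longrightarrow> y \<in> carrier M \<Longrightarrow> f (x \<oplus>\<^bsub>M\<^esub> y) = f x \<oplus>\<^bsub>M\<^esub> f y"
      "\<And>c x. x \<in> carrier M \<Longrightarrow> f (c \<odot>\<^bsub>M\<^esub> x) = c \<odot>\<^bsub>M\<^esub> f x"
    and g: "\<And>x. x \<in> carrier A \<Longrightarrow> g x \<in> carrier A"
      "\<And>x y. x \<in> carrier A \<Longrightarrow> y \<in> carrier A \<Longrightarrow> g (x \<oplus>\<^bsub>A\<^esub> y) = g x \<oplus>\<^bsub>A\<^esub> g y"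
      "\<And>c x. x \<in> carrier A \<Longrightarrow> g (c \<odot>\<^bsub>A\<^esub> x) = c \<odot>\<^bsub>A\<^esub> g x"
  shows "(map (map_prod f g) L, map (map_prod f g) N) \<in> R"
proof -
  have f0: "f \<zero>\<^bsub>M\<^esub> = \<zero>\<^bsub>M\<^esub>"
    using f(3)[of "\<zero>\<^bsub>M\<^esub>" 0] f(1) by (simp add: M.smultc_zero)
  have Ls: "map (map_prod f g) L \<in> Ls" if "L \<in> Ls" for L
    using that f(1) g(1) by (induction L) auto
  show ?thesis
    using LN
  proof (induction rule: tensor_rel.induct)
    case (refl L)
    then show ?case by (intro tensor_rel.refl Ls)
  next
    case (sym L N)
    show ?case by (rule tensor_rel.sym[OF sym.IH])
  next
    case (trans L N K)
    show ?case by (rule tensor_rel.trans[OF trans.IH])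
  next
    case (append L L' N N')
    show ?case using tensor_rel.append[OF append.IH] by simp
  next
    case (commute L N)
    show ?case using tensor_rel.commute[OF Ls[OF commute(1)] Ls[OF commute(2)]] by simp
  qed (simp_all add: f g f0 tensor_rel.add_left tensor_rel.add_right tensor_rel.smult tensor_rel.zero)
qed

lemma list_smult_closed: "L \<in> Ls \<Longrightarrow> list_smult M c L \<in> Ls"
  by (induction L) (auto simp: list_smult_def M.smultc_closed)

lemma rel_smult: "(L, N) \<in> R \<Longrightarrow> (list_smult M c L, list_smult M c N) \<in> R"
proof -
  have eq: "(\<lambda>(a, b). (c \<odot>\<^bsub>M\<^esub> a, b)) = map_prod (\<lambda>a. c \<odot>\<^bsub>M\<^esub> a) (\<lambda>b :: 'a. b)" by auto
  assume "(L, N) \<in> R"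
  then show ?thesis
    unfolding list_smult_def eq
    by (rule rel_map) (auto simp: M.smultc_closed M.smultc_add mult.commute simp flip: M.smultc_assoc)
qed

lemma pair_mult_closed:
  "p \<in> carrier M \<times> carrier A \<Longrightarrow> q \<in> carrier M \<times> carrier A \<Longrightarrow> pair_mult M A p q \<in> carrier M \<times> carrier A"
  by (auto simp: pair_mult_def M.mult_closed A.mult_closed)

lemma list_mult_Cons: "list_mult M A (p # L) N = map (pair_mult M A p) N @ list_mult M A L N"
  by (simp add: list_mult_def)

lemma list_mult_Nil: "list_mult M A [] N = []"
  by (simp add: list_mult_def)

lemma list_mult_append: "list_mult M A (L @ L') N = list_mult M A L N @ list_mult M A L' N"
  by (simp add: list_mult_def)

lemma map_pair_mult_closed:
  "p \<in> carrier M \<times> carrier A \<Longrightarrow> N \<in> Ls \<Longrightarrow> map (pair_mult M A p) N \<in> Ls"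
  by (induction N) (use pair_mult_closed in auto)

lemma list_mult_closed: "L \<in> Ls \<Longrightarrow> N \<in> Ls \<Longrightarrow> list_mult M A L N \<in> Ls"
proof (induction L)
  case (Cons p L)
  then show ?case
    using map_pair_mult_closed[of p N] unfolding list_mult_Cons by (intro append_Ls) auto
qed (simp add: list_mult_Nil)

lemma rel_mult_left_factor:
  assumes "(L, N) \<in> R" "p \<in> carrier M \<times> carrier A"
  shows "(map (pair_mult M A p) L, map (pair_mult M A p) N) \<in> R"
proof -
  have eq: "pair_mult M A p = map_prod (\<lambda>a. fst p \<otimes>\<^bsub>M\<^esub> a) (\<lambda>b. snd p \<otimes>\<^bsub>A\<^esub> b)"
    by (auto simp: pair_mult_def)
  show ?thesis
    unfolding eq using assms
    by (intro rel_map) (auto simp: M.mult_closed A.mult_closed M.distrib_left A.distrib_left M.mult_smult A.mult_smult)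
qed

lemma rel_mult_right_factor:
  assumes "(L, N) \<in> R" "p \<in> carrier M \<times> carrier A"
  shows "(map (\<lambda>q. pair_mult M A q p) L, map (\<lambda>q. pair_mult M A q p) N) \<in> R"
proof -
  have eq: "(\<lambda>q. pair_mult M A q p) = map_prod (\<lambda>a. a \<otimes>\<^bsub>M\<^esub> fst p) (\<lambda>b. b \<otimes>\<^bsub>A\<^esub> snd p)"
    by (auto simp: pair_mult_def)
  show ?thesis
    unfolding eq using assms
    by (intro rel_map) (auto simp: M.mult_closed A.mult_closed M.distrib_right A.distrib_right M.smult_mult A.smult_mult)
qed

lemma mset_list_mult_Cons_right:
  "mset (list_mult M A L (p # N)) = mset (map (\<lambda>q. pair_mult M A q p) L @ list_mult M A L N)"
  by (induction L) (auto simp: list_mult_Nil list_mult_Cons)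

lemma mset_list_mult_append_right:
  "mset (list_mult M A L (N @ N')) = mset (list_mult M A L N @ list_mult M A L N')"
  by (induction L) (auto simp: list_mult_Nil list_mult_Cons)

text \<open>
  Changing the right factor can be done for each term of the left list in turn.  For a change of the left factor
  the products are first reordered so as to be grouped by the terms of the right list.
\<close>

lemma rel_list_mult:
  assumes "(L, L') \<in> R" "(N, N') \<in> R"
  shows "(list_mult M A L N, list_mult M A L' N') \<in> R"
proof -
  note LL = rel_lists[OF assms(1)] and NN = rel_lists[OF assms(2)]
  have "(list_mult M A L N, list_mult M A L N') \<in> R"
    using LL[THEN conjunct1]
  proof (induction L)
    case (Cons p L)
    then show ?case
      unfolding list_mult_Cons by (intro tensor_rel.append rel_mult_left_factor assms(2)) auto
  qed (auto simp: list_mult_Nil intro: tensor_rel.refl)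
  moreover have "(list_mult M A L N', list_mult M A L' N') \<in> R"
    using NN[THEN conjunct2]
  proof (induction N')
    case Nil
    have "list_mult M A K [] = []" for K by (simp add: list_mult_def)
    then show ?case by (simp add: tensor_rel.refl)
  next
    case (Cons p N')
    then have pN: "p \<in> carrier M \<times> carrier A" "N' \<in> Ls" "p # N' \<in> Ls" by auto
    have "(list_mult M A L (p # N'), map (\<lambda>q. pair_mult M A q p) L @ list_mult M A L N') \<in> R"
      by (rule rel_perm[OF mset_list_mult_Cons_right]) (use LL pN list_mult_closed in blast)
    moreover have "(map (\<lambda>q. pair_mult M A q p) L @ list_mult M A L N',
        map (\<lambda>q. pair_mult M A q p) L' @ list_mult M A L' N') \<in> R"
      using Cons pN by (intro tensor_rel.append rel_mult_right_factor assms(1)) auto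
    moreover have "(list_mult M A L' (p # N'), map (\<lambda>q. pair_mult M A q p) L' @ list_mult M A L' N') \<in> R"
      by (rule rel_perm[OF mset_list_mult_Cons_right]) (use LL pN list_mult_closed in blast)
    ultimately show ?case by (meson tensor_rel.sym tensor_rel.trans)
  qed
  ultimately show ?thesis by (rule tensor_rel.trans)
qed

lemma tensor_carrier: "U \<in> carrier T \<longleftrightarrow> (\<exists>L\<in>Ls. U = cl L)"
  by (auto simp: algebraic_tensor_def quotient_def)

lemma cl_closed: "L \<in> Ls \<Longrightarrow> cl L \<in> carrier T"
  unfolding tensor_carrier by (rule bexI[of _ L]) (rule HOL.refl)

lemma tensor_add: "L \<in> Ls \<Longrightarrow> N \<in> Ls \<Longrightarrow> cl L \<oplus>\<^bsub>T\<^esub> cl N = cl (L @ N)"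
proof -
  assume LN: "L \<in> Ls" "N \<in> Ls"
  have "congruent2 R R (\<lambda>L N. cl (L @ N))"
    by (rule congruent2I') (rule cl_eq, rule tensor_rel.append)
  from UN_equiv_class2[OF equiv_rel equiv_rel this LN] show ?thesis by (simp add: algebraic_tensor_def)
qed

lemma tensor_mult: "L \<in> Ls \<Longrightarrow> N \<in> Ls \<Longrightarrow> cl L \<otimes>\<^bsub>T\<^esub> cl N = cl (list_mult M A L N)"
proof -
  assume LN: "L \<in> Ls" "N \<in> Ls"
  have "congruent2 R R (\<lambda>L N. cl (list_mult M A L N))"
    by (rule congruent2I') (rule cl_eq, rule rel_list_mult)
  from UN_equiv_class2[OF equiv_rel equiv_rel this LN] show ?thesis
    by (simp add: algebraic_tensor_def list_mult_product)
qed

lemma tensor_smult: "L \<in> Ls \<Longrightarrow> c \<odot>\<^bsub>T\<^esub> cl L = cl (list_smult M c L)"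
proof -
  assume L: "L \<in> Ls"
  have "congruent R (\<lambda>L. cl (list_smult M c L))"
    by (rule congruentI) (rule cl_eq, rule rel_smult)
  from UN_equiv_class[OF equiv_rel this L] show ?thesis
    by (simp add: algebraic_tensor_def list_smult_def)
qed

lemma tensor_zero: "\<zero>\<^bsub>T\<^esub> = cl []"
  by (simp add: algebraic_tensor_def)

lemma tensor_nrm: "nrm T U = (INF L\<in>U. weight M A L)"
  by (simp add: algebraic_tensor_def weight_def)

lemma weight_nonneg: "L \<in> Ls \<Longrightarrow> 0 \<le> weight M A L"
  by (induction L) (auto simp: weight_def M.nrm_nonneg A.nrm_nonneg)

lemma weight_append: "weight M A (L @ N) = weight M A L + weight M A N"
  by (simp add: weight_def)

lemma weight_smult: "L \<in> Ls \<Longrightarrow> weight M A (list_smult M c L) = cmod c * weight M A L"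
  by (induction L) (auto simp: weight_def list_smult_def M.nrm_smult algebra_simps)

lemma cl_self: "L \<in> Ls \<Longrightarrow> L \<in> cl L"
  by (simp add: tensor_rel.refl)

lemma tensor_nrm_nonneg:
  assumes L: "L \<in> Ls"
  shows "0 \<le> nrm T (cl L)"
  unfolding tensor_nrm
proof (rule cINF_greatest)
  show "cl L \<noteq> {}" using cl_self[OF L] by blast
  fix N assume "N \<in> cl L"
  then have "(L, N) \<in> R" by simp
  then show "0 \<le> weight M A N" by (intro weight_nonneg conjunct2[OF rel_lists])
qed

lemma tensor_nrm_le: "L \<in> Ls \<Longrightarrow> nrm T (cl L) \<le> weight M A L"
  unfolding tensor_nrm
proof (rule cINF_lower)
  show "bdd_below (weight M A ` cl L)"
  proof (rule bdd_belowI2[of _ 0])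
    fix N assume "N \<in> cl L"
    then have "(L, N) \<in> R" by simp
    then show "0 \<le> weight M A N" by (intro weight_nonneg conjunct2[OF rel_lists])
  qed
qed (rule cl_self)

lemma tensor_nrm_le_class: "(L, L') \<in> R \<Longrightarrow> nrm T (cl L) \<le> weight M A L'"
  using tensor_nrm_le[of L'] rel_lists[of L L'] cl_eq[of L L'] by simp

lemma rel_cancel: "L \<in> Ls \<Longrightarrow> (list_smult M (-1) L @ L, []) \<in> R"
proof (induction L)
  case (Cons p L)
  obtain a b where p: "p = (a, b)" "a \<in> carrier M" "b \<in> carrier A" "L \<in> Ls" using Cons.prems by (cases p) auto
  have ma: "(-1) \<odot>\<^bsub>M\<^esub> a \<in> carrier M" using p M.smultc_closed by blast
  have zero: "(-1) \<odot>\<^bsub>M\<^esub> a \<oplus>\<^bsub>M\<^esub> a = \<zero>\<^bsub>M\<^esub>"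
    using M.smultc_add_left[OF p(2), of "-1" 1] M.smultc_one[OF p(2)] M.smultc_zero[OF p(2)] by simp
  have "([((-1) \<odot>\<^bsub>M\<^esub> a, b), (a, b)], [(\<zero>\<^bsub>M\<^esub>, b)]) \<in> R"
    using tensor_rel.sym[OF tensor_rel.add_left[OF ma p(2) p(3)]] zero by simp
  then have "([((-1) \<odot>\<^bsub>M\<^esub> a, b), (a, b)], []) \<in> R"
    by (rule tensor_rel.trans[OF _ tensor_rel.zero[OF p(3)]])
  from tensor_rel.append[OF this Cons.IH[OF p(4)]]
  have "([((-1) \<odot>\<^bsub>M\<^esub> a, b), (a, b)] @ (list_smult M (-1) L @ L), []) \<in> R" by simp
  moreover have "(list_smult M (-1) (p # L) @ p # L, [((-1) \<odot>\<^bsub>M\<^esub> a, b), (a, b)] @ (list_smult M (-1) L @ L)) \<in> R"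
    using Cons.prems list_smult_closed[of "p # L" "-1"]
    by (intro rel_perm) (auto simp: list_smult_def p)
  ultimately show ?case by (meson tensor_rel.trans)
qed (simp add: list_smult_def tensor_rel.refl)

lemma rel_smult_add: "L \<in> Ls \<Longrightarrow> (list_smult M (c + d) L, list_smult M c L @ list_smult M d L) \<in> R"
proof (induction L)
  case (Cons p L)
  obtain a b where p: "p = (a, b)" "a \<in> carrier M" "b \<in> carrier A" "L \<in> Ls" using Cons.prems by (cases p) auto
  have "([((c + d) \<odot>\<^bsub>M\<^esub> a, b)], [(c \<odot>\<^bsub>M\<^esub> a, b), (d \<odot>\<^bsub>M\<^esub> a, b)]) \<in> R"
    using tensor_rel.add_left[OF M.smultc_closed[OF p(2), of c] M.smultc_closed[OF p(2), of d] p(3)]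
    by (simp add: M.smultc_add_left p)
  from tensor_rel.append[OF this Cons.IH[OF p(4)]]
  have "(list_smult M (c + d) (p # L), [(c \<odot>\<^bsub>M\<^esub> a, b), (d \<odot>\<^bsub>M\<^esub> a, b)] @ (list_smult M c L @ list_smult M d L)) \<in> R"
    by (simp add: list_smult_def p)
  moreover have "([(c \<odot>\<^bsub>M\<^esub> a, b), (d \<odot>\<^bsub>M\<^esub> a, b)] @ (list_smult M c L @ list_smult M d L),
      list_smult M c (p # L) @ list_smult M d (p # L)) \<in> R"
    using p list_smult_closed[OF p(4)]
    by (intro rel_perm) (auto simp: list_smult_def M.smultc_closed)
  ultimately show ?case by (rule tensor_rel.trans)
qed (simp add: list_smult_def tensor_rel.refl)

lemma tensor_module: "Module.module complex_ring T"
proof (rule Module.moduleI[OF cring_complex_ring])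
  show "abelian_group T"
  proof (rule abelian_groupI)
    fix U assume "U \<in> carrier T"
    then obtain L where L: "L \<in> Ls" "U = cl L" unfolding tensor_carrier by blast
    have "cl (list_smult M (-1) L) \<oplus>\<^bsub>T\<^esub> U = \<zero>\<^bsub>T\<^esub>"
      unfolding L(2) tensor_add[OF list_smult_closed[OF L(1)] L(1)] tensor_zero
      by (rule cl_eq[OF rel_cancel[OF L(1)]])
    then show "\<exists>W\<in>carrier T. W \<oplus>\<^bsub>T\<^esub> U = \<zero>\<^bsub>T\<^esub>"
      by (rule bexI[OF _ cl_closed[OF list_smult_closed[OF L(1)]]])
  next
    fix U W assume "U \<in> carrier T" "W \<in> carrier T"
    then obtain L N where LN: "L \<in> Ls" "U = cl L" "N \<in> Ls" "W = cl N" unfolding tensor_carrier by blast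
    show "U \<oplus>\<^bsub>T\<^esub> W \<in> carrier T"
      unfolding LN(2,4) tensor_add[OF LN(1,3)] by (rule cl_closed[OF append_Ls[OF LN(1,3)]])
    show "U \<oplus>\<^bsub>T\<^esub> W = W \<oplus>\<^bsub>T\<^esub> U"
      unfolding LN(2,4) tensor_add[OF LN(1,3)] tensor_add[OF LN(3,1)]
      by (rule cl_eq[OF tensor_rel.commute[OF LN(1,3)]])
  next
    show "\<zero>\<^bsub>T\<^esub> \<in> carrier T"
      unfolding tensor_zero by (rule cl_closed) simp
  next
    fix U assume "U \<in> carrier T"
    then obtain L where L: "L \<in> Ls" "U = cl L" unfolding tensor_carrier by blast
    show "\<zero>\<^bsub>T\<^esub> \<oplus>\<^bsub>T\<^esub> U = U" unfolding tensor_zero L(2) using tensor_add[of "[]" L] L(1) by simp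
  next
    fix U W X assume "U \<in> carrier T" "W \<in> carrier T" "X \<in> carrier T"
    then obtain L N K where LN: "L \<in> Ls" "U = cl L" "N \<in> Ls" "W = cl N" "K \<in> Ls" "X = cl K"
      unfolding tensor_carrier by blast
    show "U \<oplus>\<^bsub>T\<^esub> W \<oplus>\<^bsub>T\<^esub> X = U \<oplus>\<^bsub>T\<^esub> (W \<oplus>\<^bsub>T\<^esub> X)"
      unfolding LN(2,4,6)
      by (simp only: tensor_add[OF LN(1,3)] tensor_add[OF LN(3,5)] append_assoc
          tensor_add[OF append_Ls[OF LN(1,3)] LN(5)] tensor_add[OF LN(1) append_Ls[OF LN(3,5)]])
  qed
next
  fix c d U assume "U \<in> carrier T"
  then obtain L where L: "L \<in> Ls" "U = cl L" unfolding tensor_carrier by blast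
  have "(c + d) \<odot>\<^bsub>T\<^esub> U = c \<odot>\<^bsub>T\<^esub> U \<oplus>\<^bsub>T\<^esub> d \<odot>\<^bsub>T\<^esub> U"
    unfolding L(2) tensor_smult[OF L(1)] tensor_add[OF list_smult_closed[OF L(1)] list_smult_closed[OF L(1)]]
    by (rule cl_eq[OF rel_smult_add[OF L(1)]])
  then show "(c \<oplus>\<^bsub>complex_ring\<^esub> d) \<odot>\<^bsub>T\<^esub> U = c \<odot>\<^bsub>T\<^esub> U \<oplus>\<^bsub>T\<^esub> d \<odot>\<^bsub>T\<^esub> U" by (simp add: complex_ring_def)
  have "list_smult M (c * d) L = list_smult M c (list_smult M d L)" "list_smult M 1 L = L"
    using L(1) by (induction L) (auto simp: list_smult_def M.smultc_assoc M.smultc_one)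
  then show "(c \<otimes>\<^bsub>complex_ring\<^esub> d) \<odot>\<^bsub>T\<^esub> U = c \<odot>\<^bsub>T\<^esub> (d \<odot>\<^bsub>T\<^esub> U)" "\<one>\<^bsub>complex_ring\<^esub> \<odot>\<^bsub>T\<^esub> U = U"
    using L by (simp_all add: complex_ring_def tensor_smult list_smult_closed)
  show "c \<odot>\<^bsub>T\<^esub> U \<in> carrier T"
    unfolding L(2) tensor_smult[OF L(1)] by (rule cl_closed[OF list_smult_closed[OF L(1)]])
next
  fix c U W assume "U \<in> carrier T" "W \<in> carrier T"
  then obtain L N where LN: "L \<in> Ls" "U = cl L" "N \<in> Ls" "W = cl N" unfolding tensor_carrier by blast
  have "list_smult M c (L @ N) = list_smult M c L @ list_smult M c N" by (simp add: list_smult_def)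
  then show "c \<odot>\<^bsub>T\<^esub> (U \<oplus>\<^bsub>T\<^esub> W) = c \<odot>\<^bsub>T\<^esub> U \<oplus>\<^bsub>T\<^esub> c \<odot>\<^bsub>T\<^esub> W"
    using LN list_smult_closed[OF LN(1), of c] list_smult_closed[OF LN(3), of c]
    by (simp add: tensor_add tensor_smult)
qed

lemma weight_list_mult:
  assumes C: "0 \<le> C" "\<forall>x\<in>carrier M. \<forall>y\<in>carrier M. nrm M (x \<otimes>\<^bsub>M\<^esub> y) \<le> C * nrm M x * nrm M y"
    and C': "0 \<le> C'" "\<forall>x\<in>carrier A. \<forall>y\<in>carrier A. nrm A (x \<otimes>\<^bsub>A\<^esub> y) \<le> C' * nrm A x * nrm A y"
    and LN: "L \<in> Ls" "N \<in> Ls"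
  shows "weight M A (list_mult M A L N) \<le> C * C' * weight M A L * weight M A N"
proof -
  have single: "weight M A (map (pair_mult M A p) N) \<le> C * C' * (nrm M (fst p) * nrm A (snd p)) * weight M A N"
    if p: "p \<in> carrier M \<times> carrier A" for p
    using LN(2)
  proof (induction N)
    case (Cons q N)
    then have q: "q \<in> carrier M \<times> carrier A" by auto
    have "nrm M (fst p \<otimes>\<^bsub>M\<^esub> fst q) * nrm A (snd p \<otimes>\<^bsub>A\<^esub> snd q)
        \<le> (C * nrm M (fst p) * nrm M (fst q)) * (C' * nrm A (snd p) * nrm A (snd q))"
      using p q C C' M.nrm_nonneg A.nrm_nonneg
      by (intro mult_mono) (auto simp: A.mult_closed intro!: mult_nonneg_nonneg)
    then show ?case using Cons by (auto simp: weight_def pair_mult_def split_beta algebra_simps)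
  qed (simp add: weight_def)
  show ?thesis
    using LN(1)
  proof (induction L)
    case (Cons p L)
    then show ?case using single[of p]
      by (auto simp: list_mult_Cons weight_append) (auto simp: weight_def algebra_simps)
  qed (simp add: list_mult_Nil weight_def)
qed

lemma seminormed_algebra_tensor: "seminormed_algebra T"
proof (intro seminormed_algebra.intro tensor_module seminormed_algebra_axioms.intro)
  fix U assume "U \<in> carrier T"
  then obtain L where L: "L \<in> Ls" "U = cl L" unfolding tensor_carrier by blast
  show "0 \<le> nrm T U" unfolding L(2) by (rule tensor_nrm_nonneg[OF L(1)])
next
  have le: "nrm T (c \<odot>\<^bsub>T\<^esub> U) \<le> cmod c * nrm T U" if "U \<in> carrier T" for c U
  proof -
    obtain L where L: "L \<in> Ls" "U = cl L" using \<open>U \<in> carrier T\<close> unfolding tensor_carrier by blast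
    show ?thesis
      unfolding tensor_nrm[of U]
    proof (rule le_mult_cINF)
      show "U \<noteq> {}" using L(2) cl_self[OF L(1)] by blast
      fix N assume "N \<in> U"
      then have N: "(L, N) \<in> R" using L by simp
      then show "nrm T (c \<odot>\<^bsub>T\<^esub> U) \<le> cmod c * weight M A N"
        using tensor_nrm_le_class[OF rel_smult[OF N, of c]] rel_lists[OF N] L
        by (simp add: tensor_smult weight_smult)
    qed simp
  qed
  interpret T: Module.module complex_ring T by (rule tensor_module)
  fix c U assume U: "U \<in> carrier T"
  then obtain L where L: "L \<in> Ls" "U = cl L" unfolding tensor_carrier by blast
  show "nrm T (c \<odot>\<^bsub>T\<^esub> U) = cmod c * nrm T U"
  proof (cases "c = 0")
    case True
    have "0 \<le> nrm T (c \<odot>\<^bsub>T\<^esub> U)"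
      unfolding L(2) tensor_smult[OF L(1)] by (rule tensor_nrm_nonneg[OF list_smult_closed[OF L(1)]])
    then show ?thesis using le[OF U, of c] True by simp
  next
    case False
    have cU: "c \<odot>\<^bsub>T\<^esub> U \<in> carrier T" using T.smult_closed[of c U] U by (simp add: complex_ring_def)
    have "inverse c \<odot>\<^bsub>T\<^esub> (c \<odot>\<^bsub>T\<^esub> U) = U"
      using T.smult_assoc1[of "inverse c" c U] T.smult_one[of U] U False by (simp add: complex_ring_def)
    then have "nrm T U \<le> cmod (inverse c) * nrm T (c \<odot>\<^bsub>T\<^esub> U)" using le[OF cU, of "inverse c"] by simp
    then have "cmod c * nrm T U \<le> cmod c * (cmod (inverse c) * nrm T (c \<odot>\<^bsub>T\<^esub> U))"
      by (rule mult_left_mono) simp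
    also have "\<dots> = nrm T (c \<odot>\<^bsub>T\<^esub> U)"
      using False by (simp add: norm_inverse)
    finally have "cmod c * nrm T U \<le> nrm T (c \<odot>\<^bsub>T\<^esub> U)" .
    then show ?thesis using le[OF U, of c] by simp
  qed
next
  fix U W assume "U \<in> carrier T" "W \<in> carrier T"
  then obtain L N where LN: "L \<in> Ls" "U = cl L" "N \<in> Ls" "W = cl N" unfolding tensor_carrier by blast
  have ne: "U \<noteq> {}" "W \<noteq> {}" using LN(2,4) cl_self[OF LN(1)] cl_self[OF LN(3)] by blast+
  show "U \<otimes>\<^bsub>T\<^esub> W \<in> carrier T"
    unfolding LN(2,4) tensor_mult[OF LN(1,3)] by (rule cl_closed[OF list_mult_closed[OF LN(1,3)]])
  have sum: "nrm T (U \<oplus>\<^bsub>T\<^esub> W) \<le> weight M A L' + weight M A N'" if "L' \<in> U" "N' \<in> W" for L' N'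
    using tensor_nrm_le_class[OF tensor_rel.append, of L L' N N'] that LN
    by (simp add: tensor_add weight_append)
  have "nrm T (U \<oplus>\<^bsub>T\<^esub> W) \<le> weight M A L' + nrm T W" if "L' \<in> U" for L'
    using le_add_cINF[OF ne(2), of "nrm T (U \<oplus>\<^bsub>T\<^esub> W)" "weight M A" "weight M A L'"] sum[OF that]
    by (simp add: tensor_nrm[of W] add.commute)
  then show "nrm T (U \<oplus>\<^bsub>T\<^esub> W) \<le> nrm T U + nrm T W"
    unfolding tensor_nrm[of U] by (rule le_add_cINF[OF ne(1)])
  fix c
  have "list_mult M A (list_smult M c L) N = list_smult M c (list_mult M A L N)"
    using LN(1,3) by (induction L) (auto simp: list_mult_Nil list_mult_Cons list_smult_def pair_mult_def split_beta M.smult_mult in_lists_conv_set)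
  then show "(c \<odot>\<^bsub>T\<^esub> U) \<otimes>\<^bsub>T\<^esub> W = c \<odot>\<^bsub>T\<^esub> (U \<otimes>\<^bsub>T\<^esub> W)"
    using LN by (simp add: tensor_mult tensor_smult list_smult_closed list_mult_closed)
  have "list_mult M A L (list_smult M c N) = list_smult M c (list_mult M A L N)"
    using LN(1,3) by (induction L) (auto simp: list_mult_Nil list_mult_Cons list_smult_def pair_mult_def split_beta M.mult_smult in_lists_conv_set)
  then show "U \<otimes>\<^bsub>T\<^esub> (c \<odot>\<^bsub>T\<^esub> W) = c \<odot>\<^bsub>T\<^esub> (U \<otimes>\<^bsub>T\<^esub> W)"
    using LN by (simp add: tensor_mult tensor_smult list_smult_closed list_mult_closed)
next
  fix U W X assume "U \<in> carrier T" "W \<in> carrier T" "X \<in> carrier T"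
  then obtain L N K where LN: "L \<in> Ls" "U = cl L" "N \<in> Ls" "W = cl N" "K \<in> Ls" "X = cl K"
    unfolding tensor_carrier by blast
  show "(U \<oplus>\<^bsub>T\<^esub> W) \<otimes>\<^bsub>T\<^esub> X = (U \<otimes>\<^bsub>T\<^esub> X) \<oplus>\<^bsub>T\<^esub> (W \<otimes>\<^bsub>T\<^esub> X)"
    using LN by (simp add: tensor_mult tensor_add list_mult_closed list_mult_append)
  have "cl (list_mult M A L (N @ K)) = cl (list_mult M A L N @ list_mult M A L K)"
    using LN by (intro cl_eq rel_perm mset_list_mult_append_right list_mult_closed) auto
  then show "U \<otimes>\<^bsub>T\<^esub> (W \<oplus>\<^bsub>T\<^esub> X) = (U \<otimes>\<^bsub>T\<^esub> W) \<oplus>\<^bsub>T\<^esub> (U \<otimes>\<^bsub>T\<^esub> X)"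
    using LN by (simp add: tensor_mult tensor_add list_mult_closed)
next
  obtain C where C: "0 \<le> C" "\<forall>x\<in>carrier M. \<forall>y\<in>carrier M. nrm M (x \<otimes>\<^bsub>M\<^esub> y) \<le> C * nrm M x * nrm M y"
    using M.nrm_mult_bound by blast
  obtain C' where C': "0 \<le> C'" "\<forall>x\<in>carrier A. \<forall>y\<in>carrier A. nrm A (x \<otimes>\<^bsub>A\<^esub> y) \<le> C' * nrm A x * nrm A y"
    using A.nrm_mult_bound by blast
  show "\<exists>C. \<forall>U\<in>carrier T. \<forall>W\<in>carrier T. nrm T (U \<otimes>\<^bsub>T\<^esub> W) \<le> C * nrm T U * nrm T W"
  proof (intro exI[of _ "C * C'"] ballI)
    fix U W assume "U \<in> carrier T" "W \<in> carrier T"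
    then obtain L N where LN: "L \<in> Ls" "U = cl L" "N \<in> Ls" "W = cl N" unfolding tensor_carrier by blast
    have ne: "U \<noteq> {}" "W \<noteq> {}" using LN(2,4) cl_self[OF LN(1)] cl_self[OF LN(3)] by blast+
    have "nrm T (U \<otimes>\<^bsub>T\<^esub> W) \<le> C * C' * weight M A L' * weight M A N'" if "L' \<in> U" "N' \<in> W" for L' N'
    proof -
      have rel: "(L, L') \<in> R" "(N, N') \<in> R" using that LN by auto
      have "nrm T (U \<otimes>\<^bsub>T\<^esub> W) \<le> weight M A (list_mult M A L' N')"
        using tensor_nrm_le_class[OF rel_list_mult[OF rel]] LN by (simp add: tensor_mult)
      also have "\<dots> \<le> C * C' * weight M A L' * weight M A N'"
        using rel_lists[OF rel(1)] rel_lists[OF rel(2)] by (intro weight_list_mult C C') auto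
      finally show ?thesis .
    qed
    note bound = this
    have "nrm T (U \<otimes>\<^bsub>T\<^esub> W) \<le> C * C' * weight M A L' * nrm T W" if "L' \<in> U" for L'
      unfolding tensor_nrm[of W]
    proof (rule le_mult_cINF[OF ne(2)])
      have "(L, L') \<in> R" using that LN(2) by simp
      then have "0 \<le> weight M A L'" by (intro weight_nonneg conjunct2[OF rel_lists])
      then show "0 \<le> C * C' * weight M A L'" using C(1) C'(1) by simp
    qed (rule bound[OF that])
    moreover have "0 \<le> nrm T W"
      unfolding LN(4) by (rule tensor_nrm_nonneg[OF LN(3)])
    ultimately have "nrm T (U \<otimes>\<^bsub>T\<^esub> W) \<le> (C * C' * nrm T W) * nrm T U"
      unfolding tensor_nrm[of U] using C(1) C'(1)
      by (intro le_mult_cINF[OF ne(1)]) (auto simp: algebra_simps)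
    then show "nrm T (U \<otimes>\<^bsub>T\<^esub> W) \<le> C * C' * nrm T U * nrm T W" by (simp add: algebra_simps)
  qed
qed

end


section \<open>The projective tensor product\<close>

definition elementary :: "'m normed_alg \<Rightarrow> 'a normed_alg \<Rightarrow> 'm \<Rightarrow> 'a \<Rightarrow> (nat \<Rightarrow> ('m \<times> 'a) list set) set" where
  "elementary M A m a = null_rel (algebraic_tensor M A) `` {\<lambda>_. tensor_rel M A `` {[(m, a)]}}"

context tensor_pair
begin

interpretation T: seminormed_algebra T by (rule seminormed_algebra_tensor)

abbreviation "B \<equiv> projective_tensor M A"
abbreviation "\<iota> U \<equiv> null_rel T `` {\<lambda>_. U}"

lemma single_closed: "m \<in> carrier M \<Longrightarrow> a \<in> carrier A \<Longrightarrow> [(m, a)] \<in> Ls"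
  by simp

lemma \<iota>_closed: "U \<in> carrier T \<Longrightarrow> \<iota> U \<in> carrier B"
  unfolding projective_tensor_def T.completion_carrier
  by (rule bexI[OF _ T.cauchy_const]) (rule HOL.refl)

lemma \<iota>_add: "U \<in> carrier T \<Longrightarrow> W \<in> carrier T \<Longrightarrow> \<iota> U \<oplus>\<^bsub>B\<^esub> \<iota> W = \<iota> (U \<oplus>\<^bsub>T\<^esub> W)"
  by (simp add: projective_tensor_def T.completion_add T.cauchy_const)

lemma \<iota>_smult: "U \<in> carrier T \<Longrightarrow> c \<odot>\<^bsub>B\<^esub> \<iota> U = \<iota> (c \<odot>\<^bsub>T\<^esub> U)"
  by (simp add: projective_tensor_def T.completion_smult T.cauchy_const)

lemma \<iota>_mult: "U \<in> carrier T \<Longrightarrow> W \<in> carrier T \<Longrightarrow> \<iota> U \<otimes>\<^bsub>B\<^esub> \<iota> W = \<iota> (U \<otimes>\<^bsub>T\<^esub> W)"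
  by (simp add: projective_tensor_def T.completion_mult T.cauchy_const)

lemma elementary_closed: "m \<in> carrier M \<Longrightarrow> a \<in> carrier A \<Longrightarrow> elementary M A m a \<in> carrier B"
  unfolding elementary_def by (intro \<iota>_closed cl_closed single_closed)

lemma elementary_add_left:
  assumes "m \<in> carrier M" "m' \<in> carrier M" "a \<in> carrier A"
  shows "elementary M A (m \<oplus>\<^bsub>M\<^esub> m') a = elementary M A m a \<oplus>\<^bsub>B\<^esub> elementary M A m' a"
  unfolding elementary_def using assms
  by (simp add: \<iota>_add cl_closed tensor_add cl_eq[OF tensor_rel.add_left])

lemma elementary_add_right:
  assumes "m \<in> carrier M" "a \<in> carrier A" "a' \<in> carrier A"
  shows "elementary M A m (a \<oplus>\<^bsub>A\<^esub> a') = elementary M A m a \<oplus>\<^bsub>B\<^esub> elementary M A m a'"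
  unfolding elementary_def using assms
  by (simp add: \<iota>_add cl_closed tensor_add cl_eq[OF tensor_rel.add_right])

lemma elementary_smult_left:
  assumes "m \<in> carrier M" "a \<in> carrier A"
  shows "elementary M A (c \<odot>\<^bsub>M\<^esub> m) a = c \<odot>\<^bsub>B\<^esub> elementary M A m a"
  unfolding elementary_def using assms
  by (simp add: \<iota>_smult cl_closed tensor_smult list_smult_def)

lemma elementary_smult_right:
  assumes "m \<in> carrier M" "a \<in> carrier A"
  shows "elementary M A m (c \<odot>\<^bsub>A\<^esub> a) = c \<odot>\<^bsub>B\<^esub> elementary M A m a"
  unfolding elementary_smult_left[OF assms, symmetric] unfolding elementary_def
  by (simp only: cl_eq[OF tensor_rel.smult[OF assms]])

lemma elementary_mult:
  assumes "m \<in> carrier M" "m' \<in> carrier M" "a \<in> carrier A" "a' \<in> carrier A"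
  shows "elementary M A m a \<otimes>\<^bsub>B\<^esub> elementary M A m' a' = elementary M A (m \<otimes>\<^bsub>M\<^esub> m') (a \<otimes>\<^bsub>A\<^esub> a')"
  unfolding elementary_def using assms
  by (simp add: \<iota>_mult cl_closed tensor_mult list_mult_def pair_mult_def)

lemma nrm_elementary_le:
  assumes "m \<in> carrier M" "a \<in> carrier A"
  shows "nrm B (elementary M A m a) \<le> nrm M m * nrm A a"
  using tensor_nrm_le[OF single_closed[OF assms]] T.completion_nrm_const[OF cl_closed[OF single_closed[OF assms]]]
  by (simp add: projective_tensor_def elementary_def weight_def)

text \<open>
  The elementary tensors span a dense subspace: sums of elementary tensors are the images of formal sums, and every
  element of the completion is the limit of the images of the terms of a Cauchy sequence that represents it.
\<close>

lemma bounded_linear_vanishes: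
  fixes E :: "'e normed_alg"
  assumes E: "complex_normed_space E"
    and D: "\<And>X. X \<in> carrier B \<Longrightarrow> D X \<in> carrier E"
      "\<And>X Y. X \<in> carrier B \<Longrightarrow> Y \<in> carrier B \<Longrightarrow> D (X \<oplus>\<^bsub>B\<^esub> Y) = D X \<oplus>\<^bsub>E\<^esub> D Y"
      "\<And>c X. X \<in> carrier B \<Longrightarrow> D (c \<odot>\<^bsub>B\<^esub> X) = c \<odot>\<^bsub>E\<^esub> D X"
      "\<And>X. X \<in> carrier B \<Longrightarrow> nrm E (D X) \<le> C * nrm B X"
    and elem: "\<And>m a. m \<in> carrier M \<Longrightarrow> a \<in> carrier A \<Longrightarrow> D (elementary M A m a) = \<zero>\<^bsub>E\<^esub>"
    and X: "X \<in> carrier B"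
  shows "D X = \<zero>\<^bsub>E\<^esub>"
proof -
  interpret E: complex_normed_space E by (rule E)
  have list: "D (\<iota> (cl L)) = \<zero>\<^bsub>E\<^esub>" if "L \<in> Ls" for L
    using that
  proof (induction L)
    case Nil
    have "0 \<odot>\<^bsub>B\<^esub> \<iota> (cl []) = \<iota> (cl [])"
      using \<iota>_smult[OF cl_closed[of "[]"], of 0] tensor_smult[of "[]" 0] by (simp add: list_smult_def)
    then show ?case
      using D(3)[OF \<iota>_closed[OF cl_closed[of "[]"]], of 0] D(1)[OF \<iota>_closed[OF cl_closed[of "[]"]]]
      by (simp add: E.smultc_zero)
  next
    case (Cons p L)
    obtain m a where pma: "p = (m, a)" by (cases p)
    have p: "p = (m, a)" "m \<in> carrier M" "a \<in> carrier A" "L \<in> Ls" using Cons(1,2) pma by auto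
    have "\<iota> (cl (p # L)) = elementary M A m a \<oplus>\<^bsub>B\<^esub> \<iota> (cl L)"
      using p by (simp add: elementary_def \<iota>_add cl_closed tensor_add)
    then show ?case
      using D(2)[OF elementary_closed[OF p(2,3)] \<iota>_closed[OF cl_closed[OF p(4)]]] elem[OF p(2,3)] Cons.IH
      by simp
  qed
  obtain s where s: "s \<in> cauchy_seqs T" "X = null_rel T `` {s}"
    using X unfolding projective_tensor_def T.completion_carrier by blast
  have "nrm E (D X) \<le> C * nrm B (X \<oplus>\<^bsub>B\<^esub> ((-1) \<odot>\<^bsub>B\<^esub> \<iota> (s n)))" for n
  proof -
    have sT: "s n \<in> carrier T" by (rule T.cauchy_carrier[OF s(1)])
    then obtain L where L: "L \<in> Ls" "s n = cl L" unfolding tensor_carrier by blast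
    have i: "\<iota> (s n) \<in> carrier B" by (rule \<iota>_closed[OF sT])
    have ci: "(-1) \<odot>\<^bsub>B\<^esub> \<iota> (s n) \<in> carrier B"
      unfolding \<iota>_smult[OF sT] by (rule \<iota>_closed[OF T.smultc_closed[OF sT]])
    have "D ((-1) \<odot>\<^bsub>B\<^esub> \<iota> (s n)) = \<zero>\<^bsub>E\<^esub>"
      using D(3)[OF i, of "-1"] list[OF L(1)] L(2) E.smultc_minus_one[of "\<zero>\<^bsub>E\<^esub>"] by simp
    then have "D (X \<oplus>\<^bsub>B\<^esub> ((-1) \<odot>\<^bsub>B\<^esub> \<iota> (s n))) = D X"
      using D(2)[OF X ci] D(1)[OF X] by simp
    moreover have "X \<oplus>\<^bsub>B\<^esub> ((-1) \<odot>\<^bsub>B\<^esub> \<iota> (s n)) \<in> carrier B"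
    proof -
      have "(\<lambda>k. s k \<oplus>\<^bsub>T\<^esub> (-1) \<odot>\<^bsub>T\<^esub> s n) \<in> cauchy_seqs T"
        by (intro T.cauchy_add s(1) T.cauchy_const T.smultc_closed sT)
      moreover have "X \<oplus>\<^bsub>B\<^esub> ((-1) \<odot>\<^bsub>B\<^esub> \<iota> (s n)) = null_rel T `` {\<lambda>k. s k \<oplus>\<^bsub>T\<^esub> (-1) \<odot>\<^bsub>T\<^esub> s n}"
        unfolding \<iota>_smult[OF sT] s(2) unfolding projective_tensor_def
        by (rule T.completion_add[OF s(1) T.cauchy_const[OF T.smultc_closed[OF sT]]])
      ultimately show ?thesis unfolding projective_tensor_def T.completion_carrier by blast
    qed
    ultimately show ?thesis using D(4) by metis
  qed
  moreover have "(\<lambda>n. C * nrm B (X \<oplus>\<^bsub>B\<^esub> ((-1) \<odot>\<^bsub>B\<^esub> \<iota> (s n)))) \<longlonglongrightarrow> 0"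
    using tendsto_mult_left[OF T.completion_dense[OF s(1)], of C] s(2) by (simp add: projective_tensor_def)
  ultimately have "nrm E (D X) \<le> 0"
    by (intro LIMSEQ_le_const[of _ 0 "nrm E (D X)"]) auto
  then show ?thesis
    using E.nrm_nonneg[OF D(1)[OF X]] E.nrm_eq_zero[OF D(1)[OF X]] by simp
qed

end

text \<open>
  The universal property that produces homomorphisms out of the tensor product.  Summing \<open>\<tau>\<close> over a formal sum
  respects the bilinearity relations, and since the bound \<open>K * weight\<close> holds for every representation of a tensor, it
  passes to the infimum that defines the projective norm.
\<close>

locale multiplicative_bilinear = tensor_pair M A + F: banach_algebra F
  for M :: "'m normed_alg" and A :: "'a normed_alg" and F :: "'f normed_alg" +
  fixes \<tau> :: "'m \<Rightarrow> 'a \<Rightarrow> 'f" and K :: real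
  assumes \<tau>_closed: "m \<in> carrier M \<Longrightarrow> a \<in> carrier A \<Longrightarrow> \<tau> m a \<in> carrier F"
    and \<tau>_add_left: "m \<in> carrier M \<Longrightarrow> m' \<in> carrier M \<Longrightarrow> a \<in> carrier A \<Longrightarrow>
      \<tau> (m \<oplus>\<^bsub>M\<^esub> m') a = \<tau> m a \<oplus>\<^bsub>F\<^esub> \<tau> m' a"
    and \<tau>_add_right: "m \<in> carrier M \<Longrightarrow> a \<in> carrier A \<Longrightarrow> a' \<in> carrier A \<Longrightarrow>
      \<tau> m (a \<oplus>\<^bsub>A\<^esub> a') = \<tau> m a \<oplus>\<^bsub>F\<^esub> \<tau> m a'"
    and \<tau>_smult_left: "m \<in> carrier M \<Longrightarrow> a \<in> carrier A \<Longrightarrow> \<tau> (c \<odot>\<^bsub>M\<^esub> m) a = c \<odot>\<^bsub>F\<^esub> \<tau> m a"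
    and \<tau>_smult_right: "m \<in> carrier M \<Longrightarrow> a \<in> carrier A \<Longrightarrow> \<tau> m (c \<odot>\<^bsub>A\<^esub> a) = c \<odot>\<^bsub>F\<^esub> \<tau> m a"
    and \<tau>_mult: "m \<in> carrier M \<Longrightarrow> m' \<in> carrier M \<Longrightarrow> a \<in> carrier A \<Longrightarrow> a' \<in> carrier A \<Longrightarrow>
      \<tau> (m \<otimes>\<^bsub>M\<^esub> m') (a \<otimes>\<^bsub>A\<^esub> a') = \<tau> m a \<otimes>\<^bsub>F\<^esub> \<tau> m' a'"
    and K_nonneg: "0 \<le> K"
    and \<tau>_bound: "m \<in> carrier M \<Longrightarrow> a \<in> carrier A \<Longrightarrow> nrm F (\<tau> m a) \<le> K * (nrm M m * nrm A a)"
begin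

interpretation T: seminormed_algebra T by (rule seminormed_algebra_tensor)
interpretation FS: seminormed_algebra F by (rule banach_algebra_seminormed) (rule F.banach_algebra_axioms)

fun \<tau>_sum :: "('m \<times> 'a) list \<Rightarrow> 'f" where
  "\<tau>_sum [] = \<zero>\<^bsub>F\<^esub>"
| "\<tau>_sum (p # L) = \<tau> (fst p) (snd p) \<oplus>\<^bsub>F\<^esub> \<tau>_sum L"

lemma \<tau>_sum_closed: "L \<in> Ls \<Longrightarrow> \<tau>_sum L \<in> carrier F"
  by (induction L) (auto simp: \<tau>_closed)

lemma \<tau>_sum_append: "L \<in> Ls \<Longrightarrow> N \<in> Ls \<Longrightarrow> \<tau>_sum (L @ N) = \<tau>_sum L \<oplus>\<^bsub>F\<^esub> \<tau>_sum N"
proof (induction L)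
  case (Cons p L)
  then have p: "\<tau> (fst p) (snd p) \<in> carrier F" "L \<in> Ls" using \<tau>_closed by auto
  then show ?case
    using Cons \<tau>_sum_closed[OF p(2)] \<tau>_sum_closed[OF Cons.prems(2)] by (simp add: F.a_assoc)
qed (simp add: \<tau>_sum_closed)

lemma \<tau>_sum_rel: "(L, N) \<in> R \<Longrightarrow> \<tau>_sum L = \<tau>_sum N"
proof (induction rule: tensor_rel.induct)
  case (append L L' N N')
  then show ?case using rel_lists[OF append(1)] rel_lists[OF append(2)] by (simp add: \<tau>_sum_append)
next
  case (commute L N)
  then show ?case by (simp add: \<tau>_sum_append \<tau>_sum_closed F.a_comm)
next
  case (add_left a a' b)
  then show ?case by (simp add: \<tau>_add_left \<tau>_closed F.a_assoc)
next
  case (add_right a b b')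
  then show ?case by (simp add: \<tau>_add_right \<tau>_closed F.a_assoc)
next
  case (smult a b c)
  then show ?case by (simp add: \<tau>_smult_left \<tau>_smult_right)
next
  case (zero b)
  have "\<tau> (0 \<odot>\<^bsub>M\<^esub> \<zero>\<^bsub>M\<^esub>) b = \<zero>\<^bsub>F\<^esub>"
    using zero by (simp only: \<tau>_smult_left M.zero_closed F.smultc_zero[OF \<tau>_closed])
  then show ?case using M.smultc_zero[of "\<zero>\<^bsub>M\<^esub>"] by simp
qed simp_all

lemma \<tau>_sum_smult: "L \<in> Ls \<Longrightarrow> \<tau>_sum (list_smult M c L) = c \<odot>\<^bsub>F\<^esub> \<tau>_sum L"
proof (induction L)
  case (Cons p L)
  then have p: "fst p \<in> carrier M" "snd p \<in> carrier A" "L \<in> Ls" by auto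
  then have "\<tau>_sum (list_smult M c L) = c \<odot>\<^bsub>F\<^esub> \<tau>_sum L" by (intro Cons.IH)
  then show ?case
    using \<tau>_sum_closed[OF p(3)] \<tau>_closed[OF p(1,2)] p
    by (simp add: list_smult_def split_beta \<tau>_smult_left F.smultc_add)
qed (simp add: list_smult_def FS.smultc_of_zero)

lemma \<tau>_sum_mult:
  assumes "L \<in> Ls" "N \<in> Ls"
  shows "\<tau>_sum (list_mult M A L N) = \<tau>_sum L \<otimes>\<^bsub>F\<^esub> \<tau>_sum N"
  using assms(1)
proof (induction L)
  case Nil
  then show ?case using assms(2) by (simp add: list_mult_Nil FS.zero_mult \<tau>_sum_closed)
next
  case (Cons p L)
  then have p: "p \<in> carrier M \<times> carrier A" "L \<in> Ls" by auto
  have "\<tau>_sum (map (pair_mult M A p) N) = \<tau> (fst p) (snd p) \<otimes>\<^bsub>F\<^esub> \<tau>_sum N"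
    using assms(2)
  proof (induction N)
    case Nil
    then show ?case using p by (auto simp: FS.mult_zero \<tau>_closed)
  next
    case (Cons q N)
    then have q: "fst q \<in> carrier M" "snd q \<in> carrier A" "N \<in> Ls" by auto
    have p': "fst p \<in> carrier M" "snd p \<in> carrier A" using p by auto
    show ?case
      using Cons.IH F.distrib_left[OF \<tau>_closed[OF p'] \<tau>_closed[OF q(1,2)] \<tau>_sum_closed[OF q(3)]]
      by (simp add: pair_mult_def \<tau>_mult p' q)
  qed
  then show ?case
    using Cons p assms(2) \<tau>_sum_closed[OF p(2)] \<tau>_sum_closed[OF assms(2)]
    unfolding list_mult_Cons
    by (subst \<tau>_sum_append[OF map_pair_mult_closed list_mult_closed])
      (auto simp: F.distrib_right \<tau>_closed)
qed

lemma \<tau>_sum_bound: "L \<in> Ls \<Longrightarrow> nrm F (\<tau>_sum L) \<le> K * weight M A L"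
proof (induction L)
  case Nil
  show ?case by (simp add: weight_def F.nrm_zero)
next
  case (Cons p L)
  then have p: "fst p \<in> carrier M" "snd p \<in> carrier A" "L \<in> Ls" by auto
  have "nrm F (\<tau>_sum (p # L)) \<le> nrm F (\<tau> (fst p) (snd p)) + nrm F (\<tau>_sum L)"
    using F.nrm_triangle[OF \<tau>_closed[OF p(1,2)] \<tau>_sum_closed[OF p(3)]] by simp
  also have "\<dots> \<le> K * (nrm M (fst p) * nrm A (snd p)) + K * weight M A L"
    using \<tau>_bound[OF p(1,2)] Cons.IH[OF p(3)] by simp
  finally show ?case by (simp add: weight_def split_beta distrib_left)
qed

definition \<tau>_lift :: "('m \<times> 'a) list set \<Rightarrow> 'f" where
  "\<tau>_lift U = \<tau>_sum (SOME L. L \<in> U)"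

lemma \<tau>_lift_cl: "L \<in> Ls \<Longrightarrow> \<tau>_lift (cl L) = \<tau>_sum L"
proof -
  assume L: "L \<in> Ls"
  have "(SOME N. N \<in> cl L) \<in> cl L" using cl_self[OF L] by (rule someI)
  then have "(L, SOME N. N \<in> cl L) \<in> R" by simp
  from \<tau>_sum_rel[OF this] show ?thesis by (simp add: \<tau>_lift_def)
qed

lemma bounded_hom_\<tau>_lift: "bounded_hom T F \<tau>_lift"
  unfolding bounded_hom_def
proof (intro conjI ballI allI exI[of _ K])
  fix U c assume "U \<in> carrier T"
  then obtain L where L: "L \<in> Ls" "U = cl L" unfolding tensor_carrier by blast
  show "\<tau>_lift U \<in> carrier F" unfolding L(2) \<tau>_lift_cl[OF L(1)] by (rule \<tau>_sum_closed[OF L(1)])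
  show "\<tau>_lift (c \<odot>\<^bsub>T\<^esub> U) = c \<odot>\<^bsub>F\<^esub> \<tau>_lift U"
    unfolding L(2) tensor_smult[OF L(1)] \<tau>_lift_cl[OF L(1)] \<tau>_lift_cl[OF list_smult_closed[OF L(1)]]
    by (rule \<tau>_sum_smult[OF L(1)])
  show "nrm F (\<tau>_lift U) \<le> K * nrm T U"
    unfolding tensor_nrm
  proof (rule le_mult_cINF[OF _ K_nonneg])
    show "U \<noteq> {}" using L(2) cl_self[OF L(1)] by blast
    fix N assume "N \<in> U"
    then have N: "(L, N) \<in> R" using L(2) by simp
    show "nrm F (\<tau>_lift U) \<le> K * weight M A N"
      unfolding L(2) \<tau>_lift_cl[OF L(1)] \<tau>_sum_rel[OF N]
      by (rule \<tau>_sum_bound[OF conjunct2[OF rel_lists[OF N]]])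
  qed
next
  fix U W assume "U \<in> carrier T" "W \<in> carrier T"
  then obtain L N where LN: "L \<in> Ls" "U = cl L" "N \<in> Ls" "W = cl N" unfolding tensor_carrier by blast
  show "\<tau>_lift (U \<oplus>\<^bsub>T\<^esub> W) = \<tau>_lift U \<oplus>\<^bsub>F\<^esub> \<tau>_lift W"
    unfolding LN(2,4) tensor_add[OF LN(1,3)] \<tau>_lift_cl[OF LN(1)] \<tau>_lift_cl[OF LN(3)] \<tau>_lift_cl[OF append_Ls[OF LN(1,3)]]
    by (rule \<tau>_sum_append[OF LN(1,3)])
  show "\<tau>_lift (U \<otimes>\<^bsub>T\<^esub> W) = \<tau>_lift U \<otimes>\<^bsub>F\<^esub> \<tau>_lift W"
    unfolding LN(2,4) tensor_mult[OF LN(1,3)] \<tau>_lift_cl[OF LN(1)] \<tau>_lift_cl[OF LN(3)] \<tau>_lift_cl[OF list_mult_closed[OF LN(1,3)]]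
    by (rule \<tau>_sum_mult[OF LN(1,3)])
qed

lemma extends_to_projective_tensor:
  "\<exists>\<theta>. bounded_hom (projective_tensor M A) F \<theta> \<and>
    (\<forall>m\<in>carrier M. \<forall>a\<in>carrier A. \<theta> (elementary M A m a) = \<tau> m a)"
proof (intro exI conjI ballI)
  show "bounded_hom (projective_tensor M A) F (completion_lift F \<tau>_lift)"
    unfolding projective_tensor_def
    by (rule bounded_hom_completion_lift[OF seminormed_algebra_tensor F.banach_algebra_axioms bounded_hom_\<tau>_lift])
  fix m a assume ma: "m \<in> carrier M" "a \<in> carrier A"
  show "completion_lift F \<tau>_lift (elementary M A m a) = \<tau> m a"
    unfolding elementary_def
      completion_lift_const[OF seminormed_algebra_tensor F.banach_algebra_axioms bounded_hom_\<tau>_lift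
        cl_closed[OF single_closed[OF ma]]]
      \<tau>_lift_cl[OF single_closed[OF ma]]
    using \<tau>_closed[OF ma] by simp
qed

end


section \<open>The algebra of absolutely summable functions\<close>

definition l1_algebra :: "('g::group_add \<Rightarrow> complex) normed_alg" where
  "l1_algebra =
     \<lparr>carrier = {f. (\<lambda>x. cmod (f x)) summable_on UNIV},
      monoid.mult = (\<lambda>f g x. \<Sum>\<^sub>\<infinity>u. f u * g (- u + x)),
      one = (\<lambda>x. if x = 0 then 1 else 0),
      ring.zero = (\<lambda>x. 0),
      add = (\<lambda>f g x. f x + g x),
      smult = (\<lambda>c f x. c * f x),
      nrm = (\<lambda>f. \<Sum>\<^sub>\<infinity>x. cmod (f x))\<rparr>"

lemma l1_simps:
  "f \<in> carrier l1_algebra \<longleftrightarrow> (\<lambda>x. cmod (f x)) summable_on UNIV"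
  "f \<otimes>\<^bsub>l1_algebra\<^esub> g = (\<lambda>x. \<Sum>\<^sub>\<infinity>u. f u * g (- u + x))"
  "\<zero>\<^bsub>l1_algebra\<^esub> = (\<lambda>x. 0)"
  "f \<oplus>\<^bsub>l1_algebra\<^esub> g = (\<lambda>x. f x + g x)"
  "c \<odot>\<^bsub>l1_algebra\<^esub> f = (\<lambda>x. c * f x)"
  "nrm l1_algebra f = (\<Sum>\<^sub>\<infinity>x. cmod (f x))"
  by (simp_all add: l1_algebra_def)

lemma l1_add_closed:
  assumes "f \<in> carrier l1_algebra" "g \<in> carrier l1_algebra"
  shows "(\<lambda>x. f x + g x) \<in> carrier l1_algebra"
proof -
  have "(\<lambda>x. cmod (f x) + cmod (g x)) summable_on UNIV"
    using assms by (intro summable_on_add) (simp_all add: l1_simps)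
  then have "(\<lambda>x. norm (cmod (f x) + cmod (g x))) summable_on UNIV" by simp
  then show ?thesis
    unfolding l1_simps
    by (rule Infinite_Sum.abs_summable_on_comparison_test) (simp add: norm_triangle_ineq)
qed

lemma l1_smult_closed: "f \<in> carrier l1_algebra \<Longrightarrow> (\<lambda>x. c * f x) \<in> carrier l1_algebra"
  by (simp add: l1_simps norm_mult summable_on_cmult_right)

lemma l1_summable: "f \<in> carrier l1_algebra \<Longrightarrow> f summable_on UNIV"
  unfolding l1_simps by (rule Infinite_Sum.abs_summable_summable)

lemma bij_translate: "bij_betw (\<lambda>x. - u + x) UNIV (UNIV :: 'g::group_add set)"
  by (rule bij_betwI[where g = "\<lambda>x. u + x"]) (auto simp: add.assoc[symmetric])

text \<open>
  Summing over \<open>x\<close> first gives \<open>cmod (f u)\<close> times the norm of \<open>g\<close>, which is summable in \<open>u\<close>.  Interchanging the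
  order of summation then yields the closure of the carrier under convolution, the bound and the associativity.
\<close>

lemma l1_mult_summable:
  fixes f g :: "'g::group_add \<Rightarrow> complex"
  assumes f: "f \<in> carrier l1_algebra" and g: "g \<in> carrier l1_algebra"
  shows "(\<lambda>p. cmod (f (fst p) * g (- fst p + snd p))) summable_on UNIV \<times> UNIV"
proof -
  have 1: "(\<lambda>x. cmod (g (- u + x))) summable_on UNIV" for u
    using g summable_on_reindex_bij_betw[OF bij_translate, of "\<lambda>x. cmod (g x)" u] by (simp add: l1_simps)
  have 2: "(\<Sum>\<^sub>\<infinity>x. cmod (g (- u + x))) = (\<Sum>\<^sub>\<infinity>x. cmod (g x))" for u
    by (rule infsum_reindex_bij_betw[OF bij_translate])
  show ?thesis
  proof (rule Infinite_Sum.abs_summable_on_Sigma_iff[THEN iffD2], intro conjI ballI)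
    show "(\<lambda>x. cmod (f (fst (u, x)) * g (- fst (u, x) + snd (u, x)))) summable_on UNIV" for u
      using 1[of u] by (simp add: norm_mult summable_on_cmult_right)
    show "(\<lambda>u. norm (\<Sum>\<^sub>\<infinity>x. cmod (f (fst (u, x)) * g (- fst (u, x) + snd (u, x))))) summable_on UNIV"
      using f by (simp add: norm_mult infsum_cmult_right' 2 l1_simps abs_mult summable_on_cmult_left infsum_nonneg)
  qed
qed

lemma l1_mult_summable_row:
  fixes f g :: "'g::group_add \<Rightarrow> complex"
  assumes "f \<in> carrier l1_algebra" "g \<in> carrier l1_algebra"
  shows "(\<lambda>u. cmod (f u * g (- u + x))) summable_on UNIV"
    and "(\<lambda>x. \<Sum>\<^sub>\<infinity>u. cmod (f u * g (- u + x))) summable_on UNIV"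
proof -
  have "(\<lambda>p. cmod (f (snd p) * g (- snd p + fst p))) summable_on UNIV \<times> UNIV"
    using l1_mult_summable[OF assms] summable_on_swap[of "\<lambda>p. cmod (f (fst p) * g (- fst p + snd p))" UNIV UNIV]
    by (simp add: case_prod_unfold)
  from Infinite_Sum.abs_summable_on_Sigma_iff[THEN iffD1, OF this]
  show "(\<lambda>u. cmod (f u * g (- u + x))) summable_on UNIV"
    and "(\<lambda>x. \<Sum>\<^sub>\<infinity>u. cmod (f u * g (- u + x))) summable_on UNIV"
    by (auto simp: infsum_nonneg)
qed

lemma l1_mult_bound:
  fixes f g :: "'g::group_add \<Rightarrow> complex"
  assumes f: "f \<in> carrier l1_algebra" and g: "g \<in> carrier l1_algebra"
  shows "f \<otimes>\<^bsub>l1_algebra\<^esub> g \<in> carrier l1_algebra"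
    and "nrm l1_algebra (f \<otimes>\<^bsub>l1_algebra\<^esub> g) \<le> nrm l1_algebra f * nrm l1_algebra g"
proof -
  let ?h = "\<lambda>x. \<Sum>\<^sub>\<infinity>u. f u * g (- u + x)" and ?H = "\<lambda>x. \<Sum>\<^sub>\<infinity>u. cmod (f u * g (- u + x))"
  note row = l1_mult_summable_row[OF f g]
  have le: "cmod (?h x) \<le> ?H x" for x by (rule norm_infsum_bound[OF row(1)])
  have "(\<lambda>x. norm (?H x)) summable_on UNIV" using row(2) by (simp add: infsum_nonneg)
  then have sum: "(\<lambda>x. cmod (?h x)) summable_on UNIV"
    by (rule Infinite_Sum.abs_summable_on_comparison_test) (use le in \<open>simp add: infsum_nonneg\<close>)
  then show "f \<otimes>\<^bsub>l1_algebra\<^esub> g \<in> carrier l1_algebra" by (simp add: l1_simps)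
  have "(\<Sum>\<^sub>\<infinity>x. cmod (?h x)) \<le> (\<Sum>\<^sub>\<infinity>x. ?H x)" by (rule infsum_mono[OF sum row(2) le])
  also have "\<dots> = (\<Sum>\<^sub>\<infinity>u. \<Sum>\<^sub>\<infinity>x. cmod (f u * g (- u + x)))"
    using l1_mult_summable[OF f g]
    by (intro infsum_swap_banach[symmetric]) (simp add: case_prod_unfold)
  also have "\<dots> = (\<Sum>\<^sub>\<infinity>u. cmod (f u)) * (\<Sum>\<^sub>\<infinity>x. cmod (g x))"
    by (simp add: norm_mult infsum_cmult_right' infsum_cmult_left'
        infsum_reindex_bij_betw[OF bij_translate, of "\<lambda>x. cmod (g x)"])
  finally show "nrm l1_algebra (f \<otimes>\<^bsub>l1_algebra\<^esub> g) \<le> nrm l1_algebra f * nrm l1_algebra g"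
    by (simp add: l1_simps)
qed

lemma cmod_le_l1_nrm: "f \<in> carrier l1_algebra \<Longrightarrow> cmod (f x) \<le> nrm l1_algebra f"
  using finite_sum_le_infsum[of "\<lambda>x. cmod (f x)" UNIV "{x}"] by (simp add: l1_simps)

lemma l1_mult_assoc:
  fixes f g k :: "'g::group_add \<Rightarrow> complex"
  assumes f: "f \<in> carrier l1_algebra" and g: "g \<in> carrier l1_algebra" and k: "k \<in> carrier l1_algebra"
  shows "(f \<otimes>\<^bsub>l1_algebra\<^esub> g) \<otimes>\<^bsub>l1_algebra\<^esub> k = f \<otimes>\<^bsub>l1_algebra\<^esub> (g \<otimes>\<^bsub>l1_algebra\<^esub> k)"
proof
  fix x
  have sum: "(\<lambda>(u, v). f u * g (- u + v) * k (- v + x)) summable_on UNIV \<times> UNIV"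
  proof (rule Infinite_Sum.abs_summable_summable)
    have "(\<lambda>p. norm (cmod (f (fst p) * g (- fst p + snd p)) * nrm l1_algebra k)) summable_on UNIV \<times> UNIV"
      using l1_mult_summable[OF f g] summable_on_cmult_left[of _ _ "\<bar>nrm l1_algebra k\<bar>"]
      by (simp add: abs_mult norm_mult)
    then show "(\<lambda>p. norm (case p of (u, v) \<Rightarrow> f u * g (- u + v) * k (- v + x))) summable_on UNIV \<times> UNIV"
    proof (rule Infinite_Sum.abs_summable_on_comparison_test)
      fix p :: "'g \<times> 'g"
      have "cmod (k (- snd p + x)) \<le> \<bar>nrm l1_algebra k\<bar>" using cmod_le_l1_nrm[OF k, of "- snd p + x"] by linarith
      then show "norm (case p of (u, v) \<Rightarrow> f u * g (- u + v) * k (- v + x))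
          \<le> norm (cmod (f (fst p) * g (- fst p + snd p)) * nrm l1_algebra k)"
        by (cases p) (auto simp: norm_mult abs_mult intro!: mult_left_mono)
    qed
  qed
  have "((f \<otimes>\<^bsub>l1_algebra\<^esub> g) \<otimes>\<^bsub>l1_algebra\<^esub> k) x = (\<Sum>\<^sub>\<infinity>v. \<Sum>\<^sub>\<infinity>u. f u * g (- u + v) * k (- v + x))"
    by (simp add: l1_simps infsum_cmult_left')
  also have "\<dots> = (\<Sum>\<^sub>\<infinity>u. \<Sum>\<^sub>\<infinity>v. f u * g (- u + v) * k (- v + x))"
    by (rule infsum_swap_banach[OF sum, symmetric])
  also have "\<dots> = (\<Sum>\<^sub>\<infinity>u. f u * (\<Sum>\<^sub>\<infinity>w. g w * k (- w + (- u + x))))"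
  proof (rule infsum_cong)
    fix u
    have "(\<Sum>\<^sub>\<infinity>v. f u * g (- u + v) * k (- v + x)) = f u * (\<Sum>\<^sub>\<infinity>v. g (- u + v) * k (- v + x))"
      by (simp add: mult.assoc infsum_cmult_right')
    also have "(\<Sum>\<^sub>\<infinity>v. g (- u + v) * k (- v + x)) = (\<Sum>\<^sub>\<infinity>v. g (- u + v) * k (- (- u + v) + (- u + x)))"
      by (simp add: minus_add add.assoc)
    also have "\<dots> = (\<Sum>\<^sub>\<infinity>w. g w * k (- w + (- u + x)))"
      by (rule infsum_reindex_bij_betw[OF bij_translate, of "\<lambda>w. g w * k (- w + (- u + x))"])
    finally show "(\<Sum>\<^sub>\<infinity>v. f u * g (- u + v) * k (- v + x)) = f u * (\<Sum>\<^sub>\<infinity>w. g w * k (- w + (- u + x)))" .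
  qed
  also have "\<dots> = (f \<otimes>\<^bsub>l1_algebra\<^esub> (g \<otimes>\<^bsub>l1_algebra\<^esub> k)) x" by (simp add: l1_simps)
  finally show "((f \<otimes>\<^bsub>l1_algebra\<^esub> g) \<otimes>\<^bsub>l1_algebra\<^esub> k) x = (f \<otimes>\<^bsub>l1_algebra\<^esub> (g \<otimes>\<^bsub>l1_algebra\<^esub> k)) x" .
qed

lemma l1_abelian_group: "abelian_group (l1_algebra :: ('g::group_add \<Rightarrow> complex) normed_alg)"
proof (rule abelian_groupI)
  fix f :: "'g \<Rightarrow> complex" assume "f \<in> carrier l1_algebra"
  then show "\<exists>g\<in>carrier l1_algebra. g \<oplus>\<^bsub>l1_algebra\<^esub> f = \<zero>\<^bsub>l1_algebra\<^esub>"
    using l1_smult_closed[of f "-1"] by (intro bexI[of _ "\<lambda>x. - 1 * f x"]) (auto simp: l1_simps)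
next
  fix f g :: "'g \<Rightarrow> complex" assume "f \<in> carrier l1_algebra" "g \<in> carrier l1_algebra"
  then show "f \<oplus>\<^bsub>l1_algebra\<^esub> g \<in> carrier l1_algebra" unfolding l1_simps(4) by (rule l1_add_closed)
qed (auto simp: l1_simps add_ac)

lemma l1_minus:
  assumes "f \<in> carrier l1_algebra" "g \<in> carrier l1_algebra"
  shows "f \<ominus>\<^bsub>l1_algebra\<^esub> g = (\<lambda>x. f x - g x)"
proof -
  interpret abelian_group l1_algebra by (rule l1_abelian_group)
  have "(\<lambda>x. - 1 * g x) \<in> carrier l1_algebra" by (rule l1_smult_closed[OF assms(2)])
  then have "\<ominus>\<^bsub>l1_algebra\<^esub> g = (\<lambda>x. - 1 * g x)"
    by (intro minus_equality) (auto simp: l1_simps assms)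
  then show ?thesis by (simp add: a_minus_def l1_simps)
qed

lemma l1_normed_space: "complex_normed_space (l1_algebra :: ('g::group_add \<Rightarrow> complex) normed_alg)"
proof (intro complex_normed_space.intro complex_normed_space_axioms.intro)
  show "Module.module complex_ring (l1_algebra :: ('g \<Rightarrow> complex) normed_alg)"
    by (rule Module.moduleI[OF cring_complex_ring l1_abelian_group])
      (auto simp: l1_simps complex_ring_def norm_mult summable_on_cmult_right algebra_simps)
next
  fix f :: "'g \<Rightarrow> complex" assume f: "f \<in> carrier l1_algebra"
  show "0 \<le> nrm l1_algebra f" by (simp add: l1_simps infsum_nonneg)
  show "nrm l1_algebra f = 0 \<longleftrightarrow> f = \<zero>\<^bsub>l1_algebra\<^esub>"
    using cmod_le_l1_nrm[OF f] by (auto simp: l1_simps)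
  show "nrm l1_algebra (c \<odot>\<^bsub>l1_algebra\<^esub> f) = cmod c * nrm l1_algebra f" for c
    by (simp add: l1_simps norm_mult infsum_cmult_right')
next
  fix f g :: "'g \<Rightarrow> complex" assume fg: "f \<in> carrier l1_algebra" "g \<in> carrier l1_algebra"
  have "(\<Sum>\<^sub>\<infinity>x. cmod (f x + g x)) \<le> (\<Sum>\<^sub>\<infinity>x. cmod (f x) + cmod (g x))"
    using fg l1_add_closed[OF fg] by (intro infsum_mono summable_on_add norm_triangle_ineq) (simp_all add: l1_simps)
  also have "\<dots> = (\<Sum>\<^sub>\<infinity>x. cmod (f x)) + (\<Sum>\<^sub>\<infinity>x. cmod (g x))"
    using fg by (intro infsum_add) (simp_all add: l1_simps)
  finally show "nrm l1_algebra (f \<oplus>\<^bsub>l1_algebra\<^esub> g) \<le> nrm l1_algebra f + nrm l1_algebra g"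
    by (simp add: l1_simps)
qed

lemma l1_complete:
  fixes s :: "nat \<Rightarrow> 'g::group_add \<Rightarrow> complex"
  assumes s: "s \<in> cauchy_seqs l1_algebra"
  shows "\<exists>f\<in>carrier l1_algebra. (\<lambda>n. nrm l1_algebra (s n \<ominus>\<^bsub>l1_algebra\<^esub> f)) \<longlonglongrightarrow> 0"
proof -
  have sc: "s n \<in> carrier l1_algebra" for n using s by (simp add: cauchy_seqs_def)
  have dc: "(\<lambda>x. s m x - s n x) \<in> carrier l1_algebra" for m n
    using l1_add_closed[OF sc[of m] l1_smult_closed[OF sc[of n], of "-1"]] by simp
  have C: "\<exists>N. \<forall>m\<ge>N. \<forall>n\<ge>N. (\<Sum>\<^sub>\<infinity>x. cmod (s m x - s n x)) < e" if "0 < e" for e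
    using s that by (simp add: cauchy_seqs_def l1_minus sc l1_simps(6))
  have "\<exists>y. (\<lambda>n. s n x) \<longlonglongrightarrow> y" for x
  proof -
    have "Cauchy (\<lambda>n. s n x)"
    proof (rule CauchyI)
      fix e :: real assume "0 < e"
      then obtain N where N: "\<forall>m\<ge>N. \<forall>n\<ge>N. (\<Sum>\<^sub>\<infinity>x. cmod (s m x - s n x)) < e" using C by blast
      have "norm (s m x - s n x) < e" if "m \<ge> N" "n \<ge> N" for m n
        using cmod_le_l1_nrm[OF dc[of m n], of x] N[rule_format, OF that] by (simp add: l1_simps)
      then show "\<exists>M. \<forall>m\<ge>M. \<forall>n\<ge>M. norm (s m x - s n x) < e" by blast
    qed
    then show ?thesis using Cauchy_convergent convergent_def by blast
  qed
  then have "\<forall>x. \<exists>y. (\<lambda>n. s n x) \<longlonglongrightarrow> y" ..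
  from choice[OF this] obtain f where f: "\<forall>x. (\<lambda>n. s n x) \<longlonglongrightarrow> f x" ..
  have tail: "\<exists>N. \<forall>n\<ge>N. (\<forall>F. finite F \<longrightarrow> (\<Sum>x\<in>F. cmod (s n x - f x)) \<le> e)" if e: "0 < e" for e
  proof -
    obtain N where N: "\<forall>m\<ge>N. \<forall>n\<ge>N. (\<Sum>\<^sub>\<infinity>x. cmod (s m x - s n x)) < e" using C[OF e] by blast
    have "(\<Sum>x\<in>F. cmod (s n x - f x)) \<le> e" if n: "n \<ge> N" and F: "finite F" for n F
    proof (rule LIMSEQ_le_const2)
      show "(\<lambda>m. \<Sum>x\<in>F. cmod (s n x - s m x)) \<longlonglongrightarrow> (\<Sum>x\<in>F. cmod (s n x - f x))"
        using f by (intro tendsto_intros) auto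
      have "(\<Sum>x\<in>F. cmod (s n x - s m x)) \<le> e" if "m \<ge> N" for m
        using finite_sum_le_infsum[of "\<lambda>x. cmod (s n x - s m x)" UNIV F] dc[of n m] F
          N[rule_format, OF n that] by (simp add: l1_simps)
      then show "\<exists>N. \<forall>m\<ge>N. (\<Sum>x\<in>F. cmod (s n x - s m x)) \<le> e" by blast
    qed
    then show ?thesis by blast
  qed
  have diff: "(\<lambda>x. s n x - f x) \<in> carrier l1_algebra"
    if "\<forall>F. finite F \<longrightarrow> (\<Sum>x\<in>F. cmod (s n x - f x)) \<le> e" for n e
    unfolding l1_simps by (rule nonneg_bdd_above_summable_on) (use that in \<open>auto intro!: bdd_aboveI2\<close>)
  obtain N where N: "\<forall>F. finite F \<longrightarrow> (\<Sum>x\<in>F. cmod (s N x - f x)) \<le> 1" using tail[of 1] by auto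
  have fc: "f \<in> carrier l1_algebra"
    using l1_add_closed[OF sc[of N] l1_smult_closed[OF diff[OF N], of "-1"]] by simp
  have "(\<lambda>n. nrm l1_algebra (s n \<ominus>\<^bsub>l1_algebra\<^esub> f)) \<longlonglongrightarrow> 0"
  proof (rule LIMSEQ_I)
    fix e :: real assume "0 < e"
    then obtain N where N: "\<forall>n\<ge>N. \<forall>F. finite F \<longrightarrow> (\<Sum>x\<in>F. cmod (s n x - f x)) \<le> e/2"
      using tail[of "e/2"] by auto
    have "norm (nrm l1_algebra (s n \<ominus>\<^bsub>l1_algebra\<^esub> f) - 0) < e" if n: "n \<ge> N" for n
    proof -
      have Fn: "\<forall>F. finite F \<longrightarrow> (\<Sum>x\<in>F. cmod (s n x - f x)) \<le> e/2" using N n by blast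
      have "(\<Sum>\<^sub>\<infinity>x. cmod (s n x - f x)) \<le> e/2"
        using diff[OF Fn] Fn by (intro infsum_le_finite_sums) (simp_all add: l1_simps)
      moreover have "0 \<le> (\<Sum>\<^sub>\<infinity>x. cmod (s n x - f x))" by (simp add: infsum_nonneg)
      ultimately show ?thesis using \<open>0 < e\<close> by (simp add: l1_minus[OF sc fc] l1_simps(6))
    qed
    then show "\<exists>N. \<forall>n\<ge>N. norm (nrm l1_algebra (s n \<ominus>\<^bsub>l1_algebra\<^esub> f) - 0) < e" by blast
  qed
  with fc show ?thesis by blast
qed

lemma banach_algebra_l1: "banach_algebra (l1_algebra :: ('g::group_add \<Rightarrow> complex) normed_alg)"
proof (intro banach_algebra.intro banach_algebra_axioms.intro complex_banach_space.intro
    complex_banach_space_axioms.intro l1_normed_space l1_complete)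
  fix f g k :: "'g \<Rightarrow> complex"
  assume c: "f \<in> carrier l1_algebra" "g \<in> carrier l1_algebra" "k \<in> carrier l1_algebra"
  note s = Infinite_Sum.abs_summable_summable[OF l1_mult_summable_row(1)]
  show "(f \<otimes>\<^bsub>l1_algebra\<^esub> g) \<otimes>\<^bsub>l1_algebra\<^esub> k = f \<otimes>\<^bsub>l1_algebra\<^esub> (g \<otimes>\<^bsub>l1_algebra\<^esub> k)"
    by (rule l1_mult_assoc[OF c])
  show "(f \<oplus>\<^bsub>l1_algebra\<^esub> g) \<otimes>\<^bsub>l1_algebra\<^esub> k =
      f \<otimes>\<^bsub>l1_algebra\<^esub> k \<oplus>\<^bsub>l1_algebra\<^esub> g \<otimes>\<^bsub>l1_algebra\<^esub> k"
    using infsum_add[OF s[OF c(1,3)] s[OF c(2,3)]] by (simp add: l1_simps distrib_right)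
  show "f \<otimes>\<^bsub>l1_algebra\<^esub> (g \<oplus>\<^bsub>l1_algebra\<^esub> k) =
      f \<otimes>\<^bsub>l1_algebra\<^esub> g \<oplus>\<^bsub>l1_algebra\<^esub> f \<otimes>\<^bsub>l1_algebra\<^esub> k"
    using infsum_add[OF s[OF c(1,2)] s[OF c(1,3)]] by (simp add: l1_simps distrib_left)
next
  fix f g :: "'g \<Rightarrow> complex" and c
  assume fg: "f \<in> carrier l1_algebra" "g \<in> carrier l1_algebra"
  show "f \<otimes>\<^bsub>l1_algebra\<^esub> g \<in> carrier l1_algebra" by (rule l1_mult_bound(1)[OF fg])
  show "nrm l1_algebra (f \<otimes>\<^bsub>l1_algebra\<^esub> g) \<le> nrm l1_algebra f * nrm l1_algebra g"
    by (rule l1_mult_bound(2)[OF fg])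
  show "(c \<odot>\<^bsub>l1_algebra\<^esub> f) \<otimes>\<^bsub>l1_algebra\<^esub> g = c \<odot>\<^bsub>l1_algebra\<^esub> (f \<otimes>\<^bsub>l1_algebra\<^esub> g)"
    by (simp add: l1_simps mult.assoc infsum_cmult_right')
  show "f \<otimes>\<^bsub>l1_algebra\<^esub> (c \<odot>\<^bsub>l1_algebra\<^esub> g) = c \<odot>\<^bsub>l1_algebra\<^esub> (f \<otimes>\<^bsub>l1_algebra\<^esub> g)"
    by (simp add: l1_simps mult.left_commute infsum_cmult_right')
qed

definition l1_delta :: "'g \<Rightarrow> 'g \<Rightarrow> complex" where
  "l1_delta g x = (if x = g then 1 else 0)"

lemma l1_delta_has_sum: "(\<lambda>x. l1_delta g x * c x) summable_on UNIV" "(\<Sum>\<^sub>\<infinity>x. l1_delta g x * c x) = c g"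
proof -
  have "((\<lambda>x. l1_delta g x * c x) has_sum (\<Sum>x\<in>{g}. l1_delta g x * c x)) UNIV"
    by (rule has_sum_finite_neutralI[of "{g}"]) (auto simp: l1_delta_def)
  then show "(\<lambda>x. l1_delta g x * c x) summable_on UNIV" "(\<Sum>\<^sub>\<infinity>x. l1_delta g x * c x) = c g"
    by (auto simp: l1_delta_def summable_on_def infsumI)
qed

lemma l1_delta_closed: "l1_delta g \<in> carrier l1_algebra"
proof -
  have "((\<lambda>x. cmod (l1_delta g x)) has_sum (\<Sum>x\<in>{g}. cmod (l1_delta g x))) UNIV"
    by (rule has_sum_finite_neutralI[of "{g}"]) (auto simp: l1_delta_def)
  then show ?thesis unfolding l1_simps summable_on_def by blast
qed

lemma l1_delta_mult: "l1_delta g \<otimes>\<^bsub>l1_algebra\<^esub> f = (\<lambda>x. f (- g + x))"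
  by (simp add: l1_simps l1_delta_has_sum)

lemma infsum_l1_mult:
  fixes f g :: "'g::group_add \<Rightarrow> complex"
  assumes f: "f \<in> carrier l1_algebra" and g: "g \<in> carrier l1_algebra"
  shows "(\<Sum>\<^sub>\<infinity>x. (f \<otimes>\<^bsub>l1_algebra\<^esub> g) x) = (\<Sum>\<^sub>\<infinity>x. f x) * (\<Sum>\<^sub>\<infinity>x. g x)"
proof -
  have "(\<lambda>(u, x). f u * g (- u + x)) summable_on UNIV \<times> UNIV"
    using Infinite_Sum.abs_summable_summable[OF l1_mult_summable[OF f g]] by (simp add: case_prod_unfold)
  from infsum_swap_banach[OF this]
  have "(\<Sum>\<^sub>\<infinity>x. (f \<otimes>\<^bsub>l1_algebra\<^esub> g) x) = (\<Sum>\<^sub>\<infinity>u. \<Sum>\<^sub>\<infinity>x. f u * g (- u + x))" by (simp add: l1_simps)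
  then show ?thesis
    by (simp add: infsum_cmult_right' infsum_cmult_left' infsum_reindex_bij_betw[OF bij_translate, of g])
qed

lemma cmod_infsum_le: "f \<in> carrier l1_algebra \<Longrightarrow> cmod (\<Sum>\<^sub>\<infinity>x. f x) \<le> nrm l1_algebra f"
  unfolding l1_simps by (rule norm_infsum_bound)

subsection \<open>A derivation that is not inner on an infinite group\<close>

text \<open>
  The augmentation \<open>\<epsilon> f = (\<Sum>\<^sub>\<infinity>x. f x)\<close> is a character.  The algebra acts on itself by convolution from the left
  and through \<open>\<epsilon>\<close> from the right.
\<close>

lemma l1_bimodule:
  "banach_bimodule l1_algebra (l1_algebra :: ('g::group_add \<Rightarrow> complex) normed_alg)
    (\<lambda>f k. f \<otimes>\<^bsub>l1_algebra\<^esub> k) (\<lambda>k f. (\<Sum>\<^sub>\<infinity>x. f x) \<odot>\<^bsub>l1_algebra\<^esub> k)"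
proof -
  interpret L: banach_algebra "l1_algebra :: ('g \<Rightarrow> complex) normed_alg" by (rule banach_algebra_l1)
  show ?thesis
  proof (intro banach_bimodule.intro banach_bimodule_axioms.intro L.complex_banach_space_axioms)
    show "\<exists>C. \<forall>f\<in>carrier l1_algebra. \<forall>k\<in>carrier (l1_algebra :: ('g \<Rightarrow> complex) normed_alg).
      nrm l1_algebra (f \<otimes>\<^bsub>l1_algebra\<^esub> k) \<le> C * nrm l1_algebra f * nrm l1_algebra k \<and>
      nrm l1_algebra ((\<Sum>\<^sub>\<infinity>x. f x) \<odot>\<^bsub>l1_algebra\<^esub> k) \<le> C * nrm l1_algebra f * nrm l1_algebra k"
      by (intro exI[of _ 1])
        (simp add: L.nrm_mult L.nrm_smult cmod_infsum_le mult_right_mono L.nrm_nonneg)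
  next
    fix f g k :: "'g \<Rightarrow> complex"
    assume c: "f \<in> carrier l1_algebra" "g \<in> carrier l1_algebra" "k \<in> carrier l1_algebra"
    show "(\<Sum>\<^sub>\<infinity>x. (f \<oplus>\<^bsub>l1_algebra\<^esub> g) x) \<odot>\<^bsub>l1_algebra\<^esub> k =
        (\<Sum>\<^sub>\<infinity>x. f x) \<odot>\<^bsub>l1_algebra\<^esub> k \<oplus>\<^bsub>l1_algebra\<^esub> (\<Sum>\<^sub>\<infinity>x. g x) \<odot>\<^bsub>l1_algebra\<^esub> k"
      using infsum_add[OF l1_summable[OF c(1)] l1_summable[OF c(2)]] by (simp add: l1_simps distrib_right)
    show "(\<Sum>\<^sub>\<infinity>x. (f \<otimes>\<^bsub>l1_algebra\<^esub> g) x) \<odot>\<^bsub>l1_algebra\<^esub> k =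
        (\<Sum>\<^sub>\<infinity>x. g x) \<odot>\<^bsub>l1_algebra\<^esub> ((\<Sum>\<^sub>\<infinity>x. f x) \<odot>\<^bsub>l1_algebra\<^esub> k)"
      unfolding infsum_l1_mult[OF c(1,2)] by (simp add: l1_simps(5) mult_ac)
    show "(\<Sum>\<^sub>\<infinity>x. g x) \<odot>\<^bsub>l1_algebra\<^esub> (f \<otimes>\<^bsub>l1_algebra\<^esub> k) =
        f \<otimes>\<^bsub>l1_algebra\<^esub> ((\<Sum>\<^sub>\<infinity>x. g x) \<odot>\<^bsub>l1_algebra\<^esub> k)"
      by (simp add: L.mult_smult c)
  next
    fix f k :: "'g \<Rightarrow> complex" and c
    show "(\<Sum>\<^sub>\<infinity>x. (c \<odot>\<^bsub>l1_algebra\<^esub> f) x) \<odot>\<^bsub>l1_algebra\<^esub> k =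
        c \<odot>\<^bsub>l1_algebra\<^esub> ((\<Sum>\<^sub>\<infinity>x. f x) \<odot>\<^bsub>l1_algebra\<^esub> k)"
      by (simp add: l1_simps(5) infsum_cmult_right' mult.assoc)
    show "(\<Sum>\<^sub>\<infinity>x. f x) \<odot>\<^bsub>l1_algebra\<^esub> (c \<odot>\<^bsub>l1_algebra\<^esub> k) =
        c \<odot>\<^bsub>l1_algebra\<^esub> ((\<Sum>\<^sub>\<infinity>x. f x) \<odot>\<^bsub>l1_algebra\<^esub> k)"
      by (simp add: l1_simps(5) mult.left_commute)
  qed (simp_all add: L.mult_closed L.smultc_closed L.distrib_left L.distrib_right L.smultc_add
      L.mult_smult L.smult_mult L.mult_assoc)
qed

text \<open>
  The inner derivation that comes from \<open>- \<delta>\<^sub>0\<close>.  Its values have sum 0, and it need not be inner as a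
  derivation into the submodule of the functions with sum 0.
\<close>

lemma l1_derivation:
  "bounded_derivation l1_algebra (l1_algebra :: ('g::group_add \<Rightarrow> complex) normed_alg)
    (\<lambda>f k. f \<otimes>\<^bsub>l1_algebra\<^esub> k) (\<lambda>k f. (\<Sum>\<^sub>\<infinity>x. f x) \<odot>\<^bsub>l1_algebra\<^esub> k)
    (\<lambda>f x. f x - (\<Sum>\<^sub>\<infinity>x. f x) * l1_delta 0 x)"
proof -
  interpret L: banach_algebra "l1_algebra :: ('g \<Rightarrow> complex) normed_alg" by (rule banach_algebra_l1)
  have D: "(\<lambda>x. f x - (\<Sum>\<^sub>\<infinity>x. f x) * l1_delta 0 x) =
      f \<oplus>\<^bsub>l1_algebra\<^esub> (- (\<Sum>\<^sub>\<infinity>x. f x)) \<odot>\<^bsub>l1_algebra\<^esub> l1_delta 0" for f :: "'g \<Rightarrow> complex"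
    by (simp add: l1_simps)
  have \<delta>: "c \<odot>\<^bsub>l1_algebra\<^esub> l1_delta (0 :: 'g) \<in> carrier l1_algebra" for c
    by (rule L.smultc_closed[OF l1_delta_closed])
  have mult_\<delta>: "f \<otimes>\<^bsub>l1_algebra\<^esub> l1_delta 0 = f" for f :: "'g \<Rightarrow> complex"
  proof
    fix x
    have "(\<Sum>\<^sub>\<infinity>u. f u * l1_delta 0 (- u + x)) = (\<Sum>\<^sub>\<infinity>u. l1_delta x u * f u)"
    proof (rule infsum_cong)
      fix u
      have "- u + x = 0 \<longleftrightarrow> u = x" by (metis add.right_inverse add_left_imp_eq add.left_inverse)
      then show "f u * l1_delta 0 (- u + x) = l1_delta x u * f u" by (simp add: l1_delta_def)
    qed
    then show "(f \<otimes>\<^bsub>l1_algebra\<^esub> l1_delta 0) x = f x" by (simp add: l1_simps l1_delta_has_sum)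
  qed
  show ?thesis
    unfolding bounded_derivation_def
  proof (intro conjI ballI allI)
    fix f g :: "'g \<Rightarrow> complex" assume fg: "f \<in> carrier l1_algebra" "g \<in> carrier l1_algebra"
    show "(\<lambda>x. f x - (\<Sum>\<^sub>\<infinity>x. f x) * l1_delta 0 x) \<in> carrier l1_algebra"
      unfolding D by (rule L.a_closed[OF fg(1) \<delta>])
    show "(\<lambda>x. (f \<oplus>\<^bsub>l1_algebra\<^esub> g) x - (\<Sum>\<^sub>\<infinity>x. (f \<oplus>\<^bsub>l1_algebra\<^esub> g) x) * l1_delta 0 x) =
        (\<lambda>x. f x - (\<Sum>\<^sub>\<infinity>x. f x) * l1_delta 0 x) \<oplus>\<^bsub>l1_algebra\<^esub> (\<lambda>x. g x - (\<Sum>\<^sub>\<infinity>x. g x) * l1_delta 0 x)"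
      using infsum_add[OF l1_summable[OF fg(1)] l1_summable[OF fg(2)]]
      by (simp add: l1_simps algebra_simps)
    have "f \<otimes>\<^bsub>l1_algebra\<^esub> (\<lambda>x. g x - (\<Sum>\<^sub>\<infinity>x. g x) * l1_delta 0 x) =
        (\<lambda>x. (f \<otimes>\<^bsub>l1_algebra\<^esub> g) x - (\<Sum>\<^sub>\<infinity>x. g x) * f x)"
      unfolding D L.distrib_left[OF fg \<delta>] L.mult_smult[OF fg(1) l1_delta_closed] mult_\<delta>
      by (simp add: l1_simps)
    then show "(\<lambda>x. (f \<otimes>\<^bsub>l1_algebra\<^esub> g) x - (\<Sum>\<^sub>\<infinity>x. (f \<otimes>\<^bsub>l1_algebra\<^esub> g) x) * l1_delta 0 x) =
        (\<Sum>\<^sub>\<infinity>x. g x) \<odot>\<^bsub>l1_algebra\<^esub> (\<lambda>x. f x - (\<Sum>\<^sub>\<infinity>x. f x) * l1_delta 0 x) \<oplus>\<^bsub>l1_algebra\<^esub>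
        f \<otimes>\<^bsub>l1_algebra\<^esub> (\<lambda>x. g x - (\<Sum>\<^sub>\<infinity>x. g x) * l1_delta 0 x)"
      unfolding infsum_l1_mult[OF fg] by (simp add: l1_simps(4,5) fun_eq_iff algebra_simps)
  next
    fix c and f :: "'g \<Rightarrow> complex"
    show "(\<lambda>x. (c \<odot>\<^bsub>l1_algebra\<^esub> f) x - (\<Sum>\<^sub>\<infinity>x. (c \<odot>\<^bsub>l1_algebra\<^esub> f) x) * l1_delta 0 x) =
        c \<odot>\<^bsub>l1_algebra\<^esub> (\<lambda>x. f x - (\<Sum>\<^sub>\<infinity>x. f x) * l1_delta 0 x)"
      by (simp add: l1_simps infsum_cmult_right' algebra_simps)
  next
    show "\<exists>C. \<forall>f\<in>carrier l1_algebra. nrm l1_algebra (\<lambda>x. f x - (\<Sum>\<^sub>\<infinity>x. f x) * l1_delta (0 :: 'g) x) \<le> C * nrm l1_algebra f"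
    proof (intro exI[of _ "1 + nrm l1_algebra (l1_delta (0 :: 'g))"] ballI)
      fix f :: "'g \<Rightarrow> complex" assume f: "f \<in> carrier l1_algebra"
      have "nrm l1_algebra (\<lambda>x. f x - (\<Sum>\<^sub>\<infinity>x. f x) * l1_delta 0 x) \<le>
          nrm l1_algebra f + cmod (\<Sum>\<^sub>\<infinity>x. f x) * nrm l1_algebra (l1_delta (0 :: 'g))"
        unfolding D using L.nrm_triangle[OF f \<delta>[of "- (\<Sum>\<^sub>\<infinity>x. f x)"]] by (simp add: L.nrm_smult l1_delta_closed)
      also have "\<dots> \<le> nrm l1_algebra f + nrm l1_algebra f * nrm l1_algebra (l1_delta (0 :: 'g))"
        by (intro add_left_mono mult_right_mono cmod_infsum_le f L.nrm_nonneg l1_delta_closed)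
      finally show "nrm l1_algebra (\<lambda>x. f x - (\<Sum>\<^sub>\<infinity>x. f x) * l1_delta 0 x) \<le>
          (1 + nrm l1_algebra (l1_delta (0 :: 'g))) * nrm l1_algebra f" by (simp add: algebra_simps)
    qed
  qed
qed

lemma infsum_l1_delta: "(\<Sum>\<^sub>\<infinity>x. l1_delta g x) = 1"
  using l1_delta_has_sum(2)[of g "\<lambda>_. 1"] by simp

lemma constant_l1_finite:
  assumes "(\<lambda>x :: 'g. cmod c) summable_on UNIV" "c \<noteq> 0"
  shows "finite (UNIV :: 'g set)"
proof (rule ccontr)
  assume inf: "infinite (UNIV :: 'g set)"
  let ?S = "\<Sum>\<^sub>\<infinity>x :: 'g. cmod c"
  obtain n :: nat where n: "?S < real n * cmod c"
    using reals_Archimedean3[of "cmod c"] assms(2) by auto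
  obtain F :: "'g set" where F: "finite F" "card F = n"
    using infinite_arbitrarily_large[OF inf] by blast
  have "(\<Sum>x\<in>F. cmod c) \<le> ?S" using assms(1) F(1) by (intro finite_sum_le_infsum) auto
  then show False using n F by simp
qed

text \<open>
  Consider the derivation \<open>f \<mapsto> f - \<epsilon> f \<cdot> \<delta>\<^sub>0\<close> into the functions with sum 0.  If it is implemented by \<open>z\<close> with
  sum 0, then \<open>w = z + \<delta>\<^sub>0\<close> is invariant under translations, hence constant, and its sum is 1.  A non-zero
  constant is summable on a finite group only.
\<close>

lemma finite_group_if_l1_quotient:
  fixes \<theta> :: "'b \<Rightarrow> 'g::group_add \<Rightarrow> complex" and \<kappa> :: "('g \<Rightarrow> complex) \<Rightarrow> 'u"
  assumes contr: "derivations_inner TYPE('u) B" and \<kappa>: "inj \<kappa>"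
    and \<theta>: "bounded_hom B l1_algebra \<theta>"
    and surj: "\<And>g. \<exists>b\<in>carrier B. \<theta> b = l1_delta g"
  shows "finite (UNIV :: 'g set)"
proof -
  interpret L: banach_algebra "l1_algebra :: ('g \<Rightarrow> complex) normed_alg" by (rule banach_algebra_l1)
  let ?X = "{f \<in> carrier l1_algebra. (\<Sum>\<^sub>\<infinity>x :: 'g. f x) = 0}"
  let ?D = "\<lambda>f x. f x - (\<Sum>\<^sub>\<infinity>x. f x) * l1_delta 0 x"
  have nonneg: "\<And>f :: 'g \<Rightarrow> complex. f \<in> carrier l1_algebra \<Longrightarrow> 0 \<le> nrm l1_algebra f" by (rule L.nrm_nonneg)
  note \<theta>c = bounded_homD(1)[OF \<theta>]
  have "\<exists>z\<in>?X. \<forall>b\<in>carrier B. ?D (\<theta> b) =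
      (\<Sum>\<^sub>\<infinity>x. \<theta> b x) \<odot>\<^bsub>l1_algebra\<^esub> z \<ominus>\<^bsub>l1_algebra\<^esub> \<theta> b \<otimes>\<^bsub>l1_algebra\<^esub> z"
  proof (rule derivation_into_submodule_inner[OF contr banach_bimodule_pullback[OF l1_bimodule \<theta> nonneg]
        bounded_derivation_pullback[OF l1_derivation \<theta> nonneg], of ?X \<kappa>])
    show "inj_on \<kappa> ?X" using \<kappa> by (rule inj_on_subset) simp
    show "?D (\<theta> b) \<in> ?X" if "b \<in> carrier B" for b
    proof -
      note f = \<theta>c[OF that]
      have "(\<lambda>x. \<theta> b x + (- (\<Sum>\<^sub>\<infinity>x. \<theta> b x)) * l1_delta 0 x) \<in> carrier l1_algebra"
        by (intro l1_add_closed f l1_smult_closed l1_delta_closed)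
      moreover have "(\<Sum>\<^sub>\<infinity>x. \<theta> b x + (- (\<Sum>\<^sub>\<infinity>x. \<theta> b x)) * l1_delta 0 x) = 0"
        unfolding infsum_add[OF l1_summable[OF f] l1_summable[OF l1_smult_closed[OF l1_delta_closed]]]
          infsum_cmult_right' infsum_l1_delta by simp
      ultimately show ?thesis by simp
    qed
    show "f \<oplus>\<^bsub>l1_algebra\<^esub> g \<in> ?X" if "f \<in> ?X" "g \<in> ?X" for f g
      using that l1_add_closed[of f g] infsum_add[of f UNIV g] by (simp add: l1_simps(4) l1_summable)
    show smult: "c \<odot>\<^bsub>l1_algebra\<^esub> f \<in> ?X" if "f \<in> ?X" for c f
      using that by (simp add: L.smultc_closed) (simp add: l1_simps(5) infsum_cmult_right')
    show "\<theta> b \<otimes>\<^bsub>l1_algebra\<^esub> f \<in> ?X" if "b \<in> carrier B" "f \<in> ?X" for b f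
      using that by (simp add: L.mult_closed \<theta>c infsum_l1_mult)
    show "(\<Sum>\<^sub>\<infinity>x. \<theta> b x) \<odot>\<^bsub>l1_algebra\<^esub> f \<in> ?X" if "b \<in> carrier B" "f \<in> ?X" for b f
      using smult[OF that(2)] .
    show "x \<in> ?X" if s: "\<And>n. s n \<in> ?X" and x: "x \<in> carrier l1_algebra"
      and lim: "(\<lambda>n. nrm l1_algebra (s n \<ominus>\<^bsub>l1_algebra\<^esub> x)) \<longlonglongrightarrow> 0" for s x
    proof -
      have "cmod (\<Sum>\<^sub>\<infinity>y. x y) \<le> nrm l1_algebra (s n \<ominus>\<^bsub>l1_algebra\<^esub> x)" for n
      proof -
        have sn: "s n \<in> carrier l1_algebra" "(\<Sum>\<^sub>\<infinity>y. s n y) = 0" using s by auto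
        have "(\<Sum>\<^sub>\<infinity>y. s n y + - 1 * x y) = - (\<Sum>\<^sub>\<infinity>y. x y)"
          using infsum_add[OF l1_summable[OF sn(1)] l1_summable[OF l1_smult_closed[OF x, of "-1"]]]
          by (simp add: sn(2) infsum_uminus)
        then show ?thesis
          using cmod_infsum_le[OF L.minus_closed[OF sn(1) x]] by (simp add: l1_minus[OF sn(1) x])
      qed
      then have "cmod (\<Sum>\<^sub>\<infinity>y. x y) \<le> 0" by (intro LIMSEQ_le_const[OF lim]) auto
      then show ?thesis using x by simp
    qed
    show "\<zero>\<^bsub>l1_algebra\<^esub> \<in> ?X" by (simp add: l1_simps(1,3))
    show "?X \<subseteq> carrier l1_algebra" by (rule Collect_restrict)
  qed
  then obtain z where z: "z \<in> carrier l1_algebra" "(\<Sum>\<^sub>\<infinity>x. z x) = 0"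
      "\<And>b. b \<in> carrier B \<Longrightarrow> ?D (\<theta> b) = (\<Sum>\<^sub>\<infinity>x. \<theta> b x) \<odot>\<^bsub>l1_algebra\<^esub> z \<ominus>\<^bsub>l1_algebra\<^esub> \<theta> b \<otimes>\<^bsub>l1_algebra\<^esub> z"
    by blast
  define w where "w x = z x + l1_delta 0 x" for x
  have w: "w \<in> carrier l1_algebra" unfolding w_def[abs_def] by (rule l1_add_closed[OF z(1) l1_delta_closed])
  have sum1: "(\<Sum>\<^sub>\<infinity>x. w x) = 1"
    unfolding w_def using infsum_add[OF l1_summable[OF z(1)] l1_summable[OF l1_delta_closed]] z(2)
    by (simp add: infsum_l1_delta)
  have const: "w x = w 0" for x
  proof -
    obtain b where b: "b \<in> carrier B" "\<theta> b = l1_delta x" using surj by blast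
    have "?D (l1_delta x) = 1 \<odot>\<^bsub>l1_algebra\<^esub> z \<ominus>\<^bsub>l1_algebra\<^esub> l1_delta x \<otimes>\<^bsub>l1_algebra\<^esub> z"
      using z(3)[OF b(1)] unfolding b(2) infsum_l1_delta .
    also have "\<dots> = (\<lambda>y. z y - z (- x + y))"
      using l1_minus[OF z(1) L.mult_closed[OF l1_delta_closed z(1)], of x]
      by (simp add: L.smultc_one[OF z(1)] l1_delta_mult)
    finally have "l1_delta x x - l1_delta 0 x = z x - z (- x + x)"
      by (simp add: fun_eq_iff infsum_l1_delta)
    then show ?thesis by (simp add: w_def l1_delta_def algebra_simps)
  qed
  have "w 0 \<noteq> 0"
  proof
    assume "w 0 = 0"
    then have "w x = 0" for x using const[of x] by simp
    then have "(\<Sum>\<^sub>\<infinity>x. w x) = 0" by (intro infsum_0) simp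
    with sum1 show False by simp
  qed
  moreover have "(\<lambda>x :: 'g. cmod (w 0)) summable_on UNIV"
  proof (rule summable_on_cong[THEN iffD1])
    show "(\<lambda>x. cmod (w x)) summable_on UNIV" using w by (simp add: l1_simps)
    show "cmod (w x) = cmod (w 0)" for x using const[of x] by simp
  qed
  ultimately show ?thesis by (rule constant_l1_finite[rotated])
qed


section \<open>Units, characters and bimodules\<close>

text \<open>
  A right (left) unit comes from the derivation \<open>id\<close> into the algebra with the zero action on the right (left),
  and a left and a right unit agree.
\<close>

lemma contractible_has_unit:
  assumes A: "banach_algebra (A :: 'a normed_alg)" and contr: "contractible_algebra A"
  shows "\<exists>e\<in>carrier A. \<forall>a\<in>carrier A. e \<otimes>\<^bsub>A\<^esub> a = a \<and> a \<otimes>\<^bsub>A\<^esub> e = a"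
proof -
  interpret A: banach_algebra A by (rule A)
  interpret S: seminormed_algebra A by (rule banach_algebra_seminormed[OF A])
  have inner: "derivations_inner TYPE('a) A" by (rule contractible_derivations_inner[OF contr A])
  have bound: "\<exists>C. \<forall>a\<in>carrier A. \<forall>x\<in>carrier A. nrm A (f a x) \<le> C * nrm A a * nrm A x \<and>
      nrm A (\<zero>\<^bsub>A\<^esub>) \<le> C * nrm A a * nrm A x"
    if "\<And>a x. a \<in> carrier A \<Longrightarrow> x \<in> carrier A \<Longrightarrow> nrm A (f a x) \<le> nrm A a * nrm A x" for f
    using that by (intro exI[of _ 1]) (simp add: A.nrm_zero A.nrm_nonneg)
  have "banach_bimodule A A (\<lambda>a x. a \<otimes>\<^bsub>A\<^esub> x) (\<lambda>x a. \<zero>\<^bsub>A\<^esub>)"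
    using bound[of "\<lambda>a x. a \<otimes>\<^bsub>A\<^esub> x"]
    by (intro banach_bimodule.intro banach_bimodule_axioms.intro A.complex_banach_space_axioms)
      (simp_all add: A.mult_closed A.distrib_left A.distrib_right A.mult_smult A.smult_mult A.mult_assoc
        A.nrm_mult S.smultc_of_zero S.mult_zero)
  moreover have "bounded_derivation A A (\<lambda>a x. a \<otimes>\<^bsub>A\<^esub> x) (\<lambda>x a. \<zero>\<^bsub>A\<^esub>) (\<lambda>a. a)"
    unfolding bounded_derivation_def by (auto simp: A.mult_closed intro!: exI[of _ 1])
  ultimately obtain z where z: "z \<in> carrier A" "\<forall>a\<in>carrier A. a = \<zero>\<^bsub>A\<^esub> \<ominus>\<^bsub>A\<^esub> a \<otimes>\<^bsub>A\<^esub> z"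
    using inner unfolding derivations_inner_def inner_derivation_def by blast
  define f where "f = (-1) \<odot>\<^bsub>A\<^esub> z"
  have f: "f \<in> carrier A" "a \<otimes>\<^bsub>A\<^esub> f = a" if "a \<in> carrier A" for a
  proof -
    show "f \<in> carrier A" unfolding f_def by (rule A.smultc_closed[OF z(1)])
    have "a = \<zero>\<^bsub>A\<^esub> \<ominus>\<^bsub>A\<^esub> a \<otimes>\<^bsub>A\<^esub> z" using z(2) that by blast
    also have "\<dots> = a \<otimes>\<^bsub>A\<^esub> f"
      using that z(1) by (simp add: f_def A.minus_as_smult A.mult_closed A.mult_smult A.smultc_closed)
    finally show "a \<otimes>\<^bsub>A\<^esub> f = a" by simp
  qed
  have "banach_bimodule A A (\<lambda>a x. \<zero>\<^bsub>A\<^esub>) (\<lambda>x a. x \<otimes>\<^bsub>A\<^esub> a)"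
  proof (intro banach_bimodule.intro banach_bimodule_axioms.intro A.complex_banach_space_axioms)
    show "\<exists>C. \<forall>a\<in>carrier A. \<forall>x\<in>carrier A. nrm A \<zero>\<^bsub>A\<^esub> \<le> C * nrm A a * nrm A x \<and>
        nrm A (x \<otimes>\<^bsub>A\<^esub> a) \<le> C * nrm A a * nrm A x"
    proof (intro exI[of _ 1] ballI conjI)
      fix a x assume ax: "a \<in> carrier A" "x \<in> carrier A"
      show "nrm A \<zero>\<^bsub>A\<^esub> \<le> 1 * nrm A a * nrm A x" using ax by (simp add: A.nrm_zero A.nrm_nonneg)
      show "nrm A (x \<otimes>\<^bsub>A\<^esub> a) \<le> 1 * nrm A a * nrm A x"
        using A.nrm_mult[OF ax(2,1)] by (simp add: mult.commute)
    qed
  qed (simp_all add: A.mult_closed A.distrib_left A.distrib_right A.mult_smult A.smult_mult A.mult_assoc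
      S.smultc_of_zero S.zero_mult)
  moreover have "bounded_derivation A A (\<lambda>a x. \<zero>\<^bsub>A\<^esub>) (\<lambda>x a. x \<otimes>\<^bsub>A\<^esub> a) (\<lambda>a. a)"
    unfolding bounded_derivation_def by (auto simp: A.mult_closed intro!: exI[of _ 1])
  ultimately obtain e where e: "e \<in> carrier A" "\<forall>a\<in>carrier A. a = e \<otimes>\<^bsub>A\<^esub> a \<ominus>\<^bsub>A\<^esub> \<zero>\<^bsub>A\<^esub>"
    using inner unfolding derivations_inner_def inner_derivation_def by blast
  have e': "e \<otimes>\<^bsub>A\<^esub> a = a" if "a \<in> carrier A" for a
  proof -
    have "a = e \<otimes>\<^bsub>A\<^esub> a \<ominus>\<^bsub>A\<^esub> \<zero>\<^bsub>A\<^esub>" using e(2) that by blast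
    also have "\<dots> = e \<otimes>\<^bsub>A\<^esub> a"
      using that e(1) by (simp add: A.minus_as_smult S.smultc_of_zero A.mult_closed)
    finally show ?thesis by simp
  qed
  have "e = f" using e'[OF f(1)[OF e(1)]] f(2)[OF e(1)] by simp
  then show ?thesis using e(1) e' f(2) by blast
qed

text \<open>
  Otherwise \<open>a\<close> can be scaled so that \<open>\<phi> a = 1\<close> and \<open>a\<close> has norm less than 1.  Then the contraction
  \<open>x \<mapsto> a + a x\<close> has a fixed point \<open>b\<close>, for which \<open>\<phi> b = 1 + \<phi> b\<close>.
\<close>

lemma character_contractive:
  assumes A: "banach_algebra A" and \<phi>: "\<phi> \<in> character_space A" and a: "a \<in> carrier A"
  shows "cmod (\<phi> a) \<le> nrm A a"
proof (rule ccontr)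
  assume "\<not> cmod (\<phi> a) \<le> nrm A a"
  then have lt: "nrm A a < cmod (\<phi> a)" by simp
  interpret A: banach_algebra A by (rule A)
  interpret S: seminormed_algebra A by (rule banach_algebra_seminormed[OF A])
  have nz: "\<phi> a \<noteq> 0" using lt A.nrm_nonneg[OF a] by auto
  define c where "c = inverse (\<phi> a) \<odot>\<^bsub>A\<^esub> a"
  have c: "c \<in> carrier A" unfolding c_def by (rule A.smultc_closed[OF a])
  have \<phi>c: "\<phi> c = 1" using \<phi> a nz by (simp add: character_space_def c_def)
  have nc: "nrm A c < 1"
    using lt nz by (simp add: c_def A.nrm_smult[OF a] norm_inverse) (simp add: divide_simps)
  define d where "d x y = (if x \<in> carrier A \<and> y \<in> carrier A then nrm A (x \<ominus>\<^bsub>A\<^esub> y) else 0)" for x y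
  interpret Metric_space "carrier A" d
  proof
    fix x y
    show "0 \<le> d x y" by (simp add: d_def A.nrm_nonneg)
    show "d x y = d y x" by (simp add: d_def A.nrm_minus_commute)
  next
    fix x y assume xy: "x \<in> carrier A" "y \<in> carrier A"
    have "x \<ominus>\<^bsub>A\<^esub> y = \<zero>\<^bsub>A\<^esub> \<longleftrightarrow> x = y"
      using xy A.minus_equality[of x "\<ominus>\<^bsub>A\<^esub> y"] by (auto simp: A.minus_eq A.r_neg)
    then show "d x y = 0 \<longleftrightarrow> x = y" using xy by (simp add: d_def A.nrm_eq_zero)
  next
    fix x y z assume "x \<in> carrier A" "y \<in> carrier A" "z \<in> carrier A"
    then show "d x z \<le> d x y + d y z" by (simp add: d_def A.minus_trans)
  qed
  have complete: "mcomplete"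
    unfolding mcomplete_def
  proof (intro allI impI)
    fix s assume s: "MCauchy s"
    then have sc: "s n \<in> carrier A" for n by (auto simp: MCauchy_def)
    have "s \<in> cauchy_seqs A"
      unfolding cauchy_seqs_def
    proof (intro CollectI conjI allI impI sc)
      fix e :: real assume "0 < e"
      then obtain N where "\<forall>m n. N \<le> m \<longrightarrow> N \<le> n \<longrightarrow> d (s m) (s n) < e"
        using s unfolding MCauchy_def by blast
      then show "\<exists>N. \<forall>m\<ge>N. \<forall>n\<ge>N. nrm A (s m \<ominus>\<^bsub>A\<^esub> s n) < e" using sc by (auto simp: d_def)
    qed
    then obtain x where x: "x \<in> carrier A" "(\<lambda>n. nrm A (s n \<ominus>\<^bsub>A\<^esub> x)) \<longlonglongrightarrow> 0" using A.complete by blast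
    have "\<exists>N. \<forall>n\<ge>N. nrm A (s n \<ominus>\<^bsub>A\<^esub> x) < e" if "0 < e" for e
      using LIMSEQ_D[OF x(2) that] sc x(1) by (simp add: A.nrm_nonneg)
    then have "limitin mtopology s x sequentially"
      unfolding limit_metric_sequentially using sc x(1) by (simp add: d_def)
    then show "\<exists>x. limitin mtopology s x sequentially" by blast
  qed
  have nonempty: "carrier A \<noteq> {}" using a by blast
  have self_map: "(\<lambda>x. c \<oplus>\<^bsub>A\<^esub> c \<otimes>\<^bsub>A\<^esub> x) \<in> carrier A \<rightarrow> carrier A" using c by (simp add: A.mult_closed)
  have contraction: "d (c \<oplus>\<^bsub>A\<^esub> c \<otimes>\<^bsub>A\<^esub> x) (c \<oplus>\<^bsub>A\<^esub> c \<otimes>\<^bsub>A\<^esub> y) \<le> nrm A c * d x y"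
    if xy: "x \<in> carrier A" "y \<in> carrier A" for x y
  proof -
    have "nrm A ((c \<oplus>\<^bsub>A\<^esub> c \<otimes>\<^bsub>A\<^esub> x) \<ominus>\<^bsub>A\<^esub> (c \<oplus>\<^bsub>A\<^esub> c \<otimes>\<^bsub>A\<^esub> y)) \<le> nrm A (c \<otimes>\<^bsub>A\<^esub> x \<ominus>\<^bsub>A\<^esub> c \<otimes>\<^bsub>A\<^esub> y)"
      using S.nrm_add_minus_add[of c "c \<otimes>\<^bsub>A\<^esub> x" c "c \<otimes>\<^bsub>A\<^esub> y"] c xy by (simp add: A.mult_closed S.nrm_self)
    also have "c \<otimes>\<^bsub>A\<^esub> x \<ominus>\<^bsub>A\<^esub> c \<otimes>\<^bsub>A\<^esub> y = c \<otimes>\<^bsub>A\<^esub> (x \<ominus>\<^bsub>A\<^esub> y)"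
      using c xy by (simp add: A.minus_as_smult A.mult_closed A.distrib_left A.mult_smult A.smultc_closed)
    also have "nrm A \<dots> \<le> nrm A c * nrm A (x \<ominus>\<^bsub>A\<^esub> y)" using c xy by (intro A.nrm_mult) auto
    finally show ?thesis using c xy by (simp add: d_def A.mult_closed)
  qed
  obtain b where b: "b \<in> carrier A" "c \<oplus>\<^bsub>A\<^esub> c \<otimes>\<^bsub>A\<^esub> b = b"
    by (rule Banach_fixedpoint_thm[OF complete nonempty self_map nc contraction])
  have "\<phi> (c \<oplus>\<^bsub>A\<^esub> c \<otimes>\<^bsub>A\<^esub> b) = \<phi> c + \<phi> c * \<phi> b"
    using \<phi> c b(1) by (simp add: character_space_def A.mult_closed)
  then show False using b(2) \<phi>c by simp
qed

context banach_bimodule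
begin

lemma l_zero: "a \<in> carrier B \<Longrightarrow> l a \<zero>\<^bsub>E\<^esub> = \<zero>\<^bsub>E\<^esub>"
  using l_smult[of a "\<zero>\<^bsub>E\<^esub>" 0] by (simp add: smultc_zero l_closed)

lemma r_zero: "a \<in> carrier B \<Longrightarrow> r \<zero>\<^bsub>E\<^esub> a = \<zero>\<^bsub>E\<^esub>"
  using r_smult[of a "\<zero>\<^bsub>E\<^esub>" 0] by (simp add: smultc_zero r_closed)

lemma l_minus: "a \<in> carrier B \<Longrightarrow> x \<in> carrier E \<Longrightarrow> y \<in> carrier E \<Longrightarrow> l a (x \<ominus>\<^bsub>E\<^esub> y) = l a x \<ominus>\<^bsub>E\<^esub> l a y"
  by (simp add: minus_as_smult l_add l_smult smultc_closed l_closed)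

lemma r_minus: "a \<in> carrier B \<Longrightarrow> x \<in> carrier E \<Longrightarrow> y \<in> carrier E \<Longrightarrow> r (x \<ominus>\<^bsub>E\<^esub> y) a = r x a \<ominus>\<^bsub>E\<^esub> r y a"
  by (simp add: minus_as_smult r_add r_smult smultc_closed r_closed)

lemma telescope:
  assumes "x \<in> carrier E" "y \<in> carrier E" "t \<in> carrier E"
  shows "(x \<oplus>\<^bsub>E\<^esub> t) \<oplus>\<^bsub>E\<^esub> (y \<ominus>\<^bsub>E\<^esub> t) = x \<oplus>\<^bsub>E\<^esub> y"
  using assms by (simp add: minus_eq a_assoc a_comm[of y] r_neg2)

lemma bounded_derivation_minus_inner:
  assumes D: "bounded_derivation B E l r D" and z: "z \<in> carrier E"
  shows "bounded_derivation B E l r (\<lambda>b. D b \<ominus>\<^bsub>E\<^esub> (r z b \<ominus>\<^bsub>E\<^esub> l b z))"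
proof -
  have Dc: "D a \<in> carrier E" if "a \<in> carrier B" for a using D that by (simp add: bounded_derivation_def)
  note c = Dc l_closed[OF _ z] r_closed[OF _ z]
  obtain C where C: "\<forall>a\<in>carrier B. nrm E (D a) \<le> C * nrm B a"
    using D unfolding bounded_derivation_def by blast
  obtain C' where C': "\<forall>a\<in>carrier B. \<forall>x\<in>carrier E.
      nrm E (l a x) \<le> C' * nrm B a * nrm E x \<and> nrm E (r x a) \<le> C' * nrm B a * nrm E x"
    using act_bounded by blast
  have sub: "nrm E (x \<ominus>\<^bsub>E\<^esub> y) \<le> nrm E x + nrm E y" if "x \<in> carrier E" "y \<in> carrier E" for x y
    using nrm_triangle[of x "(-1) \<odot>\<^bsub>E\<^esub> y"] nrm_smult[of y "-1"] that
    by (simp add: minus_as_smult smultc_closed)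
  show ?thesis
    unfolding bounded_derivation_def
  proof (intro conjI ballI allI)
    fix a assume a: "a \<in> carrier B"
    show "D a \<ominus>\<^bsub>E\<^esub> (r z a \<ominus>\<^bsub>E\<^esub> l a z) \<in> carrier E" using c[OF a] by simp
    fix b assume b: "b \<in> carrier B"
    have "D (a \<oplus>\<^bsub>B\<^esub> b) = D a \<oplus>\<^bsub>E\<^esub> D b" using D a b by (simp add: bounded_derivation_def)
    then show "D (a \<oplus>\<^bsub>B\<^esub> b) \<ominus>\<^bsub>E\<^esub> (r z (a \<oplus>\<^bsub>B\<^esub> b) \<ominus>\<^bsub>E\<^esub> l (a \<oplus>\<^bsub>B\<^esub> b) z) =
        D a \<ominus>\<^bsub>E\<^esub> (r z a \<ominus>\<^bsub>E\<^esub> l a z) \<oplus>\<^bsub>E\<^esub> (D b \<ominus>\<^bsub>E\<^esub> (r z b \<ominus>\<^bsub>E\<^esub> l b z))"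
      using c[OF a] c[OF b] by (simp add: add_r[OF a b z] add_l[OF a b z] minus_eq minus_add a_ac)
    let ?p = "r (D a) b" and ?q = "l a (D b)" and ?s = "r (r z a) b" and ?t = "l a (r z b)" and ?v = "l a (l b z)"
    have cl: "?p \<in> carrier E" "?q \<in> carrier E" "?s \<in> carrier E" "?t \<in> carrier E" "?v \<in> carrier E"
      using c[OF a] c[OF b] a b by (simp_all add: l_closed r_closed)
    have "r (D a \<ominus>\<^bsub>E\<^esub> (r z a \<ominus>\<^bsub>E\<^esub> l a z)) b \<oplus>\<^bsub>E\<^esub> l a (D b \<ominus>\<^bsub>E\<^esub> (r z b \<ominus>\<^bsub>E\<^esub> l b z)) =
        (?p \<ominus>\<^bsub>E\<^esub> (?s \<ominus>\<^bsub>E\<^esub> ?t)) \<oplus>\<^bsub>E\<^esub> (?q \<ominus>\<^bsub>E\<^esub> (?t \<ominus>\<^bsub>E\<^esub> ?v))"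
      using c[OF a] c[OF b] a b z by (simp add: r_minus l_minus l_r)
    also have "\<dots> = ((?p \<ominus>\<^bsub>E\<^esub> ?s) \<oplus>\<^bsub>E\<^esub> ?t) \<oplus>\<^bsub>E\<^esub> ((?q \<oplus>\<^bsub>E\<^esub> ?v) \<ominus>\<^bsub>E\<^esub> ?t)"
      using cl by (simp add: minus_eq minus_add a_ac)
    also have "\<dots> = (?p \<ominus>\<^bsub>E\<^esub> ?s) \<oplus>\<^bsub>E\<^esub> (?q \<oplus>\<^bsub>E\<^esub> ?v)"
      using cl by (intro telescope) auto
    also have "\<dots> = (?p \<oplus>\<^bsub>E\<^esub> ?q) \<ominus>\<^bsub>E\<^esub> (?s \<ominus>\<^bsub>E\<^esub> ?v)"
      using cl by (simp add: minus_eq minus_add a_ac)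
    also have "\<dots> = D (a \<otimes>\<^bsub>B\<^esub> b) \<ominus>\<^bsub>E\<^esub> (r z (a \<otimes>\<^bsub>B\<^esub> b) \<ominus>\<^bsub>E\<^esub> l (a \<otimes>\<^bsub>B\<^esub> b) z)"
      using D a b z by (simp add: bounded_derivation_def r_mult l_mult)
    finally show "D (a \<otimes>\<^bsub>B\<^esub> b) \<ominus>\<^bsub>E\<^esub> (r z (a \<otimes>\<^bsub>B\<^esub> b) \<ominus>\<^bsub>E\<^esub> l (a \<otimes>\<^bsub>B\<^esub> b) z) =
        r (D a \<ominus>\<^bsub>E\<^esub> (r z a \<ominus>\<^bsub>E\<^esub> l a z)) b \<oplus>\<^bsub>E\<^esub> l a (D b \<ominus>\<^bsub>E\<^esub> (r z b \<ominus>\<^bsub>E\<^esub> l b z))" by simp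
  next
    fix k a assume a: "a \<in> carrier B"
    have "D (k \<odot>\<^bsub>B\<^esub> a) = k \<odot>\<^bsub>E\<^esub> D a" using D a by (simp add: bounded_derivation_def)
    then show "D (k \<odot>\<^bsub>B\<^esub> a) \<ominus>\<^bsub>E\<^esub> (r z (k \<odot>\<^bsub>B\<^esub> a) \<ominus>\<^bsub>E\<^esub> l (k \<odot>\<^bsub>B\<^esub> a) z) =
        k \<odot>\<^bsub>E\<^esub> (D a \<ominus>\<^bsub>E\<^esub> (r z a \<ominus>\<^bsub>E\<^esub> l a z))"
      using c[OF a] by (simp add: smult_r[OF a z] smult_l[OF a z] minus_as_smult smultc_closed smultc_add
          smultc_assoc[symmetric] mult.commute)
  next
    show "\<exists>K. \<forall>a\<in>carrier B. nrm E (D a \<ominus>\<^bsub>E\<^esub> (r z a \<ominus>\<^bsub>E\<^esub> l a z)) \<le> K * nrm B a"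
    proof (intro exI[of _ "C + 2 * (C' * nrm E z)"] ballI)
      fix a assume a: "a \<in> carrier B"
      have "nrm E (D a \<ominus>\<^bsub>E\<^esub> (r z a \<ominus>\<^bsub>E\<^esub> l a z)) \<le> nrm E (D a) + (nrm E (r z a) + nrm E (l a z))"
        using sub[of "D a" "r z a \<ominus>\<^bsub>E\<^esub> l a z"] sub[of "r z a" "l a z"] c[OF a] by simp
      also have "\<dots> \<le> C * nrm B a + (C' * nrm B a * nrm E z + C' * nrm B a * nrm E z)"
        using C C' a z by (intro add_mono) auto
      finally show "nrm E (D a \<ominus>\<^bsub>E\<^esub> (r z a \<ominus>\<^bsub>E\<^esub> l a z)) \<le> (C + 2 * (C' * nrm E z)) * nrm B a"
        by (simp add: algebra_simps)
    qed
  qed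
qed

lemma inner_derivation_shift:
  assumes D: "\<And>b. b \<in> carrier B \<Longrightarrow> D b \<in> carrier E" and z: "z \<in> carrier E" and w: "w \<in> carrier E"
    and eq: "\<And>b. b \<in> carrier B \<Longrightarrow> D b \<ominus>\<^bsub>E\<^esub> (r z b \<ominus>\<^bsub>E\<^esub> l b z) = r w b \<ominus>\<^bsub>E\<^esub> l b w"
  shows "inner_derivation B E l r D"
  unfolding inner_derivation_def
proof (intro bexI[of _ "w \<oplus>\<^bsub>E\<^esub> z"] ballI)
  fix b assume b: "b \<in> carrier B"
  note c = D[OF b] l_closed[OF b z] r_closed[OF b z] l_closed[OF b w] r_closed[OF b w]
  have "D b = (D b \<ominus>\<^bsub>E\<^esub> (r z b \<ominus>\<^bsub>E\<^esub> l b z)) \<oplus>\<^bsub>E\<^esub> (r z b \<ominus>\<^bsub>E\<^esub> l b z)"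
    using c by (simp only: minus_eq a_assoc l_neg r_zero add.inv_closed a_closed add.m_closed r_neg add.r_one)
  also have "\<dots> = r (w \<oplus>\<^bsub>E\<^esub> z) b \<ominus>\<^bsub>E\<^esub> l b (w \<oplus>\<^bsub>E\<^esub> z)"
    unfolding eq[OF b] using c by (simp add: r_add[OF b w z] l_add[OF b w z] minus_eq minus_add a_ac)
  finally show "D b = r (w \<oplus>\<^bsub>E\<^esub> z) b \<ominus>\<^bsub>E\<^esub> l b (w \<oplus>\<^bsub>E\<^esub> z)" .
qed (use z w in simp)

end

lemma (in complex_normed_space) additive_finsum:
  assumes "finite S" "\<And>i. i \<in> S \<Longrightarrow> f i \<in> carrier E"
    and h: "\<And>x. x \<in> carrier E \<Longrightarrow> h x \<in> carrier E" "h \<zero>\<^bsub>E\<^esub> = \<zero>\<^bsub>E\<^esub>"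
      "\<And>x y. x \<in> carrier E \<Longrightarrow> y \<in> carrier E \<Longrightarrow> h (x \<oplus>\<^bsub>E\<^esub> y) = h x \<oplus>\<^bsub>E\<^esub> h y"
  shows "h (finsum E f S) = finsum E (\<lambda>i. h (f i)) S"
  using assms(1,2)
proof (induction S rule: finite_induct)
  case empty
  show ?case by (simp add: h)
next
  case (insert i S)
  then show ?case
    by (subst (1 2) finsum_insert) (auto simp: h Pi_def)
qed

lemma (in complex_normed_space) finsum_constant:
  assumes "finite S" "x \<in> carrier E"
  shows "finsum E (\<lambda>i. x) S = of_nat (card S) \<odot>\<^bsub>E\<^esub> x"
  using assms(1)
proof (induction S rule: finite_induct)
  case empty
  show ?case using assms(2) by (simp add: smultc_zero)
next
  case (insert i S)
  then show ?case using assms(2)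
    by (subst finsum_insert) (auto simp: smultc_add_left smultc_one)
qed


section \<open>Contractibility of the tensor product\<close>

lemma measure_algebra_ops:
  "\<mu> \<oplus>\<^bsub>measure_algebra\<^esub> \<nu> = (\<lambda>S. \<mu> S + \<nu> S)"
  "c \<odot>\<^bsub>measure_algebra\<^esub> \<mu> = (\<lambda>S. c * \<mu> S)"
  "\<mu> \<otimes>\<^bsub>measure_algebra\<^esub> \<nu> = convolution \<mu> \<nu>"
  "\<zero>\<^bsub>measure_algebra\<^esub> = (\<lambda>S. 0)"
  by (simp_all add: measure_algebra_def)

lemma seminormed_measure_algebra:
  assumes lc: "locally_compact_space (euclidean :: 'g::{topological_group_add, t2_space} topology)"
  shows "seminormed_algebra (measure_algebra :: ('g set \<Rightarrow> complex) normed_alg)"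
proof (intro seminormed_algebra.intro seminormed_algebra_axioms.intro)
  let ?M = "measure_algebra :: ('g set \<Rightarrow> complex) normed_alg"
  note ops = measure_algebra_ops and D = carrier_measure_algebraD(1)
  show "Module.module complex_ring ?M"
  proof (rule Module.moduleI[OF cring_complex_ring])
    show "abelian_group ?M"
    proof (rule abelian_groupI)
      fix \<mu> assume \<mu>: "\<mu> \<in> carrier ?M"
      show "\<exists>\<nu>\<in>carrier ?M. \<nu> \<oplus>\<^bsub>?M\<^esub> \<mu> = \<zero>\<^bsub>?M\<^esub>"
        by (intro bexI[of _ "\<lambda>S. -1 * \<mu> S"] measure_algebra_smult_closed[OF \<mu>]) (simp add: ops)
    qed (simp_all add: ops measure_algebra_add_closed measure_algebra_zero_closed add_ac)
  qed (simp_all add: ops complex_ring_def measure_algebra_smult_closed distrib_left distrib_right mult.assoc)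
  fix \<mu> \<nu> :: "'g set \<Rightarrow> complex" assume \<mu>: "\<mu> \<in> carrier ?M"
  show "0 \<le> nrm ?M \<mu>" by (simp add: nrm_measure_algebra)
  show "nrm ?M (c \<odot>\<^bsub>?M\<^esub> \<mu>) = cmod c * nrm ?M \<mu>" for c
    by (simp add: ops nrm_measure_algebra variation_smult enn2real_mult)
  assume \<nu>: "\<nu> \<in> carrier ?M"
  show "nrm ?M (\<mu> \<oplus>\<^bsub>?M\<^esub> \<nu>) \<le> nrm ?M \<mu> + nrm ?M \<nu>"
  proof -
    have "ennreal (nrm ?M (\<lambda>S. \<mu> S + \<nu> S)) \<le> ennreal (nrm ?M \<mu>) + ennreal (nrm ?M \<nu>)"
      using variation_add[OF D[OF \<mu>] D[OF \<nu>], of UNIV]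
      by (simp add: variation_eq_nrm D[OF \<mu>] D[OF \<nu>] complex_measure_add)
    also have "\<dots> = ennreal (nrm ?M \<mu> + nrm ?M \<nu>)" by (simp add: nrm_measure_algebra)
    finally have "nrm ?M (\<lambda>S. \<mu> S + \<nu> S) \<le> nrm ?M \<mu> + nrm ?M \<nu>"
      by (subst (asm) ennreal_le_iff) (simp_all add: nrm_measure_algebra)
    then show ?thesis unfolding ops .
  qed
  show "\<mu> \<otimes>\<^bsub>?M\<^esub> \<nu> \<in> carrier ?M" unfolding ops by (rule convolution_closed[OF lc \<mu> \<nu>])
  show "(c \<odot>\<^bsub>?M\<^esub> \<mu>) \<otimes>\<^bsub>?M\<^esub> \<nu> = c \<odot>\<^bsub>?M\<^esub> (\<mu> \<otimes>\<^bsub>?M\<^esub> \<nu>)" for c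
    unfolding ops by (rule convolution_smult_left[OF D[OF \<mu>] \<nu>])
  show "\<mu> \<otimes>\<^bsub>?M\<^esub> (c \<odot>\<^bsub>?M\<^esub> \<nu>) = c \<odot>\<^bsub>?M\<^esub> (\<mu> \<otimes>\<^bsub>?M\<^esub> \<nu>)" for c
    unfolding ops by (rule convolution_smult_right)
  fix \<rho> assume \<rho>: "\<rho> \<in> carrier ?M"
  show "(\<mu> \<oplus>\<^bsub>?M\<^esub> \<nu>) \<otimes>\<^bsub>?M\<^esub> \<rho> = \<mu> \<otimes>\<^bsub>?M\<^esub> \<rho> \<oplus>\<^bsub>?M\<^esub> \<nu> \<otimes>\<^bsub>?M\<^esub> \<rho>"
    unfolding ops by (rule convolution_add_left[OF D[OF \<mu>] D[OF \<nu>] \<rho>])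
  show "\<mu> \<otimes>\<^bsub>?M\<^esub> (\<nu> \<oplus>\<^bsub>?M\<^esub> \<rho>) = \<mu> \<otimes>\<^bsub>?M\<^esub> \<nu> \<oplus>\<^bsub>?M\<^esub> \<mu> \<otimes>\<^bsub>?M\<^esub> \<rho>"
    unfolding ops by (rule convolution_add_right[OF D[OF \<mu>] \<nu> \<rho>])
next
  show "\<exists>C. \<forall>\<mu>\<in>carrier measure_algebra. \<forall>\<nu>\<in>carrier (measure_algebra :: ('g set \<Rightarrow> complex) normed_alg).
      nrm measure_algebra (\<mu> \<otimes>\<^bsub>measure_algebra\<^esub> \<nu>) \<le> C * nrm measure_algebra \<mu> * nrm measure_algebra \<nu>"
    unfolding measure_algebra_ops by (intro exI[of _ 4] ballI nrm_convolution)
qed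

context
  fixes A :: "'a normed_alg"
  assumes lc: "locally_compact_space (euclidean :: 'g::{topological_group_add, t2_space} topology)"
    and A: "banach_algebra A"
begin

abbreviation (input) "M \<equiv> measure_algebra :: ('g set \<Rightarrow> complex) normed_alg"

interpretation A: banach_algebra A by (rule A)
interpretation MA: tensor_pair M A
  by (intro tensor_pair.intro seminormed_measure_algebra[OF lc] banach_algebra_seminormed[OF A])

lemmas ops = measure_algebra_ops
lemmas cmD = carrier_measure_algebraD(1)


subsection \<open>Necessity\<close>

text \<open>The total mass \<open>\<mu> \<mapsto> \<mu> UNIV\<close> is a character of the measure algebra, which gives a homomorphism onto \<open>A\<close>.\<close>

lemma contractible_factor:
  assumes contr: "contractible_algebra (projective_tensor M A)"
  shows "contractible_algebra A"
proof -
  have "multiplicative_bilinear M A A (\<lambda>\<mu> a. \<mu> UNIV \<odot>\<^bsub>A\<^esub> a) 1"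
  proof (intro multiplicative_bilinear.intro multiplicative_bilinear_axioms.intro MA.tensor_pair_axioms A)
    fix \<mu> \<nu> a b assume \<mu>: "\<mu> \<in> carrier M" and a: "a \<in> carrier A"
    show "\<mu> UNIV \<odot>\<^bsub>A\<^esub> a \<in> carrier A" by (rule A.smultc_closed[OF a])
    show "nrm A (\<mu> UNIV \<odot>\<^bsub>A\<^esub> a) \<le> 1 * (nrm M \<mu> * nrm A a)"
      using cmod_le_nrm[OF cmD[OF \<mu>], of UNIV] a by (simp add: A.nrm_smult mult_right_mono A.nrm_nonneg)
    assume \<nu>: "\<nu> \<in> carrier M"
    show "(\<mu> \<oplus>\<^bsub>M\<^esub> \<nu>) UNIV \<odot>\<^bsub>A\<^esub> a = \<mu> UNIV \<odot>\<^bsub>A\<^esub> a \<oplus>\<^bsub>A\<^esub> \<nu> UNIV \<odot>\<^bsub>A\<^esub> a"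
      unfolding ops by (rule A.smultc_add_left[OF a])
    assume b: "b \<in> carrier A"
    show "(\<mu> \<otimes>\<^bsub>M\<^esub> \<nu>) UNIV \<odot>\<^bsub>A\<^esub> (a \<otimes>\<^bsub>A\<^esub> b) = (\<mu> UNIV \<odot>\<^bsub>A\<^esub> a) \<otimes>\<^bsub>A\<^esub> (\<nu> UNIV \<odot>\<^bsub>A\<^esub> b)"
      unfolding ops convolution_UNIV[OF cmD[OF \<mu>]]
      using a b by (simp add: A.smult_mult A.mult_smult A.smultc_closed A.mult_closed mult.commute
          flip: A.smultc_assoc)
  qed (simp_all add: ops A.smultc_add A.smultc_closed A.smultc_assoc[symmetric] mult.commute)
  then obtain \<theta> where \<theta>: "bounded_hom (projective_tensor M A) A \<theta>"
      "\<forall>\<mu>\<in>carrier M. \<forall>a\<in>carrier A. \<theta> (elementary M A \<mu> a) = \<mu> UNIV \<odot>\<^bsub>A\<^esub> a"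
    using multiplicative_bilinear.extends_to_projective_tensor by blast
  have onto: "\<exists>b\<in>carrier (projective_tensor M A). \<theta> b = a" if a: "a \<in> carrier A" for a
    using \<theta>(2)[rule_format, OF point_mass_closed[of 0] a] MA.elementary_closed[OF point_mass_closed[of 0] a]
    by (intro bexI[of _ "elementary M A (point_mass 0) a"]) (simp_all add: point_mass_def A.smultc_one[OF a])
  \<comment> \<open>Any injection into the type of the bimodules that occur in the contractibility of the tensor product will do.\<close>
  define j :: "'a \<Rightarrow> (nat \<Rightarrow> (('g set \<Rightarrow> complex) \<times> 'a) list set) set" where
    "j a = {\<lambda>_. {[(\<lambda>_. 0, a)]}}" for a
  define \<kappa> where "\<kappa> f = (\<lambda>n. map j (f n))" for f :: "nat \<Rightarrow> 'a list"
  have "inj j" by (rule injI) (simp add: j_def fun_eq_iff)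
  then have "inj \<kappa>" by (intro injI) (simp add: \<kappa>_def fun_eq_iff inj_map_eq_map)
  show ?thesis
    unfolding contractible_algebra_def derivations_inner_def
  proof (intro allI impI)
    fix E :: "(nat \<Rightarrow> 'a list) normed_alg" and l r D
    assume bim: "banach_bimodule A E l r" and der: "bounded_derivation A E l r D"
    obtain z where z: "z \<in> carrier E"
        "\<forall>b\<in>carrier (projective_tensor M A). D (\<theta> b) = r z (\<theta> b) \<ominus>\<^bsub>E\<^esub> l (\<theta> b) z"
      using derivation_inner_if_injective[OF contr[unfolded contractible_algebra_def] \<open>inj \<kappa>\<close>
          banach_bimodule_pullback[OF bim \<theta>(1) A.nrm_nonneg] bounded_derivation_pullback[OF der \<theta>(1) A.nrm_nonneg]]
      by blast
    have "D a = r z a \<ominus>\<^bsub>E\<^esub> l a z" if "a \<in> carrier A" for a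
      using onto[OF that] z(2) by blast
    then show "inner_derivation A E l r D" unfolding inner_derivation_def using z(1) by blast
  qed
qed

text \<open>
  Passing to the atoms, \<open>\<mu> \<mapsto> (\<lambda>x. \<mu> {x})\<close>, is a homomorphism onto the algebra of absolutely summable functions on
  the group, whatever its topology.  Together with a character of \<open>A\<close> it makes this algebra a quotient of the
  tensor product.
\<close>

lemma finite_group_if_contractible:
  assumes contr: "contractible_algebra (projective_tensor M A)" and \<phi>: "\<phi> \<in> character_space A"
  shows "finite (UNIV :: 'g set)"
proof -
  have \<phi>D: "\<phi> (a \<oplus>\<^bsub>A\<^esub> b) = \<phi> a + \<phi> b" "\<phi> (c \<odot>\<^bsub>A\<^esub> a) = c * \<phi> a" "\<phi> (a \<otimes>\<^bsub>A\<^esub> b) = \<phi> a * \<phi> b"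
    if "a \<in> carrier A" "b \<in> carrier A" for a b c
    using \<phi> that by (simp_all add: character_space_def)
  have atoms: "(\<lambda>x. \<mu> {x}) \<in> carrier l1_algebra" if "\<mu> \<in> carrier M" for \<mu>
    using atoms_summable[OF cmD[OF that]] by (simp add: l1_simps)
  have "multiplicative_bilinear M A l1_algebra (\<lambda>\<mu> a. \<phi> a \<odot>\<^bsub>l1_algebra\<^esub> (\<lambda>x. \<mu> {x})) 1"
  proof (intro multiplicative_bilinear.intro multiplicative_bilinear_axioms.intro MA.tensor_pair_axioms banach_algebra_l1)
    fix \<mu> \<nu> a b assume \<mu>: "\<mu> \<in> carrier M" and a: "a \<in> carrier A"
    show "\<phi> a \<odot>\<^bsub>l1_algebra\<^esub> (\<lambda>x. \<mu> {x}) \<in> carrier l1_algebra"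
      unfolding l1_simps(5) by (rule l1_smult_closed[OF atoms[OF \<mu>]])
    have "nrm l1_algebra (\<phi> a \<odot>\<^bsub>l1_algebra\<^esub> (\<lambda>x. \<mu> {x})) = cmod (\<phi> a) * (\<Sum>\<^sub>\<infinity>x. cmod (\<mu> {x}))"
      by (simp add: l1_simps norm_mult infsum_cmult_right')
    also have "\<dots> \<le> nrm A a * nrm M \<mu>"
      using infsum_atoms_le_nrm[OF cmD[OF \<mu>]] character_contractive[OF A \<phi> a]
      by (intro mult_mono) (simp_all add: nrm_measure_algebra A.nrm_nonneg a infsum_nonneg)
    finally show "nrm l1_algebra (\<phi> a \<odot>\<^bsub>l1_algebra\<^esub> (\<lambda>x. \<mu> {x})) \<le> 1 * (nrm M \<mu> * nrm A a)"
      by (simp add: mult.commute)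
    show "\<phi> a \<odot>\<^bsub>l1_algebra\<^esub> (\<lambda>x. (c \<odot>\<^bsub>M\<^esub> \<mu>) {x}) = c \<odot>\<^bsub>l1_algebra\<^esub> (\<phi> a \<odot>\<^bsub>l1_algebra\<^esub> (\<lambda>x. \<mu> {x}))" for c
      by (simp add: ops l1_simps mult.left_commute)
    show "\<phi> (c \<odot>\<^bsub>A\<^esub> a) \<odot>\<^bsub>l1_algebra\<^esub> (\<lambda>x. \<mu> {x}) = c \<odot>\<^bsub>l1_algebra\<^esub> (\<phi> a \<odot>\<^bsub>l1_algebra\<^esub> (\<lambda>x. \<mu> {x}))" for c
      by (simp add: l1_simps \<phi>D(2)[OF a a] mult.assoc)
    assume \<nu>: "\<nu> \<in> carrier M"
    show "\<phi> a \<odot>\<^bsub>l1_algebra\<^esub> (\<lambda>x. (\<mu> \<oplus>\<^bsub>M\<^esub> \<nu>) {x}) =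
        \<phi> a \<odot>\<^bsub>l1_algebra\<^esub> (\<lambda>x. \<mu> {x}) \<oplus>\<^bsub>l1_algebra\<^esub> \<phi> a \<odot>\<^bsub>l1_algebra\<^esub> (\<lambda>x. \<nu> {x})"
      by (simp add: ops l1_simps distrib_left)
    assume b: "b \<in> carrier A"
    show "\<phi> (a \<otimes>\<^bsub>A\<^esub> b) \<odot>\<^bsub>l1_algebra\<^esub> (\<lambda>x. (\<mu> \<otimes>\<^bsub>M\<^esub> \<nu>) {x}) =
        (\<phi> a \<odot>\<^bsub>l1_algebra\<^esub> (\<lambda>x. \<mu> {x})) \<otimes>\<^bsub>l1_algebra\<^esub> (\<phi> b \<odot>\<^bsub>l1_algebra\<^esub> (\<lambda>x. \<nu> {x}))"
      unfolding ops convolution_atom[OF cmD[OF \<mu>] \<nu>] \<phi>D(3)[OF a b]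
      by (simp add: l1_simps mult_ac flip: infsum_cmult_right')
  next
    fix \<mu> a b assume "\<mu> \<in> carrier M" and ab: "a \<in> carrier A" "b \<in> carrier A"
    show "\<phi> (a \<oplus>\<^bsub>A\<^esub> b) \<odot>\<^bsub>l1_algebra\<^esub> (\<lambda>x. \<mu> {x}) =
        \<phi> a \<odot>\<^bsub>l1_algebra\<^esub> (\<lambda>x. \<mu> {x}) \<oplus>\<^bsub>l1_algebra\<^esub> \<phi> b \<odot>\<^bsub>l1_algebra\<^esub> (\<lambda>x. \<mu> {x})"
      by (simp add: l1_simps \<phi>D(1)[OF ab] distrib_right)
  qed simp
  then obtain \<theta> where \<theta>: "bounded_hom (projective_tensor M A) l1_algebra \<theta>"
      "\<forall>\<mu>\<in>carrier M. \<forall>a\<in>carrier A. \<theta> (elementary M A \<mu> a) = \<phi> a \<odot>\<^bsub>l1_algebra\<^esub> (\<lambda>x. \<mu> {x})"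
    using multiplicative_bilinear.extends_to_projective_tensor by blast
  obtain a where a: "a \<in> carrier A" "\<phi> a \<noteq> 0" using \<phi> by (auto simp: character_space_def)
  define c where "c = inverse (\<phi> a) \<odot>\<^bsub>A\<^esub> a"
  have c: "c \<in> carrier A" "\<phi> c = 1" using a by (simp_all add: c_def A.smultc_closed \<phi>D(2)[OF a(1) a(1)])
  have onto: "\<exists>b\<in>carrier (projective_tensor M A). \<theta> b = l1_delta g" for g
  proof
    show "elementary M A (point_mass g) c \<in> carrier (projective_tensor M A)"
      by (rule MA.elementary_closed[OF point_mass_closed c(1)])
    have "\<theta> (elementary M A (point_mass g) c) = (\<lambda>x. point_mass g {x})"
      using \<theta>(2)[rule_format, OF point_mass_closed[of g] c(1)] by (simp add: c(2) l1_simps(5))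
    also have "\<dots> = l1_delta g" by (auto simp: point_mass_def l1_delta_def)
    finally show "\<theta> (elementary M A (point_mass g) c) = l1_delta g" .
  qed
  \<comment> \<open>An injection into the type of the bimodules that occur in the contractibility of the tensor product:
    \<open>f\<close> is recovered from the set function that takes the value \<open>f x\<close> on the singleton \<open>{x}\<close>.\<close>
  define \<kappa> :: "('g \<Rightarrow> complex) \<Rightarrow> nat \<Rightarrow> (nat \<Rightarrow> (('g set \<Rightarrow> complex) \<times> 'a) list set) set list" where
    "\<kappa> f = (\<lambda>_. [{\<lambda>_. {[(\<lambda>S. f (the_elem S), undefined)]}}])" for f
  have "inj \<kappa>"
  proof (rule injI, rule ext)
    fix f h x assume "\<kappa> f = \<kappa> h"
    then have "(\<lambda>S. f (the_elem S)) = (\<lambda>S. h (the_elem S))" by (simp add: \<kappa>_def fun_eq_iff)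
    then have "f (the_elem {x}) = h (the_elem {x})" by (rule fun_cong)
    then show "f x = h x" by simp
  qed
  then show ?thesis
    by (rule finite_group_if_l1_quotient[OF contr[unfolded contractible_algebra_def] _ \<theta>(1) onto])
qed


subsection \<open>Sufficiency\<close>

text \<open>
  Let \<open>u g a\<close> be the tensor of \<open>\<delta>\<^sub>g\<close> and \<open>a\<close>, and let \<open>D\<close> vanish on all \<open>u 0 a\<close>.  Then
  \<open>D (u g a) = D (u g e) \<cdot> u 0 a = u 0 a \<cdot> D (u g e)\<close>, and the average \<open>W\<close> of the elements
  \<open>D (u h e) \<cdot> u (-h) e\<close> implements \<open>D\<close> on all \<open>u g a\<close>: the product rule for \<open>D (u (g + h) e)\<close> shows that
  \<open>u g e \<cdot> W\<close> and \<open>W \<cdot> u g e\<close> differ by \<open>D (u g e)\<close>, after the substitution of \<open>g + h\<close> for \<open>h\<close>.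
\<close>

lemma derivation_inner_if_vanishes_on_factor:
  fixes E :: "'e normed_alg"
  assumes fin: "finite (UNIV :: 'g set)"
    and e_closed: "e \<in> carrier A" and unit: "\<forall>a\<in>carrier A. e \<otimes>\<^bsub>A\<^esub> a = a \<and> a \<otimes>\<^bsub>A\<^esub> e = a"
    and bim: "banach_bimodule (projective_tensor M A) E l r"
    and der: "bounded_derivation (projective_tensor M A) E l r D"
    and D0: "\<And>a. a \<in> carrier A \<Longrightarrow> D (elementary M A (point_mass 0) a) = \<zero>\<^bsub>E\<^esub>"
  shows "\<exists>w\<in>carrier E. \<forall>b\<in>carrier (projective_tensor M A). D b = r w b \<ominus>\<^bsub>E\<^esub> l b w"
proof -
  let ?B = "projective_tensor M A"
  have e: "e \<in> carrier A" "\<And>a. a \<in> carrier A \<Longrightarrow> e \<otimes>\<^bsub>A\<^esub> a = a" "\<And>a. a \<in> carrier A \<Longrightarrow> a \<otimes>\<^bsub>A\<^esub> e = a"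
    using e_closed unit by blast+
  have inverse_add: "- (g + h) + g = - h" for g h :: 'g by (simp add: minus_add add.assoc)
  interpret banach_bimodule ?B E l r by (rule bim)
  define u where "u g a = elementary M A (point_mass g) a" for g :: 'g and a
  have uc: "u g a \<in> carrier ?B" if "a \<in> carrier A" for g a
    unfolding u_def by (rule MA.elementary_closed[OF point_mass_closed that])
  have um: "u g a \<otimes>\<^bsub>?B\<^esub> u h b = u (g + h) (a \<otimes>\<^bsub>A\<^esub> b)" if "a \<in> carrier A" "b \<in> carrier A" for g h a b
    unfolding u_def MA.elementary_mult[OF point_mass_closed point_mass_closed that]
    by (simp add: ops convolution_point_mass)
  have Dc: "D b \<in> carrier E" if "b \<in> carrier ?B" for b using der that by (simp add: bounded_derivation_def)
  have Dm: "D (a \<otimes>\<^bsub>?B\<^esub> b) = r (D a) b \<oplus>\<^bsub>E\<^esub> l a (D b)" if "a \<in> carrier ?B" "b \<in> carrier ?B" for a b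
    using der that by (simp add: bounded_derivation_def)
  define d where "d g = D (u g e)" for g
  note ue = uc[OF e(1)]
  have d: "d g \<in> carrier E" for g unfolding d_def by (rule Dc[OF ue])
  have right: "D (u g a) = r (d g) (u 0 a)" if a: "a \<in> carrier A" for g a
  proof -
    have "D (u g a) = D (u g e \<otimes>\<^bsub>?B\<^esub> u 0 a)" using a e by (simp add: um)
    also have "\<dots> = r (d g) (u 0 a) \<oplus>\<^bsub>E\<^esub> l (u g e) (D (u 0 a))" unfolding d_def by (rule Dm[OF ue uc[OF a]])
    also have "D (u 0 a) = \<zero>\<^bsub>E\<^esub>" using D0[OF a] by (simp add: u_def)
    finally show ?thesis using d r_closed[OF uc[OF a] d] ue by (simp add: l_zero)
  qed
  have left: "D (u g a) = l (u 0 a) (d g)" if a: "a \<in> carrier A" for g a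
  proof -
    have "D (u g a) = D (u 0 a \<otimes>\<^bsub>?B\<^esub> u g e)" using a e by (simp add: um)
    also have "\<dots> = r (D (u 0 a)) (u g e) \<oplus>\<^bsub>E\<^esub> l (u 0 a) (d g)" unfolding d_def by (rule Dm[OF uc[OF a] ue])
    also have "D (u 0 a) = \<zero>\<^bsub>E\<^esub>" using D0[OF a] by (simp add: u_def)
    finally show ?thesis using d l_closed[OF uc[OF a] d] ue by (simp add: r_zero)
  qed
  have dd: "d (g + h) = r (d g) (u h e) \<oplus>\<^bsub>E\<^esub> l (u g e) (d h)" for g h
    using Dm[OF ue ue, of g h] e by (simp add: um d_def)
  define c where "c h = r (d h) (u (- h) e)" for h
  have c: "c h \<in> carrier E" for h unfolding c_def by (rule r_closed[OF ue d])
  define N where "N = complex_of_nat (card (UNIV :: 'g set))"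
  have N: "N \<noteq> 0" using fin by (simp add: N_def)
  define W0 where "W0 = finsum E c UNIV"
  have W0: "W0 \<in> carrier E" unfolding W0_def using c by (intro finsum_closed) auto
  define W where "W = inverse N \<odot>\<^bsub>E\<^esub> W0"
  have W: "W \<in> carrier E" unfolding W_def by (rule smultc_closed[OF W0])
  have shift: "l (u g e) (c h) = r (c (g + h)) (u g e) \<ominus>\<^bsub>E\<^esub> d g" for g h
  proof -
    have rc: "r (d (g + h)) (u (- h) e) \<in> carrier E" "r (r (d g) (u h e)) (u (- h) e) \<in> carrier E"
        "r (l (u g e) (d h)) (u (- h) e) \<in> carrier E"
      using d ue by (simp_all add: r_closed l_closed)
    have "r (c (g + h)) (u g e) = r (d (g + h)) (u (- (g + h)) e \<otimes>\<^bsub>?B\<^esub> u g e)"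
      unfolding c_def by (rule r_mult[OF ue ue d, symmetric])
    also have "u (- (g + h)) e \<otimes>\<^bsub>?B\<^esub> u g e = u (- h) e"
      using e by (simp add: um inverse_add)
    also have "r (d (g + h)) (u (- h) e) = r (r (d g) (u h e)) (u (- h) e) \<oplus>\<^bsub>E\<^esub> r (l (u g e) (d h)) (u (- h) e)"
      unfolding dd using d ue by (simp add: r_add r_closed l_closed)
    also have "r (r (d g) (u h e)) (u (- h) e) = r (d g) (u h e \<otimes>\<^bsub>?B\<^esub> u (- h) e)"
      by (rule r_mult[OF ue ue d, symmetric])
    also have "u h e \<otimes>\<^bsub>?B\<^esub> u (- h) e = u 0 e" using e by (simp add: um)
    also have "r (d g) (u 0 e) = d g" using right[OF e(1), of g] by (simp add: d_def)
    also have "r (l (u g e) (d h)) (u (- h) e) = l (u g e) (c h)"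
      unfolding c_def by (rule l_r[OF ue ue d])
    finally have "r (c (g + h)) (u g e) = d g \<oplus>\<^bsub>E\<^esub> l (u g e) (c h)" .
    then show ?thesis
      using d[of g] l_closed[OF ue c, of g h] by (simp add: minus_eq a_comm[of "d g"] a_assoc r_neg)
  qed
  have W0_shift: "l (u g e) W0 = r W0 (u g e) \<ominus>\<^bsub>E\<^esub> N \<odot>\<^bsub>E\<^esub> d g" for g
  proof -
    have bij: "bij_betw (\<lambda>h. g + h) UNIV (UNIV :: 'g set)"
      by (rule bij_betwI[where g = "\<lambda>h. - g + h"]) (auto simp: add.assoc[symmetric])
    have md: "(-1) \<odot>\<^bsub>E\<^esub> d g \<in> carrier E" by (rule smultc_closed[OF d])
    have rc: "r (c h) (u g e) \<in> carrier E" for h by (rule r_closed[OF ue c])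
    have "l (u g e) W0 = finsum E (\<lambda>h. l (u g e) (c h)) UNIV"
      unfolding W0_def using c ue by (intro additive_finsum fin) (simp_all add: l_closed l_add l_zero)
    also have "\<dots> = finsum E (\<lambda>h. r (c (g + h)) (u g e) \<oplus>\<^bsub>E\<^esub> (-1) \<odot>\<^bsub>E\<^esub> d g) UNIV"
      unfolding shift using rc d by (simp add: minus_as_smult)
    also have "\<dots> = finsum E (\<lambda>h. r (c (g + h)) (u g e)) UNIV \<oplus>\<^bsub>E\<^esub> finsum E (\<lambda>h :: 'g. (-1) \<odot>\<^bsub>E\<^esub> d g) UNIV"
      using rc md by (intro finsum_addf) auto
    also have "finsum E (\<lambda>h. r (c (g + h)) (u g e)) UNIV = finsum E (\<lambda>h. r (c h) (u g e)) UNIV"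
      using finsum_reindex[of "\<lambda>h. r (c h) (u g e)" "\<lambda>h. g + h" UNIV] rc bij
      by (simp add: bij_betw_def)
    also have "finsum E (\<lambda>h. r (c h) (u g e)) UNIV = r W0 (u g e)"
      unfolding W0_def using c ue
      by (intro additive_finsum[where h = "\<lambda>x. r x (u g e)", symmetric] fin) (simp_all add: r_closed r_add r_zero)
    also have "finsum E (\<lambda>h :: 'g. (-1) \<odot>\<^bsub>E\<^esub> d g) UNIV = N \<odot>\<^bsub>E\<^esub> ((-1) \<odot>\<^bsub>E\<^esub> d g)"
      unfolding N_def by (rule finsum_constant[OF fin md])
    also have "\<dots> = (-1) \<odot>\<^bsub>E\<^esub> (N \<odot>\<^bsub>E\<^esub> d g)"
      using d by (simp add: smultc_assoc[symmetric] mult.commute)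
    finally show ?thesis
      using r_closed[OF ue W0] smultc_closed[OF d] by (simp add: minus_as_smult)
  qed
  have W_shift: "d g = r W (u g e) \<ominus>\<^bsub>E\<^esub> l (u g e) W" for g
  proof -
    have rW: "r W0 (u g e) \<in> carrier E" and Nd: "N \<odot>\<^bsub>E\<^esub> d g \<in> carrier E"
      using r_closed[OF ue W0] smultc_closed[OF d] by auto
    have "r W0 (u g e) \<ominus>\<^bsub>E\<^esub> l (u g e) W0 = N \<odot>\<^bsub>E\<^esub> d g"
      unfolding W0_shift using rW Nd by (simp add: minus_eq minus_add r_neg1 a_assoc[symmetric] r_neg)
    then have "inverse N \<odot>\<^bsub>E\<^esub> (r W0 (u g e) \<ominus>\<^bsub>E\<^esub> l (u g e) W0) = d g"
      using N d by (simp add: smultc_assoc[symmetric] smultc_one)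
    moreover have "inverse N \<odot>\<^bsub>E\<^esub> (r W0 (u g e) \<ominus>\<^bsub>E\<^esub> l (u g e) W0) = r W (u g e) \<ominus>\<^bsub>E\<^esub> l (u g e) W"
      unfolding W_def r_smult[OF ue W0] l_smult[OF ue W0]
      using rW l_closed[OF ue W0] by (simp add: minus_as_smult smultc_add smultc_closed smultc_assoc[symmetric] mult.commute)
    ultimately show ?thesis by simp
  qed
  have W_comm: "r W (u 0 a) = l (u 0 a) W" if a: "a \<in> carrier A" for a
  proof -
    have cc: "r (c h) (u 0 a) = l (u 0 a) (c h)" for h
    proof -
      have "r (c h) (u 0 a) = r (d h) (u (- h) e \<otimes>\<^bsub>?B\<^esub> u 0 a)"
        unfolding c_def by (rule r_mult[OF ue uc[OF a] d, symmetric])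
      also have "u (- h) e \<otimes>\<^bsub>?B\<^esub> u 0 a = u 0 a \<otimes>\<^bsub>?B\<^esub> u (- h) e" using a e by (simp add: um)
      also have "r (d h) (u 0 a \<otimes>\<^bsub>?B\<^esub> u (- h) e) = r (r (d h) (u 0 a)) (u (- h) e)"
        by (rule r_mult[OF uc[OF a] ue d])
      also have "r (d h) (u 0 a) = l (u 0 a) (d h)" using right[OF a, of h] left[OF a, of h] by simp
      also have "r (l (u 0 a) (d h)) (u (- h) e) = l (u 0 a) (c h)"
        unfolding c_def by (rule l_r[OF uc[OF a] ue d])
      finally show ?thesis .
    qed
    have "r W0 (u 0 a) = finsum E (\<lambda>h. r (c h) (u 0 a)) UNIV"
      unfolding W0_def using c uc[OF a]
      by (intro additive_finsum[where h = "\<lambda>x. r x (u 0 a)"] fin) (simp_all add: r_closed r_add r_zero)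
    also have "\<dots> = l (u 0 a) W0"
      unfolding cc W0_def using c uc[OF a]
      by (intro additive_finsum[symmetric] fin) (simp_all add: l_closed l_add l_zero)
    finally show ?thesis unfolding W_def using W0 uc[OF a] by (simp add: r_smult l_smult)
  qed
  have on_u: "D (u g a) = r W (u g a) \<ominus>\<^bsub>E\<^esub> l (u g a) W" if a: "a \<in> carrier A" for g a
  proof -
    have ga: "u g a = u g e \<otimes>\<^bsub>?B\<^esub> u 0 a" using a e by (simp add: um)
    have "D (u g a) = r (r W (u g e) \<ominus>\<^bsub>E\<^esub> l (u g e) W) (u 0 a)"
      unfolding right[OF a] W_shift[of g, symmetric] ..
    also have "\<dots> = r (r W (u g e)) (u 0 a) \<ominus>\<^bsub>E\<^esub> r (l (u g e) W) (u 0 a)"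
      using r_minus[OF uc[OF a] r_closed[OF ue W] l_closed[OF ue W]] .
    also have "r (r W (u g e)) (u 0 a) = r W (u g a)" unfolding ga by (rule r_mult[OF ue uc[OF a] W, symmetric])
    also have "r (l (u g e) W) (u 0 a) = l (u g e) (r W (u 0 a))" by (rule l_r[OF ue uc[OF a] W])
    also have "\<dots> = l (u g a) W" unfolding ga W_comm[OF a] by (rule l_mult[OF ue uc[OF a] W, symmetric])
    finally show ?thesis .
  qed
  let ?D = "\<lambda>b. D b \<ominus>\<^bsub>E\<^esub> (r W b \<ominus>\<^bsub>E\<^esub> l b W)"
  have der': "bounded_derivation ?B E l r ?D" by (rule bounded_derivation_minus_inner[OF der W])
  have D': "\<And>b. b \<in> carrier ?B \<Longrightarrow> ?D b \<in> carrier E"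
      "\<And>a b. a \<in> carrier ?B \<Longrightarrow> b \<in> carrier ?B \<Longrightarrow> ?D (a \<oplus>\<^bsub>?B\<^esub> b) = ?D a \<oplus>\<^bsub>E\<^esub> ?D b"
      "\<And>k b. b \<in> carrier ?B \<Longrightarrow> ?D (k \<odot>\<^bsub>?B\<^esub> b) = k \<odot>\<^bsub>E\<^esub> ?D b"
    using der' by (simp_all add: bounded_derivation_def)
  obtain C where C: "\<forall>b\<in>carrier ?B. nrm E (?D b) \<le> C * nrm ?B b"
    using der' unfolding bounded_derivation_def by blast
  have D'u: "?D (u g a) = \<zero>\<^bsub>E\<^esub>" if "a \<in> carrier A" for g a
    unfolding on_u[OF that] using r_closed[OF uc[OF that] W] l_closed[OF uc[OF that] W]
    by (simp add: minus_eq r_neg)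
  have elem: "?D (elementary M A \<mu> a) = \<zero>\<^bsub>E\<^esub>" if \<mu>: "\<mu> \<in> carrier M" and a: "a \<in> carrier A" for \<mu> a
  proof -
    have "(\<lambda>S. \<Sum>g\<in>F. \<mu> {g} * point_mass g S) \<in> carrier M \<and>
        ?D (elementary M A (\<lambda>S. \<Sum>g\<in>F. \<mu> {g} * point_mass g S) a) = \<zero>\<^bsub>E\<^esub>" if "finite F" for F
      using that
    proof (induction F rule: finite_induct)
      case empty
      have eq: "(\<lambda>S. \<Sum>g\<in>{}. \<mu> {g} * point_mass g S) = 0 \<odot>\<^bsub>M\<^esub> point_mass 0" by (simp add: ops)
      have "?D (elementary M A (0 \<odot>\<^bsub>M\<^esub> point_mass 0) a) = 0 \<odot>\<^bsub>E\<^esub> ?D (u 0 a)"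
        unfolding MA.elementary_smult_left[OF point_mass_closed a] u_def[symmetric] by (rule D'(3)[OF uc[OF a]])
      also have "\<dots> = \<zero>\<^bsub>E\<^esub>" by (rule smultc_zero[OF D'(1)[OF uc[OF a]]])
      finally have "?D (elementary M A (0 \<odot>\<^bsub>M\<^esub> point_mass 0) a) = \<zero>\<^bsub>E\<^esub>" .
      moreover have "0 \<odot>\<^bsub>M\<^esub> point_mass 0 \<in> carrier M"
        unfolding ops by (rule measure_algebra_smult_closed[OF point_mass_closed])
      ultimately show ?case unfolding eq by (intro conjI)
    next
      case (insert g F)
      let ?\<nu> = "\<lambda>S. \<Sum>g\<in>F. \<mu> {g} * point_mass g S"
      have \<nu>: "?\<nu> \<in> carrier M" "?D (elementary M A ?\<nu> a) = \<zero>\<^bsub>E\<^esub>" using insert.IH by auto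
      have pg: "\<mu> {g} \<odot>\<^bsub>M\<^esub> point_mass g \<in> carrier M"
        unfolding ops by (rule measure_algebra_smult_closed[OF point_mass_closed])
      have eq: "(\<lambda>S. \<Sum>g\<in>insert g F. \<mu> {g} * point_mass g S) = (\<mu> {g} \<odot>\<^bsub>M\<^esub> point_mass g) \<oplus>\<^bsub>M\<^esub> ?\<nu>"
        using insert.hyps by (simp add: ops)
      have "?D (elementary M A (\<mu> {g} \<odot>\<^bsub>M\<^esub> point_mass g) a) = \<mu> {g} \<odot>\<^bsub>E\<^esub> ?D (u g a)"
        unfolding MA.elementary_smult_left[OF point_mass_closed a] u_def[symmetric] by (rule D'(3)[OF uc[OF a]])
      also have "\<dots> = \<zero>\<^bsub>E\<^esub>" unfolding D'u[OF a] using smultc_assoc[of "\<zero>\<^bsub>E\<^esub>" "\<mu> {g}" 0] by (simp add: smultc_zero)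
      finally have 0: "?D (elementary M A (\<mu> {g} \<odot>\<^bsub>M\<^esub> point_mass g) a) = \<zero>\<^bsub>E\<^esub>" .
      show ?case
      proof
        show "(\<lambda>S. \<Sum>g\<in>insert g F. \<mu> {g} * point_mass g S) \<in> carrier M"
          unfolding eq by (rule MA.M.a_closed[OF pg \<nu>(1)])
        show "?D (elementary M A (\<lambda>S. \<Sum>g\<in>insert g F. \<mu> {g} * point_mass g S) a) = \<zero>\<^bsub>E\<^esub>"
          unfolding eq MA.elementary_add_left[OF pg \<nu>(1) a]
            D'(2)[OF MA.elementary_closed[OF pg a] MA.elementary_closed[OF \<nu>(1) a]] 0 \<nu>(2)
          by simp
      qed
    qed
    from this[OF fin] measure_finite_group[OF fin cmD[OF \<mu>], symmetric] show ?thesis by simp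
  qed
  have vanish: "?D b = \<zero>\<^bsub>E\<^esub>" if "b \<in> carrier ?B" for b
    by (rule MA.bounded_linear_vanishes[where D = ?D, OF complex_normed_space_axioms D' C[rule_format] elem that])
  have "D b = r W b \<ominus>\<^bsub>E\<^esub> l b W" if b: "b \<in> carrier ?B" for b
  proof -
    have i: "r W b \<ominus>\<^bsub>E\<^esub> l b W \<in> carrier E" using r_closed[OF b W] l_closed[OF b W] by simp
    show ?thesis
      using vanish[OF b] minus_equality[of "D b" "\<ominus>\<^bsub>E\<^esub> (r W b \<ominus>\<^bsub>E\<^esub> l b W)"] Dc[OF b] i
      by (simp add: minus_eq[of "D b"])
  qed
  then show ?thesis using W by blast
qed

text \<open>
  Contractibility of \<open>A\<close> makes the derivation inner on the copy \<open>\<delta>\<^sub>0 \<otimes> A\<close> of \<open>A\<close>.  After the corresponding inner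
  derivation is subtracted, the averaging argument applies.
\<close>

lemma contractible_tensor:
  assumes fin: "finite (UNIV :: 'g set)" and contr: "contractible_algebra A"
  shows "contractible_algebra (projective_tensor M A)"
  unfolding contractible_algebra_def derivations_inner_def
proof (intro allI impI)
  let ?B = "projective_tensor M A"
  fix E :: "(nat \<Rightarrow> (nat \<Rightarrow> (('g set \<Rightarrow> complex) \<times> 'a) list set) set list) normed_alg" and l r D
  assume bim: "banach_bimodule ?B E l r" and der: "bounded_derivation ?B E l r D"
  interpret banach_bimodule ?B E l r by (rule bim)
  obtain e where e: "e \<in> carrier A" and unit: "\<forall>a\<in>carrier A. e \<otimes>\<^bsub>A\<^esub> a = a \<and> a \<otimes>\<^bsub>A\<^esub> e = a"
    using contractible_has_unit[OF A contr] by blast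
  define \<psi> where "\<psi> a = elementary M A (point_mass 0) a" for a
  note p0 = point_mass_closed[of "0 :: 'g"]
  have \<psi>: "bounded_hom A ?B \<psi>"
    unfolding bounded_hom_def \<psi>_def
  proof (intro conjI ballI allI exI[of _ "nrm M (point_mass 0)"])
    fix a b assume ab: "a \<in> carrier A" "b \<in> carrier A"
    show "elementary M A (point_mass 0) (a \<otimes>\<^bsub>A\<^esub> b) =
        elementary M A (point_mass 0) a \<otimes>\<^bsub>?B\<^esub> elementary M A (point_mass 0) b"
      unfolding MA.elementary_mult[OF p0 p0 ab] by (simp add: ops convolution_point_mass)
  qed (simp_all add: MA.elementary_closed p0 MA.elementary_add_right MA.elementary_smult_right MA.nrm_elementary_le)
  have nonneg: "0 \<le> nrm ?B b" if "b \<in> carrier ?B" for b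
    using that unfolding projective_tensor_def
    by (rule seminormed_algebra.completion_nrm_nonneg[OF MA.seminormed_algebra_tensor])
  have "inner_derivation A E (\<lambda>a. l (\<psi> a)) (\<lambda>x a. r x (\<psi> a)) (\<lambda>a. D (\<psi> a))"
    using contractible_derivations_inner[OF contr A] banach_bimodule_pullback[OF bim \<psi> nonneg]
      bounded_derivation_pullback[OF der \<psi> nonneg]
    unfolding derivations_inner_def by blast
  then obtain z where z: "z \<in> carrier E" "\<forall>a\<in>carrier A. D (\<psi> a) = r z (\<psi> a) \<ominus>\<^bsub>E\<^esub> l (\<psi> a) z"
    unfolding inner_derivation_def by blast
  let ?D = "\<lambda>b. D b \<ominus>\<^bsub>E\<^esub> (r z b \<ominus>\<^bsub>E\<^esub> l b z)"
  have "?D (\<psi> a) = \<zero>\<^bsub>E\<^esub>" if a: "a \<in> carrier A" for a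
  proof -
    have \<psi>a: "\<psi> a \<in> carrier ?B" by (rule bounded_homD(1)[OF \<psi> a])
    show ?thesis unfolding z(2)[rule_format, OF a]
      using r_closed[OF \<psi>a z(1)] l_closed[OF \<psi>a z(1)] by (simp add: minus_eq r_neg)
  qed
  then obtain w where w: "w \<in> carrier E" "\<forall>b\<in>carrier ?B. ?D b = r w b \<ominus>\<^bsub>E\<^esub> l b w"
    using derivation_inner_if_vanishes_on_factor[OF fin e unit bim bounded_derivation_minus_inner[OF der z(1)]]
    unfolding \<psi>_def by blast
  show "inner_derivation ?B E l r D"
    by (rule inner_derivation_shift[OF _ z(1) w(1)]) (use der w(2) in \<open>auto simp: bounded_derivation_def\<close>)
qed

end

theorem theorem4p12:
  fixes A :: "'a normed_alg"
  assumes "locally_compact_space (euclidean :: 'g::{topological_group_add, t2_space} topology)"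
    and "banach_algebra A"
    and "character_space A \<noteq> {}"
  shows "contractible_algebra (projective_tensor
           (measure_algebra :: ('g::{topological_group_add, t2_space} set \<Rightarrow> complex) normed_alg) A)
         \<longleftrightarrow> finite (UNIV :: 'g set) \<and> contractible_algebra A"
  using finite_group_if_contractible[OF assms(1,2)] contractible_factor[OF assms(1,2)]
    contractible_tensor[OF assms(1,2)] assms(3)
  by blast

end
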